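(* Consider the pessimistic Basis Inverse Linear Feasibility Problem: given $A\in\mathbb{Q}^{m\times n}$, $B\in\mathbb{Q}^{m\times k}$, $b\in\mathbb{Q}^m$, $C\in\mathbb{Q}^{n\times k}$, $c\in\mathbb{Q}^n$, a polyhedron $X=\{x\in\mathbb{R}^k \mid Dx\le d\}$ with $D\in\mathbb{Q}^{g\times k}$, $d\in\mathbb{Q}^g$, and a basis $\bar{\mathcal B}$ of $A$, decide whether there exists $x\in X$ such that $\bar{\mathcal B}$ is the unique optimal basis for the LP $$\min\{(Cx+c)^\top y \mid Ay=Bx+b,\ y\in\mathbb{R}^n,\ y\ge 0\}.$$ This decision problem is solvable in polynomial time.
   Context: All input data are rational and given in the usual binary encoding; polynomial time means polynomial in the encoding length of the input. A basis of $A\in\mathbb{R}^{m\times n}$ is an index set $\mathcal B\subseteq\{1,\dots,n\}$ such that the submatrix $A_{[\mathcal B]}$ of $A$ consisting of the columns with index in $\mathcal B$ is regular (square and invertible). For a right-hand side $\beta\in\mathbb{R}^m$, the basic solution associated with $\mathcal B$ is the vector $y\in\mathbb{R}^n$ with $y_{\mathcal B}=A_{[\mathcal B]}^{-1}\beta$ and $y_i=0$ for $i\notin\mathcal B$. A basis is optimal for the LP if its associated basic solution is feasible and optimal for the LP (here, $\beta=Bx+b$). It is the unique optimal basis if it is optimal and no other basis of $A$ is optimal. *)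

theory Defs
  imports
    "Jordan_Normal_Form.DL_Submatrix"
    "Jordan_Normal_Form.Gauss_Jordan_Elimination"
    "HOL-Computational_Algebra.Polynomial"
    "HOL-Library.Log_Nat"
    Complex_Main
begin

section \<open>Polynomial-time decidability\<close>

text \<open>
  The machine model is the random access machine with arithmetic \<open>+, -, *, div\<close> under the
  logarithmic cost criterion of Aho, Hopcroft and Ullman: every access or operation is charged
  the binary length of the numbers and of the memory addresses it handles. With this cost measure
  the machine and the Turing machine simulate each other with polynomial overhead.
  Programs are structured (while-programs) instead of lists of jumps, and memory cells, each
  holding an integer, are addressed by integers.
\<close>

type_synonym memory = "int \<Rightarrow> int"

datatype expr =
    Const int
  | Load expr
  | Add expr expr
  | Sub expr expr
  | Mul expr expr
  | Div expr expr

datatype prog =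
    Skip
  | Store expr expr  \<comment> \<open>address, value\<close>
  | Seq prog prog
  | IfPos expr prog prog
  | WhilePos expr prog

fun eval :: "expr \<Rightarrow> memory \<Rightarrow> int" where
  "eval (Const z) s = z"
| "eval (Load e) s = s (eval e s)"
| "eval (Add e f) s = eval e s + eval f s"
| "eval (Sub e f) s = eval e s - eval f s"
| "eval (Mul e f) s = eval e s * eval f s"
| "eval (Div e f) s = eval e s div eval f s"

text \<open>Binary length of an integer; the extra bit is the sign.\<close>

definition bit_length :: "int \<Rightarrow> nat" where
  "bit_length z = floorlog 2 (nat \<bar>z\<bar>) + 1"

text \<open>
  The operands (and the address of a \<open>Load\<close>) are charged through the recursive calls.
\<close>

fun eval_cost :: "expr \<Rightarrow> memory \<Rightarrow> nat" where
  "eval_cost (Const z) s = bit_length z"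
| "eval_cost (Load e) s = eval_cost e s + bit_length (eval (Load e) s)"
| "eval_cost (Add e f) s = eval_cost e s + eval_cost f s + bit_length (eval (Add e f) s)"
| "eval_cost (Sub e f) s = eval_cost e s + eval_cost f s + bit_length (eval (Sub e f) s)"
| "eval_cost (Mul e f) s = eval_cost e s + eval_cost f s + bit_length (eval (Mul e f) s)"
| "eval_cost (Div e f) s = eval_cost e s + eval_cost f s + bit_length (eval (Div e f) s)"

text \<open>\<open>exec p s t s'\<close>: started in \<open>s\<close>, program \<open>p\<close> terminates in \<open>s'\<close> at cost \<open>t\<close>.\<close>

inductive exec :: "prog \<Rightarrow> memory \<Rightarrow> nat \<Rightarrow> memory \<Rightarrow> bool" where
  exec_Skip: "exec Skip s 1 s"
| exec_Store:
    "exec (Store a e) s (1 + eval_cost a s + eval_cost e s) (s(eval a s := eval e s))"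
| exec_Seq:
    "exec p s t s' \<Longrightarrow> exec q s' u s'' \<Longrightarrow> exec (Seq p q) s (1 + t + u) s''"
| exec_IfPos_True:
    "0 < eval e s \<Longrightarrow> exec p s t s' \<Longrightarrow> exec (IfPos e p q) s (1 + eval_cost e s + t) s'"
| exec_IfPos_False:
    "\<not> 0 < eval e s \<Longrightarrow> exec q s t s' \<Longrightarrow> exec (IfPos e p q) s (1 + eval_cost e s + t) s'"
| exec_WhilePos_False:
    "\<not> 0 < eval e s \<Longrightarrow> exec (WhilePos e p) s (1 + eval_cost e s) s"
| exec_WhilePos_True:
    "0 < eval e s \<Longrightarrow> exec p s t s' \<Longrightarrow> exec (WhilePos e p) s' u s'' \<Longrightarrow>
     exec (WhilePos e p) s (1 + eval_cost e s + t + u) s''"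

inductive_cases exec_SkipE: "exec Skip s t s'"
inductive_cases exec_StoreE: "exec (Store a e) s t s'"
inductive_cases exec_SeqE: "exec (Seq p q) s t s'"
inductive_cases exec_IfPosE: "exec (IfPos e p q) s t s'"
inductive_cases exec_WhilePosE: "exec (WhilePos e p) s t s'"

lemma exec_deterministic:
  "exec p s t s' \<Longrightarrow> exec p s u s'' \<Longrightarrow> t = u \<and> s' = s''"
proof (induction arbitrary: u s'' rule: exec.induct)
  case (exec_Skip s)
  from exec_Skip.prems show ?case by (rule exec_SkipE) simp
next
  case (exec_Store a e s)
  from exec_Store.prems show ?case by (rule exec_StoreE) simp
next
  case (exec_Seq p s t s' q v r)
  from exec_Seq.prems show ?case
    by (rule exec_SeqE) (auto dest!: exec_Seq.IH)
next
  case (exec_IfPos_True e s p t s' q)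
  from exec_IfPos_True.prems show ?case
    by (rule exec_IfPosE) (use exec_IfPos_True.hyps(1) in \<open>auto dest!: exec_IfPos_True.IH\<close>)
next
  case (exec_IfPos_False e s q t s' p)
  from exec_IfPos_False.prems show ?case
    by (rule exec_IfPosE) (use exec_IfPos_False.hyps(1) in \<open>auto dest!: exec_IfPos_False.IH\<close>)
next
  case (exec_WhilePos_False e s p)
  from exec_WhilePos_False.prems show ?case
    by (rule exec_WhilePosE) (use exec_WhilePos_False.hyps in auto)
next
  case (exec_WhilePos_True e s p t s' v r)
  from exec_WhilePos_True.prems show ?case
    by (rule exec_WhilePosE) (use exec_WhilePos_True.hyps(1) in \<open>auto dest!: exec_WhilePos_True.IH\<close>)
qed

text \<open>
  A word \<open>w\<close> of integers is presented in the cells \<open>1, \<dots>, length w\<close>, its length in cell \<open>0\<close>;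
  all other cells are zero. The answer (\<open>1\<close> or \<open>0\<close>) is returned in cell \<open>0\<close>.
\<close>

definition input_memory :: "int list \<Rightarrow> memory" where
  "input_memory w a =
    (if a = 0 then int (length w)
     else if 1 \<le> a \<and> a \<le> int (length w) then w ! nat (a - 1)
     else 0)"

definition encoding_length :: "int list \<Rightarrow> nat" where
  "encoding_length w = (\<Sum>z\<leftarrow>w. bit_length z)"

text \<open>
  A decision problem is given by its set of instances, an encoding of instances,
  and the property of instances that has to be decided.
\<close>

definition decidable_in_polynomial_time ::
  "('i \<Rightarrow> int list) \<Rightarrow> 'i set \<Rightarrow> ('i \<Rightarrow> bool) \<Rightarrow> bool" where
  "decidable_in_polynomial_time enc Inst P \<longleftrightarrow>
    (\<exists>(p :: prog) (T :: nat poly). \<forall>x \<in> Inst.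
       \<exists>t s. exec p (input_memory (enc x)) t s \<and>
             t \<le> poly T (encoding_length (enc x)) \<and>
             s 0 = (if P x then 1 else 0))"


section \<open>Bases of linear programs\<close>

text \<open>
  Indices are \<open>0\<close>-based. \<open>columns A S\<close> consists of the columns of \<open>A\<close> with index in \<open>S\<close>,
  in increasing order of the indices.
\<close>

definition columns :: "'a mat \<Rightarrow> nat set \<Rightarrow> 'a mat" where
  "columns A S = submatrix A UNIV S"

definition is_basis :: "real mat \<Rightarrow> nat set \<Rightarrow> bool" where
  "is_basis A S \<longleftrightarrow> S \<subseteq> {0..<dim_col A} \<and> invertible_mat (columns A S)"

text \<open>
  The column of \<open>columns A S\<close> that comes from the index \<open>i \<in> S\<close> is number \<open>card {j \<in> S. j < i}\<close>.
  The value is meaningful only for a basis \<open>S\<close>.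
\<close>

definition basic_solution :: "real mat \<Rightarrow> real vec \<Rightarrow> nat set \<Rightarrow> real vec" where
  "basic_solution A \<beta> S =
    vec (dim_col A) (\<lambda>i.
      if i \<in> S
      then (the (mat_inverse (columns A S)) *\<^sub>v \<beta>) $ card {j \<in> S. j < i}
      else 0)"

text \<open>The linear program \<open>min {q\<^sup>T y | A y = \<beta>, y \<ge> 0}\<close>.\<close>

definition lp_feasible :: "real mat \<Rightarrow> real vec \<Rightarrow> real vec set" where
  "lp_feasible A \<beta> = {y \<in> carrier_vec (dim_col A). A *\<^sub>v y = \<beta> \<and> 0\<^sub>v (dim_col A) \<le> y}"

definition lp_optimal :: "real vec \<Rightarrow> real mat \<Rightarrow> real vec \<Rightarrow> real vec \<Rightarrow> bool" where
  "lp_optimal q A \<beta> y \<longleftrightarrow>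
    y \<in> lp_feasible A \<beta> \<and> (\<forall>z \<in> lp_feasible A \<beta>. q \<bullet> y \<le> q \<bullet> z)"

definition optimal_basis :: "real vec \<Rightarrow> real mat \<Rightarrow> real vec \<Rightarrow> nat set \<Rightarrow> bool" where
  "optimal_basis q A \<beta> S \<longleftrightarrow> is_basis A S \<and> lp_optimal q A \<beta> (basic_solution A \<beta> S)"

definition unique_optimal_basis :: "real vec \<Rightarrow> real mat \<Rightarrow> real vec \<Rightarrow> nat set \<Rightarrow> bool" where
  "unique_optimal_basis q A \<beta> S \<longleftrightarrow>
    optimal_basis q A \<beta> S \<and> (\<forall>S'. optimal_basis q A \<beta> S' \<longrightarrow> S' = S)"


section \<open>The pessimistic Basis Inverse Linear Feasibility Problem\<close>

record bilfp =
  nrows :: nat     \<comment> \<open>\<open>m\<close>\<close>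
  nvars :: nat     \<comment> \<open>\<open>n\<close>\<close>
  nparams :: nat   \<comment> \<open>\<open>k\<close>\<close>
  nineqs :: nat    \<comment> \<open>\<open>g\<close>\<close>
  matA :: "rat mat"
  matB :: "rat mat"
  vecb :: "rat vec"
  matC :: "rat mat"
  vecc :: "rat vec"
  matD :: "rat mat"
  vecd :: "rat vec"
  basis :: "nat set"

abbreviation real_mat :: "rat mat \<Rightarrow> real mat" where
  "real_mat \<equiv> map_mat real_of_rat"

abbreviation real_vec :: "rat vec \<Rightarrow> real vec" where
  "real_vec \<equiv> map_vec real_of_rat"

definition bilfp_instances :: "bilfp set" where
  "bilfp_instances = {I.
     matA I \<in> carrier_mat (nrows I) (nvars I) \<and>
     matB I \<in> carrier_mat (nrows I) (nparams I) \<and>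
     vecb I \<in> carrier_vec (nrows I) \<and>
     matC I \<in> carrier_mat (nvars I) (nparams I) \<and>
     vecc I \<in> carrier_vec (nvars I) \<and>
     matD I \<in> carrier_mat (nineqs I) (nparams I) \<and>
     vecd I \<in> carrier_vec (nineqs I) \<and>
     is_basis (real_mat (matA I)) (basis I)}"

definition bilfp_X :: "bilfp \<Rightarrow> real vec set" where
  "bilfp_X I =
    {x \<in> carrier_vec (nparams I). real_mat (matD I) *\<^sub>v x \<le> real_vec (vecd I)}"

definition pessimistic_bilfp :: "bilfp \<Rightarrow> bool" where
  "pessimistic_bilfp I \<longleftrightarrow>
    (\<exists>x \<in> bilfp_X I.
       unique_optimal_basis
         (real_mat (matC I) *\<^sub>v x + real_vec (vecc I))
         (real_mat (matA I))
         (real_mat (matB I) *\<^sub>v x + real_vec (vecb I))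
         (basis I))"

text \<open>
  A rational is encoded by the numerator and the positive denominator of its reduced fraction.
  No separators are needed: the dimensions come first, and a basis has exactly \<open>m\<close> elements.
\<close>

definition encode_rat :: "rat \<Rightarrow> int list" where
  "encode_rat r = [fst (quotient_of r), snd (quotient_of r)]"

definition encode_vec :: "rat vec \<Rightarrow> int list" where
  "encode_vec v = concat (map encode_rat (list_of_vec v))"

definition encode_mat :: "rat mat \<Rightarrow> int list" where
  "encode_mat M = concat (map encode_vec (rows M))"

definition encode_bilfp :: "bilfp \<Rightarrow> int list" where
  "encode_bilfp I =
    [int (nrows I), int (nvars I), int (nparams I), int (nineqs I)]
    @ encode_mat (matA I) @ encode_mat (matB I) @ encode_vec (vecb I)
    @ encode_mat (matC I) @ encode_vec (vecc I)
    @ encode_mat (matD I) @ encode_vec (vecd I)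
    @ map int (sorted_list_of_set (basis I))"

end

theory Submission
  imports Defs "Jordan_Normal_Form.Determinant"
begin

text \<open>Let \<open>y\<close> be the basic solution of the basis \<open>S\<close>, and for \<open>j \<notin> S\<close> let \<open>\<eta>\<^sup>j\<close> be the kernel vector
  of \<open>A\<close> supported on \<open>S \<union> {j}\<close> with \<open>\<eta>\<^sup>j\<^sub>j > 0\<close>. Then \<open>S\<close> is the unique optimal basis iff
  \<open>y \<ge> 0\<close>, with \<open>y\<^sub>i > 0\<close> whenever some pivot on row \<open>i\<close> is possible, and every reduced cost
  \<open>q\<^sup>T \<eta>\<^sup>j\<close> is nonnegative, and positive unless \<open>\<eta>\<^sup>j \<ge> 0\<close> is a ray, along which no other basic solution
  is reached. For \<open>q = C x + c\<close> and \<open>\<beta> = B x + b\<close> these conditions are linear in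
  \<open>x\<close>; homogenised, they ask for a vector of \<open>{\<xi> \<ge> 0. M \<xi> = 0}\<close> that is positive in given coordinates.

  The support of such vectors is found by a rescaling method in the style of Chubanov. If \<open>N = d P\<close>
  with \<open>P\<close> the orthogonal projection onto the kernel of the scaled matrix, then von Neumann steps
  \<open>y\<^sub>k := y\<^sub>k + 1\<close> at coordinates with \<open>(N y)\<^sub>k \<le> 0\<close> keep \<open>|P y|\<^sup>2 \<le> \<Sum> y\<close>. Either \<open>N y\<close> becomes positive
  on all live coordinates and solves the system, or some \<open>y\<^sub>j\<close> becomes so large that every solution in
  the unit cube has \<open>\<xi>\<^sub>j \<le> 1/2\<close>, and coordinate \<open>j\<close> is rescaled by \<open>2\<close>. A coordinate rescaled below
  the inverse of a bound on the minors of \<open>M\<close> vanishes in all solutions. All numbers are integers: \<open>d\<close>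
  is a Gram determinant, and \<open>N\<close> is computed by fraction-free rank-one updates. The same projection
  yields multiples of the \<open>\<eta>\<^sup>j\<close>.

  Running time is bounded on a small while-language, by a weakest precondition that bounds every loop
  count by \<open>R\<close> and every stored value by \<open>B\<close>; a single polynomial then bounds the cost of the compiled
  random access program.\<close>

section \<open>While programs with arrays on the random access machine\<close>

text \<open>Optimality alone would be a question of weak inequalities; uniqueness of the basis adds
  strict ones, and all of them must hold at the same \<open>x\<close>. They can be tested coordinate
  by coordinate because the homogenised solutions form a convex cone: sums of solutions have the
  union of their supports, so one solution has the largest support. Homogenising is harmless, since
  the new variable is itself among the coordinates required to be positive.

  The cut uses \<open>4 n^4\<close> sweeps over the \<open>n\<close> coordinates. They make at most
  \<open>4 n^5\<close> steps, so a solution \<open>z\<close> in the unit cube satisfies y^T z \<le>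
  |P y| |z| \<le> sqrt (4 n^5) sqrt n = 2 n^3. If every sweep makes a step, some coordinate of
  \<open>y\<close> reaches \<open>4 n^3\<close>, and the corresponding coordinate of
  \<open>z\<close> is at most 1/2.

  Gram determinants keep the numbers short: entries of \<open>N\<close> are at most
  \<open>d\<close>, and \<open>d\<close> is at most a product of bounds on squared row norms. The
  projection is recomputed after each rescaling and the scales never exceed their initial value, so
  bit lengths do not accumulate over the iterations.\<close>

type_synonym store = "nat \<Rightarrow> nat \<Rightarrow> nat \<Rightarrow> int"

datatype aexp =
    Num int
  | Arr nat aexp aexp
  | Inp aexp
  | Plus aexp aexp
  | Minus aexp aexp
  | Times aexp aexp
  | Quot aexp aexp

datatype com =
    CSkip
  | Asg nat aexp aexp aexp
  | CSeq com com  (infixr ";;" 60)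
  | CIf aexp com com
  | CWhile aexp com

fun aval :: "(int \<Rightarrow> int) \<Rightarrow> aexp \<Rightarrow> store \<Rightarrow> int" where
  "aval w (Num z) \<sigma> = z"
| "aval w (Arr x e f) \<sigma> = \<sigma> x (nat (aval w e \<sigma>)) (nat (aval w f \<sigma>))"
| "aval w (Inp e) \<sigma> = w (aval w e \<sigma>)"
| "aval w (Plus e f) \<sigma> = aval w e \<sigma> + aval w f \<sigma>"
| "aval w (Minus e f) \<sigma> = aval w e \<sigma> - aval w f \<sigma>"
| "aval w (Times e f) \<sigma> = aval w e \<sigma> * aval w f \<sigma>"
| "aval w (Quot e f) \<sigma> = aval w e \<sigma> div aval w f \<sigma>"

fun ok :: "(int \<Rightarrow> int) \<Rightarrow> aexp \<Rightarrow> store \<Rightarrow> bool" where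
  "ok w (Num z) \<sigma> \<longleftrightarrow> True"
| "ok w (Arr x e f) \<sigma> \<longleftrightarrow> x < 32 \<and> ok w e \<sigma> \<and> ok w f \<sigma> \<and> 0 \<le> aval w e \<sigma> \<and> 0 \<le> aval w f \<sigma>"
| "ok w (Inp e) \<sigma> \<longleftrightarrow> ok w e \<sigma> \<and> 0 \<le> aval w e \<sigma>"
| "ok w (Plus e f) \<sigma> \<longleftrightarrow> ok w e \<sigma> \<and> ok w f \<sigma>"
| "ok w (Minus e f) \<sigma> \<longleftrightarrow> ok w e \<sigma> \<and> ok w f \<sigma>"
| "ok w (Times e f) \<sigma> \<longleftrightarrow> ok w e \<sigma> \<and> ok w f \<sigma>"
| "ok w (Quot e f) \<sigma> \<longleftrightarrow> ok w e \<sigma> \<and> ok w f \<sigma>"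

fun vars :: "aexp \<Rightarrow> nat set" where
  "vars (Num z) = {}"
| "vars (Arr x e f) = insert x (vars e \<union> vars f)"
| "vars (Inp e) = vars e"
| "vars (Plus e f) = vars e \<union> vars f"
| "vars (Minus e f) = vars e \<union> vars f"
| "vars (Times e f) = vars e \<union> vars f"
| "vars (Quot e f) = vars e \<union> vars f"

lemma aval_cong: "(\<And>x. x \<in> vars e \<Longrightarrow> \<sigma> x = \<tau> x) \<Longrightarrow> aval w e \<sigma> = aval w e \<tau>"
  by (induction e) auto

lemma ok_cong: "(\<And>x. x \<in> vars e \<Longrightarrow> \<sigma> x = \<tau> x) \<Longrightarrow> ok w e \<sigma> = ok w e \<tau>"
proof (induction e)
  case (Arr x e f)
  then have "aval w e \<sigma> = aval w e \<tau>" "aval w f \<sigma> = aval w f \<tau>"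
    by (auto intro: aval_cong)
  with Arr show ?case by auto
next
  case (Inp e)
  then have "aval w e \<sigma> = aval w e \<tau>" by (auto intro: aval_cong)
  with Inp show ?case by auto
qed auto

text \<open>Nonnegative addresses hold the input, so the \<open>32\<close> arrays live at negative ones. The pairing
  \<open>(i + j)\<^sup>2 + j\<close> is injective and, unlike the triangular one, needs no division.\<close>

definition cell :: "nat \<Rightarrow> nat \<Rightarrow> nat \<Rightarrow> int" where
  "cell x i j = - 1 - int x - 32 * ((int i + int j) * (int i + int j) + int j)"

text \<open>The number \<open>(i + j)^2 + j\<close> lies between \<open>(i + j)^2\<close> and the
  next square, so it determines \<open>i + j\<close>, and then \<open>j\<close>.\<close>

lemma pairing_inj:
  fixes i j i' j' :: nat
  assumes "(i + j) * (i + j) + j = (i' + j') * (i' + j') + j'"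
  shows "i = i' \<and> j = j'"
proof -
  have less: "(a + b) * (a + b) + b < (c + d) * (c + d) + d" if "a + b < c + d" for a b c d :: nat
  proof -
    have "(a + b) * (a + b) + b < (Suc (a + b)) * (Suc (a + b))" by simp
    also have "\<dots> \<le> (c + d) * (c + d)" using that by (intro mult_mono) auto
    finally show ?thesis by linarith
  qed
  have "i + j = i' + j'"
    using less[of i j i' j'] less[of i' j' i j] assms by (metis less_irrefl linorder_neqE_nat)
  then show ?thesis using assms by auto
qed

lemma cell_eq_iff:
  assumes "x < 32" "x' < 32"
  shows "cell x i j = cell x' i' j' \<longleftrightarrow> x = x' \<and> i = i' \<and> j = j'"
proof
  assume "cell x i j = cell x' i' j'"
  then have "int x + 32 * ((int i + int j) * (int i + int j) + int j)
           = int x' + 32 * ((int i' + int j') * (int i' + int j') + int j')"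
    unfolding cell_def by simp
  then have "int (x + 32 * ((i + j) * (i + j) + j)) = int (x' + 32 * ((i' + j') * (i' + j') + j'))"
    by simp
  then have *: "x + 32 * ((i + j) * (i + j) + j) = x' + 32 * ((i' + j') * (i' + j') + j')"
    by linarith
  then have "(x + 32 * ((i + j) * (i + j) + j)) mod 32 = (x' + 32 * ((i' + j') * (i' + j') + j')) mod 32"
    by (rule arg_cong)
  then have "x = x'" using assms by (simp only: mod_mult_self2 mod_less)
  with * have "(i + j) * (i + j) + j = (i' + j') * (i' + j') + j'" by simp
  with \<open>x = x'\<close> show "x = x' \<and> i = i' \<and> j = j'" using pairing_inj by blast
qed auto

lemma cell_neg: "cell x i j < 0"
proof -
  have *: "- 1 - int x - 32 * k < 0" if "0 \<le> k" for k using that by linarith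
  show ?thesis unfolding cell_def by (rule *) simp
qed

fun comp_addr :: "nat \<Rightarrow> expr \<Rightarrow> expr \<Rightarrow> expr" where
  "comp_addr x e f = Sub (Const (- 1 - int x)) (Mul (Const 32) (Add (Mul (Add e f) (Add e f)) f))"

fun comp_exp :: "aexp \<Rightarrow> expr" where
  "comp_exp (Num z) = Const z"
| "comp_exp (Arr x e f) = Load (comp_addr x (comp_exp e) (comp_exp f))"
| "comp_exp (Inp e) = Load (comp_exp e)"
| "comp_exp (Plus e f) = Add (comp_exp e) (comp_exp f)"
| "comp_exp (Minus e f) = Sub (comp_exp e) (comp_exp f)"
| "comp_exp (Times e f) = Mul (comp_exp e) (comp_exp f)"
| "comp_exp (Quot e f) = Div (comp_exp e) (comp_exp f)"

fun comp :: "com \<Rightarrow> prog" where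
  "comp CSkip = Skip"
| "comp (Asg x e f v) = Store (comp_addr x (comp_exp e) (comp_exp f)) (comp_exp v)"
| "comp (CSeq p q) = Seq (comp p) (comp q)"
| "comp (CIf e p q) = IfPos (comp_exp e) (comp p) (comp q)"
| "comp (CWhile e p) = WhilePos (comp_exp e) (comp p)"

text \<open>All nonnegative cells must keep the input, cell \<open>0\<close> included; hence the
  answer is kept in an array and moved to cell \<open>0\<close> only after the compiled program has
  ended.\<close>

definition represents :: "(int \<Rightarrow> int) \<Rightarrow> memory \<Rightarrow> store \<Rightarrow> bool" where
  "represents w s \<sigma> \<longleftrightarrow> (\<forall>a\<ge>0. s a = w a) \<and> (\<forall>x<32. \<forall>i j. s (cell x i j) = \<sigma> x i j)"

definition upd :: "store \<Rightarrow> nat \<Rightarrow> nat \<Rightarrow> nat \<Rightarrow> int \<Rightarrow> store" where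
  "upd \<sigma> x i j v = \<sigma>(x := (\<sigma> x)(i := (\<sigma> x i)(j := v)))"

lemma upd_same [simp]: "upd \<sigma> x i j v x = (\<sigma> x)(i := (\<sigma> x i)(j := v))"
  and upd_other [simp]: "y \<noteq> x \<Longrightarrow> upd \<sigma> x i j v y = \<sigma> y"
  by (simp_all add: upd_def)

lemma eval_comp_addr:
  "0 \<le> eval e s \<Longrightarrow> 0 \<le> eval f s \<Longrightarrow>
   eval (comp_addr x e f) s = cell x (nat (eval e s)) (nat (eval f s))"
  by (simp add: cell_def)

lemma eval_comp_exp:
  "represents w s \<sigma> \<Longrightarrow> ok w e \<sigma> \<Longrightarrow> eval (comp_exp e) s = aval w e \<sigma>"
proof (induction e)
  case (Arr x e f)
  then show ?case
    using eval_comp_addr[of "comp_exp e" s "comp_exp f" x]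
    by (simp add: represents_def)
qed (auto simp: represents_def)

lemma represents_upd:
  assumes "represents w s \<sigma>" "x < 32"
  shows "represents w (s(cell x i j := v)) (upd \<sigma> x i j v)"
proof -
  have "(s(cell x i j := v)) a = w a" if "a \<ge> 0" for a
    using assms(1) that cell_neg[of x i j] by (auto simp: represents_def)
  moreover have "(s(cell x i j := v)) (cell y i' j') = upd \<sigma> x i j v y i' j'" if "y < 32" for y i' j'
    using assms that cell_eq_iff[of y x i' j' i j] by (auto simp: represents_def upd_def)
  ultimately show ?thesis by (simp add: represents_def)
qed

section \<open>Costs\<close>

text \<open>If all cells hold at most \<open>W \<ge> 1\<close> bits, the value of \<open>e\<close> has at most \<open>val_const e * W\<close> bits and
  evaluating \<open>e\<close> costs at most \<open>cost_const e * W\<close>.\<close>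

fun val_const :: "expr \<Rightarrow> nat" where
  "val_const (Const z) = bit_length z"
| "val_const (Load e) = 1"
| "val_const (Add e f) = val_const e + val_const f + 1"
| "val_const (Sub e f) = val_const e + val_const f + 1"
| "val_const (Mul e f) = val_const e + val_const f"
| "val_const (Div e f) = val_const e"

fun cost_const :: "expr \<Rightarrow> nat" where
  "cost_const (Const z) = bit_length z"
| "cost_const (Load e) = cost_const e + 3"
| "cost_const (Add e f) = cost_const e + cost_const f + val_const (Add e f) + 2"
| "cost_const (Sub e f) = cost_const e + cost_const f + val_const (Add e f) + 2"
| "cost_const (Mul e f) = cost_const e + cost_const f + val_const (Mul e f) + 2"
| "cost_const (Div e f) = cost_const e + cost_const f + val_const (Div e f) + 2"

lemma abs_le_bit_length: "\<bar>z\<bar> < 2 ^ bit_length z"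
proof -
  have "nat \<bar>z\<bar> < 2 ^ floorlog 2 (nat \<bar>z\<bar>)"
    using floorlog_bounds[of "nat \<bar>z\<bar>" 2] by (cases "nat \<bar>z\<bar> = 0") auto
  then have "int (nat \<bar>z\<bar>) < int (2 ^ floorlog 2 (nat \<bar>z\<bar>))" by linarith
  then show ?thesis unfolding bit_length_def by simp
qed

text \<open>The summand \<open>2\<close> covers the sign bit and the boundary case
  \<open>2 ^ k\<close>, which needs one more bit. It is the origin of the additive constants
  \<open>2\<close> and \<open>3\<close> in \<open>cost_const\<close>.\<close>

lemma bit_length_le:
  assumes "\<bar>z\<bar> \<le> 2 ^ k"
  shows "bit_length z \<le> k + 2"
proof -
  have "\<bar>z\<bar> < 2 ^ Suc k"
    using assms zero_less_power[of "2::int" k] by (simp del: zero_less_power)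
  then have "nat \<bar>z\<bar> < 2 ^ Suc k" by (simp add: nat_less_iff)
  then have "floorlog 2 (nat \<bar>z\<bar>) \<le> Suc k"
    by (intro floorlog_leI) auto
  then show ?thesis unfolding bit_length_def by simp
qed

lemma abs_div_le: "\<bar>a div b\<bar> \<le> \<bar>a :: int\<bar>"
proof -
  have pos: "\<bar>a div b\<bar> \<le> \<bar>a\<bar>" if b: "b > 0" for a b :: int
  proof -
    define q r where "q = a div b" and "r = a mod b"
    have a: "a = b * q + r" and r: "0 \<le> r" "r < b"
      using b by (simp_all add: q_def r_def)
    show ?thesis
    proof (cases "q \<ge> 0")
      case True
      then have "1 * q \<le> b * q" using b by (intro mult_right_mono) auto
      then show ?thesis using a r True unfolding q_def[symmetric] by linarith
    next
      case False
      \<comment> \<open>Together with \<open>r \<le> b - 1\<close> this says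
        \<open>a \<le> q\<close>, and \<open>q\<close> is negative here.\<close>
      then have "(b - 1) * (q + 1) \<le> 0" using b by (intro mult_nonneg_nonpos) auto
      moreover have "(b - 1) * (q + 1) = b * q + b - q - 1" by (simp add: algebra_simps)
      ultimately show ?thesis using a r False unfolding q_def[symmetric] by linarith
    qed
  qed
  show ?thesis
    using pos[of b a] pos[of "- b" "- a"] by (cases "b = 0"; cases "b > 0") auto
qed

lemma val_const_bound:
  assumes "\<And>a. \<bar>s a\<bar> \<le> 2 ^ W" "1 \<le> W"
  shows "\<bar>eval e s\<bar> \<le> 2 ^ (val_const e * W)"
proof (induction e)
  case (Const z)
  have "\<bar>z\<bar> \<le> 2 ^ bit_length z" using abs_le_bit_length[of z] by simp
  also have "(2::int) ^ bit_length z \<le> 2 ^ (bit_length z * W)"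
    using assms(2) by (intro power_increasing) auto
  finally show ?case by simp
next
  case (Load e)
  then show ?case using assms(1) by simp
next
  case (Add e f)
  define S where "S = val_const e * W + val_const f * W"
  have "(2::int) ^ (val_const e * W) \<le> 2 ^ S" "(2::int) ^ (val_const f * W) \<le> 2 ^ S"
    unfolding S_def by (intro power_increasing; simp)+
  moreover have "(2::int) ^ (S + 1) = 2 * 2 ^ S" by simp
  ultimately have "\<bar>eval (Add e f) s\<bar> \<le> 2 ^ (S + 1)"
    using Add.IH unfolding eval.simps by linarith
  also have "\<dots> \<le> 2 ^ (val_const (Add e f) * W)"
    using assms(2) by (intro power_increasing) (auto simp: S_def algebra_simps)
  finally show ?case .
next
  case (Sub e f)
  define S where "S = val_const e * W + val_const f * W"
  have "(2::int) ^ (val_const e * W) \<le> 2 ^ S" "(2::int) ^ (val_const f * W) \<le> 2 ^ S"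
    unfolding S_def by (intro power_increasing; simp)+
  moreover have "(2::int) ^ (S + 1) = 2 * 2 ^ S" by simp
  ultimately have "\<bar>eval (Sub e f) s\<bar> \<le> 2 ^ (S + 1)"
    using Sub.IH unfolding eval.simps by linarith
  also have "\<dots> \<le> 2 ^ (val_const (Sub e f) * W)"
    using assms(2) by (intro power_increasing) (auto simp: S_def algebra_simps)
  finally show ?case .
next
  case (Mul e f)
  then have "\<bar>eval e s\<bar> * \<bar>eval f s\<bar> \<le> 2 ^ (val_const e * W) * 2 ^ (val_const f * W)"
    by (intro mult_mono) auto
  then show ?case by (simp add: abs_mult power_add distrib_right)
next
  case (Div e f)
  then show ?case using abs_div_le[of "eval e s" "eval f s"] by simp
qed

lemma cost_const_bound:
  assumes "\<And>a. \<bar>s a\<bar> \<le> 2 ^ W" "1 \<le> W"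
  shows "eval_cost e s \<le> cost_const e * W"
proof -
  have *: "bit_length (eval e s) \<le> val_const e * W + 2 * W" for e
    using bit_length_le[OF val_const_bound[where s = s and W = W and e = e, OF assms]] assms(2) by linarith
  show ?thesis
  proof (induction e)
    case (Const z)
    then show ?case using assms(2) by simp
  next
    case (Load e)
    then show ?case using *[of "Load e"] by (simp add: algebra_simps)
  next
    case (Add e f)
    then show ?case using *[of "Add e f"] by (simp add: algebra_simps)
  next
    case (Sub e f)
    then show ?case using *[of "Sub e f"] by (simp add: algebra_simps)
  next
    case (Mul e f)
    then show ?case using *[of "Mul e f"] by (simp add: algebra_simps)
  next
    case (Div e f)
    then show ?case using *[of "Div e f"] by (simp add: algebra_simps)
  qed
qed

text \<open>Polymorphic, so that the same recursion yields a number and the polynomial that bounds it.\<close>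

fun time_bound :: "com \<Rightarrow> 'a::comm_semiring_1 \<Rightarrow> 'a \<Rightarrow> 'a" where
  "time_bound CSkip R W = 1"
| "time_bound (Asg x e f v) R W =
    1 + of_nat (cost_const (comp_addr x (comp_exp e) (comp_exp f)) + cost_const (comp_exp v)) * W"
| "time_bound (CSeq p q) R W = 1 + time_bound p R W + time_bound q R W"
| "time_bound (CIf e p q) R W =
    1 + of_nat (cost_const (comp_exp e)) * W + time_bound p R W + time_bound q R W"
| "time_bound (CWhile e p) R W =
    (R + 1) * (1 + of_nat (cost_const (comp_exp e)) * W + time_bound p R W)"

lemma poly_time_bound:
  "poly (time_bound p R W) x = time_bound p (poly R x) (poly W x)"
  by (induction p) (simp_all)

section \<open>Weakest preconditions\<close>

text \<open>\<open>w\<close> is the read-only input; a loop must come with an invariant indexed by the number of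
  iterations made.\<close>

fun wp :: "(int \<Rightarrow> int) \<Rightarrow> nat \<Rightarrow> int \<Rightarrow> com \<Rightarrow> (store \<Rightarrow> bool) \<Rightarrow> store \<Rightarrow> bool" where
  "wp w R B CSkip Q \<sigma> \<longleftrightarrow> Q \<sigma>"
| "wp w R B (Asg x e f v) Q \<sigma> \<longleftrightarrow>
    x < 32 \<and> ok w e \<sigma> \<and> ok w f \<sigma> \<and> ok w v \<sigma> \<and> 0 \<le> aval w e \<sigma> \<and> 0 \<le> aval w f \<sigma> \<and>
    \<bar>aval w v \<sigma>\<bar> \<le> B \<and> Q (upd \<sigma> x (nat (aval w e \<sigma>)) (nat (aval w f \<sigma>)) (aval w v \<sigma>))"
| "wp w R B (CSeq p q) Q \<sigma> \<longleftrightarrow> wp w R B p (wp w R B q Q) \<sigma>"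
| "wp w R B (CIf e p q) Q \<sigma> \<longleftrightarrow>
    ok w e \<sigma> \<and> (if 0 < aval w e \<sigma> then wp w R B p Q \<sigma> else wp w R B q Q \<sigma>)"
| "wp w R B (CWhile e p) Q \<sigma> \<longleftrightarrow>
    (\<exists>Inv. Inv 0 \<sigma> \<and>
      (\<forall>(j::nat) \<sigma>. Inv j \<sigma> \<longrightarrow> ok w e \<sigma> \<and>
         (if 0 < aval w e \<sigma> then j < R \<and> wp w R B p (Inv (Suc j)) \<sigma> else Q \<sigma>)))"

lemma wp_mono: "wp w R B p Q \<sigma> \<Longrightarrow> (\<And>\<tau>. Q \<tau> \<Longrightarrow> Q' \<tau>) \<Longrightarrow> wp w R B p Q' \<sigma>"
proof (induction p arbitrary: Q Q' \<sigma>)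
  case (CSeq p q)
  show ?case using CSeq.prems CSeq.IH by (fastforce)
next
  case (CIf e p q)
  then show ?case by (auto split: if_splits)
next
  case (CWhile e p)
  from CWhile.prems(1) obtain Inv where "Inv 0 \<sigma>" "\<And>j \<sigma>. Inv j \<sigma> \<Longrightarrow> ok w e \<sigma> \<and>
         (if 0 < aval w e \<sigma> then j < R \<and> wp w R B p (Inv (Suc j)) \<sigma> else Q \<sigma>)" by auto
  then show ?case using CWhile.prems(2) by (auto intro!: exI[of _ Inv])
qed auto

text \<open>Only stored values are bounded by \<open>2 ^ W\<close>. A value inside an expression may
  be larger, but its bit length exceeds \<open>W\<close> at most by a factor that is read off the
  program text.\<close>

theorem wp_sound:
  assumes "wp w R (2 ^ W) p Q \<sigma>" "represents w s \<sigma>" "\<And>a. \<bar>s a\<bar> \<le> 2 ^ W" "1 \<le> W"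
  shows "\<exists>t s' \<sigma>'. exec (comp p) s t s' \<and> t \<le> time_bound p R W \<and>
    represents w s' \<sigma>' \<and> (\<forall>a. \<bar>s' a\<bar> \<le> 2 ^ W) \<and> Q \<sigma>'"
  using assms(1-3)
proof (induction p arbitrary: Q \<sigma> s)
  case CSkip
  then show ?case by (auto intro!: exI exec_Skip)
next
  case (Asg x e f v)
  let ?a = "comp_addr x (comp_exp e) (comp_exp f)"
  have e: "eval (comp_exp e) s = aval w e \<sigma>" "eval (comp_exp f) s = aval w f \<sigma>"
     "eval (comp_exp v) s = aval w v \<sigma>"
    using Asg.prems by (auto intro: eval_comp_exp)
  then have a: "eval ?a s = cell x (nat (aval w e \<sigma>)) (nat (aval w f \<sigma>))"
    using eval_comp_addr[of "comp_exp e" s "comp_exp f" x] Asg.prems by simp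
  have "exec (comp (Asg x e f v)) s (1 + eval_cost ?a s + eval_cost (comp_exp v) s)
      (s(cell x (nat (aval w e \<sigma>)) (nat (aval w f \<sigma>)) := aval w v \<sigma>))"
    using exec_Store[of ?a "comp_exp v" s] unfolding a e by (simp del: comp_addr.simps)
  moreover have "1 + eval_cost ?a s + eval_cost (comp_exp v) s \<le> time_bound (Asg x e f v) R W"
    using cost_const_bound[where s = s and W = W and e = ?a, OF Asg.prems(3) assms(4)]
      cost_const_bound[where s = s and W = W and e = "comp_exp v", OF Asg.prems(3) assms(4)]
    by (simp add: distrib_right del: comp_addr.simps)
  moreover have "represents w (s(cell x (nat (aval w e \<sigma>)) (nat (aval w f \<sigma>)) := aval w v \<sigma>))
     (upd \<sigma> x (nat (aval w e \<sigma>)) (nat (aval w f \<sigma>)) (aval w v \<sigma>))"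
    using Asg.prems by (intro represents_upd) auto
  ultimately show ?case using Asg.prems by (fastforce simp del: comp.simps time_bound.simps)
next
  case (CSeq p q)
  from CSeq.prems(1) have "wp w R (2 ^ W) p (wp w R (2 ^ W) q Q) \<sigma>" by simp
  from CSeq.IH(1)[OF this CSeq.prems(2,3)] obtain t s' \<sigma>' where
    1: "exec (comp p) s t s'" "t \<le> time_bound p R W" "represents w s' \<sigma>'"
       "\<forall>a. \<bar>s' a\<bar> \<le> 2 ^ W" "wp w R (2 ^ W) q Q \<sigma>'" by blast
  from CSeq.IH(2)[OF 1(5,3)] 1(4) obtain u s'' \<sigma>'' where
    2: "exec (comp q) s' u s''" "u \<le> time_bound q R W" "represents w s'' \<sigma>''"
       "\<forall>a. \<bar>s'' a\<bar> \<le> 2 ^ W" "Q \<sigma>''" by blast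
  show ?case
    using exec_Seq[OF 1(1) 2(1)] 1(2) 2(2-5)
    by (intro exI[of _ "1 + t + u"] exI[of _ s''] exI[of _ \<sigma>'']) auto
next
  case (CIf e p q)
  have e: "eval (comp_exp e) s = aval w e \<sigma>"
    using CIf.prems by (auto intro: eval_comp_exp)
  have c: "eval_cost (comp_exp e) s \<le> cost_const (comp_exp e) * W"
    by (rule cost_const_bound[OF CIf.prems(3) assms(4)])
  show ?case
  proof (cases "0 < aval w e \<sigma>")
    case True
    then have "wp w R (2 ^ W) p Q \<sigma>" using CIf.prems(1) by simp
    from CIf.IH(1)[OF this CIf.prems(2,3)] obtain t s' \<sigma>' where
      1: "exec (comp p) s t s'" "t \<le> time_bound p R W" "represents w s' \<sigma>'"
       "\<forall>a. \<bar>s' a\<bar> \<le> 2 ^ W" "Q \<sigma>'" by blast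
    have "exec (comp (CIf e p q)) s (1 + eval_cost (comp_exp e) s + t) s'"
      using exec_IfPos_True[of "comp_exp e" s "comp p" t s' "comp q"] 1(1) True e by simp
    moreover have "1 + eval_cost (comp_exp e) s + t \<le> time_bound (CIf e p q) R W"
      using c 1(2) by simp
    ultimately show ?thesis using 1(3-5) by blast
  next
    case False
    then have "wp w R (2 ^ W) q Q \<sigma>" using CIf.prems(1) by simp
    from CIf.IH(2)[OF this CIf.prems(2,3)] obtain t s' \<sigma>' where
      1: "exec (comp q) s t s'" "t \<le> time_bound q R W" "represents w s' \<sigma>'"
       "\<forall>a. \<bar>s' a\<bar> \<le> 2 ^ W" "Q \<sigma>'" by blast
    have "exec (comp (CIf e p q)) s (1 + eval_cost (comp_exp e) s + t) s'"
      using exec_IfPos_False[of "comp_exp e" s "comp q" t s' "comp p"] 1(1) False e by simp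
    moreover have "1 + eval_cost (comp_exp e) s + t \<le> time_bound (CIf e p q) R W"
      using c 1(2) by simp
    ultimately show ?thesis using 1(3-5) by blast
  qed
next
  case (CWhile e p)
  from CWhile.prems(1) obtain Inv where Inv: "Inv 0 \<sigma>" "\<And>j \<sigma>. Inv j \<sigma> \<Longrightarrow> ok w e \<sigma> \<and>
      (if 0 < aval w e \<sigma> then j < R \<and> wp w R (2 ^ W) p (Inv (Suc j)) \<sigma> else Q \<sigma>)" by auto
  define c where "c = cost_const (comp_exp e) * W"
  define T :: nat where "T = time_bound p R W"
  \<comment> \<open>From iteration \<open>j\<close> on, the guard is evaluated at most
    \<open>R - j + 1\<close> times, the last time unsuccessfully.\<close>
  have "\<exists>t s' \<sigma>'. exec (comp (CWhile e p)) s t s' \<and> t \<le> (R - j + 1) * (1 + c + T) \<and>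
    represents w s' \<sigma>' \<and> (\<forall>a. \<bar>s' a\<bar> \<le> 2 ^ W) \<and> Q \<sigma>'"
    if "Inv j \<sigma>" "represents w s \<sigma>" "\<And>a. \<bar>s a\<bar> \<le> 2 ^ W" for j \<sigma> s
    using that
  proof (induction "R - j" arbitrary: j \<sigma> s rule: less_induct)
    case less
    have okk: "ok w e \<sigma>" using Inv(2) less.prems(1) by blast
    then have e: "eval (comp_exp e) s = aval w e \<sigma>" using less.prems(2) eval_comp_exp by blast
    have c: "eval_cost (comp_exp e) s \<le> c"
      unfolding c_def by (rule cost_const_bound[OF less.prems(3) assms(4)])
    show ?case
    proof (cases "0 < aval w e \<sigma>")
      case True
      then have j: "j < R" and "wp w R (2 ^ W) p (Inv (Suc j)) \<sigma>"
        using Inv(2)[OF less.prems(1)] by auto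
      from CWhile.IH[OF this(2) less.prems(2,3)] obtain t s' \<sigma>' where
        1: "exec (comp p) s t s'" "t \<le> T" "represents w s' \<sigma>'"
         "\<forall>a. \<bar>s' a\<bar> \<le> 2 ^ W" "Inv (Suc j) \<sigma>'" unfolding T_def by blast
      have "R - Suc j < R - j" using j by simp
      from less.hyps[OF this 1(5,3) spec[OF 1(4)]] obtain u s'' \<sigma>'' where
        2: "exec (comp (CWhile e p)) s' u s''" "u \<le> (R - Suc j + 1) * (1 + c + T)"
          "represents w s'' \<sigma>''" "\<forall>a. \<bar>s'' a\<bar> \<le> 2 ^ W" "Q \<sigma>''" by blast
      have "exec (comp (CWhile e p)) s (1 + eval_cost (comp_exp e) s + t + u) s''"
        using exec_WhilePos_True[of "comp_exp e" s "comp p" t s' u s''] 1 2 True e by simp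
      moreover have "1 + eval_cost (comp_exp e) s + t + u \<le> (R - j + 1) * (1 + c + T)"
      proof -
        have "R - j + 1 = Suc (R - Suc j + 1)" using j by simp
        then have "(R - j + 1) * (1 + c + T) = (1 + c + T) + (R - Suc j + 1) * (1 + c + T)"
          by (metis mult_Suc)
        then show ?thesis using c 1(2) 2(2) by linarith
      qed
      ultimately show ?thesis using 2(3-5) by blast
    next
      case False
      then have "Q \<sigma>" using Inv(2)[OF less.prems(1)] by auto
      moreover have "exec (comp (CWhile e p)) s (1 + eval_cost (comp_exp e) s) s"
        using exec_WhilePos_False[of "comp_exp e" s "comp p"] False e by simp
      moreover have "1 + eval_cost (comp_exp e) s \<le> (R - j + 1) * (1 + c + T)"
        using c by (simp add: add_mono le_add1 trans_le_add1)
      ultimately show ?thesis using less.prems(2,3) by blast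
    qed
  qed
  from this[OF Inv(1) CWhile.prems(2,3)] show ?case by (simp add: c_def T_def)
qed

section \<open>Frame rule, counting loops and sums\<close>

fun mods :: "com \<Rightarrow> nat set" where
  "mods CSkip = {}"
| "mods (Asg x e f v) = {x}"
| "mods (CSeq p q) = mods p \<union> mods q"
| "mods (CIf e p q) = mods p \<union> mods q"
| "mods (CWhile e p) = mods p"

text \<open>A fixed reference store and a set \<open>M\<close> that may be larger than
  \<open>mods p\<close> make the claim inductive: both halves of a sequence are compared with the
  same store, although each of them modifies only a part of \<open>M\<close>.\<close>

lemma wp_frame_aux:
  "wp w R B p Q \<sigma> \<Longrightarrow> mods p \<subseteq> M \<Longrightarrow> \<forall>x. x \<notin> M \<longrightarrow> \<sigma> x = \<sigma>\<^sub>0 x \<Longrightarrow>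
   wp w R B p (\<lambda>\<tau>. Q \<tau> \<and> (\<forall>x. x \<notin> M \<longrightarrow> \<tau> x = \<sigma>\<^sub>0 x)) \<sigma>"
proof (induction p arbitrary: Q \<sigma>)
  case (CSeq p q)
  from CSeq.prems have "wp w R B p (\<lambda>\<tau>. wp w R B q Q \<tau> \<and> (\<forall>x. x \<notin> M \<longrightarrow> \<tau> x = \<sigma>\<^sub>0 x)) \<sigma>"
    by (intro CSeq.IH(1)) auto
  then show ?case
    unfolding wp.simps(3) by (rule wp_mono) (use CSeq.IH(2) CSeq.prems(2) in auto)
next
  case (CWhile e p)
  from CWhile.prems(1) obtain Inv where Inv: "Inv 0 \<sigma>" "\<And>j \<sigma>. Inv j \<sigma> \<Longrightarrow> ok w e \<sigma> \<and>
      (if 0 < aval w e \<sigma> then j < R \<and> wp w R B p (Inv (Suc j)) \<sigma> else Q \<sigma>)" by auto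
  show ?case
    using Inv CWhile.prems(2,3) CWhile.IH
    by (auto intro!: exI[of _ "\<lambda>j \<tau>. Inv j \<tau> \<and> (\<forall>x. x \<notin> M \<longrightarrow> \<tau> x = \<sigma>\<^sub>0 x)"])
qed (auto simp: upd_def split: if_splits)

lemma wp_frame:
  assumes "wp w R B p Q \<sigma>"
  shows "wp w R B p (\<lambda>\<tau>. Q \<tau> \<and> (\<forall>x. x \<notin> mods p \<longrightarrow> \<tau> x = \<sigma> x)) \<sigma>"
  using wp_frame_aux[OF assms subset_refl] by simp

abbreviation Var :: "nat \<Rightarrow> aexp" where "Var x \<equiv> Arr x (Num 0) (Num 0)"
abbreviation Set_Var :: "nat \<Rightarrow> aexp \<Rightarrow> com" where "Set_Var x v \<equiv> Asg x (Num 0) (Num 0) v"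

definition For :: "nat \<Rightarrow> aexp \<Rightarrow> com \<Rightarrow> com" where
  "For x e p = Set_Var x (Num 0) ;;
     CWhile (Minus e (Var x)) (p ;; Set_Var x (Plus (Var x) (Num 1)))"

lemma mods_For [simp]: "mods (For x e p) = insert x (mods p)"
  by (auto simp: For_def)

text \<open>The counter is incremented after the body, so the body has to establish the invariant
  for the store in which the counter already reads \<open>Suc j\<close>. Agreement with the initial
  store outside the modified variables comes for free by the frame rule; an invariant need only
  speak of what changes.\<close>

lemma wp_For:
  assumes x: "x < 32" "x \<notin> mods p" "vars e \<inter> insert x (mods p) = {}"
    and n: "ok w e \<sigma>" "aval w e \<sigma> = int n" "n \<le> R" "int n \<le> B"
    and init: "I 0 (upd \<sigma> x 0 0 0)"
    and step: "\<And>j \<tau>. j < n \<Longrightarrow> I j \<tau> \<Longrightarrow> \<tau> x 0 0 = int j \<Longrightarrow>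
       (\<And>y. y \<notin> insert x (mods p) \<Longrightarrow> \<tau> y = \<sigma> y) \<Longrightarrow>
       wp w R B p (\<lambda>\<tau>'. I (Suc j) (upd \<tau>' x 0 0 (int (Suc j)))) \<tau>"
    and post: "\<And>\<tau>. I n \<tau> \<Longrightarrow> (\<And>y. y \<notin> insert x (mods p) \<Longrightarrow> \<tau> y = \<sigma> y) \<Longrightarrow> Q \<tau>"
  shows "wp w R B (For x e p) Q \<sigma>"
proof -
  define Inv where "Inv j \<tau> \<longleftrightarrow> j \<le> n \<and> I j \<tau> \<and> \<tau> x 0 0 = int j \<and>
    (\<forall>y. y \<notin> insert x (mods p) \<longrightarrow> \<tau> y = \<sigma> y)" for j \<tau>
  have "Inv 0 (upd \<sigma> x 0 0 0)" using init by (simp add: Inv_def)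
  moreover have "ok w (Minus e (Var x)) \<tau> \<and> (if 0 < aval w (Minus e (Var x)) \<tau> then
      j < R \<and> wp w R B (p ;; Set_Var x (Plus (Var x) (Num 1))) (Inv (Suc j)) \<tau> else Q \<tau>)"
    if I: "Inv j \<tau>" for j \<tau>
  proof -
    have eq: "\<tau> y = \<sigma> y" if "y \<in> vars e" for y
      using I x(3) that unfolding Inv_def by blast
    have e: "aval w e \<tau> = int n" "ok w e \<tau>"
      using n(1,2) aval_cong[of e \<tau> \<sigma> w] ok_cong[of e \<tau> \<sigma> w] eq by auto
    show ?thesis
    proof (cases "j < n")
      case True
      have "wp w R B p (\<lambda>\<tau>'. I (Suc j) (upd \<tau>' x 0 0 (int (Suc j)))) \<tau>"
        using I by (intro step[OF True]) (auto simp: Inv_def)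
      from wp_frame[OF this] have "wp w R B p (wp w R B (Set_Var x (Plus (Var x) (Num 1))) (Inv (Suc j))) \<tau>"
      proof (rule wp_mono)
        fix \<rho> assume \<rho>: "I (Suc j) (upd \<rho> x 0 0 (int (Suc j))) \<and> (\<forall>y. y \<notin> mods p \<longrightarrow> \<rho> y = \<tau> y)"
        then have "\<rho> x 0 0 = int j" using x(2) I by (auto simp: Inv_def)
        with \<rho> show "wp w R B (Set_Var x (Plus (Var x) (Num 1))) (Inv (Suc j)) \<rho>"
          using x True n(4) I by (auto simp: Inv_def add.commute)
      qed
      then show ?thesis using e x(1) True n(3) I by (auto simp: Inv_def)
    next
      case False
      then have "j = n" using I by (auto simp: Inv_def)
      then show ?thesis using e x(1) I by (auto simp: Inv_def intro: post)
    qed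
  qed
  ultimately have "wp w R B (CWhile (Minus e (Var x)) (p ;; Set_Var x (Plus (Var x) (Num 1)))) Q (upd \<sigma> x 0 0 0)"
    by (subst wp.simps(5)) (rule exI[of _ Inv], blast)
  then show ?thesis
    using x(1) n(4) by (simp add: For_def del: wp.simps(5))
qed

definition Sum :: "nat \<Rightarrow> nat \<Rightarrow> aexp \<Rightarrow> aexp \<Rightarrow> com" where
  "Sum y x e f = Set_Var y (Num 0) ;; For x e (Set_Var y (Plus (Var y) f))"

lemma mods_Sum [simp]: "mods (Sum y x e f) = {y, x}"
  by (auto simp: Sum_def)

text \<open>Every partial sum is stored, so the bound has to cover all of them; bounding the sum of
  the absolute values does so whatever the signs are.\<close>

lemma wp_Sum:
  assumes x: "x < 32" "y < 32" "x \<noteq> y" "vars e \<inter> {x, y} = {}"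
    and n: "ok w e \<sigma>" "aval w e \<sigma> = int n" "n \<le> R" "int n \<le> B"
    and f: "\<And>j \<tau>. j < n \<Longrightarrow> \<tau> x 0 0 = int j \<Longrightarrow>
       (\<And>z. z \<notin> {x, y} \<Longrightarrow> \<tau> z = \<sigma> z) \<Longrightarrow> ok w f \<tau> \<and> aval w f \<tau> = F j"
    and B: "(\<Sum>j<n. \<bar>F j\<bar>) \<le> B"
    and post: "\<And>\<tau>. \<tau> y 0 0 = (\<Sum>j<n. F j) \<Longrightarrow> (\<And>z. z \<notin> {x, y} \<Longrightarrow> \<tau> z = \<sigma> z) \<Longrightarrow> Q \<tau>"
  shows "wp w R B (Sum y x e f) Q \<sigma>"
proof -
  have partial: "\<bar>\<Sum>l<j. F l\<bar> \<le> B" if "j \<le> n" for j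
  proof -
    have "\<bar>\<Sum>l<j. F l\<bar> \<le> (\<Sum>l<j. \<bar>F l\<bar>)" by (rule sum_abs)
    also have "\<dots> \<le> (\<Sum>l<n. \<bar>F l\<bar>)" using that by (intro sum_mono2) auto
    finally show ?thesis using B by linarith
  qed
  have e: "ok w e (upd \<sigma> y 0 0 0)" "aval w e (upd \<sigma> y 0 0 0) = int n"
  proof -
    have eq: "upd \<sigma> y 0 0 0 z = \<sigma> z" if "z \<in> vars e" for z
      using x(4) that by (intro upd_other) auto
    show "ok w e (upd \<sigma> y 0 0 0)" "aval w e (upd \<sigma> y 0 0 0) = int n"
      using n(1,2) aval_cong[of e "upd \<sigma> y 0 0 0" \<sigma> w] ok_cong[of e "upd \<sigma> y 0 0 0" \<sigma> w] eq
      by auto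
  qed
  have "wp w R B (For x e (Set_Var y (Plus (Var y) f))) Q (upd \<sigma> y 0 0 0)"
  proof (rule wp_For[where I = "\<lambda>j \<tau>. \<tau> y 0 0 = (\<Sum>l<j. F l)" and n = n])
    show "wp w R B (Set_Var y (Plus (Var y) f))
       (\<lambda>\<tau>'. upd \<tau>' x 0 0 (int (Suc j)) y 0 0 = (\<Sum>l<Suc j. F l)) \<tau>"
      if "j < n" "\<tau> y 0 0 = (\<Sum>l<j. F l)" "\<tau> x 0 0 = int j"
        "\<And>z. z \<notin> insert x (mods (Set_Var y (Plus (Var y) f))) \<Longrightarrow> \<tau> z = upd \<sigma> y 0 0 0 z" for j \<tau>
    proof -
      have "ok w f \<tau> \<and> aval w f \<tau> = F j"
        by (rule f) (use that in auto)
      moreover have "\<bar>\<Sum>l<Suc j. F l\<bar> \<le> B" using that(1) by (intro partial) auto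
      ultimately show ?thesis using x that(2) by auto
    qed
    show "Q \<tau>" if "\<tau> y 0 0 = (\<Sum>l<n. F l)"
       "\<And>z. z \<notin> insert x (mods (Set_Var y (Plus (Var y) f))) \<Longrightarrow> \<tau> z = upd \<sigma> y 0 0 0 z" for \<tau>
      by (rule post) (use that in auto)
  qed (use x n e in auto)
  moreover have "0 \<le> B" using partial[of 0] by simp
  ultimately show ?thesis using x by (simp add: Sum_def)
qed

section \<open>Gram matrices\<close>

definition gram :: "int mat \<Rightarrow> int mat" where
  "gram A = A * A\<^sup>T"

text \<open>For rows of full rank and \<open>G = A A^T\<close> this is \<open>det G\<close> times
  \<open>1 - A^T G^(-1) A\<close>, the orthogonal projection onto the kernel of \<open>A\<close>.
  The adjugate, in place of \<open>det G\<close> times the inverse, keeps it integral.\<close>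

definition scaled_proj :: "int mat \<Rightarrow> int mat" where
  "scaled_proj A = det (gram A) \<cdot>\<^sub>m 1\<^sub>m (dim_col A) - A\<^sup>T * (adj_mat (gram A) * A)"

definition add_row :: "int mat \<Rightarrow> int vec \<Rightarrow> int mat" where
  "add_row A a = mat (Suc (dim_row A)) (dim_col A) (\<lambda>(i, j). if i < dim_row A then A $$ (i, j) else a $ j)"

context
  fixes A :: "int mat" and r n :: nat
  assumes A: "A \<in> carrier_mat r n" and d: "det (gram A) \<noteq> 0"
begin

lemma gram_carrier: "gram A \<in> carrier_mat r r"
  using A by (simp add: gram_def)

lemma gram_sym: "(gram A)\<^sup>T = gram A"
proof -
  have "A\<^sup>T \<in> carrier_mat n r" using A by simp
  then show ?thesis by (simp add: gram_def transpose_mult[OF A])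
qed

text \<open>With \<open>G\<close> the Gram matrix and \<open>H\<close> its adjugate,
  \<open>H^T G H\<close> equals both \<open>det G\<close> times \<open>H^T\<close> and
  \<open>det G\<close> times \<open>H\<close>.\<close>

lemma adj_gram_sym: "(adj_mat (gram A))\<^sup>T = adj_mat (gram A)"
proof -
  note G = gram_carrier
  let ?G = "gram A" and ?H = "adj_mat (gram A)"
  note H = adj_mat(1)[OF G]
  have HT: "?H\<^sup>T \<in> carrier_mat r r" using H by simp
  have "?H\<^sup>T * ?G = (?G * ?H)\<^sup>T"
    by (simp add: transpose_mult[OF G H] gram_sym)
  also have "\<dots> = det ?G \<cdot>\<^sub>m 1\<^sub>m r"
    unfolding adj_mat(2)[OF G] by (intro eq_matI) auto
  finally have 1: "?H\<^sup>T * ?G = det ?G \<cdot>\<^sub>m 1\<^sub>m r" .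
  have "det ?G \<cdot>\<^sub>m ?H\<^sup>T = ?H\<^sup>T * (det ?G \<cdot>\<^sub>m 1\<^sub>m r)"
    using HT by (simp add: mult_smult_distrib[OF HT one_carrier_mat])
  also have "\<dots> = (?H\<^sup>T * ?G) * ?H"
    unfolding adj_mat(2)[OF G, symmetric] using HT G H by simp
  also have "\<dots> = det ?G \<cdot>\<^sub>m ?H"
    unfolding 1 using H by (simp add: mult_smult_assoc_mat[OF one_carrier_mat H])
  finally have eq: "det ?G \<cdot>\<^sub>m ?H\<^sup>T = det ?G \<cdot>\<^sub>m ?H" .
  show ?thesis
  proof (rule eq_matI)
    fix i j assume "i < dim_row ?H" "j < dim_col ?H"
    then show "?H\<^sup>T $$ (i, j) = ?H $$ (i, j)"
      using arg_cong[OF eq, of "\<lambda>M. M $$ (i, j)"] d H by simp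
  qed (use H in auto)
qed

lemma scaled_proj_carrier: "scaled_proj A \<in> carrier_mat n n"
  using A adj_mat(1)[OF gram_carrier] by (auto simp: scaled_proj_def intro!: minus_carrier_mat)

lemma scaled_proj_sym: "(scaled_proj A)\<^sup>T = scaled_proj A"
proof -
  let ?H = "adj_mat (gram A)"
  note H = adj_mat(1)[OF gram_carrier]
  have AT: "A\<^sup>T \<in> carrier_mat n r" using A by simp
  have HA: "?H * A \<in> carrier_mat r n" using A H by simp
  have "(A\<^sup>T * (?H * A))\<^sup>T = A\<^sup>T * (?H * A)"
    using A AT H by (simp add: transpose_mult[OF AT HA] transpose_mult[OF H A] adj_gram_sym)
  then show ?thesis
    using A AT HA unfolding scaled_proj_def
    by (subst transpose_minus[where nr = n and nc = n]) (auto intro!: eq_matI)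
qed

lemma mult_scaled_proj: "A * scaled_proj A = 0\<^sub>m r n"
proof -
  let ?H = "adj_mat (gram A)"
  note G = gram_carrier
  note H = adj_mat(1)[OF G]
  have AT: "A\<^sup>T \<in> carrier_mat n r" using A by simp
  have HA: "?H * A \<in> carrier_mat r n" using A H by simp
  have "A * (A\<^sup>T * (?H * A)) = (A * A\<^sup>T) * (?H * A)"
    using A AT HA by simp
  also have "\<dots> = (gram A * ?H) * A"
    using A H G unfolding gram_def[symmetric] by simp
  also have "\<dots> = det (gram A) \<cdot>\<^sub>m A"
    unfolding adj_mat(2)[OF G] using A by (simp add: mult_smult_assoc_mat[OF one_carrier_mat A])
  finally have 1: "A * (A\<^sup>T * (?H * A)) = det (gram A) \<cdot>\<^sub>m A" .
  have "A * (det (gram A) \<cdot>\<^sub>m 1\<^sub>m n) = det (gram A) \<cdot>\<^sub>m A"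
    using A by (simp add: mult_smult_distrib[OF A one_carrier_mat])
  with 1 show ?thesis
    unfolding scaled_proj_def using A AT HA
    by (subst mult_minus_distrib_mat[where nr = r and n = n and nc = n]) auto
qed

lemma scaled_proj_mult_kernel:
  assumes X: "X \<in> carrier_mat n q" "A * X = 0\<^sub>m r q"
  shows "scaled_proj A * X = det (gram A) \<cdot>\<^sub>m X"
proof -
  let ?H = "adj_mat (gram A)"
  note H = adj_mat(1)[OF gram_carrier]
  have AT: "A\<^sup>T \<in> carrier_mat n r" using A by simp
  have HA: "?H * A \<in> carrier_mat r n" using A H by simp
  have "(?H * A) * X = 0\<^sub>m r q"
    using A H X by (simp add: assoc_mult_mat[OF H A X(1)])
  then have "A\<^sup>T * (?H * A) * X = 0\<^sub>m n q"
    using AT by (simp add: assoc_mult_mat[OF AT HA X(1)])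
  moreover have "det (gram A) \<cdot>\<^sub>m 1\<^sub>m n * X = det (gram A) \<cdot>\<^sub>m X"
    using X(1) by (simp add: mult_smult_assoc_mat[OF one_carrier_mat X(1)])
  moreover have "scaled_proj A * X = det (gram A) \<cdot>\<^sub>m 1\<^sub>m n * X - A\<^sup>T * (?H * A) * X"
  proof -
    have "A\<^sup>T * (?H * A) \<in> carrier_mat n n" using AT HA by (rule mult_carrier_mat)
    then show ?thesis
      unfolding scaled_proj_def carrier_matD(2)[OF A]
      by (intro minus_mult_distrib_mat[where nr = n and n = n and nc = q] X(1) smult_carrier_mat one_carrier_mat)
  qed
  ultimately show ?thesis using X(1) by (auto intro!: eq_matI)
qed

context
  fixes a :: "int vec"
  assumes a: "a \<in> carrier_vec n"
begin

text \<open>The row as a matrix with one column: scalar products become entries of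
  \<open>1 x 1\<close> matrices, and the whole computation stays within matrix algebra.\<close>

definition "colm = mat n 1 (\<lambda>(i, j). a $ i)"

lemma colm: "colm \<in> carrier_mat n 1" by (simp add: colm_def)

lemma add_row_carrier: "add_row A a \<in> carrier_mat (Suc r) n"
  using A by (simp add: add_row_def)

lemma row_add_row: "i < r \<Longrightarrow> row (add_row A a) i = row A i" "row (add_row A a) r = a"
  using A a by (auto simp: add_row_def intro!: eq_vecI)

lemma row_colm: "row colm\<^sup>T 0 = a"
  using a by (auto simp: colm_def intro!: eq_vecI)

lemma add_row_mult_zero:
  assumes "X \<in> carrier_mat n q"
  shows "add_row A a * X = 0\<^sub>m (Suc r) q \<longleftrightarrow> A * X = 0\<^sub>m r q \<and> colm\<^sup>T * X = 0\<^sub>m 1 q"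
proof -
  have "add_row A a * X = 0\<^sub>m (Suc r) q \<longleftrightarrow> (\<forall>i<Suc r. \<forall>j<q. row (add_row A a) i \<bullet> col X j = 0)"
    using assms add_row_carrier by (auto simp: mat_eq_iff)
  moreover have "A * X = 0\<^sub>m r q \<longleftrightarrow> (\<forall>i<r. \<forall>j<q. row A i \<bullet> col X j = 0)"
    using assms A by (auto simp: mat_eq_iff)
  moreover have "colm\<^sup>T * X = 0\<^sub>m 1 q \<longleftrightarrow> (\<forall>j<q. a \<bullet> col X j = 0)"
    using assms colm row_colm by (auto simp: mat_eq_iff)
  ultimately show ?thesis by (auto simp: row_add_row less_Suc_eq)
qed

lemma gram_add_row:
  "gram (add_row A a) = four_block_mat (gram A) (A * colm) ((A * colm)\<^sup>T) (colm\<^sup>T * colm)"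
proof (rule eq_matI)
  let ?B = "four_block_mat (gram A) (A * colm) ((A * colm)\<^sup>T) (colm\<^sup>T * colm)"
  have dims: "dim_row ?B = Suc r" "dim_col ?B = Suc r"
    using A gram_carrier colm by auto
  show "dim_row (gram (add_row A a)) = dim_row ?B" "dim_col (gram (add_row A a)) = dim_col ?B"
    using dims add_row_carrier by (auto simp: gram_def)
  fix i j assume "i < dim_row ?B" "j < dim_col ?B"
  then have ij: "i < Suc r" "j < Suc r" using dims by auto
  have cc: "col colm 0 = a" using a by (auto simp: colm_def intro!: eq_vecI)
  have l: "gram (add_row A a) $$ (i, j) = row (add_row A a) i \<bullet> row (add_row A a) j"
    using ij add_row_carrier by (simp add: gram_def)
  have g: "i < r \<Longrightarrow> j < r \<Longrightarrow> gram A $$ (i, j) = row A i \<bullet> row A j"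
    using A by (simp add: gram_def)
  have ra: "row A k \<in> carrier_vec n" for k using A by (metis carrier_matD(2) row_carrier)
  note carr = carrier_matD[OF gram_carrier] carrier_matD[OF colm] carrier_matD[OF A]
  show "gram (add_row A a) $$ (i, j) = ?B $$ (i, j)"
  proof (cases "i < r")
    case True
    note i = this
    show ?thesis
    proof (cases "j < r")
      case True
      then show ?thesis unfolding l using i by (simp add: carr row_add_row g)
    next
      case False
      then have "j = r" using ij by simp
      then show ?thesis unfolding l using i by (simp add: carr row_add_row cc)
    qed
  next
    case False
    then have i: "i = r" using ij by simp
    show ?thesis
    proof (cases "j < r")
      case True
      then show ?thesis unfolding l using i comm_scalar_prod[OF a ra[of j]]
        by (simp add: carr row_add_row cc)
    next
      case False
      then have "j = r" using ij by simp
      then show ?thesis unfolding l using i by (simp add: carr row_add_row cc row_colm)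
    qed
  qed
qed

text \<open>A Schur complement without division. The new determinant is the quadratic form of the
  scaled projection at the new row, so it vanishes exactly when that row depends on the earlier
  ones.\<close>

lemma det_gram_add_row:
  "det (gram (add_row A a)) = (colm\<^sup>T * (scaled_proj A * colm)) $$ (0, 0)"
proof -
  let ?G = "gram A" and ?H = "adj_mat (gram A)" and ?d = "det (gram A)"
  note G = gram_carrier
  note H = adj_mat(1)[OF G]
  note c = colm
  define U where "U = A * colm"
  define s where "s = colm\<^sup>T * colm"
  have U: "U \<in> carrier_mat r 1" and s: "s \<in> carrier_mat 1 1" and UT: "U\<^sup>T \<in> carrier_mat 1 r"
    using A c by (auto simp: U_def s_def)
  have HU: "?H * U \<in> carrier_mat r 1" using H U by simp
  \<comment> \<open>Multiplication by \<open>K\<close> clears the upper right block, because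
    \<open>G\<close> times its adjugate is \<open>d\<close> times the identity. The determinant of
    \<open>K\<close> is a power of \<open>d\<close>, which cancels afterwards.\<close>
  define K where "K = four_block_mat (?d \<cdot>\<^sub>m 1\<^sub>m r) (- (?H * U)) (0\<^sub>m 1 r) (?d \<cdot>\<^sub>m 1\<^sub>m 1)"
  define E where "E = ?d \<cdot>\<^sub>m s - U\<^sup>T * (?H * U)"
  have E: "E \<in> carrier_mat 1 1" using s UT HU by (auto simp: E_def intro!: minus_carrier_mat)
  have K: "?d \<cdot>\<^sub>m 1\<^sub>m r \<in> carrier_mat r r" "- (?H * U) \<in> carrier_mat r 1"
      "0\<^sub>m 1 r \<in> carrier_mat 1 r" "?d \<cdot>\<^sub>m 1\<^sub>m 1 \<in> carrier_mat 1 1"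
    using HU by auto
  have b1: "?G * (?d \<cdot>\<^sub>m 1\<^sub>m r) + U * 0\<^sub>m 1 r = ?d \<cdot>\<^sub>m ?G"
    using G U by (simp add: mult_smult_distrib[OF G one_carrier_mat])
  have b2: "?G * (- (?H * U)) + U * (?d \<cdot>\<^sub>m 1\<^sub>m 1) = 0\<^sub>m r 1"
  proof -
    have "?G * (?H * U) = (?G * ?H) * U" using G H U by simp
    also have "\<dots> = ?d \<cdot>\<^sub>m U"
      unfolding adj_mat(2)[OF G] using U by (simp add: mult_smult_assoc_mat[OF one_carrier_mat U])
    finally have "?G * (?H * U) = ?d \<cdot>\<^sub>m U" .
    then have "?G * (- (?H * U)) = - (?d \<cdot>\<^sub>m U)" using G HU by (subst uminus_mult_right_mat) (simp_all only: carrier_matD)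
    moreover have "U * (?d \<cdot>\<^sub>m 1\<^sub>m 1) = ?d \<cdot>\<^sub>m U"
      using U by (simp add: mult_smult_distrib[OF U one_carrier_mat] del: One_nat_def)
    ultimately show ?thesis using U by (auto intro!: eq_matI)
  qed
  have b3: "U\<^sup>T * (?d \<cdot>\<^sub>m 1\<^sub>m r) + s * 0\<^sub>m 1 r = ?d \<cdot>\<^sub>m U\<^sup>T"
    using UT s by (simp add: mult_smult_distrib[OF UT one_carrier_mat])
  have b4: "U\<^sup>T * (- (?H * U)) + s * (?d \<cdot>\<^sub>m 1\<^sub>m 1) = E"
  proof -
    have "U\<^sup>T * (- (?H * U)) = - (U\<^sup>T * (?H * U))"
      using UT HU by (subst uminus_mult_right_mat) (simp_all only: carrier_matD)
    moreover have "s * (?d \<cdot>\<^sub>m 1\<^sub>m 1) = ?d \<cdot>\<^sub>m s"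
      using s by (simp add: mult_smult_distrib[OF s one_carrier_mat] del: One_nat_def)
    ultimately show ?thesis using s UT HU by (auto simp: E_def intro!: eq_matI)
  qed
  have "gram (add_row A a) * K = four_block_mat (?d \<cdot>\<^sub>m ?G) (0\<^sub>m r 1) (?d \<cdot>\<^sub>m U\<^sup>T) E"
    unfolding gram_add_row K_def U_def[symmetric] s_def[symmetric]
    by (simp only: mult_four_block_mat[OF G U UT s K] b1 b2 b3 b4)
  then have "det (gram (add_row A a) * K) = det (?d \<cdot>\<^sub>m ?G) * det E"
    using det_four_block_mat_upper_right_zero[of "?d \<cdot>\<^sub>m ?G" r "0\<^sub>m r 1" 1 "?d \<cdot>\<^sub>m U\<^sup>T" E] G UT E
    by simp
  moreover have "det (gram (add_row A a) * K) = det (gram (add_row A a)) * det K"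
    by (rule det_mult[of _ "Suc r"])
       (use add_row_carrier HU in \<open>auto simp: gram_def K_def\<close>)
  moreover have "det K = ?d ^ r * ?d"
    unfolding K_def
    by (subst det_four_block_mat_lower_left_zero[where n = r and m = 1]) (use HU in auto)
  moreover have "det (?d \<cdot>\<^sub>m ?G) = ?d ^ r * ?d" using G by simp
  ultimately have "det (gram (add_row A a)) = det E" using d by simp
  also have "\<dots> = E $$ (0, 0)" using E by (simp add: det_single)
  also have "E = colm\<^sup>T * (scaled_proj A * colm)"
  proof -
    have AT: "A\<^sup>T \<in> carrier_mat n r" using A by simp
    have HA: "?H * A \<in> carrier_mat r n" using A H by simp
    have cT: "colm\<^sup>T \<in> carrier_mat 1 n" using c by simp
    have AHU: "A\<^sup>T * (?H * U) \<in> carrier_mat n 1" using AT HU by simp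
    have "A\<^sup>T * (?H * A) * colm = A\<^sup>T * (?H * U)"
      unfolding U_def by (simp add: assoc_mult_mat[OF AT HA c] assoc_mult_mat[OF H A c])
    then have 1: "scaled_proj A * colm = ?d \<cdot>\<^sub>m colm - A\<^sup>T * (?H * U)"
      unfolding scaled_proj_def using A AT HA c
      by (subst minus_mult_distrib_mat[where nr = n and n = n and nc = 1])
         (auto simp: mult_smult_assoc_mat[OF one_carrier_mat c])
    have 2: "U\<^sup>T = colm\<^sup>T * A\<^sup>T" unfolding U_def by (rule transpose_mult[OF A c])
    have "colm\<^sup>T * (A\<^sup>T * (?H * U)) = U\<^sup>T * (?H * U)"
      unfolding 2 by (simp add: assoc_mult_mat[OF cT AT HU])
    then show ?thesis
      unfolding 1 E_def s_def using c cT AHU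
      by (subst mult_minus_distrib_mat[where nr = 1 and n = n and nc = 1])
         (auto simp: mult_smult_distrib[OF cT c])
  qed
  finally show ?thesis .
qed

end
end

lemma transpose_smult_mat: "(k \<cdot>\<^sub>m A)\<^sup>T = k \<cdot>\<^sub>m A\<^sup>T"
  by (intro eq_matI) auto

text \<open>Let \<open>Z\<close> be the right-hand side and \<open>N'\<close> the new scaled
  projection. The columns of \<open>Z\<close> lie in the new kernel, so \<open>N' Z = d' Z\<close>;
  the columns of \<open>N'\<close> lie in the old kernel and are orthogonal to \<open>v\<close>, so
  \<open>Z N' = d' d N'\<close>. Both matrices are symmetric, so transposing identifies the two
  products.\<close>

lemma scaled_proj_add_row:
  fixes A :: "int mat"
  assumes A: "A \<in> carrier_mat r n" and a: "a \<in> carrier_vec n"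
    and d: "det (gram A) \<noteq> 0" and d': "det (gram (add_row A a)) \<noteq> 0"
  defines "v \<equiv> scaled_proj A * mat n 1 (\<lambda>(i, j). a $ i)"
  shows "det (gram A) \<cdot>\<^sub>m scaled_proj (add_row A a)
    = det (gram (add_row A a)) \<cdot>\<^sub>m scaled_proj A - v * v\<^sup>T"
proof -
  let ?A' = "add_row A a" and ?N = "scaled_proj A" and ?N' = "scaled_proj (add_row A a)"
  let ?d = "det (gram A)" and ?d' = "det (gram (add_row A a))"
  define c where "c = mat n 1 (\<lambda>(i, j). a $ i)"
  have c_eq: "c = colm n a" unfolding c_def colm_def[OF A d a] ..
  have c: "c \<in> carrier_mat n 1" by (simp add: c_def)
  have cT: "c\<^sup>T \<in> carrier_mat 1 n" using c by simp
  have A': "?A' \<in> carrier_mat (Suc r) n" by (rule add_row_carrier[OF A d a])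
  have N: "?N \<in> carrier_mat n n" by (rule scaled_proj_carrier[OF A d])
  have N': "?N' \<in> carrier_mat n n" by (rule scaled_proj_carrier[OF A' d'])
  have v_eq: "v = ?N * c" by (simp add: v_def c_def)
  have v: "v \<in> carrier_mat n 1" using N c by (simp add: v_eq)
  have vT: "v\<^sup>T \<in> carrier_mat 1 n" using v by simp
  have vT_eq: "v\<^sup>T = c\<^sup>T * ?N"
    unfolding v_eq transpose_mult[OF N c] scaled_proj_sym[OF A d] ..
  have vv: "v * v\<^sup>T \<in> carrier_mat n n" using v vT by simp
  define Z where "Z = ?d' \<cdot>\<^sub>m ?N - v * v\<^sup>T"
  have Z: "Z \<in> carrier_mat n n" using N vv by (auto simp: Z_def intro!: minus_carrier_mat)
  have sN: "?d' \<cdot>\<^sub>m ?N \<in> carrier_mat n n" using N by simp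
  have "A * Z = 0\<^sub>m r n"
  proof -
    have "A * v = 0\<^sub>m r 1"
      unfolding v_eq using assoc_mult_mat[OF A N c] mult_scaled_proj[OF A d] c by simp
    then have "A * (v * v\<^sup>T) = 0\<^sub>m r n" using assoc_mult_mat[OF A v vT] vT by simp
    moreover have "A * (?d' \<cdot>\<^sub>m ?N) = 0\<^sub>m r n"
      using mult_smult_distrib[OF A N, of ?d'] mult_scaled_proj[OF A d] by (simp add: smult_zero_mat)
    ultimately show ?thesis
      unfolding Z_def mult_minus_distrib_mat[OF A sN vv] by simp
  qed
  moreover have "c\<^sup>T * Z = 0\<^sub>m 1 n"
  proof -
    have cv: "c\<^sup>T * v \<in> carrier_mat 1 1" using cT v by simp
    have "c\<^sup>T * v = ?d' \<cdot>\<^sub>m 1\<^sub>m 1"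
      using cv det_gram_add_row[OF A d a] unfolding c_eq[symmetric] v_eq[symmetric]
      by (intro eq_matI) auto
    then have "c\<^sup>T * (v * v\<^sup>T) = ?d' \<cdot>\<^sub>m v\<^sup>T"
      using assoc_mult_mat[OF cT v vT] mult_smult_assoc_mat[OF one_carrier_mat vT, of ?d'] vT
      by (simp del: One_nat_def)
    moreover have "c\<^sup>T * (?d' \<cdot>\<^sub>m ?N) = ?d' \<cdot>\<^sub>m v\<^sup>T"
      unfolding vT_eq by (rule mult_smult_distrib[OF cT N])
    ultimately show ?thesis
      unfolding Z_def mult_minus_distrib_mat[OF cT sN vv] using vT by (auto intro!: eq_matI)
  qed
  ultimately have A'Z: "?A' * Z = 0\<^sub>m (Suc r) n"
    using add_row_mult_zero[OF A d a Z] unfolding c_eq by blast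
  have N'Z: "?N' * Z = ?d' \<cdot>\<^sub>m Z"
    by (rule scaled_proj_mult_kernel[OF A' d' Z A'Z])
  have "A * ?N' = 0\<^sub>m r n \<and> c\<^sup>T * ?N' = 0\<^sub>m 1 n"
    using add_row_mult_zero[OF A d a N'] mult_scaled_proj[OF A' d'] unfolding c_eq by blast
  then have AN': "A * ?N' = 0\<^sub>m r n" and cN': "c\<^sup>T * ?N' = 0\<^sub>m 1 n" by auto
  have NN': "?N * ?N' = ?d \<cdot>\<^sub>m ?N'"
    by (rule scaled_proj_mult_kernel[OF A d N' AN'])
  have "v\<^sup>T * ?N' = 0\<^sub>m 1 n"
    unfolding vT_eq assoc_mult_mat[OF cT N N'] NN' mult_smult_distrib[OF cT N'] cN'
    by auto
  then have "v * v\<^sup>T * ?N' = 0\<^sub>m n n"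
    unfolding assoc_mult_mat[OF v vT N'] using v by simp
  then have ZN': "Z * ?N' = ?d' \<cdot>\<^sub>m (?d \<cdot>\<^sub>m ?N')"
    unfolding Z_def minus_mult_distrib_mat[OF sN vv N'] mult_smult_assoc_mat[OF N N'] NN'
    using N' by (auto intro!: eq_matI)
  have "(v * v\<^sup>T)\<^sup>T = v * v\<^sup>T" by (simp add: transpose_mult[OF v vT])
  then have ZT: "Z\<^sup>T = Z"
    using N vv arg_cong[OF scaled_proj_sym[OF A d], of "\<lambda>M. ?d' \<cdot>\<^sub>m M"] unfolding Z_def
    by (subst transpose_minus[OF sN vv]) (auto simp: transpose_smult_mat)
  have "(?N' * Z)\<^sup>T = Z * ?N'"
    unfolding transpose_mult[OF N' Z] ZT scaled_proj_sym[OF A' d'] ..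
  then have "(?d' \<cdot>\<^sub>m Z)\<^sup>T = ?d' \<cdot>\<^sub>m (?d \<cdot>\<^sub>m ?N')" unfolding N'Z ZN' .
  then have eq: "?d' \<cdot>\<^sub>m Z\<^sup>T = ?d' \<cdot>\<^sub>m (?d \<cdot>\<^sub>m ?N')" by (simp add: transpose_smult_mat)
  have "Z = ?d \<cdot>\<^sub>m ?N'"
  proof (rule eq_matI)
    fix i j assume "i < dim_row (?d \<cdot>\<^sub>m ?N')" "j < dim_col (?d \<cdot>\<^sub>m ?N')"
    then show "Z $$ (i, j) = (?d \<cdot>\<^sub>m ?N') $$ (i, j)"
      using arg_cong[OF eq, of "\<lambda>M. M $$ (i, j)"] d' N' Z unfolding ZT by simp
  qed (use Z N' in auto)
  then show ?thesis unfolding Z_def by simp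
qed

section \<open>Integral projections by rank-one updates\<close>

text \<open>Says that \<open>N / d\<close> is the orthogonal projection onto the common kernel of
  the rows \<open>a i\<close>: the columns of the symmetric matrix \<open>N\<close> lie in the
  kernel, and kernel vectors are multiplied by \<open>d\<close>. The rows may be dependent. The
  vector \<open>x\<close> is real because the solutions of the systems to be decided are
  real.\<close>

definition ortho_proj :: "nat \<Rightarrow> nat \<Rightarrow> (nat \<Rightarrow> nat \<Rightarrow> int) \<Rightarrow> int \<Rightarrow> (nat \<Rightarrow> nat \<Rightarrow> int) \<Rightarrow> bool" where
  "ortho_proj r n a d N \<longleftrightarrow> 1 \<le> d \<and> (\<forall>l<n. \<forall>p<n. N l p = N p l) \<and>
    (\<forall>i<r. \<forall>l<n. (\<Sum>p<n. N l p * a i p) = 0) \<and>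
    (\<forall>x :: nat \<Rightarrow> real. (\<forall>i<r. (\<Sum>p<n. a i p * x p) = 0) \<longrightarrow>
       (\<forall>l<n. (\<Sum>p<n. N l p * x p) = d * x l))"

text \<open>Since \<open>d \<ge> 1\<close> and \<open>N\<close> annihilates all rows \<open>a i\<close>, the rows of \<open>A\<close> are a basis of their span;
  that \<open>d\<close> is a Gram determinant bounds \<open>d\<close> and makes \<open>N\<close> integral.\<close>

definition gram_proj :: "nat \<Rightarrow> nat \<Rightarrow> (nat \<Rightarrow> nat \<Rightarrow> int) \<Rightarrow> int \<Rightarrow> (nat \<Rightarrow> nat \<Rightarrow> int) \<Rightarrow> bool" where
  "gram_proj r n a d N \<longleftrightarrow> 1 \<le> d \<and> (\<forall>i<r. \<forall>l<n. (\<Sum>p<n. N l p * a i p) = 0) \<and>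
    (\<exists>q A. A \<in> carrier_mat q n \<and> det (gram A) = d \<and> (\<forall>i<q. \<exists>k<r. row A i = vec n (a k)) \<and>
      (\<forall>l<n. \<forall>p<n. scaled_proj A $$ (l, p) = N l p))"

lemma gram_proj_init: "gram_proj 0 n a 1 (\<lambda>l p. if l = p then 1 else 0)"
proof -
  \<comment> \<open>Without rows, the Gram matrix is \<open>0 x 0\<close> with determinant
    \<open>1\<close>, and the projection is the identity.\<close>
  define A :: "int mat" where "A = 0\<^sub>m 0 n"
  have A: "A \<in> carrier_mat 0 n" by (simp add: A_def)
  have g: "gram A \<in> carrier_mat 0 0" using A by (auto simp: gram_def)
  have d: "det (gram A) = 1" using g by simp
  have "scaled_proj A $$ (l, p) = (if l = p then 1 else 0)" if "l < n" "p < n" for l p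
    using that A adj_mat(1)[OF g] unfolding scaled_proj_def d by (simp add: scalar_prod_def)
  with A d show ?thesis
    unfolding gram_proj_def by (intro conjI exI[of _ 0] exI[of _ A]) auto
qed

text \<open>As \<open>x\<close> is real and the matrices are integral, the product of
  \<open>scaled_proj A\<close> with \<open>x\<close> is expanded into sums. The correction term
  contains the factor \<open>A x\<close>, which vanishes because every row of \<open>A\<close> is
  one of the \<open>a k\<close>.\<close>

lemma gram_proj_imp_ortho_proj:
  assumes "gram_proj r n a d N"
  shows "ortho_proj r n a d N"
proof -
  from assms obtain q A where d: "1 \<le> d" and N0: "\<forall>i<r. \<forall>l<n. (\<Sum>p<n. N l p * a i p) = 0"
    and A: "A \<in> carrier_mat q n" and dA: "det (gram A) = d"
    and rA: "\<forall>i<q. \<exists>k<r. row A i = vec n (a k)"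
    and NA': "\<forall>l<n. \<forall>p<n. scaled_proj A $$ (l, p) = N l p"
    unfolding gram_proj_def by (elim conjE exE) (rule that)
  have NA: "scaled_proj A $$ (l, p) = N l p" if "l < n" "p < n" for l p
    using NA' that by simp
  have dA0: "det (gram A) \<noteq> 0" using d dA by simp
  have sym: "N l p = N p l" if "l < n" "p < n" for l p
  proof -
    have "(scaled_proj A)\<^sup>T $$ (l, p) = scaled_proj A $$ (p, l)"
      using that scaled_proj_carrier[OF A dA0] by simp
    then show ?thesis using that NA unfolding scaled_proj_sym[OF A dA0] by simp
  qed
  have ker: "(\<Sum>p<n. N l p * x p) = d * x l"
    if x: "\<And>i. i < r \<Longrightarrow> (\<Sum>p<n. a i p * x p) = 0" and l: "l < n" for x :: "nat \<Rightarrow> real" and l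
  proof -
    define H where "H = adj_mat (gram A)"
    have H: "H \<in> carrier_mat q q"
      unfolding H_def by (rule adj_mat(1)[OF gram_carrier[OF A dA0]])
    have Ax: "(\<Sum>p<n. A $$ (e, p) * x p) = 0" if e: "e < q" for e
    proof -
      obtain k where k: "k < r" "row A e = vec n (a k)" using rA e by blast
      have "A $$ (e, p) = a k p" if "p < n" for p
        using arg_cong[OF k(2), of "\<lambda>v. v $ p"] that \<open>e < q\<close> A by simp
      then show ?thesis using x[OF k(1)] by simp
    qed
    have Nlp: "N l p = (if l = p then d else 0) - (\<Sum>k<q. A $$ (k, l) * (\<Sum>e<q. H $$ (k, e) * A $$ (e, p)))"
      if "p < n" for p
    proof -
      have "(A\<^sup>T * (H * A)) $$ (l, p) = (\<Sum>k<q. A $$ (k, l) * (\<Sum>e<q. H $$ (k, e) * A $$ (e, p)))"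
        using l that A H by (simp add: scalar_prod_def atLeast0LessThan)
      then show ?thesis
        using NA[OF l that] l that A H unfolding scaled_proj_def H_def[symmetric] dA by auto
    qed
    have "(\<Sum>p<n. N l p * x p) = (\<Sum>p<n. (if l = p then d else 0) * x p
        - (\<Sum>k<q. A $$ (k, l) * (\<Sum>e<q. H $$ (k, e) * (A $$ (e, p) * x p))))"
      by (intro sum.cong refl) (simp add: Nlp left_diff_distrib sum_distrib_left sum_distrib_right mult.assoc)
    also have "\<dots> = (\<Sum>p<n. (if l = p then d else 0) * x p)
        - (\<Sum>p<n. \<Sum>k<q. A $$ (k, l) * (\<Sum>e<q. H $$ (k, e) * (A $$ (e, p) * x p)))"
      by (rule sum_subtractf)
    also have "(\<Sum>p<n. (if l = p then d else 0) * x p) = d * x l"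
    proof -
      have "(\<Sum>p<n. (if l = p then d else 0) * x p) = (\<Sum>p<n. if l = p then d * x p else 0)"
        by (intro sum.cong) auto
      then show ?thesis using l by simp
    qed
    also have "(\<Sum>p<n. \<Sum>k<q. A $$ (k, l) * (\<Sum>e<q. H $$ (k, e) * (A $$ (e, p) * x p)))
        = (\<Sum>k<q. A $$ (k, l) * (\<Sum>p<n. \<Sum>e<q. H $$ (k, e) * (A $$ (e, p) * x p)))"
      by (subst sum.swap) (simp add: sum_distrib_left)
    also have "\<dots> = (\<Sum>k<q. A $$ (k, l) * (\<Sum>e<q. H $$ (k, e) * (\<Sum>p<n. A $$ (e, p) * x p)))"
      by (subst sum.swap) (simp add: sum_distrib_left)
    also have "\<dots> = 0" by (simp add: Ax)
    finally show ?thesis by simp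
  qed
  show ?thesis unfolding ortho_proj_def using d sym N0 ker by auto
qed

lemma ortho_proj_kernel:
  fixes x :: "nat \<Rightarrow> real"
  assumes "ortho_proj r n a d N" "\<And>i. i < r \<Longrightarrow> (\<Sum>p<n. a i p * x p) = 0" "l < n"
  shows "(\<Sum>p<n. N l p * x p) = d * x l"
proof -
  have "(\<forall>i<r. (\<Sum>p<n. a i p * x p) = 0) \<longrightarrow> (\<forall>l<n. (\<Sum>p<n. N l p * x p) = d * x l)"
    using assms(1) unfolding ortho_proj_def by (elim conjE) (erule spec)
  then show ?thesis using assms(2,3) by blast
qed

lemma ortho_proj_sym: "ortho_proj r n a d N \<Longrightarrow> l < n \<Longrightarrow> p < n \<Longrightarrow> N l p = N p l"
  unfolding ortho_proj_def by (elim conjE) simp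

lemma ortho_proj_row:
  "ortho_proj r n a d N \<Longrightarrow> i < r \<Longrightarrow> l < n \<Longrightarrow> (\<Sum>p<n. N l p * a i p) = 0"
  unfolding ortho_proj_def by blast

text \<open>The columns of \<open>N\<close> are kernel vectors, on which \<open>N\<close> acts as
  \<open>d\<close>; this is \<open>P P = P\<close> multiplied by \<open>d^2\<close>.\<close>

lemma ortho_proj_idem:
  assumes "ortho_proj r n a d N" "l < n" "q < n"
  shows "(\<Sum>p<n. N l p * N p q) = d * N l q"
proof -
  have "(\<Sum>p<n. a i p * N p q) = 0" if "i < r" for i
  proof -
    have "(\<Sum>p<n. N q p * a i p) = 0" using assms that unfolding ortho_proj_def by blast
    moreover have "N q p = N p q" if "p < n" for p using assms that unfolding ortho_proj_def by blast
    ultimately show ?thesis by (simp add: mult.commute)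
  qed
  then have "(\<Sum>p<n. of_int (a i p) * of_int (N p q)) = (0::real)" if "i < r" for i
    using that by (simp flip: of_int_mult of_int_sum)
  then have "(\<Sum>p<n. of_int (N l p) * real_of_int (N p q)) = real_of_int d * of_int (N l q)"
    by (intro ortho_proj_kernel[OF assms(1)] assms(2))
  then show ?thesis by (simp flip: of_int_mult of_int_sum)
qed

text \<open>Everything follows from one identity: by idempotence and symmetry, the squared norm of
  column \<open>q\<close> is \<open>d\<close> times its diagonal entry.\<close>

lemma ortho_proj_entry_bound:
  assumes P: "ortho_proj r n a d N" and lq: "l < n" "q < n"
  shows "0 \<le> N q q" "\<bar>N l q\<bar> \<le> d" "N q q = 0 \<Longrightarrow> N l q = 0"
proof -
  have d: "1 \<le> d" using P by (simp add: ortho_proj_def)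
  have "(\<Sum>p<n. N q p * N p q) = (\<Sum>p<n. (N p q)\<^sup>2)"
    using P lq by (intro sum.cong) (auto simp: ortho_proj_def power2_eq_square)
  then have sq: "(\<Sum>p<n. (N p q)\<^sup>2) = d * N q q"
    using ortho_proj_idem[OF P lq(2,2)] by simp
  have le: "(N p q)\<^sup>2 \<le> d * N q q" if "p < n" for p
    unfolding sq[symmetric] using that by (intro member_le_sum) auto
  have "0 \<le> d * N q q" unfolding sq[symmetric] by (intro sum_nonneg) auto
  then show 0: "0 \<le> N q q" using d by (simp add: zero_le_mult_iff)
  have "N q q * N q q \<le> d * N q q" using le[OF lq(2)] by (simp add: power2_eq_square)
  then have "N q q \<le> d" using 0 d by (cases "N q q = 0") (auto simp: mult_le_cancel_right)
  then have "d * N q q \<le> d * d" using d by (intro mult_left_mono) auto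
  then have "(N l q)\<^sup>2 \<le> d\<^sup>2" using le[OF lq(1)] by (simp add: power2_eq_square)
  then show "\<bar>N l q\<bar> \<le> d" using d by (simp add: abs_le_square_iff[symmetric])
  show "N l q = 0" if "N q q = 0" using le[OF lq(1)] that by simp
qed

text \<open>Lagrange's identity: the double sum of squares is twice the difference of the two
  sides.\<close>

lemma Cauchy_Schwarz_sum:
  fixes x y :: "'b \<Rightarrow> 'a::linordered_idom"
  shows "(\<Sum>i\<in>S. x i * y i)\<^sup>2 \<le> (\<Sum>i\<in>S. (x i)\<^sup>2) * (\<Sum>i\<in>S. (y i)\<^sup>2)"
proof -
  have "0 \<le> (\<Sum>i\<in>S. \<Sum>j\<in>S. (x i * y j - x j * y i)\<^sup>2)" by (intro sum_nonneg) auto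
  also have "\<dots> = (\<Sum>i\<in>S. \<Sum>j\<in>S. (x i)\<^sup>2 * (y j)\<^sup>2 + (y i)\<^sup>2 * (x j)\<^sup>2 - 2 * ((x i * y i) * (x j * y j)))"
    by (intro sum.cong refl) (simp add: power2_eq_square algebra_simps)
  also have "\<dots> = (\<Sum>i\<in>S. (x i)\<^sup>2) * (\<Sum>i\<in>S. (y i)\<^sup>2) + (\<Sum>i\<in>S. (y i)\<^sup>2) * (\<Sum>i\<in>S. (x i)\<^sup>2)
      - 2 * ((\<Sum>i\<in>S. x i * y i) * (\<Sum>i\<in>S. x i * y i))"
    by (simp only: sum.distrib sum_subtractf sum_distrib_left[symmetric] sum_product)
  finally have "0 \<le> 2 * ((\<Sum>i\<in>S. (x i)\<^sup>2) * (\<Sum>i\<in>S. (y i)\<^sup>2) - (\<Sum>i\<in>S. x i * y i)\<^sup>2)"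
    by (simp add: power2_eq_square algebra_simps)
  then show ?thesis by (simp add: zero_le_mult_iff)
qed

text \<open>Since \<open>v = N a\<close> has squared norm \<open>d * \<alpha>\<close>, the number
  \<open>\<alpha>\<close> is nonnegative, and it is zero only if \<open>v\<close> is, that is, if
  \<open>N\<close> already annihilates the new row, which can then be skipped. Otherwise
  \<open>\<alpha>\<close> is the next Gram determinant, and the division by \<open>d\<close> is
  exact because its result is an integral scaled projection. The upper bound is
  Cauchy-Schwarz.\<close>

lemma gram_proj_step:
  assumes P: "gram_proj r n a d N"
  defines "v \<equiv> \<lambda>l. \<Sum>p<n. N l p * a r p"
  defines "\<alpha> \<equiv> \<Sum>l<n. a r l * v l"
  shows "0 \<le> \<alpha>" "\<alpha> \<le> d * (\<Sum>l<n. (a r l)\<^sup>2)"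
    "0 < \<alpha> \<Longrightarrow> gram_proj (Suc r) n a \<alpha> (\<lambda>l p. (N l p * \<alpha> - v l * v p) div d)"
    "\<alpha> = 0 \<Longrightarrow> gram_proj (Suc r) n a d N"
proof -
  note O = gram_proj_imp_ortho_proj[OF P]
  from P obtain q A where d: "1 \<le> d" and N0: "\<forall>i<r. \<forall>l<n. (\<Sum>p<n. N l p * a i p) = 0"
    and A: "A \<in> carrier_mat q n" and dA: "det (gram A) = d"
    and rA: "\<forall>i<q. \<exists>k<r. row A i = vec n (a k)"
    and NA': "\<forall>l<n. \<forall>p<n. scaled_proj A $$ (l, p) = N l p"
    unfolding gram_proj_def by (elim conjE exE) (rule that)
  have NA: "scaled_proj A $$ (l, p) = N l p" if "l < n" "p < n" for l p
    using NA' that by simp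
  have dA0: "det (gram A) \<noteq> 0" using d dA by simp
  have sym: "N l p = N p l" if "l < n" "p < n" for l p
    using O that by (simp add: ortho_proj_def)
  have Nv: "(\<Sum>l<n. N p l * v l) = d * v p" if "p < n" for p
  proof -
    have "(\<Sum>l<n. N p l * v l) = (\<Sum>l<n. \<Sum>e<n. N p l * N l e * a r e)"
      by (simp add: v_def sum_distrib_left mult.assoc)
    also have "\<dots> = (\<Sum>e<n. (\<Sum>l<n. N p l * N l e) * a r e)"
      by (subst sum.swap) (simp add: sum_distrib_right)
    also have "\<dots> = (\<Sum>e<n. d * N p e * a r e)"
      using ortho_proj_idem[OF O that] by simp
    finally show ?thesis by (simp add: v_def sum_distrib_left mult.assoc)
  qed
  have vv: "(\<Sum>l<n. (v l)\<^sup>2) = d * \<alpha>"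
  proof -
    have "(\<Sum>l<n. (v l)\<^sup>2) = (\<Sum>l<n. \<Sum>p<n. N l p * a r p * v l)"
      by (simp add: v_def power2_eq_square sum_distrib_right)
    also have "\<dots> = (\<Sum>p<n. a r p * (\<Sum>l<n. N l p * v l))"
      by (subst sum.swap) (simp add: sum_distrib_left algebra_simps)
    also have "\<dots> = (\<Sum>p<n. a r p * (d * v p))"
    proof (intro sum.cong refl)
      fix p assume "p \<in> {..<n}"
      then have "(\<Sum>l<n. N l p * v l) = (\<Sum>l<n. N p l * v l)"
        using sym by (intro sum.cong) auto
      then show "a r p * (\<Sum>l<n. N l p * v l) = a r p * (d * v p)"
        using Nv \<open>p \<in> {..<n}\<close> by simp
    qed
    finally show ?thesis by (simp add: \<alpha>_def sum_distrib_left algebra_simps)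
  qed
  have "0 \<le> d * \<alpha>" unfolding vv[symmetric] by (intro sum_nonneg) auto
  then show \<alpha>0: "0 \<le> \<alpha>" using d by (simp add: zero_le_mult_iff)
  have "\<alpha>\<^sup>2 \<le> (\<Sum>l<n. (a r l)\<^sup>2) * (\<Sum>l<n. (v l)\<^sup>2)"
    unfolding \<alpha>_def by (rule Cauchy_Schwarz_sum)
  then have cs: "\<alpha> * \<alpha> \<le> (d * (\<Sum>l<n. (a r l)\<^sup>2)) * \<alpha>"
    unfolding vv by (simp add: power2_eq_square algebra_simps)
  have "0 \<le> d * (\<Sum>l<n. (a r l)\<^sup>2)" using d by (intro mult_nonneg_nonneg sum_nonneg) auto
  with cs \<alpha>0 show "\<alpha> \<le> d * (\<Sum>l<n. (a r l)\<^sup>2)"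
    by (cases "\<alpha> = 0") (simp_all add: mult_le_cancel_right)
  show "gram_proj (Suc r) n a d N" if "\<alpha> = 0"
  proof -
    have "\<forall>l\<in>{..<n}. (v l)\<^sup>2 = 0"
      using vv that by (subst sum_nonneg_eq_0_iff[symmetric]) auto
    then have "\<forall>i<Suc r. \<forall>l<n. (\<Sum>p<n. N l p * a i p) = 0"
      using N0 by (auto simp: less_Suc_eq v_def)
    then show ?thesis
      unfolding gram_proj_def using d A dA rA NA
      by (intro conjI exI[of _ q] exI[of _ A]) (simp_all, meson less_SucI)
  qed
  show "gram_proj (Suc r) n a \<alpha> (\<lambda>l p. (N l p * \<alpha> - v l * v p) div d)" if "0 < \<alpha>"
  proof -
    define b where "b = vec n (a r)"
    have b: "b \<in> carrier_vec n" by (simp add: b_def)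
    define c where "c = mat n 1 (\<lambda>(i, j). b $ i)"
    have c: "c \<in> carrier_mat n 1" by (simp add: c_def)
    note NC = scaled_proj_carrier[OF A dA0]
    define M where "M = scaled_proj A * c"
    have Nc: "M $$ (l, 0) = v l" if "l < n" for l
      using that NC c NA
      by (simp add: M_def scalar_prod_def atLeast0LessThan v_def c_def b_def)
    have NcC: "M \<in> carrier_mat n 1" using NC c by (simp add: M_def)
    have "(c\<^sup>T * M) $$ (0, 0) = (\<Sum>l<n. c $$ (l, 0) * M $$ (l, 0))"
      using NcC c by (simp add: scalar_prod_def atLeast0LessThan)
    also have "\<dots> = \<alpha>" unfolding \<alpha>_def by (intro sum.cong refl) (simp only: Nc lessThan_iff, simp add: c_def b_def)
    finally have dA': "det (gram (add_row A b)) = \<alpha>"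
      using det_gram_add_row[OF A dA0 b] unfolding colm_def[OF A dA0 b] c_def[symmetric] M_def by simp
    then have dA'0: "det (gram (add_row A b)) \<noteq> 0" using that by simp
    note A' = add_row_carrier[OF A dA0 b]
    note N'C = scaled_proj_carrier[OF A' dA'0]
    have eq: "d * scaled_proj (add_row A b) $$ (l, p) = N l p * \<alpha> - v l * v p" if "l < n" "p < n" for l p
    proof -
      have "(M * M\<^sup>T) $$ (l, p) = v l * v p"
        using that NcC by (simp add: scalar_prod_def Nc)
      moreover have "(d \<cdot>\<^sub>m scaled_proj (add_row A b)) $$ (l, p) = (\<alpha> \<cdot>\<^sub>m scaled_proj A - M * M\<^sup>T) $$ (l, p)"
        using scaled_proj_add_row[OF A b dA0 dA'0] unfolding c_def[symmetric] M_def[symmetric] dA dA' by simp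
      ultimately show ?thesis
        using that N'C NC NcC NA by (simp del: index_mult_mat(1) add: mult.commute)
    qed
    then have div: "scaled_proj (add_row A b) $$ (l, p) = (N l p * \<alpha> - v l * v p) div d" if "l < n" "p < n" for l p
      using that d by (metis nonzero_mult_div_cancel_left not_one_le_zero)
    have rows: "\<exists>k<Suc r. row (add_row A b) i = vec n (a k)" if "i < Suc q" for i
    proof (cases "i < q")
      case True
      then show ?thesis using rA row_add_row(1)[OF A dA0 b True] less_SucI by metis
    next
      case False
      then have "i = q" using that by simp
      then show ?thesis using row_add_row(2)[OF A dA0 b] b_def by auto
    qed
    \<comment> \<open>This is required for all rows of \<open>a\<close>, also for those that were
      skipped in \<open>A\<close>. For the new row the two terms cancel; for an earlier one both
      vanish.\<close>
    have zero: "(\<Sum>p<n. ((N l p * \<alpha> - v l * v p) div d) * a i p) = 0" if "i < Suc r" "l < n" for i l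
    proof -
      have "d * (\<Sum>p<n. ((N l p * \<alpha> - v l * v p) div d) * a i p)
         = (\<Sum>p<n. (N l p * \<alpha> - v l * v p) * a i p)"
        unfolding sum_distrib_left
      proof (intro sum.cong refl)
        fix p assume "p \<in> {..<n}"
        then have "d * ((N l p * \<alpha> - v l * v p) div d) = N l p * \<alpha> - v l * v p"
          using eq[OF that(2), of p] div[OF that(2), of p] by simp
        then show "d * ((N l p * \<alpha> - v l * v p) div d * a i p) = (N l p * \<alpha> - v l * v p) * a i p"
          by (metis mult.assoc)
      qed
      also have "\<dots> = \<alpha> * (\<Sum>p<n. N l p * a i p) - v l * (\<Sum>p<n. v p * a i p)"
        by (simp add: sum_distrib_left sum_subtractf algebra_simps)
      also have "\<dots> = 0"
      proof (cases "i = r")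
        case True
        have "(\<Sum>p<n. v p * a r p) = \<alpha>" by (simp add: \<alpha>_def mult.commute)
        then show ?thesis using True by (simp add: v_def)
      next
        case False
        then have i: "i < r" using that by simp
        have "(\<Sum>p<n. v p * a i p) = (\<Sum>p<n. \<Sum>e<n. N p e * a r e * a i p)"
          by (simp add: v_def sum_distrib_right)
        also have "\<dots> = (\<Sum>e<n. \<Sum>p<n. a r e * (N e p * a i p))"
        proof (subst sum.swap, intro sum.cong refl)
          fix e p assume "e \<in> {..<n}" "p \<in> {..<n}"
          then show "N p e * a r e * a i p = a r e * (N e p * a i p)"
            using sym[of p e] by simp
        qed
        also have "\<dots> = (\<Sum>e<n. a r e * (\<Sum>p<n. N e p * a i p))"
          by (simp add: sum_distrib_left)
        also have "\<dots> = 0" using N0 i by simp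
        finally show ?thesis using N0 i that by simp
      qed
      finally show ?thesis using d by simp
    qed
    show ?thesis
      unfolding gram_proj_def using that A' dA' rows div zero
      by (intro conjI exI[of _ "Suc q"] exI[of _ "add_row A b"]) auto
  qed
qed

text \<open>Each row multiplies the determinant by at most its squared norm, as in Hadamard's
  inequality; the summand \<open>1\<close> keeps the factor at least \<open>1\<close> when the row
  is skipped.\<close>

lemma exists_gram_proj:
  "\<exists>d N. gram_proj r n a d N \<and> d \<le> (\<Prod>i<r. (\<Sum>l<n. (a i l)\<^sup>2) + 1)"
proof (induction r)
  case 0
  show ?case using gram_proj_init by (intro exI conjI) auto
next
  case (Suc r)
  then obtain d N where P: "gram_proj r n a d N" and d: "d \<le> (\<Prod>i<r. (\<Sum>l<n. (a i l)\<^sup>2) + 1)"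
    by blast
  have d1: "1 \<le> d" using P by (simp add: gram_proj_def)
  define v where "v l = (\<Sum>p<n. N l p * a r p)" for l
  define \<alpha> where "\<alpha> = (\<Sum>l<n. a r l * v l)"
  have s: "0 \<le> (\<Sum>l<n. (a r l)\<^sup>2)" by (intro sum_nonneg) auto
  note step = gram_proj_step[OF P, folded v_def, folded \<alpha>_def]
  have "d * ((\<Sum>l<n. (a r l)\<^sup>2) + 1) \<le> (\<Prod>i<Suc r. (\<Sum>l<n. (a i l)\<^sup>2) + 1)"
    using d s by (simp add: mult_right_mono)
  moreover have "\<alpha> \<le> d * ((\<Sum>l<n. (a r l)\<^sup>2) + 1)" "d \<le> d * ((\<Sum>l<n. (a r l)\<^sup>2) + 1)"
    using step(2) d1 s by (simp_all add: distrib_left)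
  ultimately show ?case
    using step(1,3,4) by (cases "\<alpha> = 0") fastforce+
qed

section \<open>Cones and their elementary vectors\<close>

definition cone :: "nat \<Rightarrow> nat \<Rightarrow> (nat \<Rightarrow> nat \<Rightarrow> int) \<Rightarrow> nat set \<Rightarrow> (nat \<Rightarrow> real) set" where
  "cone r n M S = {x. (\<forall>i<r. (\<Sum>l<n. M i l * x l) = 0) \<and> (\<forall>l<n. 0 \<le> x l) \<and> (\<forall>l<n. l \<notin> S \<longrightarrow> x l = 0)}"

definition minor_bound :: "nat \<Rightarrow> nat \<Rightarrow> (nat \<Rightarrow> nat \<Rightarrow> int) \<Rightarrow> int" where
  "minor_bound r n M = (\<Prod>i<r. (\<Sum>l<n. (M i l)\<^sup>2) + 1)"

lemma minor_bound_pos: "1 \<le> minor_bound r n M"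
proof -
  have "(\<Prod>i<r. 1) \<le> minor_bound r n M"
    unfolding minor_bound_def by (intro prod_mono) (auto intro!: sum_nonneg)
  then show ?thesis by simp
qed

text \<open>Ratio test: moving from \<open>x\<close> along \<open>- y\<close> until the first
  coordinate reaches zero stays in the cone, removes that coordinate from the support, adds none,
  and leaves \<open>x j\<close> alone because \<open>y j = 0\<close>.\<close>

lemma cone_reduce_support:
  fixes x y :: "nat \<Rightarrow> real"
  assumes x: "x \<in> cone r n M S" "0 < x j" "j < n"
    and y: "\<forall>i<r. (\<Sum>l<n. M i l * y l) = 0" "\<And>l. l < n \<Longrightarrow> x l = 0 \<Longrightarrow> y l = 0" "y j = 0"
      "i < n" "0 < y i"
  shows "\<exists>x' \<in> cone r n M S. 0 < x' j \<and> card {l. l < n \<and> x' l \<noteq> 0} < card {l. l < n \<and> x l \<noteq> 0}"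
proof -
  define P where "P = {l. l < n \<and> 0 < y l}"
  have P: "finite P" "P \<noteq> {}" using y by (auto simp: P_def)
  define t where "t = Min ((\<lambda>l. x l / y l) ` P)"
  have "t \<in> (\<lambda>l. x l / y l) ` P" unfolding t_def using P by (intro Min_in) auto
  then obtain i0 where i0: "i0 \<in> P" "t = x i0 / y i0" by auto
  have t_le: "t * y l \<le> x l" if "l \<in> P" for l
  proof -
    have "t \<le> x l / y l" unfolding t_def using P that by (intro Min_le) auto
    then show ?thesis using that by (simp add: P_def field_simps)
  qed
  have x0: "0 \<le> x l" if "l < n" for l using x(1) that by (simp add: cone_def)
  have t0: "0 \<le> t" using i0 x0 by (simp add: P_def)
  define x' where "x' l = x l - t * y l" for l
  have nonneg: "0 \<le> x' l" if "l < n" for l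
  proof (cases "l \<in> P")
    case True then show ?thesis using t_le by (simp add: x'_def)
  next
    case False
    then have "t * y l \<le> 0" using t0 that by (auto simp: P_def intro: mult_nonneg_nonpos)
    then show ?thesis using x0[OF that] by (simp add: x'_def)
  qed
  have Mx: "(\<Sum>l<n. M i l * x' l) = 0" if "i < r" for i
  proof -
    have "(\<Sum>l<n. M i l * x' l) = (\<Sum>l<n. M i l * x l) - t * (\<Sum>l<n. M i l * y l)"
      by (simp add: x'_def sum_subtractf sum_distrib_left algebra_simps)
    then show ?thesis using x(1) y(1) that by (simp add: cone_def)
  qed
  have supp: "l < n \<and> x' l \<noteq> 0 \<longrightarrow> x l \<noteq> 0" for l using y(2) by (auto simp: x'_def)
  have "x' i0 = 0" "i0 < n" using i0 by (auto simp: x'_def P_def)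
  moreover have "x i0 \<noteq> 0" using y(2)[of i0] i0 by (auto simp: P_def)
  ultimately have "{l. l < n \<and> x' l \<noteq> 0} \<subset> {l. l < n \<and> x l \<noteq> 0}" using supp by blast
  then have "card {l. l < n \<and> x' l \<noteq> 0} < card {l. l < n \<and> x l \<noteq> 0}"
    by (intro psubset_card_mono) auto
  moreover have "x' \<in> cone r n M S"
    using nonneg Mx supp x(1) unfolding cone_def by blast
  moreover have "0 < x' j" using x(2) y(3) by (simp add: x'_def)
  ultimately show ?thesis by blast
qed

text \<open>A solution of minimal support is, up to scaling, a column of an integral projection, so its
  entries are integers between \<open>1\<close> and the bound on the Gram determinant.\<close>

lemma cone_entry_lower_bound:
  assumes x0: "x0 \<in> cone r n M S" "0 < x0 j" and j: "j < n"
  shows "\<exists>y \<in> cone r n M S. (\<forall>l<n. y l \<le> 1) \<and> 1 \<le> y j * minor_bound r n M"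
proof -
  define supp where "supp x = {l. l < n \<and> x l \<noteq> 0}" for x :: "nat \<Rightarrow> real"
  obtain x where x: "x \<in> cone r n M S" "0 < x j"
    and min: "\<And>x'. x' \<in> cone r n M S \<Longrightarrow> 0 < x' j \<Longrightarrow> card (supp x) \<le> card (supp x')"
    using ex_has_least_nat[of "\<lambda>x. x \<in> cone r n M S \<and> 0 < x j" x0 "\<lambda>x. card (supp x)"] x0 by blast
  \<comment> \<open>Columns outside the support of \<open>x\<close> are set to zero; for vectors
    supported there, being in the kernel of \<open>a\<close> and of \<open>M\<close> is the
    same.\<close>
  define a where "a i l = (if x l \<noteq> 0 then M i l else 0)" for i l
  obtain d N where P: "gram_proj r n a d N" and d: "d \<le> (\<Prod>i<r. (\<Sum>l<n. (a i l)\<^sup>2) + 1)"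
    using exists_gram_proj by blast
  note O = gram_proj_imp_ortho_proj[OF P]
  have d1: "1 \<le> d" using P by (simp add: gram_proj_def)
  have "(\<Prod>i<r. (\<Sum>l<n. (a i l)\<^sup>2) + 1) \<le> minor_bound r n M"
    unfolding minor_bound_def
    by (intro prod_mono conjI add_right_mono sum_mono) (auto simp: a_def intro!: add_nonneg_nonneg sum_nonneg)
  with d have d: "d \<le> minor_bound r n M" by linarith
  have sym: "N l p = N p l" if "l < n" "p < n" for l p
    by (rule ortho_proj_sym[OF O that])
  have ax: "(\<Sum>p<n. a i p * x p) = 0" if "i < r" for i
  proof -
    have "(\<Sum>p<n. a i p * x p) = (\<Sum>p<n. M i p * x p)"
      by (intro sum.cong) (auto simp: a_def)
    then show ?thesis using x(1) that by (simp add: cone_def)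
  qed
  have Nx: "(\<Sum>p<n. N j p * x p) = d * x j"
    by (rule ortho_proj_kernel[OF O ax j])
  have "N j j \<noteq> 0"
  proof
    assume "N j j = 0"
    then have "N p j = 0" if "p < n" for p using ortho_proj_entry_bound(3)[OF O that j] by simp
    then have "N j p = 0" if "p < n" for p using sym[OF j that] that by simp
    then have "(\<Sum>p<n. N j p * x p) = 0" by simp
    then show False using Nx d1 x(2) by simp
  qed
  then have Njj: "1 \<le> N j j" using ortho_proj_entry_bound(1)[OF O j j] by simp
  define u where "u l = (if x l \<noteq> 0 then real_of_int (N l j) else 0)" for l
  have Mu: "(\<Sum>l<n. M i l * u l) = 0" if "i < r" for i
  proof -
    have "(\<Sum>l<n. M i l * u l) = real_of_int (\<Sum>p<n. N j p * a i p)"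
      unfolding of_int_sum by (intro sum.cong) (auto simp: u_def a_def sym[OF j])
    also have "(\<Sum>p<n. N j p * a i p) = 0" by (rule ortho_proj_row[OF O that j])
    finally show ?thesis by simp
  qed
  \<comment> \<open>Chosen so that \<open>u - \<mu> x\<close> vanishes at \<open>j\<close>: unless
    it is zero, it or its negative would serve to shrink the support of \<open>x\<close>.\<close>
  define \<mu> where "\<mu> = u j / x j"
  have \<mu>: "0 < \<mu>" using x(2) Njj by (simp add: \<mu>_def u_def)
  have no: False if "i < n" "0 < s * (u i - \<mu> * x i)" "s = 1 \<or> s = -1" for i and s :: real
  proof -
    define y where "y l = s * (u l - \<mu> * x l)" for l
    have "(\<Sum>l<n. M i l * y l) = 0" if "i < r" for i
    proof -
      have "(\<Sum>l<n. M i l * y l) = s * ((\<Sum>l<n. M i l * u l) - \<mu> * (\<Sum>l<n. M i l * x l))"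
        by (simp add: y_def sum_subtractf sum_distrib_left algebra_simps)
      then show ?thesis using Mu[OF that] x(1) that by (simp add: cone_def)
    qed
    then have "\<exists>x' \<in> cone r n M S. 0 < x' j \<and> card (supp x') < card (supp x)"
      unfolding supp_def using that x
      by (intro cone_reduce_support[OF x j, of y i]) (auto simp: y_def u_def \<mu>_def)
    then show False using min by fastforce
  qed
  have u_eq: "u l = \<mu> * x l" if "l < n" for l
    using no[OF that, of 1] no[OF that, of "-1"] by (cases "u l - \<mu> * x l" "0::real" rule: linorder_cases) auto
  \<comment> \<open>Entries of \<open>N\<close> are at most \<open>d\<close>, which bounds
    \<open>y\<close> by \<open>1\<close>, and \<open>N j j\<close> is a positive integer, which
    gives \<open>y j \<ge> 1 / d\<close>.\<close>
  define y where "y l = u l / d" for l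
  have "y \<in> cone r n M S"
  proof -
    have "(\<Sum>l<n. M i l * y l) = 0" if "i < r" for i
    proof -
      have "(\<Sum>l<n. M i l * y l) = (\<Sum>l<n. M i l * u l) / d"
        by (simp add: y_def sum_divide_distrib)
      then show ?thesis using Mu[OF that] by simp
    qed
    moreover have "0 \<le> y l" "l \<notin> S \<longrightarrow> y l = 0" if "l < n" for l
      using x(1) that \<mu> d1 by (auto simp: y_def u_eq cone_def)
    ultimately show ?thesis by (simp add: cone_def)
  qed
  moreover have "y l \<le> 1" if "l < n" for l
    using ortho_proj_entry_bound(2)[OF O that j] d1 by (auto simp: y_def u_def)
  moreover have "1 \<le> y j * minor_bound r n M"
  proof -
    have "1 * real_of_int d \<le> real_of_int (N j j) * minor_bound r n M"
      using Njj d d1 by (intro mult_mono) auto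
    then show ?thesis using d1 x(2) by (simp add: y_def u_def field_simps)
  qed
  ultimately show ?thesis by blast
qed

text \<open>For \<open>N = d P\<close> with an orthogonal projection \<open>P\<close>, this is \<open>d\<close> times the squared norm of \<open>P y\<close>.\<close>

definition energy :: "nat \<Rightarrow> (nat \<Rightarrow> nat \<Rightarrow> int) \<Rightarrow> (nat \<Rightarrow> int) \<Rightarrow> int" where
  "energy n N y = (\<Sum>l<n. y l * (\<Sum>p<n. N l p * y p))"

text \<open>A unit step at \<open>k\<close> changes the energy by \<open>2 (N y)_k + N k k\<close>;
  the first term is not positive by the choice of \<open>k\<close>, and the second is at most
  \<open>d\<close>.\<close>

lemma energy_increment:
  assumes O: "ortho_proj r n a d N" and k: "k < n"
    and y: "energy n N y \<le> d * (\<Sum>l<n. y l)" "(\<Sum>p<n. N k p * y p) \<le> 0"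
  shows "energy n N (y(k := y k + 1)) \<le> d * (\<Sum>l<n. (y(k := y k + 1)) l)"
proof -
  define e where "e l = (if l = k then 1 else 0 :: int)" for l
  have y': "y(k := y k + 1) = (\<lambda>l. y l + e l)" by (auto simp: e_def)
  have e: "(\<Sum>p<n. f p * e p) = f k" "(\<Sum>p<n. e p * f p) = f k" for f :: "nat \<Rightarrow> int"
    using k by (simp_all add: e_def sum.remove[of "{..<n}" k])
  have N: "(\<Sum>p<n. N l p * (y p + e p)) = (\<Sum>p<n. N l p * y p) + N l k" for l
    by (simp add: distrib_left sum.distrib e)
  have "energy n N (\<lambda>l. y l + e l) = (\<Sum>l<n. (y l + e l) * ((\<Sum>p<n. N l p * y p) + N l k))"
    unfolding energy_def N ..
  also have "\<dots> = energy n N y + (\<Sum>l<n. y l * N l k) + (\<Sum>p<n. N k p * y p) + N k k"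
    by (simp add: energy_def distrib_left distrib_right sum.distrib e)
  also have "(\<Sum>l<n. y l * N l k) = (\<Sum>p<n. N k p * y p)"
    using ortho_proj_sym[OF O k] by (intro sum.cong) auto
  finally have "energy n N (\<lambda>l. y l + e l) \<le> d * (\<Sum>l<n. y l) + d"
    using y ortho_proj_entry_bound(2)[OF O k k] by linarith
  moreover have "(\<Sum>l<n. y l + e l) = (\<Sum>l<n. y l) + 1"
    using k by (simp add: sum.distrib e_def)
  ultimately show ?thesis unfolding y' by (simp add: distrib_left)
qed

text \<open>As \<open>z\<close> lies in the kernel and \<open>N\<close> is symmetric,
  \<open>d\<close> times the scalar product of \<open>y\<close> and \<open>z\<close> is that of
  \<open>N y\<close> and \<open>z\<close>. Cauchy-Schwarz bounds it, because the squared norm of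
  \<open>N y\<close> is \<open>d\<close> times the energy. All terms \<open>y l * z l\<close> are
  nonnegative, so the bound applies to \<open>y j * z j\<close> alone.\<close>

lemma projection_cut:
  fixes z :: "nat \<Rightarrow> real"
  assumes O: "ortho_proj r n a d N"
    and z: "\<And>l. l < n \<Longrightarrow> 0 \<le> z l \<and> z l \<le> 1" "\<And>i. i < r \<Longrightarrow> (\<Sum>p<n. a i p * z p) = 0"
    and y: "\<And>l. l < n \<Longrightarrow> 0 \<le> y l" "energy n N y \<le> d * (\<Sum>l<n. y l)"
      "(\<Sum>l<n. y l) \<le> int n * (4 * int n ^ 4)"
    and j: "j < n" "4 * int n ^ 4 \<le> y j * int n"
  shows "z j \<le> 1 / 2"
proof -
  have n: "0 < n" using j by simp
  have d: "1 \<le> d" using O by (simp add: ortho_proj_def)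
  have sym: "N l p = N p l" if "l < n" "p < n" for l p
    by (rule ortho_proj_sym[OF O that])
  define w where "w l = (\<Sum>p<n. N l p * y p)" for l
  define s where "s = (\<Sum>l<n. y l)"
  have Nw: "(\<Sum>l<n. N p l * w l) = d * w p" if "p < n" for p
  proof -
    have "(\<Sum>l<n. N p l * w l) = (\<Sum>l<n. \<Sum>q<n. N p l * N l q * y q)"
      by (simp add: w_def sum_distrib_left mult.assoc)
    also have "\<dots> = (\<Sum>q<n. (\<Sum>l<n. N p l * N l q) * y q)"
      by (subst sum.swap) (simp add: sum_distrib_right)
    also have "\<dots> = (\<Sum>q<n. d * N p q * y q)"
      using ortho_proj_idem[OF O that] by simp
    finally show ?thesis by (simp add: w_def sum_distrib_left mult.assoc)
  qed
  have "(\<Sum>l<n. (w l)\<^sup>2) = (\<Sum>l<n. \<Sum>p<n. N p l * w l * y p)"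
    unfolding power2_eq_square
  proof (intro sum.cong refl)
    fix l assume "l \<in> {..<n}"
    then have "(\<Sum>p<n. N p l * w l * y p) = (\<Sum>p<n. w l * (N l p * y p))"
      using sym by (intro sum.cong) auto
    then show "w l * w l = (\<Sum>p<n. N p l * w l * y p)"
      by (simp add: w_def[of l] sum_distrib_left)
  qed
  also have "\<dots> = (\<Sum>p<n. y p * (\<Sum>l<n. N p l * w l))"
    by (subst sum.swap) (simp add: sum_distrib_left algebra_simps)
  also have "\<dots> = (\<Sum>p<n. y p * (d * w p))" by (simp add: Nw)
  also have "\<dots> = d * energy n N y"
    by (simp add: energy_def w_def sum_distrib_left algebra_simps)
  also have "\<dots> \<le> d * (d * s)" using y(2) d by (intro mult_left_mono) (auto simp: s_def)
  finally have ww: "(\<Sum>l<n. (w l)\<^sup>2) \<le> d * (d * s)" .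
  define q where "q = (\<Sum>l<n. y l * z l)"
  have "(\<Sum>l<n. w l * z l) = (\<Sum>l<n. \<Sum>p<n. N l p * y p * z l)"
    by (simp add: w_def sum_distrib_right)
  also have "\<dots> = (\<Sum>p<n. \<Sum>l<n. y p * (N p l * z l))"
  proof (subst sum.swap, intro sum.cong refl)
    fix p l assume "p \<in> {..<n}" "l \<in> {..<n}"
    then show "N l p * y p * z l = y p * (N p l * z l)" using sym[of l p] by simp
  qed
  also have "\<dots> = (\<Sum>p<n. y p * (\<Sum>l<n. N p l * z l))" by (simp add: sum_distrib_left)
  also have "\<dots> = (\<Sum>p<n. y p * (d * z p))"
    using ortho_proj_kernel[OF O z(2)] by simp
  also have "\<dots> = d * q" by (simp add: q_def sum_distrib_left algebra_simps)
  finally have wz: "(\<Sum>l<n. w l * z l) = d * q" .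
  have "(\<Sum>l<n. w l * z l)\<^sup>2 \<le> (\<Sum>l<n. (real_of_int (w l))\<^sup>2) * (\<Sum>l<n. (z l)\<^sup>2)"
    by (rule Cauchy_Schwarz_sum)
  also have "\<dots> \<le> real_of_int (d * (d * s)) * n"
  proof (rule mult_mono)
    have "(\<Sum>l<n. (real_of_int (w l))\<^sup>2) = real_of_int (\<Sum>l<n. (w l)\<^sup>2)" by simp
    then show "(\<Sum>l<n. (real_of_int (w l))\<^sup>2) \<le> real_of_int (d * (d * s))"
      using ww by (simp only: of_int_le_iff)
    have "(\<Sum>l<n. (z l)\<^sup>2) \<le> (\<Sum>l<n. 1)"
      using z(1) by (intro sum_mono) (simp add: power_le_one)
    then show "(\<Sum>l<n. (z l)\<^sup>2) \<le> real n" by simp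
    show "0 \<le> real_of_int (d * (d * s))"
      using d y(1) by (auto simp: s_def intro!: mult_nonneg_nonneg sum_nonneg)
  qed (auto intro: sum_nonneg)
  finally have "(d * q)\<^sup>2 \<le> real_of_int d ^ 2 * (real_of_int s * real n)" unfolding wz by (simp add: power2_eq_square algebra_simps)
  then have "q\<^sup>2 \<le> real_of_int s * real n" using d by (simp add: power_mult_distrib)
  moreover have "y j * z j \<le> q"
    unfolding q_def using j y(1) z(1) by (intro member_le_sum[of j _ "\<lambda>l. y l * z l"]) auto
  moreover have nz: "0 \<le> y j * z j" using y(1) z(1) j by simp
  ultimately have yz: "(y j * z j)\<^sup>2 \<le> real_of_int s * real n"
    by (meson order.trans power_mono)
  have "real_of_int s \<le> real_of_int (int n * (4 * int n ^ 4))"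
    using y(3) unfolding s_def by (simp only: of_int_le_iff)
  then have "real_of_int s \<le> n * (4 * real n ^ 4)" by simp
  then have "real_of_int s * real n \<le> (n * (4 * real n ^ 4)) * real n" by (intro mult_right_mono) auto
  also have "\<dots> = (2 * real n ^ 3)\<^sup>2" by (simp add: power2_eq_square eval_nat_numeral)
  finally have "(y j * z j)\<^sup>2 \<le> (2 * real n ^ 3)\<^sup>2" using yz by linarith
  then have 1: "y j * z j \<le> 2 * real n ^ 3" by (rule power2_le_imp_le) simp
  have "4 * int n ^ 3 \<le> y j"
  proof -
    have "(4 * int n ^ 3) * int n \<le> y j * int n" using j(2) by (simp add: eval_nat_numeral)
    then show ?thesis using n by (simp add: mult_le_cancel_right)
  qed
  then have "real_of_int (4 * int n ^ 3) \<le> y j" by (simp only: of_int_le_iff)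
  then have "(4 * real n ^ 3) * z j \<le> y j * z j"
    using z(1) j by (intro mult_right_mono) auto
  with 1 have "(4 * real n ^ 3) * z j \<le> (4 * real n ^ 3) * (1 / 2)" by linarith
  then show ?thesis using n by (simp add: mult_le_cancel_left)
qed

section \<open>Rescaling\<close>

text \<open>Every solution in the unit cube satisfies \<open>x l \<le> \<sigma> l / 2 ^ b\<close>; the scales are powers of \<open>2\<close> and
  become \<open>0\<close> on coordinates that vanish in all solutions.\<close>

definition valid_scaling :: "nat \<Rightarrow> nat \<Rightarrow> (nat \<Rightarrow> nat \<Rightarrow> int) \<Rightarrow> nat set \<Rightarrow> nat \<Rightarrow> (nat \<Rightarrow> int) \<Rightarrow> bool" where
  "valid_scaling r n M S b \<sigma> \<longleftrightarrow>
    (\<forall>l<n. (\<sigma> l = 0 \<or> (\<exists>e\<le>b. \<sigma> l = 2 ^ e)) \<and> (l \<notin> S \<longrightarrow> \<sigma> l = 0)) \<and>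
    (\<forall>x \<in> cone r n M S. (\<forall>l<n. x l \<le> 1) \<longrightarrow> (\<forall>l<n. x l * 2 ^ b \<le> \<sigma> l))"

lemma valid_scaling_init:
  "(\<And>l. l < n \<Longrightarrow> \<sigma> l = (if l \<in> S then 2 ^ b else 0)) \<Longrightarrow> valid_scaling r n M S b \<sigma>"
  by (auto simp: valid_scaling_def cone_def)

text \<open>Dividing a solution by its bounds gives a point of the unit cube that solves the
  rescaled system, so the cut halves the bound of \<open>j\<close>. All large coordinates can be
  halved at once, because the same \<open>y\<close> yields a separate cut for each of them.\<close>

lemma valid_scaling_halve:
  assumes V: "valid_scaling r n M S b \<sigma>" and b: "minor_bound r n M \<le> 2 ^ b"
    and O: "ortho_proj r n (\<lambda>i l. M i l * \<sigma> l) d N"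
    and y: "\<And>l. l < n \<Longrightarrow> 0 \<le> y l" "energy n N y \<le> d * (\<Sum>l<n. y l)"
      "(\<Sum>l<n. y l) \<le> int n * (4 * int n ^ 4)"
    and \<sigma>': "\<And>l. l < n \<Longrightarrow> \<sigma>' l = (if 4 * int n ^ 4 \<le> y l * int n then \<sigma> l div 2 else \<sigma> l)"
  shows "valid_scaling r n M S b \<sigma>'"
proof -
  have form: "(\<sigma> l = 0 \<or> (\<exists>e\<le>b. \<sigma> l = 2 ^ e)) \<and> (l \<notin> S \<longrightarrow> \<sigma> l = 0)" if "l < n" for l
    using V that unfolding valid_scaling_def by blast
  have bnd: "x l * 2 ^ b \<le> \<sigma> l" if "x \<in> cone r n M S" "\<forall>l<n. x l \<le> 1" "l < n" for x l
    using V that unfolding valid_scaling_def by blast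
  have half: "x j * 2 ^ b * 2 \<le> \<sigma> j"
    if x: "x \<in> cone r n M S" "\<forall>l<n. x l \<le> 1" and j: "j < n" "4 * int n ^ 4 \<le> y j * int n" for x j
  proof -
    \<comment> \<open>At scale \<open>0\<close> the quotient is \<open>0\<close> by convention,
      which is right because \<open>x l\<close> vanishes there.\<close>
    define z where "z l = x l * 2 ^ b / \<sigma> l" for l
    have x0: "0 \<le> x l" if "l < n" for l using x(1) that by (simp add: cone_def)
    have zero: "x l = 0" if "l < n" "\<sigma> l = 0" for l
    proof -
      have "\<not> 0 < x l * 2 ^ b" using bnd[OF x that(1)] that(2) by simp
      then have "\<not> 0 < x l" by (simp add: zero_less_mult_iff)
      then show ?thesis using x0[OF that(1)] by linarith
    qed
    have pos: "0 < \<sigma> l" if "l < n" "\<sigma> l \<noteq> 0" for l using form[OF that(1)] that by auto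
    have z01: "0 \<le> z l \<and> z l \<le> 1" if "l < n" for l
    proof (cases "\<sigma> l = 0")
      case True
      then show ?thesis by (simp add: z_def)
    next
      case False
      then show ?thesis using pos[OF that] x0[OF that] bnd[OF x that] by (simp add: z_def)
    qed
    have z\<sigma>: "\<sigma> l * z l = 2 ^ b * x l" if "l < n" for l
      using zero[OF that] by (cases "\<sigma> l = 0") (auto simp: z_def)
    have "(\<Sum>p<n. (M i p * \<sigma> p) * z p) = 0" if "i < r" for i
    proof -
      have "(\<Sum>p<n. (M i p * \<sigma> p) * z p) = (\<Sum>p<n. 2 ^ b * (M i p * x p))"
        using z\<sigma> by (intro sum.cong) (auto simp: mult.assoc)
      also have "\<dots> = 2 ^ b * (\<Sum>p<n. M i p * x p)" by (simp add: sum_distrib_left)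
      finally show ?thesis using x(1) that by (simp add: cone_def)
    qed
    then have "z j \<le> 1 / 2"
      using z01 by (intro projection_cut[OF O _ _ y j]) auto
    then show ?thesis
      using zero[OF j(1)] pos[OF j(1)] by (cases "\<sigma> j = 0") (auto simp: z_def field_simps)
  qed
  have "x j * 2 ^ b \<le> \<sigma>' j" if x: "x \<in> cone r n M S" "\<forall>l<n. x l \<le> 1" and j: "j < n" for x j
  proof (cases "4 * int n ^ 4 \<le> y j * int n")
    case True
    consider "\<sigma> j = 0" | "\<sigma> j = 1" | e where "\<sigma> j = 2 ^ Suc e"
      using form[OF j] by (metis not0_implies_Suc power_0)
    then show ?thesis
    proof cases
      case 1
      then show ?thesis using half[OF x j True] \<sigma>'[OF j] x j by (simp add: cone_def)
    next
      \<comment> \<open>Scale \<open>1\<close> is followed by \<open>0\<close>, which claims that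
        the coordinate vanishes in all solutions. Otherwise \<open>cone_entry_lower_bound\<close>
        would give a solution in the unit cube with \<open>y j * 2 ^ b \<ge> 1\<close>, against the
        bound \<open>1 / 2\<close>.\<close>
      case 2
      have "x j = 0"
      proof (rule ccontr)
        assume "x j \<noteq> 0"
        then have "0 < x j" using x j by (simp add: cone_def less_le)
        then obtain y where y: "y \<in> cone r n M S" "\<forall>l<n. y l \<le> 1" "1 \<le> y j * minor_bound r n M"
          using cone_entry_lower_bound[OF x(1) _ j] by blast
        have y0: "0 \<le> y j" using y(1) j by (simp add: cone_def)
        have "real_of_int (minor_bound r n M) \<le> real_of_int (2 ^ b)" using b by (simp only: of_int_le_iff)
        then have "y j * minor_bound r n M \<le> y j * 2 ^ b" using y0 by (intro mult_left_mono) auto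
        then show False using half[OF y(1,2) j True] y(3) 2 by simp
      qed
      then show ?thesis using 2 \<sigma>'[OF j] True by simp
    next
      case 3
      then show ?thesis using half[OF x j True] \<sigma>'[OF j] True by simp
    qed
  next
    case False
    then show ?thesis using bnd[OF x j] \<sigma>'[OF j] by simp
  qed
  moreover have "(\<sigma>' l = 0 \<or> (\<exists>e\<le>b. \<sigma>' l = 2 ^ e)) \<and> (l \<notin> S \<longrightarrow> \<sigma>' l = 0)" if l: "l < n" for l
  proof (cases "4 * int n ^ 4 \<le> y l * int n")
    case True
    consider "\<sigma> l = 0" | "\<sigma> l = 1" | e where "\<sigma> l = 2 ^ Suc e" "Suc e \<le> b"
      using form[OF l] by (metis not0_implies_Suc power_0)
    then show ?thesis
    proof cases
      case 3
      then have "\<sigma>' l = 2 ^ e" using \<sigma>'[OF l] True by simp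
      then show ?thesis using 3 form[OF l] by auto
    qed (use \<sigma>'[OF l] True in auto)
  next
    case False
    then show ?thesis using form[OF l] \<sigma>'[OF l] by simp
  qed
  ultimately show ?thesis unfolding valid_scaling_def by blast
qed

text \<open>\<open>N y\<close> lies in the kernel of the scaled matrix, so multiplying it by the
  scales gives a kernel vector of \<open>M\<close>; it is zero where the scale is zero and positive
  elsewhere.\<close>

lemma stable_solution:
  assumes V: "valid_scaling r n M S b \<sigma>"
    and O: "ortho_proj r n (\<lambda>i l. M i l * \<sigma> l) d N"
    and stable: "\<And>k. k < n \<Longrightarrow> 0 < \<sigma> k \<Longrightarrow> 0 < (\<Sum>p<n. N k p * y p)"
  shows "\<exists>x \<in> cone r n M S. \<forall>l<n. 0 < \<sigma> l \<longrightarrow> 0 < x l"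
proof -
  have form: "0 \<le> \<sigma> l \<and> (l \<notin> S \<longrightarrow> \<sigma> l = 0)" if "l < n" for l
    using V that unfolding valid_scaling_def by auto
  define w where "w l = (\<Sum>p<n. N l p * y p)" for l
  define x where "x l = real_of_int (\<sigma> l * w l)" for l
  have sym: "N l p = N p l" if "l < n" "p < n" for l p
    by (rule ortho_proj_sym[OF O that])
  have "(\<Sum>l<n. M i l * x l) = 0" if "i < r" for i
  proof -
    have "(\<Sum>l<n. M i l * x l) = real_of_int (\<Sum>l<n. M i l * \<sigma> l * w l)"
      by (simp add: x_def mult.assoc)
    also have "(\<Sum>l<n. M i l * \<sigma> l * w l) = (\<Sum>l<n. \<Sum>p<n. M i l * \<sigma> l * N l p * y p)"
      by (simp add: w_def sum_distrib_left mult.assoc)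
    also have "\<dots> = (\<Sum>p<n. \<Sum>l<n. y p * (N p l * (M i l * \<sigma> l)))"
    proof (subst sum.swap, intro sum.cong refl)
      fix l p assume "l \<in> {..<n}" "p \<in> {..<n}"
      then show "M i p * \<sigma> p * N p l * y l = y l * (N l p * (M i p * \<sigma> p))" using sym[of l p] by simp
    qed
    also have "\<dots> = (\<Sum>p<n. y p * (\<Sum>l<n. N p l * (M i l * \<sigma> l)))" by (simp add: sum_distrib_left)
    also have "\<dots> = 0" using ortho_proj_row[OF O that] by simp
    finally show ?thesis by simp
  qed
  moreover have "0 \<le> x l \<and> (l \<notin> S \<longrightarrow> x l = 0) \<and> (0 < \<sigma> l \<longrightarrow> 0 < x l)" if l: "l < n" for l
  proof (cases "\<sigma> l = 0")
    case False
    then have "0 < \<sigma> l" using form[OF l] by simp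
    moreover have "0 < w l" using stable[OF l \<open>0 < \<sigma> l\<close>] by (simp add: w_def)
    ultimately have "0 < \<sigma> l * w l" by (rule mult_pos_pos)
    then have "0 < x l" unfolding x_def by (simp only: of_int_0_less_iff)
    then show ?thesis using form[OF l] False by auto
  qed (simp add: x_def)
  ultimately show ?thesis by (intro bexI[of _ x]) (auto simp: cone_def)
qed

text \<open>A positive multiple of \<open>x\<close> lies in the unit cube, where its coordinates are
  bounded by the scales. So the set of positive scales contains the support of every solution at all
  times.\<close>

lemma valid_scaling_positive:
  assumes V: "valid_scaling r n M S b \<sigma>" and x: "x \<in> cone r n M S" and l: "l < n" "0 < x l"
  shows "0 < \<sigma> l"
proof -
  \<comment> \<open>The summand \<open>1\<close> makes \<open>c\<close> positive; as the entries are
    nonnegative, \<open>c\<close> also bounds each of them.\<close>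
  define c where "c = 1 + (\<Sum>l<n. x l)"
  have x0: "0 \<le> x l" if "l < n" for l using x that by (simp add: cone_def)
  have c: "0 < c" "x l \<le> c" if "l < n" for l
    using x0 member_le_sum[of l "{..<n}" x] that unfolding c_def
    by (auto intro!: add_pos_nonneg sum_nonneg)
  define y where "y l = x l / c" for l
  have "(\<Sum>l<n. M i l * y l) = (\<Sum>l<n. M i l * x l) / c" for i
    by (simp add: y_def sum_divide_distrib)
  then have "y \<in> cone r n M S"
    using x c(1)[OF l(1)] by (auto simp: cone_def y_def intro!: divide_nonneg_nonneg)
  moreover have "\<forall>l<n. y l \<le> 1" using c by (simp add: y_def)
  ultimately have "y l * 2 ^ b \<le> \<sigma> l" using V l unfolding valid_scaling_def by blast
  moreover have "0 < y l * 2 ^ b" using l c by (simp add: y_def)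
  ultimately show ?thesis by linarith
qed

section \<open>Columns of a basis\<close>

text \<open>The position of column \<open>i\<close> within \<open>columns A S\<close>, as it occurs
  in \<open>basic_solution\<close>.\<close>

definition col_pos :: "nat set \<Rightarrow> nat \<Rightarrow> nat" where
  "col_pos S i = card {j \<in> S. j < i}"

lemma col_pos_bij:
  assumes "finite S"
  shows "bij_betw (col_pos S) S {..<card S}"
proof -
  have mono: "col_pos S i < col_pos S j" if "i \<in> S" "i < j" for i j
    unfolding col_pos_def using assms that by (intro psubset_card_mono) auto
  have inj: "inj_on (col_pos S) S"
    by (rule inj_onI) (metis mono less_irrefl linorder_neqE_nat)
  have "col_pos S ` S \<subseteq> {..<card S}"
    unfolding col_pos_def using assms by (auto intro!: psubset_card_mono)
  then have "col_pos S ` S = {..<card S}"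
    using inj by (intro card_subset_eq) (auto simp: card_image)
  with inj show ?thesis by (simp add: bij_betw_def)
qed

context
  fixes A :: "real mat" and m n :: nat and S :: "nat set"
  assumes A: "A \<in> carrier_mat m n" and S: "S \<subseteq> {0..<n}"
begin

lemma finite_S: "finite S"
  using S finite_subset by blast

lemma columns_carrier: "columns A S \<in> carrier_mat m (card S)"
proof -
  have "{j. j < n \<and> j \<in> S} = S" using S by auto
  then show ?thesis
    using A unfolding columns_def carrier_mat_def by (simp add: dim_submatrix)
qed

lemma columns_index:
  assumes "i < m" "l \<in> S"
  shows "columns A S $$ (i, col_pos S l) = A $$ (i, l)"
proof -
  have "{a. a < i} = {..<i}" by auto
  then show ?thesis
    using submatrix_index_card[of i A l UNIV S] assms A S
    by (simp add: columns_def col_pos_def subset_iff)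
qed

text \<open>Passes from vectors indexed by positions in \<open>columns A S\<close> to functions on
  all column indices that vanish outside \<open>S\<close>, so that arguments about different bases
  can share sums over all columns.\<close>

lemma columns_mult:
  assumes x: "\<And>l. l \<in> S \<Longrightarrow> x l = v $ col_pos S l" "\<And>l. l \<notin> S \<Longrightarrow> x l = 0"
    and v: "v \<in> carrier_vec (card S)" and i: "i < m"
  shows "(columns A S *\<^sub>v v) $ i = (\<Sum>l<n. A $$ (i, l) * x l)"
proof -
  have "(columns A S *\<^sub>v v) $ i = (\<Sum>c<card S. columns A S $$ (i, c) * v $ c)"
    using columns_carrier v i by (simp add: scalar_prod_def atLeast0LessThan)
  also have "\<dots> = (\<Sum>l\<in>S. columns A S $$ (i, col_pos S l) * v $ col_pos S l)"
    by (rule sum.reindex_bij_betw[OF col_pos_bij[OF finite_S], symmetric])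
  also have "\<dots> = (\<Sum>l\<in>S. A $$ (i, l) * x l)"
    using columns_index[OF i] x(1) by (intro sum.cong) auto
  also have "\<dots> = (\<Sum>l<n. A $$ (i, l) * x l)"
    using S x(2) by (intro sum.mono_neutral_left) auto
  finally show ?thesis .
qed

lemma columns_mult_all:
  assumes x: "\<And>l. l \<in> S \<Longrightarrow> x l = v $ col_pos S l" "\<And>l. l \<notin> S \<Longrightarrow> x l = 0"
    and v: "v \<in> carrier_vec (card S)"
  shows "columns A S *\<^sub>v v = vec m (\<lambda>i. \<Sum>l<n. A $$ (i, l) * x l)"
  using columns_mult[of x v, OF x v] columns_carrier by (intro eq_vecI) auto

end

lemma is_basis_card:
  assumes "A \<in> carrier_mat m n" "is_basis A S"
  shows "S \<subseteq> {0..<n}" "card S = m"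
proof -
  show S: "S \<subseteq> {0..<n}" using assms by (auto simp: is_basis_def)
  show "card S = m"
    using assms columns_carrier[OF assms(1) S] by (auto simp: is_basis_def invertible_mat_def)
qed

text \<open>Links invertibility in the sense of \<open>is_basis\<close> with
  \<open>mat_inverse\<close>, which \<open>basic_solution\<close> uses; the bridge is the group of
  units of the matrix ring.\<close>

lemma is_basis_inverse:
  assumes A: "A \<in> carrier_mat m n" and B: "is_basis A S"
  obtains C where "mat_inverse (columns A S) = Some C" "C \<in> carrier_mat m m"
    "columns A S * C = 1\<^sub>m m" "C * columns A S = 1\<^sub>m m"
proof -
  note S = is_basis_card[OF A B]
  have C: "columns A S \<in> carrier_mat m m" using columns_carrier[OF A S(1)] S(2) by simp
  obtain D where D: "columns A S * D = 1\<^sub>m m" "D * columns A S = 1\<^sub>m (dim_row D)"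
    using B C by (auto simp: is_basis_def invertible_mat_def inverts_mat_def)
  have "D \<in> carrier_mat m m"
    using arg_cong[OF D(1), of dim_col] arg_cong[OF D(2), of dim_col] C by auto
  then have "columns A S \<in> Units (ring_mat TYPE(real) m ())"
    using C D by (auto simp: Units_def ring_mat_def)
  then obtain E where "mat_inverse (columns A S) = Some E"
    using mat_inverse(1)[OF C, where b = "()"] by (cases "mat_inverse (columns A S)") auto
  then show ?thesis using mat_inverse(2)[OF C] that by blast
qed

text \<open>Together with \<open>is_basis_kernel\<close> this characterises the basic solution as
  the unique solution supported on \<open>S\<close>, which takes the place of the inverse matrix.
  Applied to a column of \<open>A\<close>, it expresses that column in the basis.\<close>

lemma basic_solution_sat:
  assumes A: "A \<in> carrier_mat m n" and B: "is_basis A S" and \<beta>: "\<beta> \<in> carrier_vec m"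
  shows "\<exists>x. basic_solution A \<beta> S = vec n x \<and> (\<forall>l. l \<notin> S \<longrightarrow> x l = 0) \<and>
    (\<forall>i<m. (\<Sum>l<n. A $$ (i, l) * x l) = \<beta> $ i)"
proof -
  note S = is_basis_card[OF A B]
  obtain C where C: "mat_inverse (columns A S) = Some C" "C \<in> carrier_mat m m"
    "columns A S * C = 1\<^sub>m m" "C * columns A S = 1\<^sub>m m"
    by (rule is_basis_inverse[OF A B])
  define x where "x l = (if l \<in> S then (C *\<^sub>v \<beta>) $ col_pos S l else 0)" for l
  have "columns A S *\<^sub>v (C *\<^sub>v \<beta>) = \<beta>"
    using assoc_mult_mat_vec[of "columns A S" m m C m \<beta>] columns_carrier[OF A S(1)] C \<beta> S(2) by simp
  then have "(\<Sum>l<n. A $$ (i, l) * x l) = \<beta> $ i" if "i < m" for i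
    using columns_mult[OF A S(1), of x "C *\<^sub>v \<beta>" i] C S(2) \<beta> that by (simp add: x_def)
  moreover have "basic_solution A \<beta> S = vec n x"
    using A C(1) by (intro eq_vecI) (auto simp: basic_solution_def x_def col_pos_def)
  ultimately show ?thesis by (intro exI[of _ x]) (simp add: x_def)
qed

lemma is_basis_kernel:
  assumes A: "A \<in> carrier_mat m n" and B: "is_basis A S"
    and x: "\<And>l. l \<notin> S \<Longrightarrow> x l = 0" "\<And>i. i < m \<Longrightarrow> (\<Sum>l<n. A $$ (i, l) * x l) = 0"
  shows "x l = 0"
proof (cases "l \<in> S")
  case True
  note S = is_basis_card[OF A B]
  obtain C where C: "mat_inverse (columns A S) = Some C" "C \<in> carrier_mat m m"
    "columns A S * C = 1\<^sub>m m" "C * columns A S = 1\<^sub>m m"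
    by (rule is_basis_inverse[OF A B])
  have bij: "bij_betw (col_pos S) S {..<m}"
    using col_pos_bij[OF finite_S[OF A S(1)]] S(2) by simp
  define v where "v = vec m (\<lambda>c. x (the_inv_into S (col_pos S) c))"
  have vx: "x l = v $ col_pos S l" if "l \<in> S" for l
  proof -
    have "col_pos S l < m" using bij that by (auto simp: bij_betw_def)
    then show ?thesis
      using the_inv_into_f_f[of "col_pos S" S l] bij that by (simp add: v_def bij_betw_def)
  qed
  have v: "v \<in> carrier_vec m" by (simp add: v_def)
  have "columns A S *\<^sub>v v = vec m (\<lambda>i. \<Sum>l<n. A $$ (i, l) * x l)"
    using columns_mult_all[OF A S(1) vx x(1)] v S(2) by simp
  also have "\<dots> = 0\<^sub>v m" using x(2) by (intro eq_vecI) auto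
  finally have "C *\<^sub>v (columns A S *\<^sub>v v) = 0\<^sub>v m" using C by (intro eq_vecI) auto
  then have "v = 0\<^sub>v m"
    using assoc_mult_mat_vec[of C m m "columns A S" m v] columns_carrier[OF A S(1)] C v S(2) by simp
  moreover have "col_pos S l < m" using bij True by (auto simp: bij_betw_def)
  ultimately show ?thesis using vx[OF True] by simp
qed (use x in simp)

text \<open>A square matrix with trivial kernel has nonzero determinant and is therefore a
  unit.\<close>

lemma is_basisI:
  assumes A: "A \<in> carrier_mat m n" and S: "S \<subseteq> {0..<n}" "card S = m"
    and ker: "\<And>x. (\<And>l. l \<notin> S \<Longrightarrow> x l = 0) \<Longrightarrow> (\<And>i. i < m \<Longrightarrow> (\<Sum>l<n. A $$ (i, l) * x l) = 0) \<Longrightarrow>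
      \<forall>l\<in>S. x l = 0"
  shows "is_basis A S"
proof -
  have C: "columns A S \<in> carrier_mat m m" using columns_carrier[OF A S(1)] S(2) by simp
  have bij: "bij_betw (col_pos S) S {..<m}"
    using col_pos_bij[OF finite_S[OF A S(1)]] S(2) by simp
  have "det (columns A S) \<noteq> 0"
  proof
    assume "det (columns A S) = 0"
    then obtain v where v: "v \<in> carrier_vec m" "v \<noteq> 0\<^sub>v m" "columns A S *\<^sub>v v = 0\<^sub>v m"
      using det_0_iff_vec_prod_zero_field[OF C] by blast
    define x where "x l = (if l \<in> S then v $ col_pos S l else 0)" for l
    have "(\<Sum>l<n. A $$ (i, l) * x l) = 0" if "i < m" for i
      using columns_mult[OF A S(1), of x v i] v S(2) that by (simp add: x_def)
    then have "\<forall>l\<in>S. x l = 0" by (intro ker) (auto simp: x_def)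
    then have "v $ c = 0" if "c < m" for c
      using bij that by (auto simp: bij_betw_def x_def image_iff dest!: equalityD2)
    then show False using v by (metis eq_vecI index_zero_vec carrier_vecD)
  qed
  then have "columns A S \<in> Units (ring_mat TYPE(real) m ())"
    by (rule det_non_zero_imp_unit[OF C])
  then obtain D where "D \<in> carrier_mat m m" "columns A S * D = 1\<^sub>m m" "D * columns A S = 1\<^sub>m m"
    by (auto simp: Units_def ring_mat_def)
  then have "invertible_mat (columns A S)"
    using C by (auto simp: invertible_mat_def inverts_mat_def)
  then show ?thesis using A S by (simp add: is_basis_def)
qed

section \<open>Unique optimal bases\<close>

context
  fixes A :: "real mat" and m n :: nat and \<beta> q :: "real vec"
  assumes A: "A \<in> carrier_mat m n" and \<beta>: "\<beta> \<in> carrier_vec m" and q: "q \<in> carrier_vec n"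
begin

definition "feas z \<longleftrightarrow> (\<forall>l<n. 0 \<le> z l) \<and> (\<forall>i<m. (\<Sum>l<n. A $$ (i, l) * z l) = \<beta> $ i)"

definition "cost z = (\<Sum>l<n. q $ l * z l)" for z :: "nat \<Rightarrow> real"

lemma lp_feasible_iff: "vec n z \<in> lp_feasible A \<beta> \<longleftrightarrow> feas z"
proof -
  have "A *\<^sub>v vec n z = \<beta> \<longleftrightarrow> (\<forall>i<m. (\<Sum>l<n. A $$ (i, l) * z l) = \<beta> $ i)"
    using A \<beta> by (auto simp: vec_eq_iff scalar_prod_def atLeast0LessThan)
  then show ?thesis
    using A by (auto simp: lp_feasible_def feas_def less_eq_vec_def)
qed

lemma lp_optimal_iff:
  "lp_optimal q A \<beta> (vec n z) \<longleftrightarrow> feas z \<and> (\<forall>z'. feas z' \<longrightarrow> cost z \<le> cost z')"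
proof -
  have dot: "q \<bullet> vec n z = cost z" for z
    using q by (simp add: scalar_prod_def cost_def atLeast0LessThan)
  have *: "(\<forall>z' \<in> lp_feasible A \<beta>. P z') \<longleftrightarrow> (\<forall>z'. feas z' \<longrightarrow> P (vec n z'))" for P
  proof (intro iffI ballI allI impI)
    fix z' assume P: "\<forall>z'. feas z' \<longrightarrow> P (vec n z')" and z': "z' \<in> lp_feasible A \<beta>"
    then have "z' = vec n (\<lambda>i. z' $ i)" using A by (auto simp: lp_feasible_def intro!: eq_vecI)
    then show "P z'" using P z' lp_feasible_iff by metis
  qed (use lp_feasible_iff in auto)
  show ?thesis unfolding lp_optimal_def * lp_feasible_iff dot ..
qed

lemma optimal_basis_iff:
  assumes B: "is_basis A S" and y: "\<And>l. l \<notin> S \<Longrightarrow> y l = 0"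
    "\<And>i. i < m \<Longrightarrow> (\<Sum>l<n. A $$ (i, l) * y l) = \<beta> $ i"
  shows "optimal_basis q A \<beta> S \<longleftrightarrow> feas y \<and> (\<forall>z'. feas z' \<longrightarrow> cost y \<le> cost z')"
proof -
  obtain x where x: "basic_solution A \<beta> S = vec n x" "\<And>l. l \<notin> S \<Longrightarrow> x l = 0"
    "\<And>i. i < m \<Longrightarrow> (\<Sum>l<n. A $$ (i, l) * x l) = \<beta> $ i"
    using basic_solution_sat[OF A B \<beta>] by blast
  have "x l - y l = 0" for l
    by (rule is_basis_kernel[OF A B, of "\<lambda>l. x l - y l"])
       (use x y in \<open>simp_all add: right_diff_distrib sum_subtractf\<close>)
  then have "x = y" by auto
  then show ?thesis using B x(1) by (simp add: optimal_basis_def lp_optimal_iff)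
qed

section \<open>Directions from a fixed basis, pivots, and the uniqueness criterion\<close>

context
  fixes S :: "nat set" and y :: "nat \<Rightarrow> real" and \<eta> :: "nat \<Rightarrow> nat \<Rightarrow> real"
  assumes B: "is_basis A S"
    and y: "\<And>l. l \<notin> S \<Longrightarrow> y l = 0" "\<And>i. i < m \<Longrightarrow> (\<Sum>l<n. A $$ (i, l) * y l) = \<beta> $ i"
    and \<eta>: "\<And>j i. j < n \<Longrightarrow> j \<notin> S \<Longrightarrow> i < m \<Longrightarrow> (\<Sum>l<n. A $$ (i, l) * \<eta> j l) = 0"
      "\<And>j l. j < n \<Longrightarrow> j \<notin> S \<Longrightarrow> l \<notin> S \<Longrightarrow> l \<noteq> j \<Longrightarrow> \<eta> j l = 0"
      "\<And>j. j < n \<Longrightarrow> j \<notin> S \<Longrightarrow> 0 < \<eta> j j"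
begin

lemma S_bound: "l \<in> S \<Longrightarrow> l < n"
  using is_basis_card(1)[OF A B] by auto

text \<open>Subtracting the right-hand side from \<open>z\<close> leaves a kernel vector that
  vanishes outside \<open>S\<close>, so it is zero. The division by \<open>\<eta> j j\<close> is
  there because the directions are given only up to a positive factor.\<close>

lemma kernel_decomposition:
  assumes z: "\<And>i. i < m \<Longrightarrow> (\<Sum>l<n. A $$ (i, l) * z l) = 0" and l: "l < n"
  shows "z l = (\<Sum>j\<in>{0..<n} - S. z j / \<eta> j j * \<eta> j l)"
proof -
  define w where "w l = (if l < n then z l - (\<Sum>j\<in>{0..<n} - S. z j / \<eta> j j * \<eta> j l) else 0)" for l
  have "w l = 0"
  proof (rule is_basis_kernel[OF A B])
    show "w l = 0" if "l \<notin> S" for l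
    proof (cases "l < n")
      case True
      have "(\<Sum>j\<in>{0..<n} - S. z j / \<eta> j j * \<eta> j l) = (\<Sum>j\<in>{l}. z j / \<eta> j j * \<eta> j l)"
        using True that \<eta>(2) by (intro sum.mono_neutral_right) auto
      then show ?thesis using True \<eta>(3)[OF True that] by (simp add: w_def)
    qed (simp add: w_def)
    show "(\<Sum>l<n. A $$ (i, l) * w l) = 0" if i: "i < m" for i
    proof -
      have "(\<Sum>l<n. A $$ (i, l) * w l) = (\<Sum>l<n. A $$ (i, l) * z l)
          - (\<Sum>l<n. \<Sum>j\<in>{0..<n} - S. z j / \<eta> j j * (A $$ (i, l) * \<eta> j l))"
        by (simp add: w_def right_diff_distrib sum_subtractf sum_distrib_left mult.left_commute)
      also have "(\<Sum>l<n. \<Sum>j\<in>{0..<n} - S. z j / \<eta> j j * (A $$ (i, l) * \<eta> j l))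
          = (\<Sum>j\<in>{0..<n} - S. z j / \<eta> j j * (\<Sum>l<n. A $$ (i, l) * \<eta> j l))"
        by (subst sum.swap) (simp add: sum_distrib_left)
      also have "\<dots> = 0" using \<eta>(1) i by simp
      finally show ?thesis using z i by simp
    qed
  qed
  then show ?thesis using l by (simp add: w_def)
qed

text \<open>A kernel vector supported on the new index set has \<open>j\<close> as its only index
  outside \<open>S\<close>, so it is a multiple of \<open>\<eta> j\<close>; vanishing at
  \<open>i\<close> makes the factor zero.\<close>

lemma pivot_basis:
  assumes i: "i \<in> S" and j: "j < n" "j \<notin> S" and nz: "\<eta> j i \<noteq> 0"
  shows "is_basis A (insert j (S - {i}))"
proof (rule is_basisI[OF A])
  note S = is_basis_card[OF A B]
  show "insert j (S - {i}) \<subseteq> {0..<n}" using S j by auto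
  have "finite S" using S finite_subset by blast
  then show "card (insert j (S - {i})) = m"
    using S(2) card_Suc_Diff1[OF \<open>finite S\<close> i] j by simp
  fix x :: "nat \<Rightarrow> real" assume x: "\<And>l. l \<notin> insert j (S - {i}) \<Longrightarrow> x l = 0"
    "\<And>i. i < m \<Longrightarrow> (\<Sum>l<n. A $$ (i, l) * x l) = 0"
  have dec: "x l = x j / \<eta> j j * \<eta> j l" if "l < n" for l
  proof -
    have "x l = (\<Sum>j\<in>{0..<n} - S. x j / \<eta> j j * \<eta> j l)"
      by (rule kernel_decomposition[OF x(2) that])
    also have "\<dots> = (\<Sum>j\<in>{j}. x j / \<eta> j j * \<eta> j l)"
      using x(1) j by (intro sum.mono_neutral_right) auto
    finally show ?thesis by simp
  qed
  have "x i = 0" using x(1)[of i] i j by auto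
  then have "x j = 0" using dec[OF S_bound[OF i]] nz \<eta>(3)[OF j] by auto
  show "\<forall>l\<in>insert j (S - {i}). x l = 0"
  proof
    fix l assume "l \<in> insert j (S - {i})"
    then have "l < n" using S_bound j by auto
    then show "x l = 0" using dec[of l] \<open>x j = 0\<close> by simp
  qed
qed

lemma feas_move:
  assumes j: "j < n" "j \<notin> S" and nonneg: "\<And>l. l < n \<Longrightarrow> 0 \<le> y l + t * \<eta> j l"
  shows "feas (\<lambda>l. y l + t * \<eta> j l)" "cost (\<lambda>l. y l + t * \<eta> j l) = cost y + t * cost (\<eta> j)"
proof -
  have "(\<Sum>l<n. A $$ (i, l) * (y l + t * \<eta> j l)) = (\<Sum>l<n. A $$ (i, l) * y l) + t * (\<Sum>l<n. A $$ (i, l) * \<eta> j l)" for i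
    by (simp add: distrib_left sum.distrib sum_distrib_left mult.left_commute)
  then show "feas (\<lambda>l. y l + t * \<eta> j l)"
    using nonneg y(2) \<eta>(1)[OF j] by (simp add: feas_def)
  show "cost (\<lambda>l. y l + t * \<eta> j l) = cost y + t * cost (\<eta> j)"
    by (simp add: cost_def distrib_left sum.distrib sum_distrib_left mult.left_commute)
qed

text \<open>Necessity: a pivot at \<open>y i = 0\<close> would give a second basis with the same
  basic solution, and a zero reduced cost along a direction that is not a ray would make the basis
  reached at its end optimal too. Sufficiency: every feasible point is \<open>y\<close> plus a
  nonnegative combination of the \<open>\<eta> j\<close>, so \<open>y\<close> is optimal. Another
  optimal basic solution differs from \<open>y\<close> by rays only, hence dominates
  \<open>y\<close>, and this forces \<open>S\<close> into its basis; both have \<open>m\<close>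
  elements.\<close>

theorem unique_optimal_basis_iff:
  "unique_optimal_basis q A \<beta> S \<longleftrightarrow>
    (\<forall>i\<in>S. 0 \<le> y i) \<and>
    (\<forall>i\<in>S. \<forall>j<n. j \<notin> S \<longrightarrow> \<eta> j i \<noteq> 0 \<longrightarrow> 0 < y i) \<and>
    (\<forall>j<n. j \<notin> S \<longrightarrow> 0 \<le> cost (\<eta> j) \<and> ((\<exists>l<n. \<eta> j l < 0) \<longrightarrow> 0 < cost (\<eta> j)))"
proof
  assume U: "unique_optimal_basis q A \<beta> S"
  then have feas_y: "feas y" and opt: "\<And>z'. feas z' \<Longrightarrow> cost y \<le> cost z'"
    and uniq: "\<And>S'. optimal_basis q A \<beta> S' \<Longrightarrow> S' = S"
    using optimal_basis_iff[OF B y] by (auto simp: unique_optimal_basis_def)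
  have y0: "0 \<le> y l" if "l < n" for l using feas_y that by (simp add: feas_def)
  have pos: "0 < y i" if i: "i \<in> S" and j: "j < n" "j \<notin> S" and nz: "\<eta> j i \<noteq> 0" for i j
  proof (rule ccontr)
    assume "\<not> 0 < y i"
    then have "y i = 0" using y0[OF S_bound[OF i]] by simp
    then have "optimal_basis q A \<beta> (insert j (S - {i}))"
      using optimal_basis_iff[OF pivot_basis[OF i j nz], of y] y feas_y opt by auto
    then have "insert j (S - {i}) = S" by (rule uniq)
    then show False using j by auto
  qed
  have red: "0 \<le> cost (\<eta> j) \<and> ((\<exists>l<n. \<eta> j l < 0) \<longrightarrow> 0 < cost (\<eta> j))" if j: "j < n" "j \<notin> S" for j
  proof (cases "\<exists>l<n. \<eta> j l < 0")
    case False
    then have nn: "0 \<le> y l + 1 * \<eta> j l" if "l < n" for l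
    proof -
      have "0 \<le> \<eta> j l" using False that by (meson not_less)
      then show ?thesis using y0[OF that] by simp
    qed
    show ?thesis using opt[OF feas_move(1)[OF j nn]] feas_move(2)[OF j nn] False by auto
  next
    case True
    define P where "P = {l. l < n \<and> \<eta> j l < 0}"
    have P: "finite P" "P \<noteq> {}" using True by (auto simp: P_def)
    \<comment> \<open>The longest feasible step along \<open>\<eta> j\<close>. It is positive: a
      coordinate with a negative entry admits a pivot, so \<open>y\<close> is positive there by
      \<open>pos\<close>.\<close>
    define t where "t = Min ((\<lambda>l. y l / (- \<eta> j l)) ` P)"
    have "t \<in> (\<lambda>l. y l / (- \<eta> j l)) ` P" unfolding t_def using P by (intro Min_in) auto
    then obtain i where i: "i \<in> P" "t = y i / (- \<eta> j i)" by auto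
    have iS: "i \<in> S" using i(1) \<eta>(2,3)[OF j] by (force simp: P_def)
    have nz: "\<eta> j i \<noteq> 0" using i(1) by (simp add: P_def)
    have t: "0 < t" using pos[OF iS j nz] i by (auto simp: P_def divide_pos_neg)
    have t_le: "0 \<le> y l + t * \<eta> j l" if "l < n" for l
    proof (cases "l \<in> P")
      case True
      then have "t \<le> y l / (- \<eta> j l)" unfolding t_def using P by (intro Min_le) auto
      then show ?thesis using True by (simp add: P_def field_simps)
    next
      case False
      then have "0 \<le> t * \<eta> j l" using t that by (simp add: P_def)
      then show ?thesis using y0[OF that] by simp
    qed
    note move = feas_move[OF j t_le]
    have "0 \<le> t * cost (\<eta> j)" using opt[OF move(1)] move(2) by simp
    then have c0: "0 \<le> cost (\<eta> j)" using t by (simp add: zero_le_mult_iff)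
    have "cost (\<eta> j) \<noteq> 0"
    proof
      assume 0: "cost (\<eta> j) = 0"
      let ?y = "\<lambda>l. y l + t * \<eta> j l"
      have "?y i = 0" using i nz by simp
      then have "?y l = 0" if "l \<notin> insert j (S - {i})" for l
        using that y(1) \<eta>(2)[OF j] by (cases "l = i") auto
      moreover have "(\<Sum>l<n. A $$ (i, l) * ?y l) = \<beta> $ i" if "i < m" for i
        using move(1) that by (simp add: feas_def)
      ultimately have "optimal_basis q A \<beta> (insert j (S - {i}))"
        using optimal_basis_iff[OF pivot_basis[OF iS j nz], of ?y] move opt 0 by auto
      then have "insert j (S - {i}) = S" by (rule uniq)
      then show False using j by auto
    qed
    then show ?thesis using c0 by simp
  qed
  show "(\<forall>i\<in>S. 0 \<le> y i) \<and>
    (\<forall>i\<in>S. \<forall>j<n. j \<notin> S \<longrightarrow> \<eta> j i \<noteq> 0 \<longrightarrow> 0 < y i) \<and>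
    (\<forall>j<n. j \<notin> S \<longrightarrow> 0 \<le> cost (\<eta> j) \<and> ((\<exists>l<n. \<eta> j l < 0) \<longrightarrow> 0 < cost (\<eta> j)))"
    using y0 S_bound pos red by blast
next
  assume "(\<forall>i\<in>S. 0 \<le> y i) \<and>
    (\<forall>i\<in>S. \<forall>j<n. j \<notin> S \<longrightarrow> \<eta> j i \<noteq> 0 \<longrightarrow> 0 < y i) \<and>
    (\<forall>j<n. j \<notin> S \<longrightarrow> 0 \<le> cost (\<eta> j) \<and> ((\<exists>l<n. \<eta> j l < 0) \<longrightarrow> 0 < cost (\<eta> j)))"
  then have y0: "\<And>i. i \<in> S \<Longrightarrow> 0 \<le> y i"
    and pos: "\<And>i j. i \<in> S \<Longrightarrow> j < n \<Longrightarrow> j \<notin> S \<Longrightarrow> \<eta> j i \<noteq> 0 \<Longrightarrow> 0 < y i"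
    and c0: "\<And>j. j < n \<Longrightarrow> j \<notin> S \<Longrightarrow> 0 \<le> cost (\<eta> j)"
    and cpos: "\<And>j l. j < n \<Longrightarrow> j \<notin> S \<Longrightarrow> l < n \<Longrightarrow> \<eta> j l < 0 \<Longrightarrow> 0 < cost (\<eta> j)"
    by blast+
  have "0 \<le> y l" for l using y0 y(1) by (cases "l \<in> S") auto
  then have feas_y: "feas y" using y(2) by (simp add: feas_def)
  have diff: "z l = y l + (\<Sum>j\<in>{0..<n} - S. z j / \<eta> j j * \<eta> j l)" if "feas z" "l < n" for z l
  proof -
    have "z l - y l = (\<Sum>j\<in>{0..<n} - S. (z j - y j) / \<eta> j j * \<eta> j l)"
      by (rule kernel_decomposition[of "\<lambda>l. z l - y l"])
         (use that y in \<open>simp_all add: feas_def right_diff_distrib sum_subtractf\<close>)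
    also have "\<dots> = (\<Sum>j\<in>{0..<n} - S. z j / \<eta> j j * \<eta> j l)"
      using y(1) by (intro sum.cong) auto
    finally show ?thesis by simp
  qed
  have cost_eq: "cost z = cost y + (\<Sum>j\<in>{0..<n} - S. z j / \<eta> j j * cost (\<eta> j))" if "feas z" for z
  proof -
    have "cost z = (\<Sum>l<n. q $ l * (y l + (\<Sum>j\<in>{0..<n} - S. z j / \<eta> j j * \<eta> j l)))"
      unfolding cost_def by (intro sum.cong refl) (use diff[OF that] in simp)
    also have "\<dots> = cost y + (\<Sum>l<n. \<Sum>j\<in>{0..<n} - S. z j / \<eta> j j * (q $ l * \<eta> j l))"
      by (simp add: cost_def distrib_left sum.distrib sum_distrib_left mult.left_commute)
    also have "(\<Sum>l<n. \<Sum>j\<in>{0..<n} - S. z j / \<eta> j j * (q $ l * \<eta> j l)) =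
       (\<Sum>j\<in>{0..<n} - S. z j / \<eta> j j * cost (\<eta> j))"
      by (subst sum.swap) (simp add: cost_def sum_distrib_left)
    finally show ?thesis .
  qed
  have term0: "0 \<le> z j / \<eta> j j * cost (\<eta> j)" if "feas z" "j \<in> {0..<n} - S" for z j
    using that c0 \<eta>(3) by (auto simp: feas_def intro!: mult_nonneg_nonneg divide_nonneg_pos)
  have opt_y: "cost y \<le> cost z" if "feas z" for z
    using cost_eq[OF that] sum_nonneg[of "{0..<n} - S" "\<lambda>j. z j / \<eta> j j * cost (\<eta> j)"] term0[OF that]
    by simp
  have "optimal_basis q A \<beta> S" using optimal_basis_iff[OF B y] feas_y opt_y by simp
  moreover have "S' = S" if O: "optimal_basis q A \<beta> S'" for S'
  proof -
    have B': "is_basis A S'" using O by (simp add: optimal_basis_def)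
    obtain z where z: "\<And>l. l \<notin> S' \<Longrightarrow> z l = 0" "\<And>i. i < m \<Longrightarrow> (\<Sum>l<n. A $$ (i, l) * z l) = \<beta> $ i"
      using basic_solution_sat[OF A B' \<beta>] by blast
    then have fz: "feas z" and oz: "\<And>z'. feas z' \<Longrightarrow> cost z \<le> cost z'"
      using optimal_basis_iff[OF B' z] O by auto
    \<comment> \<open>Both points are optimal, so every direction of positive reduced cost has
      coefficient zero in the decomposition of \<open>z - y\<close>; the remaining directions have
      no negative entry.\<close>
    have "cost z \<le> cost y" using oz[OF feas_y] .
    then have "(\<Sum>j\<in>{0..<n} - S. z j / \<eta> j j * cost (\<eta> j)) = 0"
      using cost_eq[OF fz] opt_y[OF fz] by simp
    then have t0: "z j / \<eta> j j * cost (\<eta> j) = 0" if "j \<in> {0..<n} - S" for j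
      using term0[OF fz] that by (subst (asm) sum_nonneg_eq_0_iff) auto
    have nn: "0 \<le> z j / \<eta> j j * \<eta> j l" if "j \<in> {0..<n} - S" "l < n" for j l
    proof (cases "\<eta> j l < 0")
      case True
      then have "cost (\<eta> j) \<noteq> 0" using cpos[of j l] that by auto
      then have "z j / \<eta> j j = 0" using t0[OF that(1)] by (metis mult_eq_0_iff)
      then show ?thesis by (simp only: mult_zero_left order_refl)
    next
      case False
      moreover have "0 \<le> z j / \<eta> j j"
        using that fz \<eta>(3)[of j] by (auto simp: feas_def intro!: divide_nonneg_pos)
      ultimately show ?thesis by (intro mult_nonneg_nonneg) auto
    qed
    have ge: "y l \<le> z l" if "l < n" for l
      using diff[OF fz that] sum_nonneg[of "{0..<n} - S" "\<lambda>j. z j / \<eta> j j * \<eta> j l"] nn that by simp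
    have "S \<subseteq> S'"
    proof
      fix i assume i: "i \<in> S"
      show "i \<in> S'"
      proof (cases "\<exists>j<n. j \<notin> S \<and> \<eta> j i \<noteq> 0")
        case True
        then have "0 < z i" using pos[OF i] ge[OF S_bound[OF i]] by force
        then show ?thesis using z(1) by force
      next
        case False
        \<comment> \<open>Here every kernel vector vanishes at \<open>i\<close>. Expressing column
          \<open>i\<close> in the basis \<open>S'\<close> gives a kernel vector \<open>u\<close>,
          and \<open>u i = 0\<close> means \<open>v i = 1\<close>, so \<open>i\<close> belongs to
          \<open>S'\<close>.\<close>
        obtain v where v: "\<And>l. l \<notin> S' \<Longrightarrow> v l = 0"
          "\<And>i'. i' < m \<Longrightarrow> (\<Sum>l<n. A $$ (i', l) * v l) = A $$ (i', i)"
          using basic_solution_sat[OF A B', of "vec m (\<lambda>i'. A $$ (i', i))"] by auto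
        define u where "u l = (if l = i then 1 else 0) - v l" for l
        have "(\<Sum>l<n. A $$ (i', l) * u l) = 0" if "i' < m" for i'
        proof -
          have "(\<Sum>l<n. A $$ (i', l) * u l) = (\<Sum>l<n. if l = i then A $$ (i', l) else 0) - (\<Sum>l<n. A $$ (i', l) * v l)"
            unfolding sum_subtractf[symmetric] by (intro sum.cong) (auto simp: u_def algebra_simps)
          then show ?thesis using v(2)[OF that] S_bound[OF i] by simp
        qed
        then have "u i = (\<Sum>j\<in>{0..<n} - S. u j / \<eta> j j * \<eta> j i)"
          by (intro kernel_decomposition S_bound[OF i])
        also have "\<dots> = 0" using False by (intro sum.neutral) auto
        finally have "v i = 1" by (simp add: u_def)
        then show ?thesis using v(1) by force
      qed
    qed
    moreover have "card S = card S'" using is_basis_card(2)[OF A B] is_basis_card(2)[OF A B'] by simp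
    moreover have "finite S'" using is_basis_card(1)[OF A B'] finite_subset by blast
    ultimately show "S' = S" by (metis card_subset_eq)
  qed
  ultimately show "unique_optimal_basis q A \<beta> S" unfolding unique_optimal_basis_def by blast
qed

end
end

section \<open>The homogeneous system of an instance\<close>

text \<open>The columns of the homogeneous system are \<open>u\<close> (\<open>n\<close> of them, with \<open>A u = B x + t b\<close>),
  \<open>x\<^sup>+\<close> (\<open>k\<close>), the homogenising variable \<open>t\<close>, \<open>x\<^sup>-\<close> (\<open>k\<close>), the slacks of \<open>D x \<le> t d\<close> (\<open>g\<close>) and
  the scaled reduced costs (\<open>n\<close>).\<close>

definition sys_coeff :: "nat \<Rightarrow> nat \<Rightarrow> nat \<Rightarrow> nat \<Rightarrow> (nat \<Rightarrow> nat \<Rightarrow> int) \<Rightarrow> (nat \<Rightarrow> int) \<Rightarrow>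
    (nat \<Rightarrow> nat \<Rightarrow> int) \<Rightarrow> (nat \<Rightarrow> int) \<Rightarrow> (nat \<Rightarrow> nat \<Rightarrow> int) \<Rightarrow> (nat \<Rightarrow> int) \<Rightarrow>
    (nat \<Rightarrow> nat \<Rightarrow> int) \<Rightarrow> nat \<Rightarrow> nat \<Rightarrow> int" where
  "sys_coeff m n k g VB Vb VC Vc VD Vd X i p =
    (if i < m then if p < k then - VB i p else - Vb i
     else if i < m + g then if p < k then VD (i - m) p else - Vd (i - m)
     else - (\<Sum>l<n. X (i - m - g) l * (if p < k then VC l p else Vc l)))"

text \<open>The variable \<open>t\<close> stands between the two parts of \<open>x\<close> so that
  the \<open>k + 1\<close> columns of \<open>E\<close> form one contiguous block. There is a reduced
  cost row for every \<open>j < n\<close>; when the direction of a basic \<open>j\<close> is zero,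
  its row just sets its own variable to zero.\<close>

definition sys_mat :: "nat \<Rightarrow> nat \<Rightarrow> nat \<Rightarrow> (nat \<Rightarrow> nat \<Rightarrow> int) \<Rightarrow> (nat \<Rightarrow> nat \<Rightarrow> int) \<Rightarrow> nat \<Rightarrow> nat \<Rightarrow> int" where
  "sys_mat m n k VA E i c =
    (if c < n then if i < m then VA i c else 0
     else if c \<le> n + k then E i (c - n)
     else if c < n + 2 * k + 1 then - E i (c - n - k - 1)
     else if m \<le> i \<and> c = n + 2 * k + 1 + (i - m) then 1 else 0)"

lemma sum_lessThan_add:
  fixes f :: "nat \<Rightarrow> 'a::comm_monoid_add"
  shows "(\<Sum>c<a + b. f c) = (\<Sum>c<a. f c) + (\<Sum>c<b. f (a + c))"
  by (induction b) (simp_all add: add.assoc)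

lemma sys_mat_row:
  fixes \<xi> :: "nat \<Rightarrow> real"
  assumes i: "i < m + g + n"
  shows "(\<Sum>c<n + 2 * k + 1 + g + n. sys_mat m n k VA E i c * \<xi> c) =
    (if i < m then \<Sum>l<n. VA i l * \<xi> l else 0)
    + (\<Sum>p<k. E i p * (\<xi> (n + p) - \<xi> (n + k + 1 + p))) + E i k * \<xi> (n + k)
    + (if m \<le> i then \<xi> (n + 2 * k + 1 + (i - m)) else 0)"
proof -
  let ?f = "\<lambda>c. sys_mat m n k VA E i c * \<xi> c"
  have split: "(\<Sum>c<n + (k + (1 + (k + h))). f c) = (\<Sum>c<n. f c) + ((\<Sum>p<k. f (n + p))
      + (f (n + k) + ((\<Sum>p<k. f (n + k + 1 + p)) + (\<Sum>p<h. f (n + 2 * k + 1 + p)))))"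
    for f :: "nat \<Rightarrow> real" and h
    by (simp only: sum_lessThan_add) (simp add: add_ac mult_2)
  have "n + 2 * k + 1 + g + n = n + (k + (1 + (k + (g + n))))" by simp
  then have "(\<Sum>c<n + 2 * k + 1 + g + n. ?f c) = (\<Sum>c<n. ?f c) + ((\<Sum>p<k. ?f (n + p))
      + (?f (n + k) + ((\<Sum>p<k. ?f (n + k + 1 + p)) + (\<Sum>p<g + n. ?f (n + 2 * k + 1 + p)))))"
    by (simp only: split)
  also have "(\<Sum>c<n. ?f c) = (if i < m then \<Sum>l<n. VA i l * \<xi> l else 0)"
    by (auto simp: sys_mat_def)
  also have "(\<Sum>p<k. ?f (n + p)) = (\<Sum>p<k. E i p * \<xi> (n + p))"
    by (intro sum.cong) (auto simp: sys_mat_def)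
  also have "?f (n + k) = E i k * \<xi> (n + k)" by (simp add: sys_mat_def)
  also have "(\<Sum>p<k. ?f (n + k + 1 + p)) = - (\<Sum>p<k. E i p * \<xi> (n + k + 1 + p))"
    unfolding sum_negf[symmetric] by (intro sum.cong) (auto simp: sys_mat_def)
  also have "(\<Sum>p<g + n. ?f (n + 2 * k + 1 + p)) = (if m \<le> i then \<xi> (n + 2 * k + 1 + (i - m)) else 0)"
  proof -
    have "(\<Sum>p<g + n. ?f (n + 2 * k + 1 + p)) = (\<Sum>p<g + n. if p = i - m then if m \<le> i then \<xi> (n + 2 * k + 1 + p) else 0 else 0)"
      by (intro sum.cong) (auto simp: sys_mat_def)
    also have "\<dots> = (if m \<le> i then \<xi> (n + 2 * k + 1 + (i - m)) else 0)"
      using i by (subst sum.delta) auto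
    finally show ?thesis .
  qed
  finally show ?thesis
    by (simp add: right_diff_distrib sum_subtractf)
qed

text \<open>The interface between geometry and program: \<open>G\<close> is a common denominator and
  the data enter multiplied by it. The direction \<open>X j\<close> is required for all
  \<open>j < n\<close> and is zero for basic \<open>j\<close>, so that a program can loop over all
  indices without testing membership in the basis. One positive factor \<open>G\<close> for all data
  preserves equations and signs.\<close>

locale bilfp_system =
  fixes I :: bilfp and m n k g :: nat and G :: int
    and VA VB VC VD X :: "nat \<Rightarrow> nat \<Rightarrow> int" and Vb Vc Vd :: "nat \<Rightarrow> int"
  assumes inst: "I \<in> bilfp_instances"
    and dims: "m = nrows I" "n = nvars I" "k = nparams I" "g = nineqs I"
    and G: "0 < G"
    and VA: "\<And>i l. i < m \<Longrightarrow> l < n \<Longrightarrow> real_of_int (VA i l) = G * real_of_rat (matA I $$ (i, l))"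
    and VB: "\<And>i p. i < m \<Longrightarrow> p < k \<Longrightarrow> real_of_int (VB i p) = G * real_of_rat (matB I $$ (i, p))"
    and Vb: "\<And>i. i < m \<Longrightarrow> real_of_int (Vb i) = G * real_of_rat (vecb I $ i)"
    and VC: "\<And>l p. l < n \<Longrightarrow> p < k \<Longrightarrow> real_of_int (VC l p) = G * real_of_rat (matC I $$ (l, p))"
    and Vc: "\<And>l. l < n \<Longrightarrow> real_of_int (Vc l) = G * real_of_rat (vecc I $ l)"
    and VD: "\<And>i p. i < g \<Longrightarrow> p < k \<Longrightarrow> real_of_int (VD i p) = G * real_of_rat (matD I $$ (i, p))"
    and Vd: "\<And>i. i < g \<Longrightarrow> real_of_int (Vd i) = G * real_of_rat (vecd I $ i)"
    and X: "\<And>j i. j < n \<Longrightarrow> i < m \<Longrightarrow> (\<Sum>l<n. VA i l * X j l) = 0"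
      "\<And>j l. j < n \<Longrightarrow> j \<notin> basis I \<Longrightarrow> l < n \<Longrightarrow> l \<notin> basis I \<Longrightarrow> l \<noteq> j \<Longrightarrow> X j l = 0"
      "\<And>j. j < n \<Longrightarrow> j \<notin> basis I \<Longrightarrow> 0 < X j j"
      "\<And>j l. j < n \<Longrightarrow> j \<in> basis I \<Longrightarrow> l < n \<Longrightarrow> X j l = 0"
begin

definition "E = sys_coeff m n k g VB Vb VC Vc VD Vd X"
definition "ncols = n + 2 * k + 1 + g + n"
definition "live = basis I \<union> {n..<ncols}"
text \<open>The coordinates that must be positive: basic variables on whose row a pivot is possible,
  the variable \<open>t\<close>, and the reduced costs of directions that are not rays.\<close>

definition "strict = {i \<in> basis I. \<exists>j<n. i \<noteq> j \<and> X j i \<noteq> 0} \<union> {n + k} \<union>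
  {n + 2 * k + 1 + g + j |j. j < n \<and> (\<exists>l<n. X j l < 0)}"

lemma carriers:
  "matA I \<in> carrier_mat m n" "matB I \<in> carrier_mat m k" "vecb I \<in> carrier_vec m"
  "matC I \<in> carrier_mat n k" "vecc I \<in> carrier_vec n" "matD I \<in> carrier_mat g k"
  "vecd I \<in> carrier_vec g" "is_basis (real_mat (matA I)) (basis I)"
  using inst dims by (auto simp: bilfp_instances_def)

lemma basis_less: "i \<in> basis I \<Longrightarrow> i < n"
  using is_basis_card(1)[of "real_mat (matA I)" m n "basis I"] carriers by auto

definition "cost_vec x = real_mat (matC I) *\<^sub>v x + real_vec (vecc I)"
definition "rhs_vec x = real_mat (matB I) *\<^sub>v x + real_vec (vecb I)"

lemma cost_vec_index:
  "x \<in> carrier_vec k \<Longrightarrow> l < n \<Longrightarrow> G * cost_vec x $ l = (\<Sum>p<k. VC l p * x $ p) + Vc l"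
  using carriers by (simp add: cost_vec_def scalar_prod_def atLeast0LessThan VC Vc distrib_left sum_distrib_left mult.assoc)

lemma rhs_vec_index:
  "x \<in> carrier_vec k \<Longrightarrow> i < m \<Longrightarrow> G * rhs_vec x $ i = (\<Sum>p<k. VB i p * x $ p) + Vb i"
  using carriers by (simp add: rhs_vec_def scalar_prod_def atLeast0LessThan VB Vb distrib_left sum_distrib_left mult.assoc)

lemma mem_X_iff:
  "x \<in> bilfp_X I \<longleftrightarrow> x \<in> carrier_vec k \<and> (\<forall>i<g. (\<Sum>p<k. VD i p * x $ p) \<le> Vd i)"
proof -
  have "(real_mat (matD I) *\<^sub>v x) $ i \<le> real_vec (vecd I) $ i \<longleftrightarrow> (\<Sum>p<k. VD i p * x $ p) \<le> Vd i"
    if "x \<in> carrier_vec k" "i < g" for i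
  proof -
    have "(\<Sum>p<k. VD i p * x $ p) = G * (real_mat (matD I) *\<^sub>v x) $ i"
      using that carriers by (simp add: scalar_prod_def atLeast0LessThan VD sum_distrib_left mult.assoc)
    moreover have "Vd i = G * real_vec (vecd I) $ i" using that carriers by (simp add: Vd)
    ultimately show ?thesis using G by (simp add: mult_le_cancel_left)
  qed
  then show ?thesis
    using carriers dims by (auto simp: bilfp_X_def less_eq_vec_def)
qed

lemma X_cost: 
  assumes x: "x \<in> carrier_vec k"
  shows "(\<Sum>p<k. (\<Sum>l<n. X j l * VC l p) * x $ p) + (\<Sum>l<n. X j l * Vc l) = G * (\<Sum>l<n. cost_vec x $ l * X j l)"
proof -
  have "G * (\<Sum>l<n. cost_vec x $ l * X j l) = (\<Sum>l<n. X j l * (G * cost_vec x $ l))"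
    by (simp add: sum_distrib_left mult_ac)
  also have "\<dots> = (\<Sum>l<n. X j l * ((\<Sum>p<k. VC l p * x $ p) + Vc l))"
    using x by (simp add: cost_vec_index)
  also have "\<dots> = (\<Sum>l<n. \<Sum>p<k. X j l * VC l p * x $ p) + (\<Sum>l<n. X j l * Vc l)"
    by (simp add: distrib_left sum.distrib sum_distrib_left mult.assoc)
  also have "(\<Sum>l<n. \<Sum>p<k. X j l * VC l p * x $ p) = (\<Sum>p<k. (\<Sum>l<n. X j l * VC l p) * x $ p)"
    by (subst sum.swap) (simp add: sum_distrib_right)
  finally show ?thesis by simp
qed

definition "optimality_conditions x y \<longleftrightarrow>
    (\<forall>i\<in>basis I. 0 \<le> y i) \<and>
    (\<forall>i\<in>basis I. (\<exists>j<n. i \<noteq> j \<and> X j i \<noteq> 0) \<longrightarrow> 0 < y i) \<and>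
    (\<forall>j<n. 0 \<le> (\<Sum>l<n. cost_vec x $ l * X j l) \<and>
      ((\<exists>l<n. X j l < 0) \<longrightarrow> 0 < (\<Sum>l<n. cost_vec x $ l * X j l)))"
  for y :: "nat \<Rightarrow> real"

text \<open>This is \<open>unique_optimal_basis_iff\<close> with the \<open>X j\<close> as
  directions. Its conditions on nonbasic \<open>j\<close> extend to all \<open>j < n\<close>, since
  they hold trivially where \<open>X j\<close> is zero.\<close>

lemma basis_criterion:
  fixes y :: "nat \<Rightarrow> real"
  assumes x: "x \<in> carrier_vec k"
    and y: "\<And>l. l \<notin> basis I \<Longrightarrow> y l = 0"
      "\<And>i. i < m \<Longrightarrow> (\<Sum>l<n. VA i l * y l) = (\<Sum>p<k. VB i p * x $ p) + Vb i"
  shows "unique_optimal_basis (cost_vec x) (real_mat (matA I)) (rhs_vec x) (basis I) \<longleftrightarrow>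
    optimality_conditions x y"
proof -
  have A: "real_mat (matA I) \<in> carrier_mat m n" using carriers by simp
  have b: "rhs_vec x \<in> carrier_vec m" and c: "cost_vec x \<in> carrier_vec n"
    using carriers x by (auto simp: rhs_vec_def cost_vec_def)
  have GA: "G * real_mat (matA I) $$ (i, l) = VA i l" if "i < m" "l < n" for i l
    using that carriers by (simp add: VA)
  have scale: "G * (\<Sum>l<n. real_mat (matA I) $$ (i, l) * z l) = (\<Sum>l<n. VA i l * z l)"
    if "i < m" for i and z :: "nat \<Rightarrow> real"
    unfolding sum_distrib_left using GA[OF that] by (intro sum.cong refl) (simp flip: mult.assoc)
  have y2: "(\<Sum>l<n. real_mat (matA I) $$ (i, l) * y l) = rhs_vec x $ i" if "i < m" for i
  proof -
    have "G * (\<Sum>l<n. real_mat (matA I) $$ (i, l) * y l) = G * rhs_vec x $ i"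
      using that x y(2) by (simp add: scale rhs_vec_index)
    then show ?thesis using G by simp
  qed
  \<comment> \<open>Cut off at \<open>n\<close>: the criterion wants directions that vanish at all
    indices outside the basis other than \<open>j\<close>, while \<open>X j\<close> is known only
    below \<open>n\<close>.\<close>
  define \<eta> where "\<eta> j l = (if l < n then real_of_int (X j l) else 0)" for j l
  have \<eta>1: "(\<Sum>l<n. real_mat (matA I) $$ (i, l) * \<eta> j l) = 0" if "j < n" "j \<notin> basis I" "i < m" for j i
  proof -
    have "G * (\<Sum>l<n. real_mat (matA I) $$ (i, l) * \<eta> j l) = real_of_int (\<Sum>l<n. VA i l * X j l)"
      using that by (simp add: scale \<eta>_def)
    then show ?thesis using X(1) that G by simp
  qed
  have \<eta>2: "\<eta> j l = 0" if "j < n" "j \<notin> basis I" "l \<notin> basis I" "l \<noteq> j" for j l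
    using X(2) that by (simp add: \<eta>_def)
  have \<eta>3: "0 < \<eta> j j" if "j < n" "j \<notin> basis I" for j
    using X(3) that by (simp add: \<eta>_def)
  have cost: "cost n (cost_vec x) (\<eta> j) = (\<Sum>l<n. cost_vec x $ l * X j l)" for j
    by (simp add: cost_def[OF A b c] \<eta>_def)
  have j_cases: "(\<forall>j<n. j \<notin> basis I \<longrightarrow> 0 \<le> (\<Sum>l<n. cost_vec x $ l * X j l) \<and>
      ((\<exists>l<n. \<eta> j l < 0) \<longrightarrow> 0 < (\<Sum>l<n. cost_vec x $ l * X j l))) \<longleftrightarrow>
    (\<forall>j<n. 0 \<le> (\<Sum>l<n. cost_vec x $ l * X j l) \<and>
      ((\<exists>l<n. X j l < 0) \<longrightarrow> 0 < (\<Sum>l<n. cost_vec x $ l * X j l)))"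
  proof -
    have "0 \<le> (\<Sum>l<n. cost_vec x $ l * X j l) \<and>
      ((\<exists>l<n. X j l < 0) \<longrightarrow> 0 < (\<Sum>l<n. cost_vec x $ l * X j l))" if "j < n" "j \<in> basis I" for j
      using X(4)[OF that] by auto
    moreover have "(\<exists>l<n. \<eta> j l < 0) \<longleftrightarrow> (\<exists>l<n. X j l < 0)" for j by (auto simp: \<eta>_def)
    ultimately show ?thesis by metis
  qed
  have i_cases: "(\<forall>i\<in>basis I. \<forall>j<n. j \<notin> basis I \<longrightarrow> \<eta> j i \<noteq> 0 \<longrightarrow> 0 < y i) \<longleftrightarrow>
    (\<forall>i\<in>basis I. (\<exists>j<n. i \<noteq> j \<and> X j i \<noteq> 0) \<longrightarrow> 0 < y i)"
  proof -
    have "X j i \<noteq> 0 \<and> i \<noteq> j \<longleftrightarrow> \<eta> j i \<noteq> 0 \<and> j \<notin> basis I" if "i \<in> basis I" "j < n" for i j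
      using X(4)[of j i] basis_less[OF that(1)] that by (auto simp: \<eta>_def)
    then show ?thesis by blast
  qed
  show ?thesis
    unfolding optimality_conditions_def cost[symmetric] i_cases[symmetric]
    unfolding cost j_cases[symmetric]
    unfolding cost[symmetric]
    by (rule unique_optimal_basis_iff[OF A b c carriers(8)]) (use y(1) y2 \<eta>1 \<eta>2 \<eta>3 in auto)
qed

lemma E_simps:
  "i < m \<Longrightarrow> p < k \<Longrightarrow> E i p = - VB i p" "i < m \<Longrightarrow> E i k = - Vb i"
  "i < g \<Longrightarrow> p < k \<Longrightarrow> E (m + i) p = VD i p" "i < g \<Longrightarrow> E (m + i) k = - Vd i"
  "p < k \<Longrightarrow> E (m + g + j) p = - (\<Sum>l<n. X j l * VC l p)" "E (m + g + j) k = - (\<Sum>l<n. X j l * Vc l)"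
  by (auto simp: E_def sys_coeff_def)

lemma row_u:
  fixes \<xi> :: "nat \<Rightarrow> real"
  assumes "i < m"
  shows "(\<Sum>c<ncols. sys_mat m n k VA E i c * \<xi> c) = 0 \<longleftrightarrow>
    (\<Sum>l<n. VA i l * \<xi> l) = (\<Sum>p<k. VB i p * (\<xi> (n + p) - \<xi> (n + k + 1 + p))) + Vb i * \<xi> (n + k)"
  using assms unfolding ncols_def by (subst sys_mat_row) (auto simp: E_simps sum_negf)

lemma row_slack:
  fixes \<xi> :: "nat \<Rightarrow> real"
  assumes "i < g"
  shows "(\<Sum>c<ncols. sys_mat m n k VA E (m + i) c * \<xi> c) = 0 \<longleftrightarrow>
    \<xi> (n + 2 * k + 1 + i) = Vd i * \<xi> (n + k) - (\<Sum>p<k. VD i p * (\<xi> (n + p) - \<xi> (n + k + 1 + p)))"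
  using assms unfolding ncols_def by (subst sys_mat_row) (auto simp: E_simps)

lemma row_cost:
  fixes \<xi> :: "nat \<Rightarrow> real"
  assumes "j < n"
  shows "(\<Sum>c<ncols. sys_mat m n k VA E (m + g + j) c * \<xi> c) = 0 \<longleftrightarrow>
    \<xi> (n + 2 * k + 1 + g + j) = (\<Sum>p<k. (\<Sum>l<n. X j l * VC l p) * (\<xi> (n + p) - \<xi> (n + k + 1 + p)))
      + (\<Sum>l<n. X j l * Vc l) * \<xi> (n + k)"
  using assms unfolding ncols_def
  by (subst sys_mat_row) (auto simp: E_simps E_simps(5,6)[unfolded add.assoc] sum_negf add.assoc)

lemma rows_split:
  "(\<forall>i<m + g + n. P i) \<longleftrightarrow> (\<forall>i<m. P i) \<and> (\<forall>i<g. P (m + i)) \<and> (\<forall>j<n. P (m + g + j))"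
proof (intro iffI allI impI)
  fix i assume P: "(\<forall>i<m. P i) \<and> (\<forall>i<g. P (m + i)) \<and> (\<forall>j<n. P (m + g + j))" and i: "i < m + g + n"
  consider "i < m" | j where "j < g" "i = m + j" | j where "j < n" "i = m + g + j"
  proof -
    have "i < m \<or> i - m < g \<and> i = m + (i - m) \<or> i - (m + g) < n \<and> i = m + g + (i - (m + g))"
      using i by linarith
    then show ?thesis using that by blast
  qed
  then show "P i" using P by cases auto
qed auto

text \<open>From \<open>x\<close> to \<open>\<xi>\<close>: \<open>t = 1\<close>, the positive and
  negative parts of \<open>x\<close>, the slacks, and \<open>G\<close> times the reduced costs.
  Conversely, \<open>t\<close> is one of the strict coordinates, so a solution can be divided by it;
  the difference of the two parts of \<open>x\<close> then gives the parameter, and the first block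
  gives the basic solution.\<close>

theorem pessimistic_iff_cone:
  "pessimistic_bilfp I \<longleftrightarrow>
    (\<exists>\<xi> \<in> cone (m + g + n) ncols (sys_mat m n k VA E) live. \<forall>l\<in>strict. 0 < \<xi> l)"
proof
  assume "pessimistic_bilfp I"
  then obtain x where xX: "x \<in> bilfp_X I"
    and U: "unique_optimal_basis (cost_vec x) (real_mat (matA I)) (rhs_vec x) (basis I)"
    by (auto simp: pessimistic_bilfp_def cost_vec_def rhs_vec_def)
  have x: "x \<in> carrier_vec k" and Dx: "\<And>i. i < g \<Longrightarrow> (\<Sum>p<k. VD i p * x $ p) \<le> Vd i"
    using xX by (auto simp: mem_X_iff)
  have A: "real_mat (matA I) \<in> carrier_mat m n" using carriers by simp
  have b: "rhs_vec x \<in> carrier_vec m" using carriers x by (auto simp: rhs_vec_def)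
  obtain y where y: "\<And>l. l \<notin> basis I \<Longrightarrow> y l = 0"
      "\<And>i. i < m \<Longrightarrow> (\<Sum>l<n. real_mat (matA I) $$ (i, l) * y l) = rhs_vec x $ i"
    using basic_solution_sat[OF A carriers(8) b] by blast
  have y2: "(\<Sum>l<n. VA i l * y l) = (\<Sum>p<k. VB i p * x $ p) + Vb i" if "i < m" for i
  proof -
    have "(\<Sum>l<n. VA i l * y l) = G * (\<Sum>l<n. real_mat (matA I) $$ (i, l) * y l)"
      unfolding sum_distrib_left using that carriers by (intro sum.cong refl) (simp add: VA)
    then show ?thesis using y(2) that x by (simp add: rhs_vec_index)
  qed
  have crit: "optimality_conditions x y"
    by (rule basis_criterion[OF x, THEN iffD1, OF _ _ U]) (use y(1) y2 in auto)
  define \<xi> where "\<xi> c = (if c < n then y c else if c < n + k then max (x $ (c - n)) 0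
    else if c = n + k then 1 else if c < n + 2 * k + 1 then max (- (x $ (c - n - k - 1))) 0
    else if c < n + 2 * k + 1 + g then Vd (c - n - 2 * k - 1) - (\<Sum>p<k. VD (c - n - 2 * k - 1) p * x $ p)
    else G * (\<Sum>l<n. cost_vec x $ l * X (c - n - 2 * k - 1 - g) l))" for c
  have \<xi>u: "\<xi> c = y c" if "c < n" for c using that by (simp add: \<xi>_def)
  have \<xi>x: "\<xi> (n + p) - \<xi> (n + k + 1 + p) = x $ p" if "p < k" for p using that by (simp add: \<xi>_def max_def)
  have \<xi>t: "\<xi> (n + k) = 1" by (simp add: \<xi>_def)
  have \<xi>s: "\<xi> (n + 2 * k + 1 + i) = Vd i - (\<Sum>p<k. VD i p * x $ p)" if "i < g" for i
    using that by (simp add: \<xi>_def)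
  have \<xi>c: "\<xi> (n + 2 * k + 1 + g + j) = G * (\<Sum>l<n. cost_vec x $ l * X j l)" for j
    by (simp add: \<xi>_def)
  have "\<forall>i<m + g + n. (\<Sum>c<ncols. sys_mat m n k VA E i c * \<xi> c) = 0"
    unfolding rows_split
  proof (intro conjI allI impI)
    show "(\<Sum>c<ncols. sys_mat m n k VA E i c * \<xi> c) = 0" if "i < m" for i
      using y2[OF that] unfolding row_u[OF that] by (simp add: \<xi>u \<xi>x[simplified] \<xi>t)
    show "(\<Sum>c<ncols. sys_mat m n k VA E (m + i) c * \<xi> c) = 0" if "i < g" for i
      unfolding row_slack[OF that] by (simp add: \<xi>s[OF that, simplified] \<xi>x[simplified] \<xi>t)
    show "(\<Sum>c<ncols. sys_mat m n k VA E (m + g + j) c * \<xi> c) = 0" if "j < n" for j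
      unfolding row_cost[OF that] using X_cost[OF x, of j] \<xi>c[of j] by (simp add: \<xi>x[simplified] \<xi>t)
  qed
  moreover have "0 \<le> \<xi> c" if "c < ncols" for c
  proof -
    consider "c < n" | "n \<le> c" "c < n + 2 * k + 1" | i where "i < g" "c = n + 2 * k + 1 + i"
      | j where "j < n" "c = n + 2 * k + 1 + g + j"
    proof -
      have "c < n \<or> n \<le> c \<and> c < n + 2 * k + 1
        \<or> c - (n + 2 * k + 1) < g \<and> c = n + 2 * k + 1 + (c - (n + 2 * k + 1))
        \<or> c - (n + 2 * k + 1 + g) < n \<and> c = n + 2 * k + 1 + g + (c - (n + 2 * k + 1 + g))"
        using \<open>c < ncols\<close> unfolding ncols_def by linarith
      then show ?thesis using that by blast
    qed
    then show ?thesis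
    proof cases
      case 1
      then show ?thesis using crit y(1) by (cases "c \<in> basis I") (auto simp: \<xi>u optimality_conditions_def)
    next
      case 2
      then show ?thesis by (auto simp: \<xi>_def)
    next
      case 3
      then show ?thesis using Dx \<xi>s by simp
    next
      case 4
      then show ?thesis using crit G \<xi>c by (simp add: optimality_conditions_def)
    qed
  qed
  moreover have "\<xi> c = 0" if "c < ncols" "c \<notin> live" for c
    using that y(1) by (cases "c < n") (auto simp: \<xi>u live_def)
  ultimately have "\<xi> \<in> cone (m + g + n) ncols (sys_mat m n k VA E) live"
    by (simp add: cone_def)
  moreover have "0 < \<xi> l" if "l \<in> strict" for l
    using that crit basis_less G \<xi>c by (auto simp: strict_def \<xi>u \<xi>t optimality_conditions_def)
  ultimately show "\<exists>\<xi> \<in> cone (m + g + n) ncols (sys_mat m n k VA E) live. \<forall>l\<in>strict. 0 < \<xi> l"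
    by blast
next
  assume "\<exists>\<xi> \<in> cone (m + g + n) ncols (sys_mat m n k VA E) live. \<forall>l\<in>strict. 0 < \<xi> l"
  then obtain \<xi> where mem: "\<xi> \<in> cone (m + g + n) ncols (sys_mat m n k VA E) live"
    and pos: "\<forall>l\<in>strict. 0 < \<xi> l" by blast
  have rows: "\<forall>i<m + g + n. (\<Sum>c<ncols. sys_mat m n k VA E i c * \<xi> c) = 0"
    and nonneg: "\<And>c. c < ncols \<Longrightarrow> 0 \<le> \<xi> c" and dead: "\<And>c. c < ncols \<Longrightarrow> c \<notin> live \<Longrightarrow> \<xi> c = 0"
    using mem by (simp_all add: cone_def)
  have str: "0 < \<xi> c" if "c \<in> strict" for c using pos that by blast
  define t where "t = \<xi> (n + k)"
  have t: "0 < t" unfolding t_def by (rule str) (simp add: strict_def)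
  define x where "x = vec k (\<lambda>p. (\<xi> (n + p) - \<xi> (n + k + 1 + p)) / t)"
  have x: "x \<in> carrier_vec k" by (simp add: x_def)
  have xp: "\<xi> (n + p) - \<xi> (n + k + 1 + p) = t * x $ p" if "p < k" for p
    using that t by (simp add: x_def)
  define y where "y l = (if l < n then \<xi> l / t else 0)" for l
  have yl: "\<xi> l = t * y l" if "l < n" for l using that t by (simp add: y_def)
  have y1: "y l = 0" if "l \<notin> basis I" for l
    using dead[of l] that by (auto simp: y_def live_def ncols_def)
  have y2: "(\<Sum>l<n. VA i l * y l) = (\<Sum>p<k. VB i p * x $ p) + Vb i" if "i < m" for i
  proof -
    have "(\<Sum>l<n. VA i l * \<xi> l) = (\<Sum>p<k. VB i p * (\<xi> (n + p) - \<xi> (n + k + 1 + p))) + Vb i * t"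
      using rows row_u[OF that, of \<xi>] that unfolding t_def by simp
    also have "(\<Sum>l<n. VA i l * \<xi> l) = t * (\<Sum>l<n. VA i l * y l)"
      by (simp add: yl sum_distrib_left mult.left_commute)
    also have "(\<Sum>p<k. VB i p * (\<xi> (n + p) - \<xi> (n + k + 1 + p))) = t * (\<Sum>p<k. VB i p * x $ p)"
      by (simp only: sum_distrib_left) (intro sum.cong refl, simp only: xp lessThan_iff mult.left_commute)
    finally have "t * (\<Sum>l<n. VA i l * y l) = t * ((\<Sum>p<k. VB i p * x $ p) + Vb i)"
      by (simp add: algebra_simps)
    then show ?thesis using t by simp
  qed
  have s: "\<xi> (n + 2 * k + 1 + i) = t * (Vd i - (\<Sum>p<k. VD i p * x $ p))" if "i < g" for i
  proof -
    have "\<xi> (n + 2 * k + 1 + i) = Vd i * t - (\<Sum>p<k. VD i p * (\<xi> (n + p) - \<xi> (n + k + 1 + p)))"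
      using rows[unfolded rows_split] row_slack[OF that, of \<xi>] that unfolding t_def by blast
    also have "(\<Sum>p<k. VD i p * (\<xi> (n + p) - \<xi> (n + k + 1 + p))) = t * (\<Sum>p<k. VD i p * x $ p)"
      by (simp only: sum_distrib_left) (intro sum.cong refl, simp only: xp lessThan_iff mult.left_commute)
    finally show ?thesis by (simp add: algebra_simps)
  qed
  have c: "\<xi> (n + 2 * k + 1 + g + j) = t * (G * (\<Sum>l<n. cost_vec x $ l * X j l))" if "j < n" for j
  proof -
    have "\<xi> (n + 2 * k + 1 + g + j) = (\<Sum>p<k. (\<Sum>l<n. X j l * VC l p) * (\<xi> (n + p) - \<xi> (n + k + 1 + p)))
      + (\<Sum>l<n. X j l * Vc l) * t"
      using rows[unfolded rows_split] row_cost[OF that, of \<xi>] that unfolding t_def by blast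
    also have "(\<Sum>p<k. (\<Sum>l<n. X j l * VC l p) * (\<xi> (n + p) - \<xi> (n + k + 1 + p))) =
        t * (\<Sum>p<k. (\<Sum>l<n. X j l * VC l p) * x $ p)"
      by (simp only: sum_distrib_left) (intro sum.cong refl, simp only: xp lessThan_iff mult.left_commute)
    finally show ?thesis unfolding X_cost[OF x, symmetric] by (simp add: algebra_simps)
  qed
  have "x \<in> bilfp_X I"
    unfolding mem_X_iff
  proof (intro conjI allI impI x)
    fix i assume i: "i < g"
    have "0 \<le> \<xi> (n + 2 * k + 1 + i)" using i by (intro nonneg) (simp add: ncols_def)
    then show "(\<Sum>p<k. VD i p * x $ p) \<le> Vd i" unfolding s[OF i] using t by (simp add: zero_le_mult_iff)
  qed
  moreover have opt: "optimality_conditions x y"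
    unfolding optimality_conditions_def
  proof (intro conjI ballI allI impI)
    fix i assume i: "i \<in> basis I"
    have "i < ncols" using basis_less[OF i] by (simp add: ncols_def)
    then show "0 \<le> y i" using nonneg[of i] t by (simp add: y_def)
    show "0 < y i" if "\<exists>j<n. i \<noteq> j \<and> X j i \<noteq> 0"
    proof -
      have "0 < \<xi> i" by (rule str) (use i that in \<open>auto simp: strict_def\<close>)
      then show ?thesis using basis_less[OF i] t by (simp add: y_def)
    qed
  next
    fix j assume j: "j < n"
    have "0 \<le> \<xi> (n + 2 * k + 1 + g + j)" using j by (intro nonneg) (simp add: ncols_def)
    then show "0 \<le> (\<Sum>l<n. cost_vec x $ l * X j l)"
      unfolding c[OF j] using t G by (simp add: zero_le_mult_iff)
    show "0 < (\<Sum>l<n. cost_vec x $ l * X j l)" if "\<exists>l<n. X j l < 0"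
    proof -
      have "0 < \<xi> (n + 2 * k + 1 + g + j)" by (rule str) (use j that in \<open>auto simp: strict_def\<close>)
      then show ?thesis unfolding c[OF j] using t G by (simp add: zero_less_mult_iff)
    qed
  qed
  moreover have "unique_optimal_basis (cost_vec x) (real_mat (matA I)) (rhs_vec x) (basis I)"
    by (rule basis_criterion[OF x, THEN iffD2, OF _ _ opt]) (use y1 y2 in auto)
  ultimately show "pessimistic_bilfp I"
    unfolding pessimistic_bilfp_def cost_vec_def rhs_vec_def by blast
qed

end

section \<open>Evaluation in stores that agree on the relevant variables\<close>

lemma aval_frame:
  assumes "\<And>z. z \<notin> Z \<Longrightarrow> \<tau> z = \<sigma> z" "vars e \<inter> Z = {}"
  shows "aval w e \<tau> = aval w e \<sigma>" "ok w e \<tau> = ok w e \<sigma>"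
  using assms by (auto intro!: aval_cong ok_cong)

lemma wp_Seq: "wp w R B p (wp w R B q Q) \<sigma> \<Longrightarrow> wp w R B (p ;; q) Q \<sigma>"
  by simp

lemma wp_Set_Var:
  "x < 32 \<Longrightarrow> ok w v \<sigma> \<Longrightarrow> \<bar>aval w v \<sigma>\<bar> \<le> B \<Longrightarrow> Q (upd \<sigma> x 0 0 (aval w v \<sigma>)) \<Longrightarrow>
   wp w R B (Set_Var x v) Q \<sigma>"
  by simp

section \<open>Filling and inspecting arrays\<close>

text \<open>The command \<open>c\<close> runs before each entry is written and leaves in a scalar,
  read by \<open>v\<close>, what an expression cannot compute, such as an inner sum. The offsets of
  the block are \<open>ro\<close> and \<open>co\<close>.\<close>

definition Fill_With :: "com \<Rightarrow> nat \<Rightarrow> nat \<Rightarrow> nat \<Rightarrow> aexp \<Rightarrow> aexp \<Rightarrow> aexp \<Rightarrow> aexp \<Rightarrow> aexp \<Rightarrow> com" where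
  "Fill_With c x l p e f ro co v = For l e (For p f (c ;; Asg x (Plus ro (Var l)) (Plus co (Var p)) v))"

abbreviation Fill :: "nat \<Rightarrow> nat \<Rightarrow> nat \<Rightarrow> aexp \<Rightarrow> aexp \<Rightarrow> aexp \<Rightarrow> aexp \<Rightarrow> aexp \<Rightarrow> com" where
  "Fill \<equiv> Fill_With CSkip"

lemma mods_Fill_With [simp]: "mods (Fill_With c x l p e f ro co v) = {x, l, p} \<union> mods c"
  by (auto simp: Fill_With_def)

text \<open>The behaviour of \<open>c\<close> is assumed in continuation form. It may rely on the
  entry about to be written having its initial value, which permits updates in place.\<close>

lemma wp_Fill_With:
  fixes c :: com and x l p :: nat
  defines "Z \<equiv> {x, l, p} \<union> mods c"
  assumes ids: "x < 32" "l < 32" "p < 32" "l \<noteq> p" "x \<noteq> l" "x \<noteq> p" "mods c \<inter> {x, l, p} = {}"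
    and vars: "vars e \<inter> Z = {}" "vars f \<inter> Z = {}"
      "vars ro \<inter> Z = {}" "vars co \<inter> Z = {}"
    and e: "ok w e \<sigma>" "aval w e \<sigma> = int a" "a \<le> R" "int a \<le> B"
    and f: "ok w f \<sigma>" "aval w f \<sigma> = int b" "b \<le> R" "int b \<le> B"
    and ro: "ok w ro \<sigma>" "aval w ro \<sigma> = int rb" and co: "ok w co \<sigma>" "aval w co \<sigma> = int cb"
    and v: "\<And>i j \<tau> Q. i < a \<Longrightarrow> j < b \<Longrightarrow> \<tau> l 0 0 = int i \<Longrightarrow> \<tau> p 0 0 = int j \<Longrightarrow>
      \<tau> x (rb + i) (cb + j) = \<sigma> x (rb + i) (cb + j) \<Longrightarrow> (\<And>z. z \<notin> Z \<Longrightarrow> \<tau> z = \<sigma> z) \<Longrightarrow>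
      (\<And>\<tau>'. ok w v \<tau>' \<Longrightarrow> aval w v \<tau>' = F i j \<Longrightarrow> (\<And>z. z \<notin> mods c \<Longrightarrow> \<tau>' z = \<tau> z) \<Longrightarrow> Q \<tau>') \<Longrightarrow>
      wp w R B c Q \<tau>"
    and F: "\<And>i j. i < a \<Longrightarrow> j < b \<Longrightarrow> \<bar>F i j\<bar> \<le> B"
    and post: "\<And>\<tau>. (\<And>i j. i < a \<Longrightarrow> j < b \<Longrightarrow> \<tau> x (rb + i) (cb + j) = F i j) \<Longrightarrow>
      (\<And>i j. \<not> (rb \<le> i \<and> i < rb + a \<and> cb \<le> j \<and> j < cb + b) \<Longrightarrow> \<tau> x i j = \<sigma> x i j) \<Longrightarrow>
      (\<And>z. z \<notin> Z \<Longrightarrow> \<tau> z = \<sigma> z) \<Longrightarrow> Q \<tau>"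
  shows "wp w R B (Fill_With c x l p e f ro co v) Q \<sigma>"
proof -
  \<comment> \<open>Row by row: \<open>i\<close> full rows of the block and the first
    \<open>j\<close> entries of the next row are written.\<close>
  define J where "J i j \<tau> \<longleftrightarrow> (\<forall>i' j'. \<tau> x i' j' =
    (if (rb \<le> i' \<and> i' < rb + i \<and> cb \<le> j' \<and> j' < cb + b) \<or> (i' = rb + i \<and> cb \<le> j' \<and> j' < cb + j)
     then F (i' - rb) (j' - cb) else \<sigma> x i' j'))" for i j and \<tau> :: store
  have Jb: "J (Suc i) 0 \<tau>" if "J i b \<tau>" for i \<tau>
    unfolding J_def
  proof (intro allI)
    fix i' j'
    have "\<tau> x i' j' = (if (rb \<le> i' \<and> i' < rb + i \<and> cb \<le> j' \<and> j' < cb + b) \<or> (i' = rb + i \<and> cb \<le> j' \<and> j' < cb + b)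
     then F (i' - rb) (j' - cb) else \<sigma> x i' j')" using that by (simp add: J_def)
    moreover have "((rb \<le> i' \<and> i' < rb + i \<and> cb \<le> j' \<and> j' < cb + b) \<or> (i' = rb + i \<and> cb \<le> j' \<and> j' < cb + b))
      \<longleftrightarrow> ((rb \<le> i' \<and> i' < rb + Suc i \<and> cb \<le> j' \<and> j' < cb + b) \<or> (i' = rb + Suc i \<and> cb \<le> j' \<and> j' < cb + 0))"
      by auto
    ultimately show "\<tau> x i' j' = (if (rb \<le> i' \<and> i' < rb + Suc i \<and> cb \<le> j' \<and> j' < cb + b) \<or> (i' = rb + Suc i \<and> cb \<le> j' \<and> j' < cb + 0)
     then F (i' - rb) (j' - cb) else \<sigma> x i' j')" by (simp only:)
  qed
  have Jupd: "J i j (upd \<tau> y 0 0 u) \<longleftrightarrow> J i j \<tau>" if "y \<noteq> x" for i j \<tau> y u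
    using that by (simp add: J_def)
  let ?asg = "c ;; Asg x (Plus ro (Var l)) (Plus co (Var p)) v"
  show ?thesis
    unfolding Fill_With_def
  proof (rule wp_For[where I = "\<lambda>i. J i 0" and n = a])
    show "J 0 0 (upd \<sigma> l 0 0 0)" unfolding Jupd[OF ids(5)[symmetric]] by (auto simp: J_def)
    fix i \<tau> assume i: "i < a" and I: "J i 0 \<tau>" and l: "\<tau> l 0 0 = int i"
      and fr: "\<And>y. y \<notin> insert l (mods (For p f ?asg)) \<Longrightarrow> \<tau> y = \<sigma> y"
    have fr': "\<tau> z = \<sigma> z" if "z \<notin> Z" for z using fr that by (auto simp: Z_def)
    show "wp w R B (For p f ?asg)
       (\<lambda>\<tau>'. J (Suc i) 0 (upd \<tau>' l 0 0 (int (Suc i)))) \<tau>"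
    proof (rule wp_For[where I = "\<lambda>j. J i j" and n = b])
      show "J i 0 (upd \<tau> p 0 0 0)" unfolding Jupd[OF ids(6)[symmetric]] by (rule I)
      fix j \<rho> assume j: "j < b" and Ij: "J i j \<rho>" and p: "\<rho> p 0 0 = int j"
        and fr2: "\<And>y. y \<notin> insert p (mods ?asg) \<Longrightarrow> \<rho> y = \<tau> y"
      have fr3: "\<rho> z = \<sigma> z" if "z \<notin> Z" for z using fr2 fr' that by (auto simp: Z_def)
      have l': "\<rho> l 0 0 = int i" using fr2[of l] ids l by auto
      have free: "\<rho> x (rb + i) (cb + j) = \<sigma> x (rb + i) (cb + j)" using Ij by (simp add: J_def)
      show "wp w R B ?asg (\<lambda>\<tau>'. J i (Suc j) (upd \<tau>' p 0 0 (int (Suc j)))) \<rho>"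
      proof (rule wp_Seq, rule v[OF i j l' p free fr3])
        fix \<rho>' assume v': "ok w v \<rho>'" "aval w v \<rho>' = F i j" and fr4: "\<And>z. z \<notin> mods c \<Longrightarrow> \<rho>' z = \<rho> z"
        have xlp: "\<rho>' x = \<rho> x" "\<rho>' l = \<rho> l" "\<rho>' p = \<rho> p" using fr4 ids(7) by auto
        have fr5: "\<rho>' z = \<sigma> z" if "z \<notin> Z" for z using fr4 fr3 that by (auto simp: Z_def)
        note fro = aval_frame[where Z = Z and \<tau> = \<rho>' and \<sigma> = \<sigma>, OF fr5 vars(3)]
        note fco = aval_frame[where Z = Z and \<tau> = \<rho>' and \<sigma> = \<sigma>, OF fr5 vars(4)]
        have "J i (Suc j) (upd \<rho>' x (rb + i) (cb + j) (F i j))"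
          using Ij xlp by (auto simp: J_def less_Suc_eq)
        then show "wp w R B (Asg x (Plus ro (Var l)) (Plus co (Var p)) v) (\<lambda>\<tau>'. J i (Suc j) (upd \<tau>' p 0 0 (int (Suc j)))) \<rho>'"
          using ids v' F[OF i j] fro fco ro co l' p xlp Jupd[OF ids(6)[symmetric]] by (simp add: nat_int_add)
      qed
    next
      fix \<rho> assume "J i b \<rho>"
      then show "J (Suc i) 0 (upd \<rho> l 0 0 (int (Suc i)))"
        unfolding Jupd[OF ids(5)[symmetric]] by (rule Jb)
    qed (use ids vars f aval_frame[where Z = Z and \<tau> = \<tau> and \<sigma> = \<sigma>, OF fr' vars(2)] in \<open>auto simp: Z_def\<close>)
  next
    fix \<tau> assume I: "J a 0 \<tau>"
      and fr: "\<And>y. y \<notin> insert l (mods (For p f ?asg)) \<Longrightarrow> \<tau> y = \<sigma> y"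
    show "Q \<tau>"
      by (rule post) (use I fr in \<open>auto simp: J_def Z_def\<close>)
  qed (use ids vars e in \<open>auto simp: Z_def\<close>)
qed

lemma wp_Fill:
  assumes ids: "x < 32" "l < 32" "p < 32" "l \<noteq> p" "x \<noteq> l" "x \<noteq> p"
    and vars: "vars e \<inter> {x, l, p} = {}" "vars f \<inter> {x, l, p} = {}"
      "vars ro \<inter> {x, l, p} = {}" "vars co \<inter> {x, l, p} = {}"
    and e: "ok w e \<sigma>" "aval w e \<sigma> = int a" "a \<le> R" "int a \<le> B"
    and f: "ok w f \<sigma>" "aval w f \<sigma> = int b" "b \<le> R" "int b \<le> B"
    and ro: "ok w ro \<sigma>" "aval w ro \<sigma> = int rb" and co: "ok w co \<sigma>" "aval w co \<sigma> = int cb"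
    and v: "\<And>i j \<tau>. i < a \<Longrightarrow> j < b \<Longrightarrow> \<tau> l 0 0 = int i \<Longrightarrow> \<tau> p 0 0 = int j \<Longrightarrow>
      \<tau> x (rb + i) (cb + j) = \<sigma> x (rb + i) (cb + j) \<Longrightarrow> (\<And>z. z \<notin> {x, l, p} \<Longrightarrow> \<tau> z = \<sigma> z) \<Longrightarrow>
      ok w v \<tau> \<and> aval w v \<tau> = F i j"
    and F: "\<And>i j. i < a \<Longrightarrow> j < b \<Longrightarrow> \<bar>F i j\<bar> \<le> B"
    and post: "\<And>\<tau>. (\<And>i j. i < a \<Longrightarrow> j < b \<Longrightarrow> \<tau> x (rb + i) (cb + j) = F i j) \<Longrightarrow>
      (\<And>i j. \<not> (rb \<le> i \<and> i < rb + a \<and> cb \<le> j \<and> j < cb + b) \<Longrightarrow> \<tau> x i j = \<sigma> x i j) \<Longrightarrow>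
      (\<And>z. z \<notin> {x, l, p} \<Longrightarrow> \<tau> z = \<sigma> z) \<Longrightarrow> Q \<tau>"
  shows "wp w R B (Fill x l p e f ro co v) Q \<sigma>"
proof (rule wp_Fill_With[where a = a and b = b and rb = rb and cb = cb and F = F])
  show "wp w R B CSkip Q \<tau>"
    if "i < a" "j < b" "\<tau> l 0 0 = int i" "\<tau> p 0 0 = int j" "\<tau> x (rb + i) (cb + j) = \<sigma> x (rb + i) (cb + j)"
      "\<And>z. z \<notin> {x, l, p} \<union> mods CSkip \<Longrightarrow> \<tau> z = \<sigma> z"
      "\<And>\<tau>'. ok w v \<tau>' \<Longrightarrow> aval w v \<tau>' = F i j \<Longrightarrow> (\<And>z. z \<notin> mods CSkip \<Longrightarrow> \<tau>' z = \<tau> z) \<Longrightarrow> Q \<tau>'"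
    for i j \<tau> Q
    using v[of i j \<tau>] that by simp
qed (use assms in auto)

text \<open>Two nested tests act as a conjunction. The flag is only ever cleared, so consecutive
  checks with the same flag accumulate.\<close>

definition Check :: "nat \<Rightarrow> nat \<Rightarrow> nat \<Rightarrow> aexp \<Rightarrow> aexp \<Rightarrow> aexp \<Rightarrow> aexp \<Rightarrow> com" where
  "Check x l p e f c c' = For l e (For p f (CIf c (CIf c' (Set_Var x (Num 0)) CSkip) CSkip))"

lemma mods_Check [simp]: "mods (Check x l p e f c c') = {x, l, p}"
  by (auto simp: Check_def)

lemma wp_Check:
  assumes ids: "x < 32" "l < 32" "p < 32" "l \<noteq> p" "x \<noteq> l" "x \<noteq> p"
    and vars: "vars e \<inter> {x, l, p} = {}" "vars f \<inter> {x, l, p} = {}"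
    and e: "ok w e \<sigma>" "aval w e \<sigma> = int a" "a \<le> R" "int a \<le> B"
    and f: "ok w f \<sigma>" "aval w f \<sigma> = int b" "b \<le> R" "int b \<le> B"
    and c: "\<And>i j \<tau>. i < a \<Longrightarrow> j < b \<Longrightarrow> \<tau> l 0 0 = int i \<Longrightarrow> \<tau> p 0 0 = int j \<Longrightarrow>
      (\<And>z. z \<notin> {x, l, p} \<Longrightarrow> \<tau> z = \<sigma> z) \<Longrightarrow>
      ok w c \<tau> \<and> ok w c' \<tau> \<and> (0 < aval w c \<tau> \<and> 0 < aval w c' \<tau> \<longleftrightarrow> C i j)"
    and post: "\<And>\<tau>. \<tau> x 0 0 = (if \<exists>i<a. \<exists>j<b. C i j then 0 else \<sigma> x 0 0) \<Longrightarrow>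
      (\<And>z. z \<notin> {x, l, p} \<Longrightarrow> \<tau> z = \<sigma> z) \<Longrightarrow> Q \<tau>"
  shows "wp w R B (Check x l p e f c c') Q \<sigma>"
proof -
  let ?body = "CIf c (CIf c' (Set_Var x (Num 0)) CSkip) CSkip"
  define J where "J i j \<tau> \<longleftrightarrow> \<tau> x 0 0 =
    (if (\<exists>i'<i. \<exists>j'<b. C i' j') \<or> (\<exists>j'<j. C i j') then 0 else \<sigma> x 0 0)" for i j and \<tau> :: store
  have Jupd: "J i j (upd \<tau> y 0 0 u) \<longleftrightarrow> J i j \<tau>" if "y \<noteq> x" for i j \<tau> y u
    using that by (simp add: J_def)
  have Jb: "J (Suc i) 0 \<tau> \<longleftrightarrow> J i b \<tau>" for i \<tau>
    by (simp add: J_def less_Suc_eq ex_disj_distrib conj_disj_distribR)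
  show ?thesis
    unfolding Check_def
  proof (rule wp_For[where I = "\<lambda>i. J i 0" and n = a])
    show "J 0 0 (upd \<sigma> l 0 0 0)" unfolding Jupd[OF ids(5)[symmetric]] by (auto simp: J_def)
    fix i \<tau> assume i: "i < a" and I: "J i 0 \<tau>" and l: "\<tau> l 0 0 = int i"
      and fr: "\<And>y. y \<notin> insert l (mods (For p f ?body)) \<Longrightarrow> \<tau> y = \<sigma> y"
    have fr': "\<tau> z = \<sigma> z" if "z \<notin> {x, l, p}" for z using fr that by auto
    show "wp w R B (For p f ?body) (\<lambda>\<tau>'. J (Suc i) 0 (upd \<tau>' l 0 0 (int (Suc i)))) \<tau>"
    proof (rule wp_For[where I = "\<lambda>j. J i j" and n = b])
      show "J i 0 (upd \<tau> p 0 0 0)" unfolding Jupd[OF ids(6)[symmetric]] by (rule I)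
      fix j \<rho> assume j: "j < b" and Ij: "J i j \<rho>" and p: "\<rho> p 0 0 = int j"
        and fr2: "\<And>y. y \<notin> insert p (mods ?body) \<Longrightarrow> \<rho> y = \<tau> y"
      have fr3: "\<rho> z = \<sigma> z" if "z \<notin> {x, l, p}" for z using fr2 fr' that by auto
      have l': "\<rho> l 0 0 = int i" using fr2[of l] ids l by auto
      have cc: "ok w c \<rho>" "ok w c' \<rho>" "0 < aval w c \<rho> \<and> 0 < aval w c' \<rho> \<longleftrightarrow> C i j"
        using c[of i j \<rho>] i j l' p fr3 by auto
      have "J i (Suc j) \<rho>" if "\<not> C i j" using Ij that by (auto simp: J_def less_Suc_eq)
      moreover have "J i (Suc j) (upd \<rho> x 0 0 0)" if "C i j" using that by (auto simp: J_def)
      ultimately show "wp w R B ?body (\<lambda>\<tau>'. J i (Suc j) (upd \<tau>' p 0 0 (int (Suc j)))) \<rho>"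
        using ids cc f(4) unfolding Jupd[OF ids(6)[symmetric]] by auto
    next
      fix \<rho> assume "J i b \<rho>"
      then show "J (Suc i) 0 (upd \<rho> l 0 0 (int (Suc i)))"
        unfolding Jupd[OF ids(5)[symmetric]] Jb .
    qed (use ids vars f aval_frame[where Z = "{x, l, p}" and \<tau> = \<tau> and \<sigma> = \<sigma>, OF fr' vars(2)] in auto)
  next
    fix \<tau> assume I: "J a 0 \<tau>" and fr: "\<And>y. y \<notin> insert l (mods (For p f ?body)) \<Longrightarrow> \<tau> y = \<sigma> y"
    show "Q \<tau>"
      by (rule post) (use I fr in \<open>auto simp: J_def\<close>)
  qed (use ids vars e in auto)
qed

section \<open>The projection program\<close>

abbreviation (input) "v_nc \<equiv> 1 :: nat"
abbreviation (input) "v_mat \<equiv> 4 :: nat"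
abbreviation (input) "v_scale \<equiv> 5 :: nat"
abbreviation (input) "v_proj \<equiv> 6 :: nat"
abbreviation (input) "v_det \<equiv> 7 :: nat"
abbreviation (input) "v_image \<equiv> 8 :: nat"
abbreviation (input) "v_alpha \<equiv> 9 :: nat"
abbreviation (input) "v_y \<equiv> 10 :: nat"
abbreviation (input) "v_acc \<equiv> 11 :: nat"
abbreviation (input) "v_changed \<equiv> 13 :: nat"
abbreviation (input) "v_j \<equiv> 14 :: nat"
abbreviation (input) "v_i \<equiv> 15 :: nat"
abbreviation (input) "v_l \<equiv> 16 :: nat"
abbreviation (input) "v_p \<equiv> 17 :: nat"
abbreviation (input) "v_sweeps \<equiv> 19 :: nat"
abbreviation (input) "v_s0 \<equiv> 20 :: nat"
abbreviation (input) "v_prod \<equiv> 21 :: nat"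
abbreviation (input) "v_nr \<equiv> 22 :: nat"

text \<open>Integer division turns the Kronecker delta into an arithmetic expression.\<close>

definition delta :: "nat \<Rightarrow> nat \<Rightarrow> aexp" where
  "delta l p = Quot (Num 1) (Plus (Num 1) (Times (Minus (Var l) (Var p)) (Minus (Var l) (Var p))))"

lemma aval_delta:
  assumes "\<tau> l 0 0 = int i" "\<tau> p 0 0 = int j"
  shows "aval w (delta l p) \<tau> = (if i = j then 1 else 0)"
proof (cases "i = j")
  case False
  then have "0 < (int i - int j) * (int i - int j)" by (auto simp: zero_less_mult_iff linorder_neq_iff)
  then have "1 div (1 + (int i - int j) * (int i - int j)) = 0"
    by (intro div_pos_pos_trivial) auto
  then show ?thesis using assms False by (simp add: delta_def)
qed (use assms in \<open>simp add: delta_def\<close>)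

lemma ok_delta: "l < 32 \<Longrightarrow> p < 32 \<Longrightarrow> ok w (delta l p) \<tau>"
  by (simp add: delta_def)

text \<open>Computes \<open>v = N a\<close> for row \<open>i\<close> of the matrix with scaled
  columns; the scaled matrix itself is never stored.\<close>

definition Image_Row :: com where
  "Image_Row = For v_l (Var v_nc)
     (Sum v_acc v_p (Var v_nc) (Times (Arr v_proj (Var v_l) (Var v_p))
        (Times (Arr v_mat (Var v_i) (Var v_p)) (Arr v_scale (Var v_p) (Num 0)))) ;;
      Asg v_image (Var v_l) (Num 0) (Var v_acc))"

text \<open>Safe in place: entry \<open>(l, p)\<close> of the new matrix depends on the old one only
  through the same entry, while the image and the old determinant are held elsewhere.\<close>

definition Rank_One :: com where
  "Rank_One = Fill v_proj v_l v_p (Var v_nc) (Var v_nc) (Num 0) (Num 0)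
     (Quot (Minus (Times (Arr v_proj (Var v_l) (Var v_p)) (Var v_alpha))
        (Times (Arr v_image (Var v_l) (Num 0)) (Arr v_image (Var v_p) (Num 0)))) (Var v_det))"

definition Proj :: com where
  "Proj = Fill v_proj v_l v_p (Var v_nc) (Var v_nc) (Num 0) (Num 0) (delta v_l v_p) ;;
    Set_Var v_det (Num 1) ;;
    For v_i (Var v_nr)
     (Image_Row ;;
      Sum v_alpha v_l (Var v_nc) (Times (Times (Arr v_mat (Var v_i) (Var v_l)) (Arr v_scale (Var v_l) (Num 0)))
        (Arr v_image (Var v_l) (Num 0))) ;;
      CIf (Var v_alpha) (Rank_One ;; Set_Var v_det (Var v_alpha)) CSkip)"

lemma mods_Image_Row [simp]: "mods Image_Row = {v_acc, v_l, v_p, v_image}"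
  by (auto simp: Image_Row_def)

lemma mods_Rank_One [simp]: "mods Rank_One = {v_proj, v_l, v_p}"
  by (auto simp: Rank_One_def)

lemma mods_Proj [simp]: "mods Proj = {v_proj, v_l, v_p, v_det, v_i, v_image, v_acc, v_alpha}"
  by (auto simp: Proj_def)

lemma gram_proj_cong:
  assumes "gram_proj r n a d N" "\<And>l p. l < n \<Longrightarrow> p < n \<Longrightarrow> N' l p = N l p"
  shows "gram_proj r n a d N'"
proof -
  have "(\<Sum>p<n. N' l p * a i p) = (\<Sum>p<n. N l p * a i p)" if "l < n" for l i
    using assms(2) that by (intro sum.cong) auto
  then show ?thesis using assms unfolding gram_proj_def by (simp cong: conj_cong)
qed

lemma wp_Image_Row:
  assumes nc: "\<sigma> v_nc 0 0 = int n" "n \<le> R" "int n \<le> B" and i: "\<sigma> v_i 0 0 = int i"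
    and bound: "\<And>l. l < n \<Longrightarrow> (\<Sum>p<n. \<bar>\<sigma> v_proj l p * (\<sigma> v_mat i p * \<sigma> v_scale p 0)\<bar>) \<le> B"
    and post: "\<And>\<tau>. (\<And>l. l < n \<Longrightarrow> \<tau> v_image l 0 = (\<Sum>p<n. \<sigma> v_proj l p * (\<sigma> v_mat i p * \<sigma> v_scale p 0))) \<Longrightarrow>
      (\<And>z. z \<notin> {v_acc, v_l, v_p, v_image} \<Longrightarrow> \<tau> z = \<sigma> z) \<Longrightarrow> Q \<tau>"
  shows "wp w R B Image_Row Q \<sigma>"
  unfolding Image_Row_def
proof (rule wp_For[where n = n and I = "\<lambda>l \<tau>. \<forall>l'<l. \<tau> v_image l' 0 =
      (\<Sum>p<n. \<sigma> v_proj l' p * (\<sigma> v_mat i p * \<sigma> v_scale p 0))"])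
  fix l \<tau> assume l: "l < n" and I: "\<forall>l'<l. \<tau> v_image l' 0 = (\<Sum>p<n. \<sigma> v_proj l' p * (\<sigma> v_mat i p * \<sigma> v_scale p 0))"
    and lv: "\<tau> v_l 0 0 = int l"
    and fr: "\<And>y. y \<notin> insert v_l (mods (Sum v_acc v_p (Var v_nc) (Times (Arr v_proj (Var v_l) (Var v_p))
        (Times (Arr v_mat (Var v_i) (Var v_p)) (Arr v_scale (Var v_p) (Num 0)))) ;;
      Asg v_image (Var v_l) (Num 0) (Var v_acc))) \<Longrightarrow> \<tau> y = \<sigma> y"
  have fr': "\<tau> z = \<sigma> z" if "z \<notin> {v_acc, v_l, v_p, v_image}" for z using fr[of z] that by auto
  show "wp w R B (Sum v_acc v_p (Var v_nc) (Times (Arr v_proj (Var v_l) (Var v_p))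
        (Times (Arr v_mat (Var v_i) (Var v_p)) (Arr v_scale (Var v_p) (Num 0)))) ;;
      Asg v_image (Var v_l) (Num 0) (Var v_acc))
     (\<lambda>\<tau>'. \<forall>l'<Suc l. upd \<tau>' v_l 0 0 (int (Suc l)) v_image l' 0 = (\<Sum>p<n. \<sigma> v_proj l' p * (\<sigma> v_mat i p * \<sigma> v_scale p 0))) \<tau>"
  proof (rule wp_Seq, rule wp_Sum[where n = n and F = "\<lambda>p. \<sigma> v_proj l p * (\<sigma> v_mat i p * \<sigma> v_scale p 0)"])
    fix j \<rho> assume "j < n" "\<rho> v_p 0 0 = int j" "\<And>z. z \<notin> {v_p, v_acc} \<Longrightarrow> \<rho> z = \<tau> z"
    then show "ok w (Times (Arr v_proj (Var v_l) (Var v_p)) (Times (Arr v_mat (Var v_i) (Var v_p)) (Arr v_scale (Var v_p) (Num 0)))) \<rho> \<and>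
       aval w (Times (Arr v_proj (Var v_l) (Var v_p)) (Times (Arr v_mat (Var v_i) (Var v_p)) (Arr v_scale (Var v_p) (Num 0)))) \<rho> =
       \<sigma> v_proj l j * (\<sigma> v_mat i j * \<sigma> v_scale j 0)"
      using fr' lv i by simp
  next
    fix \<rho> assume acc: "\<rho> v_acc 0 0 = (\<Sum>j<n. \<sigma> v_proj l j * (\<sigma> v_mat i j * \<sigma> v_scale j 0))"
      and fr2: "\<And>z. z \<notin> {v_p, v_acc} \<Longrightarrow> \<rho> z = \<tau> z"
    have "\<bar>\<rho> v_acc 0 0\<bar> \<le> B" unfolding acc by (rule order.trans[OF sum_abs bound[OF l]])
    then show "wp w R B (Asg v_image (Var v_l) (Num 0) (Var v_acc))
     (\<lambda>\<tau>'. \<forall>l'<Suc l. upd \<tau>' v_l 0 0 (int (Suc l)) v_image l' 0 = (\<Sum>p<n. \<sigma> v_proj l' p * (\<sigma> v_mat i p * \<sigma> v_scale p 0))) \<rho>"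
      using acc fr2 lv I by (auto simp: less_Suc_eq)
  qed (use fr' nc bound[OF l] in auto)
next
  fix \<tau> assume "\<forall>l'<n. \<tau> v_image l' 0 = (\<Sum>p<n. \<sigma> v_proj l' p * (\<sigma> v_mat i p * \<sigma> v_scale p 0))"
    and fr: "\<And>y. y \<notin> insert v_l (mods (Sum v_acc v_p (Var v_nc) (Times (Arr v_proj (Var v_l) (Var v_p))
        (Times (Arr v_mat (Var v_i) (Var v_p)) (Arr v_scale (Var v_p) (Num 0)))) ;;
      Asg v_image (Var v_l) (Num 0) (Var v_acc))) \<Longrightarrow> \<tau> y = \<sigma> y"
  then show "Q \<tau>" by (intro post) auto
qed (use nc in auto)

text \<open>Squared norms of scaled rows are at most \<open>n A^2\<close>, so all determinants, and
  with them the entries of \<open>N\<close>, are at most \<open>D\<close>. This bounds the image by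
  \<open>n D A\<close> and the summands of the quadratic form by \<open>A\<close> times that. The
  numerator of the exact division is never stored, so \<open>B\<close> need not cover it.\<close>

lemma wp_Proj:
  assumes nc: "\<sigma> v_nc 0 0 = int n" "n \<le> R" and nr: "\<sigma> v_nr 0 0 = int r" "r \<le> R"
    and A: "\<And>i l. i < r \<Longrightarrow> l < n \<Longrightarrow> \<bar>\<sigma> v_mat i l * \<sigma> v_scale l 0\<bar> \<le> A" "1 \<le> A"
    and D: "D = (int n * A\<^sup>2 + 1) ^ r"
    and B: "int n \<le> B" "int r \<le> B" "D \<le> B" "int n * (A * (int n * (D * A))) \<le> B"
    and post: "\<And>\<tau>. ortho_proj r n (\<lambda>i l. \<sigma> v_mat i l * \<sigma> v_scale l 0) (\<tau> v_det 0 0) (\<tau> v_proj) \<Longrightarrow>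
      \<tau> v_det 0 0 \<le> D \<Longrightarrow>
      (\<And>z. z \<notin> {v_proj, v_l, v_p, v_det, v_i, v_image, v_acc, v_alpha} \<Longrightarrow> \<tau> z = \<sigma> z) \<Longrightarrow> Q \<tau>"
  shows "wp w R B Proj Q \<sigma>"
proof -
  define a where "a i l = \<sigma> v_mat i l * \<sigma> v_scale l 0" for i l
  define K where "K = int n * A\<^sup>2 + 1"
  have K: "1 \<le> K" using A(2) by (simp add: K_def)
  have D1: "1 \<le> D" unfolding D K_def[symmetric] using K by (rule one_le_power)
  have B1: "1 \<le> B" using D1 B(3) by simp
  have KD: "K ^ i \<le> D" if "i \<le> r" for i
    unfolding D K_def[symmetric] using K that by (intro power_increasing) auto
  let ?Z = "{v_proj, v_l, v_p, v_det, v_i, v_image, v_acc, v_alpha}"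
  let ?alpha = "Times (Times (Arr v_mat (Var v_i) (Var v_l)) (Arr v_scale (Var v_l) (Num 0))) (Arr v_image (Var v_l) (Num 0))"
  let ?upd = "CIf (Var v_alpha) (Rank_One ;; Set_Var v_det (Var v_alpha)) CSkip"
  let ?body = "Image_Row ;; Sum v_alpha v_l (Var v_nc) ?alpha ;; ?upd"
  define J where "J i \<tau> \<longleftrightarrow> gram_proj i n a (\<tau> v_det 0 0) (\<tau> v_proj) \<and> \<tau> v_det 0 0 \<le> K ^ i" for i and \<tau> :: store
  have Jupd: "J i (upd \<tau> v_i 0 0 u) \<longleftrightarrow> J i \<tau>" for i \<tau> u by (simp add: J_def)
  have loop: "wp w R B (For v_i (Var v_nr) ?body) Q \<sigma>'"
    if J0: "J 0 \<sigma>'" and fr0: "\<And>z. z \<notin> ?Z \<Longrightarrow> \<sigma>' z = \<sigma> z" for \<sigma>'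
  proof (rule wp_For[where n = r and I = J])
    show "J 0 (upd \<sigma>' v_i 0 0 0)" using J0 Jupd by simp
    fix i \<tau> assume i: "i < r" and Ji: "J i \<tau>" and iv: "\<tau> v_i 0 0 = int i"
      and fr1: "\<And>y. y \<notin> insert v_i (mods ?body) \<Longrightarrow> \<tau> y = \<sigma>' y"
    have fr: "\<tau> z = \<sigma> z" if "z \<notin> ?Z" for z using fr1[of z] fr0[OF that] that by auto
    define N d where "N = \<tau> v_proj" and "d = \<tau> v_det 0 0"
    have P: "gram_proj i n a d N" and dK: "d \<le> K ^ i" using Ji by (auto simp: J_def N_def d_def)
    note O = gram_proj_imp_ortho_proj[OF P]
    have d1: "1 \<le> d" using P by (simp add: gram_proj_def)
    have dD: "d \<le> D" using dK KD[of i] i by linarith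
    have aA: "\<bar>a i l\<bar> \<le> A" if "l < n" for l using A(1)[OF i that] by (simp add: a_def)
    define v where "v l = (\<Sum>p<n. N l p * a i p)" for l
    define \<alpha> where "\<alpha> = (\<Sum>l<n. a i l * v l)"
    note step = gram_proj_step[OF P, folded v_def, folded \<alpha>_def]
    have entry: "\<bar>N l p * a i p\<bar> \<le> D * A" if "l < n" "p < n" for l p
      unfolding abs_mult using ortho_proj_entry_bound(2)[OF O that] dD aA[OF that(2)] D1
      by (intro mult_mono) auto
    have sumN: "(\<Sum>p<n. \<bar>N l p * a i p\<bar>) \<le> int n * (D * A)" if "l < n" for l
      using sum_bounded_above[of "{..<n}" "\<lambda>p. \<bar>N l p * a i p\<bar>" "D * A"] entry[OF that] by simp
    have nDA: "0 \<le> int n * (D * A)" using D1 A(2) by simp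
    have nDAB: "int n * (D * A) \<le> B"
    proof (cases "n = 0")
      case False
      then have "1 * (1 * (int n * (D * A))) \<le> int n * (A * (int n * (D * A)))"
        using A(2) nDA D1 by (intro mult_mono) auto
      then show ?thesis using B(4) by simp
    qed (use B1 in simp)
    have vb: "\<bar>v l\<bar> \<le> int n * (D * A)" if "l < n" for l
      unfolding v_def using sum_abs[of "\<lambda>p. N l p * a i p" "{..<n}"] sumN[OF that] by linarith
    have suma: "(\<Sum>l<n. \<bar>a i l * v l\<bar>) \<le> B"
    proof -
      have "\<bar>a i l * v l\<bar> \<le> A * (int n * (D * A))" if "l < n" for l
        unfolding abs_mult using aA[OF that] vb[OF that] A(2) by (intro mult_mono) auto
      then have "(\<Sum>l<n. \<bar>a i l * v l\<bar>) \<le> int n * (A * (int n * (D * A)))"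
        using sum_bounded_above[of "{..<n}" "\<lambda>l. \<bar>a i l * v l\<bar>" "A * (int n * (D * A))"] by simp
      then show ?thesis using B(4) by linarith
    qed
    have \<alpha>K: "\<alpha> \<le> K ^ Suc i"
    proof -
      have "(\<Sum>l<n. (a i l)\<^sup>2) \<le> int n * A\<^sup>2"
        using sum_bounded_above[of "{..<n}" "\<lambda>l. (a i l)\<^sup>2" "A\<^sup>2"] aA A(2)
        by (simp add: abs_le_square_iff[symmetric])
      then have "d * (\<Sum>l<n. (a i l)\<^sup>2) \<le> K ^ i * K"
        using dK d1 K by (intro mult_mono) (auto simp: K_def intro: sum_nonneg)
      then show ?thesis using step(2) by (simp add: mult.commute)
    qed
    have \<alpha>D: "\<alpha> \<le> D" using \<alpha>K KD[of "Suc i"] i by linarith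
    show "wp w R B ?body (\<lambda>\<tau>'. J (Suc i) (upd \<tau>' v_i 0 0 (int (Suc i)))) \<tau>"
      unfolding Jupd
    proof (rule wp_Seq, rule wp_Image_Row[where n = n and i = i])
      show "\<tau> v_nc 0 0 = int n" using fr nc by simp
      show "(\<Sum>p<n. \<bar>\<tau> v_proj l p * (\<tau> v_mat i p * \<tau> v_scale p 0)\<bar>) \<le> B" if "l < n" for l
        using sumN[OF that] nDAB fr by (simp add: N_def a_def)
      fix \<rho> assume "\<And>l. l < n \<Longrightarrow> \<rho> v_image l 0 = (\<Sum>p<n. \<tau> v_proj l p * (\<tau> v_mat i p * \<tau> v_scale p 0))"
        and fr2: "\<And>z. z \<notin> {v_acc, v_l, v_p, v_image} \<Longrightarrow> \<rho> z = \<tau> z"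
      then have im: "\<rho> v_image l 0 = v l" if "l < n" for l
        using that fr by (simp add: v_def N_def a_def)
      show "wp w R B (Sum v_alpha v_l (Var v_nc) ?alpha ;; ?upd) (J (Suc i)) \<rho>"
      proof (rule wp_Seq, rule wp_Sum[where n = n and F = "\<lambda>l. a i l * v l"])
        fix j \<rho>' assume "j < n" "\<rho>' v_l 0 0 = int j" "\<And>z. z \<notin> {v_l, v_alpha} \<Longrightarrow> \<rho>' z = \<rho> z"
        then show "ok w ?alpha \<rho>' \<and> aval w ?alpha \<rho>' = a i j * v j"
          using fr2 fr iv im by (simp add: a_def)
      next
        fix \<rho>' assume "\<rho>' v_alpha 0 0 = (\<Sum>l<n. a i l * v l)"
          and fr3: "\<And>z. z \<notin> {v_l, v_alpha} \<Longrightarrow> \<rho>' z = \<rho> z"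
        then have al: "\<rho>' v_alpha 0 0 = \<alpha>" by (simp add: \<alpha>_def)
        have det: "\<rho>' v_det 0 0 = d" and proj: "\<rho>' v_proj = N" using fr3 fr2 by (simp_all add: d_def N_def)
        have im': "\<rho>' v_image l 0 = v l" if "l < n" for l using im[OF that] fr3 by simp
        have nc': "\<rho>' v_nc 0 0 = int n" using fr3 fr2 fr nc by simp
        show "wp w R B ?upd (J (Suc i)) \<rho>'"
        proof (cases "0 < \<alpha>")
          case True
          define N' where "N' l p = (N l p * \<alpha> - v l * v p) div d" for l p
          have P': "gram_proj (Suc i) n a \<alpha> N'" using step(3)[OF True] by (simp add: N'_def[abs_def])
          have "wp w R B Rank_One (\<lambda>\<tau>'. J (Suc i) (upd \<tau>' v_det 0 0 \<alpha>) \<and> \<tau>' v_alpha 0 0 = \<alpha>) \<rho>'"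
            unfolding Rank_One_def
          proof (rule wp_Fill[where a = n and b = n and rb = 0 and cb = 0 and F = N'])
            show "\<bar>N' l p\<bar> \<le> B" if "l < n" "p < n" for l p
              using ortho_proj_entry_bound(2)[OF gram_proj_imp_ortho_proj[OF P'] that] \<alpha>D B(3) by linarith
            fix \<tau>' assume N': "\<And>l p. l < n \<Longrightarrow> p < n \<Longrightarrow> \<tau>' v_proj (0 + l) (0 + p) = N' l p"
              and fr4: "\<And>z. z \<notin> {v_proj, v_l, v_p} \<Longrightarrow> \<tau>' z = \<rho>' z"
            have "gram_proj (Suc i) n a \<alpha> (\<tau>' v_proj)"
              by (rule gram_proj_cong[OF P']) (use N' in simp)
            then show "J (Suc i) (upd \<tau>' v_det 0 0 \<alpha>) \<and> \<tau>' v_alpha 0 0 = \<alpha>"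
              using \<alpha>K fr4 al by (simp add: J_def)
          qed (use nc' nc B al det proj im' in \<open>auto simp: N'_def\<close>)
          then show ?thesis
            using al True \<alpha>D B(3) by (auto elim!: wp_mono)
        next
          case False
          then have "\<alpha> = 0" using step(1) by simp
          then have "J (Suc i) \<rho>'"
            using step(4) det proj dK K mult_mono[of d "K ^ i" 1 K] d1
            by (auto simp: J_def mult.commute)
          then show ?thesis using al False by simp
        qed
      qed (use fr2 fr nc B suma in auto)
    qed (use fr nc B iv in auto)
  next
    fix \<tau> assume J: "J r \<tau>" and fr1: "\<And>y. y \<notin> insert v_i (mods ?body) \<Longrightarrow> \<tau> y = \<sigma>' y"
    have fr: "\<tau> z = \<sigma> z" if "z \<notin> ?Z" for z using fr1[of z] fr0[OF that] that by auto
    show "Q \<tau>"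
      using J gram_proj_imp_ortho_proj[of r n a] fr
      by (intro post) (auto simp: J_def a_def[abs_def] D K_def)
  qed (use fr0 nr B in auto)
  show ?thesis
    unfolding Proj_def
  proof (rule wp_Seq, rule wp_Fill[where a = n and b = n and rb = 0 and cb = 0 and F = "\<lambda>l p. if l = p then 1 else 0"])
    show "ok w (delta v_l v_p) \<tau> \<and> aval w (delta v_l v_p) \<tau> = (if i = j then 1 else 0)"
      if "\<tau> v_l 0 0 = int i" "\<tau> v_p 0 0 = int j" for i j \<tau>
      using aval_delta[of \<tau> v_l i v_p j w] that by (simp add: ok_delta)
    fix \<tau> assume N: "\<And>i j. i < n \<Longrightarrow> j < n \<Longrightarrow> \<tau> v_proj (0 + i) (0 + j) = (if i = j then 1 else 0)"
      and fr: "\<And>z. z \<notin> {v_proj, v_l, v_p} \<Longrightarrow> \<tau> z = \<sigma> z"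
    have "gram_proj 0 n a 1 (\<tau> v_proj)"
      by (rule gram_proj_cong[OF gram_proj_init]) (use N in simp)
    then have "J 0 (upd \<tau> v_det 0 0 1)" by (simp add: J_def)
    then have "wp w R B (For v_i (Var v_nr) ?body) Q (upd \<tau> v_det 0 0 1)"
      by (rule loop) (use fr in auto)
    then show "wp w R B (Set_Var v_det (Num 1) ;; For v_i (Var v_nr) ?body) Q \<tau>"
      using B1 by simp
  qed (use nc B B1 in auto)
qed

section \<open>The linear feasibility solver\<close>

definition Row_Norm :: com where
  "Row_Norm = Sum v_acc v_l (Var v_nc) (Times (Arr v_mat (Var v_i) (Var v_l)) (Arr v_mat (Var v_i) (Var v_l))) ;;
    Set_Var v_prod (Times (Var v_prod) (Plus (Var v_acc) (Num 1)))"

text \<open>Once the product of the row norms is formed, halving it down to zero while doubling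
  \<open>v_s0\<close> produces a power of two above it, the common initial scale.\<close>

definition Bound :: com where
  "Bound = Set_Var v_prod (Num 1) ;; For v_i (Var v_nr) Row_Norm ;; Set_Var v_s0 (Num 1) ;;
    CWhile (Var v_prod) (Set_Var v_prod (Quot (Var v_prod) (Num 2)) ;;
      Set_Var v_s0 (Times (Num 2) (Var v_s0)))"

lemma mods_Bound [simp]: "mods Row_Norm = {v_acc, v_l, v_prod}" "mods Bound = {v_prod, v_i, v_acc, v_l, v_s0}"
  by (auto simp: Bound_def Row_Norm_def)

lemma wp_Bound:
  assumes nc: "\<sigma> v_nc 0 0 = int n" "n \<le> R" and nr: "\<sigma> v_nr 0 0 = int r" "r \<le> R"
    and A: "\<And>i l. i < r \<Longrightarrow> l < n \<Longrightarrow> \<bar>\<sigma> v_mat i l\<bar> \<le> A"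
    and K: "K = (int n * A\<^sup>2 + 1) ^ r" "K < 2 ^ b1" "b1 \<le> R"
    and B: "int n \<le> B" "int r \<le> B" "2 * K \<le> B" "int n * A\<^sup>2 \<le> B"
    and post: "\<And>\<tau> b. \<tau> v_s0 0 0 = 2 ^ b \<Longrightarrow> minor_bound r n (\<sigma> v_mat) \<le> 2 ^ b \<Longrightarrow> b \<le> b1 \<Longrightarrow> 2 ^ b \<le> 2 * K \<Longrightarrow>
      (\<And>z. z \<notin> {v_prod, v_i, v_acc, v_l, v_s0} \<Longrightarrow> \<tau> z = \<sigma> z) \<Longrightarrow> Q \<tau>"
  shows "wp w R B Bound Q \<sigma>"
proof -
  define M where "M = \<sigma> v_mat"
  define P where "P i = (\<Prod>i<i. (\<Sum>l<n. (M i l)\<^sup>2) + 1)" for i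
  have sq: "(M i l)\<^sup>2 \<le> A\<^sup>2" if "i < r" "l < n" for i l
    using A[OF that] unfolding M_def by (metis abs_ge_zero power2_abs power_mono)
  have row: "(\<Sum>l<n. (M i l)\<^sup>2) \<le> int n * A\<^sup>2" if "i < r" for i
    using sum_bounded_above[of "{..<n}" "\<lambda>l. (M i l)\<^sup>2" "A\<^sup>2"] sq[OF that] by simp
  have base: "1 \<le> int n * A\<^sup>2 + 1" by simp
  have PK: "P i \<le> K" if "i \<le> r" for i
  proof -
    have "P i \<le> (\<Prod>i<i. int n * A\<^sup>2 + 1)"
      unfolding P_def using row that by (intro prod_mono) (auto intro!: add_nonneg_nonneg sum_nonneg)
    also have "\<dots> = (int n * A\<^sup>2 + 1) ^ i" by simp
    also have "\<dots> \<le> K" unfolding K using base that by (intro power_increasing)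
    finally show ?thesis .
  qed
  have P1: "1 \<le> P i" for i
    using minor_bound_pos[of i n M] by (simp add: P_def minor_bound_def)
  have B1: "1 \<le> B" "K \<le> B" using B(3) P1[of r] PK[of r] by simp_all
  have halve: "wp w R B (CWhile (Var v_prod) (Set_Var v_prod (Quot (Var v_prod) (Num 2)) ;;
      Set_Var v_s0 (Times (Num 2) (Var v_s0)))) Q \<tau>"
    if prod: "\<tau> v_prod 0 0 = P r" and s0: "\<tau> v_s0 0 0 = 1"
      and fr: "\<And>z. z \<notin> {v_prod, v_i, v_acc, v_l, v_s0} \<Longrightarrow> \<tau> z = \<sigma> z" for \<tau>
  proof -
    \<comment> \<open>The condition \<open>2 ^ j \<le> 2 * P r\<close> records that before the last
      doubling the power did not exceed the product; it bounds the final scale.\<close>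
    define Inv where "Inv j \<rho> \<longleftrightarrow> \<rho> v_s0 0 0 = 2 ^ j \<and> \<rho> v_prod 0 0 = P r div 2 ^ j \<and> 2 ^ j \<le> 2 * P r \<and>
      (\<forall>z. z \<notin> {v_prod, v_i, v_acc, v_l, v_s0} \<longrightarrow> \<rho> z = \<sigma> z)" for j and \<rho> :: store
    have "Inv 0 \<tau>" using prod s0 fr P1[of r] by (auto simp: Inv_def)
    moreover have "ok w (Var v_prod) \<rho> \<and> (if 0 < aval w (Var v_prod) \<rho> then j < R \<and>
        wp w R B (Set_Var v_prod (Quot (Var v_prod) (Num 2)) ;; Set_Var v_s0 (Times (Num 2) (Var v_s0))) (Inv (Suc j)) \<rho>
        else Q \<rho>)" if I: "Inv j \<rho>" for j \<rho>
    proof (cases "0 < \<rho> v_prod 0 0")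
      case True
      have "2 ^ j \<le> P r"
      proof (rule ccontr)
        assume "\<not> 2 ^ j \<le> P r"
        then have "P r div 2 ^ j = 0" using P1[of r] by (intro div_pos_pos_trivial) auto
        then show False using True I by (simp add: Inv_def)
      qed
      then have "(2::int) ^ j < 2 ^ b1" using PK[of r] K(2) by linarith
      then have "j < b1" by simp
      moreover have "\<bar>P r div 2 ^ j div 2\<bar> \<le> B"
      proof -
        have "\<bar>P r div 2 ^ j div 2\<bar> \<le> \<bar>P r\<bar>" using abs_div_le order.trans by blast
        then show ?thesis using P1[of r] PK[of r] B1 by simp
      qed
      moreover have "P r div 2 ^ j div 2 = P r div 2 ^ Suc j"
        by (subst power_Suc2) (simp add: zdiv_zmult2_eq)
      moreover have "2 * 2 ^ j \<le> B" using \<open>2 ^ j \<le> P r\<close> PK[of r] B(3) by simp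
      ultimately show ?thesis
        using I True K(3) \<open>2 ^ j \<le> P r\<close> by (auto simp: Inv_def)
    next
      case False
      have "P r < 2 ^ j"
      proof (rule ccontr)
        assume "\<not> P r < 2 ^ j"
        then have "0 < P r div 2 ^ j" by (simp add: pos_imp_zdiv_pos_iff)
        then show False using False I by (simp add: Inv_def)
      qed
      have "(2::int) ^ j \<le> 2 ^ b1"
      proof -
        have "j \<noteq> 0" using \<open>P r < 2 ^ j\<close> P1[of r] by (cases j) auto
        then obtain j' where j': "j = Suc j'" by (cases j) auto
        have "(2::int) * 2 ^ j' \<le> 2 * P r" using I by (simp add: Inv_def j')
        then have "(2::int) ^ j' < 2 ^ b1" using PK[of r] K(2) by linarith
        then have "Suc j' \<le> b1" by simp
        then show ?thesis unfolding j' by (intro power_increasing) auto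
      qed
      then have "j \<le> b1" by simp
      moreover have "minor_bound r n (\<sigma> v_mat) \<le> 2 ^ j"
        using \<open>P r < 2 ^ j\<close> by (simp add: minor_bound_def P_def M_def)
      moreover have "(2::int) ^ j \<le> 2 * K" using I PK[of r] by (simp add: Inv_def)
      ultimately have "Q \<rho>" using I by (intro post) (auto simp: Inv_def)
      then show ?thesis using False by simp
    qed
    ultimately show ?thesis by (subst wp.simps(5)) blast
  qed
  show ?thesis
    unfolding Bound_def
  proof (rule wp_Seq, rule wp_Set_Var)
    show "wp w R B (For v_i (Var v_nr) Row_Norm ;; Set_Var v_s0 (Num 1) ;;
        CWhile (Var v_prod) (Set_Var v_prod (Quot (Var v_prod) (Num 2)) ;; Set_Var v_s0 (Times (Num 2) (Var v_s0)))) Q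
        (upd \<sigma> v_prod 0 0 (aval w (Num 1) \<sigma>))"
    proof (rule wp_Seq, rule wp_For[where n = r and I = "\<lambda>i \<tau>. \<tau> v_prod 0 0 = P i"])
      fix i \<tau> assume i: "i < r" and I: "\<tau> v_prod 0 0 = P i" and iv: "\<tau> v_i 0 0 = int i"
        and fr: "\<And>y. y \<notin> insert v_i (mods Row_Norm) \<Longrightarrow> \<tau> y = upd \<sigma> v_prod 0 0 (aval w (Num 1) \<sigma>) y"
      have fr': "\<tau> z = \<sigma> z" if "z \<notin> {v_prod, v_i, v_acc, v_l, v_s0}" for z using fr[of z] that by auto
      show "wp w R B Row_Norm (\<lambda>\<tau>'. upd \<tau>' v_i 0 0 (int (Suc i)) v_prod 0 0 = P (Suc i)) \<tau>"
        unfolding Row_Norm_def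
      proof (rule wp_Seq, rule wp_Sum[where n = n and F = "\<lambda>l. (M i l)\<^sup>2"])
        fix \<rho> assume acc: "\<rho> v_acc 0 0 = (\<Sum>l<n. (M i l)\<^sup>2)" and fr2: "\<And>z. z \<notin> {v_l, v_acc} \<Longrightarrow> \<rho> z = \<tau> z"
        have "P i * ((\<Sum>l<n. (M i l)\<^sup>2) + 1) = P (Suc i)" by (simp add: P_def)
        moreover have "\<bar>P (Suc i)\<bar> \<le> B" using P1[of "Suc i"] PK[of "Suc i"] i B1 by simp
        ultimately show "wp w R B (Set_Var v_prod (Times (Var v_prod) (Plus (Var v_acc) (Num 1))))
            (\<lambda>\<tau>'. upd \<tau>' v_i 0 0 (int (Suc i)) v_prod 0 0 = P (Suc i)) \<rho>"
          using acc fr2 I by simp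
      qed (use fr' nc B iv row[OF i] in \<open>auto simp: M_def power2_eq_square\<close>)
    next
      fix \<tau> assume "\<tau> v_prod 0 0 = P r"
        and fr: "\<And>y. y \<notin> insert v_i (mods Row_Norm) \<Longrightarrow> \<tau> y = upd \<sigma> v_prod 0 0 (aval w (Num 1) \<sigma>) y"
      then have "wp w R B (CWhile (Var v_prod) (Set_Var v_prod (Quot (Var v_prod) (Num 2)) ;;
          Set_Var v_s0 (Times (Num 2) (Var v_s0)))) Q (upd \<tau> v_s0 0 0 1)"
        by (intro halve) auto
      then show "wp w R B (Set_Var v_s0 (Num 1) ;; CWhile (Var v_prod) (Set_Var v_prod (Quot (Var v_prod) (Num 2)) ;;
          Set_Var v_s0 (Times (Num 2) (Var v_s0)))) Q \<tau>"
        using B1 by (intro wp_Seq wp_Set_Var) auto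
    qed (use nr B in \<open>auto simp: P_def\<close>)
  qed (use B1 in auto)
qed

text \<open>One von Neumann step at coordinate \<open>i\<close>: the else branch of the inner test
  is the case \<open>(N y)_i \<le> 0\<close>, and coordinates of scale \<open>0\<close> are left
  alone.\<close>

definition Relax :: com where
  "Relax = Sum v_acc v_p (Var v_nc) (Times (Arr v_proj (Var v_i) (Var v_p)) (Arr v_y (Var v_p) (Num 0))) ;;
     CIf (Arr v_scale (Var v_i) (Num 0))
       (CIf (Var v_acc) CSkip (Asg v_y (Var v_i) (Num 0) (Plus (Arr v_y (Var v_i) (Num 0)) (Num 1)))) CSkip"

text \<open>Guards test for positivity, hence the added \<open>1\<close>: the condition is that
  \<open>y l\<close> times the number of columns reaches the value of \<open>v_sweeps\<close>, which
  thus serves both as number of sweeps and as threshold.\<close>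

definition Halve :: com where
  "Halve = CIf (Minus (Plus (Times (Arr v_y (Var v_l) (Num 0)) (Var v_nc)) (Num 1)) (Var v_sweeps))
      (Asg v_scale (Var v_l) (Num 0) (Quot (Arr v_scale (Var v_l) (Num 0)) (Num 2)) ;; Set_Var v_changed (Num 1)) CSkip"

definition Iterate :: com where
  "Iterate = Set_Var v_changed (Num 0) ;; Proj ;;
     Fill v_y v_l v_p (Var v_nc) (Num 1) (Num 0) (Num 0) (Num 0) ;;
     For v_j (Var v_sweeps) (For v_i (Var v_nc) Relax) ;;
     For v_l (Var v_nc) Halve"

definition Solve :: com where
  "Solve = Set_Var v_changed (Num 1) ;; CWhile (Var v_changed) Iterate"

lemma mods_Relax [simp]: "mods Relax = {v_acc, v_p, v_y}"
  by (auto simp: Relax_def)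

lemma mods_Halve [simp]: "mods Halve = {v_scale, v_changed}"
  by (auto simp: Halve_def)

lemma mods_Iterate [simp]: "mods Iterate = {v_changed, v_proj, v_l, v_p, v_det, v_i, v_image, v_acc, v_alpha, v_y, v_j, v_scale}"
  by (auto simp: Iterate_def)

lemma mods_Solve [simp]: "mods Solve = {v_changed, v_proj, v_l, v_p, v_det, v_i, v_image, v_acc, v_alpha, v_y, v_j, v_scale}"
  by (auto simp: Solve_def)

lemma energy_cong: "(\<And>l. l < n \<Longrightarrow> y l = y' l) \<Longrightarrow> energy n N y = energy n N y'"
  unfolding energy_def by (intro sum.cong) auto

text \<open>State of the von Neumann iteration: the squared norm of the projection of \<open>y\<close> is at most
  the number of steps made, and only live coordinates are incremented.\<close>

definition admissible :: "nat \<Rightarrow> (nat \<Rightarrow> nat \<Rightarrow> int) \<Rightarrow> int \<Rightarrow> (nat \<Rightarrow> int) \<Rightarrow> (nat \<Rightarrow> int) \<Rightarrow> bool" where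
  "admissible n N d s y \<longleftrightarrow> (\<forall>l<n. 0 \<le> y l \<and> (0 < y l \<longrightarrow> 0 < s l)) \<and> energy n N y \<le> d * (\<Sum>l<n. y l)"

definition stable :: "nat \<Rightarrow> (nat \<Rightarrow> nat \<Rightarrow> int) \<Rightarrow> (nat \<Rightarrow> int) \<Rightarrow> (nat \<Rightarrow> int) \<Rightarrow> bool" where
  "stable n N s y \<longleftrightarrow> (\<forall>k<n. 0 < s k \<longrightarrow> 0 < (\<Sum>p<n. N k p * y p))"

lemma admissible_entry: "admissible n N d s y \<Longrightarrow> l < n \<Longrightarrow> 0 \<le> y l \<and> y l \<le> (\<Sum>l<n. y l)"
  unfolding admissible_def by (intro conjI member_le_sum) auto

lemma admissible_increment:
  assumes "ortho_proj r n a d N" "admissible n N d s y" "k < n" "0 < s k" "(\<Sum>p<n. N k p * y p) \<le> 0"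
  shows "admissible n N d s (y(k := y k + 1))"
  using energy_increment[OF assms(1,3) _ assms(5)] assms(2,3,4) unfolding admissible_def by auto

lemma sum_increment:
  fixes y :: "nat \<Rightarrow> int"
  assumes "k < n" shows "(\<Sum>l<n. (y(k := y k + 1)) l) = (\<Sum>l<n. y l) + 1"
proof -
  have "(\<Sum>l<n. (y(k := y k + 1)) l) = (\<Sum>l<n. y l + (if l = k then 1 else 0))"
    by (intro sum.cong) auto
  then show ?thesis using assms by (simp add: sum.distrib)
qed

text \<open>If no step is made, the same \<open>y\<close> has been tested at every live coordinate
  and is stable; otherwise the sum grows. The clause that the initial \<open>y\<close> was not
  stable lets stability persist through later sweeps.\<close>

lemma wp_Sweep:
  assumes nc: "\<sigma> v_nc 0 0 = int n" "n \<le> R"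
    and O: "ortho_proj r n a d (\<sigma> v_proj)"
    and adm: "admissible n (\<sigma> v_proj) d (\<lambda>l. \<sigma> v_scale l 0) (\<lambda>l. \<sigma> v_y l 0)"
    and Y: "(\<Sum>l<n. \<sigma> v_y l 0) + int n \<le> Y"
    and B: "int n \<le> B" "Y \<le> B" "int n * (d * Y) \<le> B"
    and post: "\<And>\<tau>. admissible n (\<sigma> v_proj) d (\<lambda>l. \<sigma> v_scale l 0) (\<lambda>l. \<tau> v_y l 0) \<Longrightarrow>
      (\<Sum>l<n. \<tau> v_y l 0) \<le> (\<Sum>l<n. \<sigma> v_y l 0) + int n \<Longrightarrow>
      (\<Sum>l<n. \<sigma> v_y l 0) + 1 \<le> (\<Sum>l<n. \<tau> v_y l 0) \<and> \<not> stable n (\<sigma> v_proj) (\<lambda>l. \<sigma> v_scale l 0) (\<lambda>l. \<sigma> v_y l 0) \<or>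
        stable n (\<sigma> v_proj) (\<lambda>l. \<sigma> v_scale l 0) (\<lambda>l. \<tau> v_y l 0) \<Longrightarrow>
      (\<And>z. z \<notin> {v_acc, v_p, v_y, v_i} \<Longrightarrow> \<tau> z = \<sigma> z) \<Longrightarrow> Q \<tau>"
  shows "wp w R B (For v_i (Var v_nc) Relax) Q \<sigma>"
proof -
  define N where "N = \<sigma> v_proj"
  define s where "s l = \<sigma> v_scale l 0" for l
  define y0 where "y0 l = \<sigma> v_y l 0" for l
  have d: "1 \<le> d" using O by (simp add: ortho_proj_def)
  define J where "J i \<tau> \<longleftrightarrow> admissible n N d s (\<lambda>l. \<tau> v_y l 0) \<and>
    (\<Sum>l<n. \<tau> v_y l 0) \<le> (\<Sum>l<n. y0 l) + int i \<and>
    ((\<Sum>l<n. y0 l) + 1 \<le> (\<Sum>l<n. \<tau> v_y l 0) \<and> \<not> stable n N s y0 \<or>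
     (\<forall>l<n. \<tau> v_y l 0 = y0 l) \<and> (\<forall>k<i. 0 < s k \<longrightarrow> 0 < (\<Sum>p<n. N k p * y0 p)))" for i and \<tau> :: store
  have Jupd: "J i (upd \<tau> v_i 0 0 u) \<longleftrightarrow> J i \<tau>" for i \<tau> u by (simp add: J_def)
  show ?thesis
  proof (rule wp_For[where n = n and I = J])
    show "J 0 (upd \<sigma> v_i 0 0 0)" unfolding Jupd using adm by (simp add: J_def N_def s_def[abs_def] y0_def)
    fix i \<tau> assume i: "i < n" and Ji: "J i \<tau>" and iv: "\<tau> v_i 0 0 = int i"
      and fr1: "\<And>z. z \<notin> insert v_i (mods Relax) \<Longrightarrow> \<tau> z = \<sigma> z"
    have fr: "\<tau> z = \<sigma> z" if "z \<notin> {v_acc, v_p, v_y, v_i}" for z using fr1[of z] that by auto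
    define y where "y l = \<tau> v_y l 0" for l
    have ady: "admissible n N d s y" and sy: "(\<Sum>l<n. y l) \<le> (\<Sum>l<n. y0 l) + int i"
      using Ji by (simp_all add: J_def y_def[abs_def])
    have yY: "0 \<le> y l" "y l \<le> Y - 1" if "l < n" for l
      using admissible_entry[OF ady that] sy Y i by (simp_all add: y0_def)
    have "\<bar>N i p * y p\<bar> \<le> d * Y" if "p < n" for p
      unfolding abs_mult using ortho_proj_entry_bound(2)[OF O i that] yY[OF that] d
      by (intro mult_mono) (auto simp: N_def)
    then have "(\<Sum>p<n. \<bar>N i p * y p\<bar>) \<le> int n * (d * Y)"
      using sum_bounded_above[of "{..<n}" "\<lambda>p. \<bar>N i p * y p\<bar>" "d * Y"] by simp
    then have sumB: "(\<Sum>p<n. \<bar>N i p * y p\<bar>) \<le> B" using B(3) by linarith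
    show "wp w R B Relax (\<lambda>\<tau>'. J (Suc i) (upd \<tau>' v_i 0 0 (int (Suc i)))) \<tau>"
      unfolding Jupd Relax_def
    proof (rule wp_Seq, rule wp_Sum[where n = n and F = "\<lambda>p. N i p * y p"])
      fix j \<rho> assume "j < n" "\<rho> v_p 0 0 = int j" "\<And>z. z \<notin> {v_p, v_acc} \<Longrightarrow> \<rho> z = \<tau> z"
      then show "ok w (Times (Arr v_proj (Var v_i) (Var v_p)) (Arr v_y (Var v_p) (Num 0))) \<rho> \<and>
        aval w (Times (Arr v_proj (Var v_i) (Var v_p)) (Arr v_y (Var v_p) (Num 0))) \<rho> = N i j * y j"
        using fr iv by (simp add: N_def y_def)
    next
      fix \<rho> assume acc: "\<rho> v_acc 0 0 = (\<Sum>p<n. N i p * y p)" and fr2: "\<And>z. z \<notin> {v_p, v_acc} \<Longrightarrow> \<rho> z = \<tau> z"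
      have \<rho>y: "\<rho> v_y = \<tau> v_y" using fr2 by simp
      have \<rho>i: "\<rho> v_i 0 0 = int i" using fr2 iv by simp
      have \<rho>s: "\<rho> v_scale i 0 = s i" using fr2 fr by (simp add: s_def)
      have old: "J (Suc i) \<rho>" if "0 < s i \<longrightarrow> 0 < (\<Sum>p<n. N i p * y p)"
      proof -
        have "(\<Sum>p<n. N i p * y p) = (\<Sum>p<n. N i p * y0 p)" if "\<forall>l<n. y l = y0 l"
          using that by (intro sum.cong) auto
        then show ?thesis
          using Ji that unfolding J_def \<rho>y by (auto simp: less_Suc_eq y_def[abs_def])
      qed
      have new: "J (Suc i) (upd \<rho> v_y i 0 (y i + 1))" if "0 < s i" "(\<Sum>p<n. N i p * y p) \<le> 0"
      proof -
        have eq: "(\<lambda>l. upd \<rho> v_y i 0 (y i + 1) v_y l 0) = y(i := y i + 1)"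
          by (auto simp: \<rho>y y_def)
        have "(\<Sum>l<n. y0 l) \<le> (\<Sum>l<n. y l) \<and> \<not> stable n N s y0"
        proof -
          have "\<not> stable n N s y0" if "\<forall>l<n. y l = y0 l"
          proof -
            have "(\<Sum>p<n. N i p * y0 p) = (\<Sum>p<n. N i p * y p)"
              using that by (intro sum.cong) auto
            then show ?thesis using \<open>0 < s i\<close> \<open>(\<Sum>p<n. N i p * y p) \<le> 0\<close> i by (auto simp: stable_def)
          qed
          moreover have "(\<Sum>l<n. y l) = (\<Sum>l<n. y0 l)" if "\<forall>l<n. y l = y0 l"
            using that by (intro sum.cong) auto
          ultimately show ?thesis using Ji by (auto simp: J_def y_def[abs_def])
        qed
        moreover have "admissible n N d s (y(i := y i + 1))"
          using admissible_increment[OF O _ i] ady that by (simp add: N_def)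
        ultimately show ?thesis
          unfolding J_def eq using sy sum_increment[OF i, of y] by simp
      qed
      have "\<bar>y i + 1\<bar> \<le> B" using yY[OF i] B(2) by simp
      moreover have "\<rho> v_y i 0 = y i" by (simp add: \<rho>y y_def)
      ultimately show "wp w R B (CIf (Arr v_scale (Var v_i) (Num 0))
       (CIf (Var v_acc) CSkip (Asg v_y (Var v_i) (Num 0) (Plus (Arr v_y (Var v_i) (Num 0)) (Num 1)))) CSkip) (J (Suc i)) \<rho>"
        using acc \<rho>i \<rho>s old new by (auto simp: not_less)
    qed (use fr nc B sumB in auto)
  next
    fix \<tau> assume J: "J n \<tau>" and fr1: "\<And>z. z \<notin> insert v_i (mods Relax) \<Longrightarrow> \<tau> z = \<sigma> z"
    have "stable n N s (\<lambda>l. \<tau> v_y l 0)"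
      if "\<forall>l<n. \<tau> v_y l 0 = y0 l" "\<forall>k<n. 0 < s k \<longrightarrow> 0 < (\<Sum>p<n. N k p * y0 p)"
      using that by (simp add: stable_def)
    then show "Q \<tau>"
      using J fr1 unfolding J_def N_def s_def[abs_def] y0_def[abs_def]
      by (intro post) auto
  qed (use nc B in auto)
qed

text \<open>A sweep makes at most \<open>n\<close> steps and, until stability, at least one. So
  \<open>T\<close> sweeps end with a stable \<open>y\<close> or with a sum of at least
  \<open>T\<close>, and in any case with a sum of at most \<open>n T\<close>.\<close>

lemma wp_Sweeps:
  assumes nc: "\<sigma> v_nc 0 0 = int n" "n \<le> R" and T: "\<sigma> v_sweeps 0 0 = int T" "T \<le> R" "int T \<le> B"
    and O: "ortho_proj r n a d (\<sigma> v_proj)"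
    and y0: "\<And>l. l < n \<Longrightarrow> \<sigma> v_y l 0 = 0"
    and B: "int n \<le> B" "int n * int T \<le> B" "int n * (d * (int n * int T)) \<le> B"
    and post: "\<And>\<tau>. admissible n (\<sigma> v_proj) d (\<lambda>l. \<sigma> v_scale l 0) (\<lambda>l. \<tau> v_y l 0) \<Longrightarrow>
      (\<Sum>l<n. \<tau> v_y l 0) \<le> int n * int T \<Longrightarrow>
      int T \<le> (\<Sum>l<n. \<tau> v_y l 0) \<or> stable n (\<sigma> v_proj) (\<lambda>l. \<sigma> v_scale l 0) (\<lambda>l. \<tau> v_y l 0) \<Longrightarrow>
      (\<And>z. z \<notin> {v_acc, v_p, v_y, v_i, v_j} \<Longrightarrow> \<tau> z = \<sigma> z) \<Longrightarrow> Q \<tau>"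
  shows "wp w R B (For v_j (Var v_sweeps) (For v_i (Var v_nc) Relax)) Q \<sigma>"
proof -
  define N where "N = \<sigma> v_proj"
  define s where "s l = \<sigma> v_scale l 0" for l
  define J where "J t \<tau> \<longleftrightarrow> admissible n N d s (\<lambda>l. \<tau> v_y l 0) \<and>
    (\<Sum>l<n. \<tau> v_y l 0) \<le> int n * int t \<and>
    (int t \<le> (\<Sum>l<n. \<tau> v_y l 0) \<or> stable n N s (\<lambda>l. \<tau> v_y l 0))" for t and \<tau> :: store
  have Jupd: "J t (upd \<tau> v_j 0 0 u) \<longleftrightarrow> J t \<tau>" for t \<tau> u by (simp add: J_def)
  show ?thesis
  proof (rule wp_For[where n = T and I = J])
    have "energy n N (\<lambda>l. \<sigma> v_y l 0) = 0" using y0 by (simp add: energy_def)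
    then have "admissible n N d s (\<lambda>l. \<sigma> v_y l 0)" using y0 by (simp add: admissible_def)
    then show "J 0 (upd \<sigma> v_j 0 0 0)" unfolding Jupd using y0 by (simp add: J_def)
    fix t \<tau> assume t: "t < T" and Jt: "J t \<tau>"
      and fr1: "\<And>z. z \<notin> insert v_j (mods (For v_i (Var v_nc) Relax)) \<Longrightarrow> \<tau> z = \<sigma> z"
    have fr: "\<tau> z = \<sigma> z" if "z \<notin> {v_acc, v_p, v_y, v_i, v_j}" for z using fr1[of z] that by auto
    have eqs: "\<tau> v_proj = N" "(\<lambda>l. \<tau> v_scale l 0) = s" using fr by (simp_all add: N_def s_def[abs_def])
    have "int n * int t + int n = int n * int (Suc t)" by (simp add: algebra_simps)
    also have "\<dots> \<le> int n * int T" using t by (intro mult_left_mono) auto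
    finally have Y: "int n * int t + int n \<le> int n * int T" .
    show "wp w R B (For v_i (Var v_nc) Relax) (\<lambda>\<tau>'. J (Suc t) (upd \<tau>' v_j 0 0 (int (Suc t)))) \<tau>"
      unfolding Jupd
    proof (rule wp_Sweep[where n = n and d = d and r = r and a = a and Y = "int n * int T"])
      show "ortho_proj r n a d (\<tau> v_proj)" using O unfolding eqs N_def .
      show "admissible n (\<tau> v_proj) d (\<lambda>l. \<tau> v_scale l 0) (\<lambda>l. \<tau> v_y l 0)"
        using Jt unfolding eqs J_def by blast
      show "(\<Sum>l<n. \<tau> v_y l 0) + int n \<le> int n * int T" using Jt Y by (simp add: J_def)
      show "\<tau> v_nc 0 0 = int n" using fr nc by simp
      fix \<rho> :: store assume "admissible n (\<tau> v_proj) d (\<lambda>l. \<tau> v_scale l 0) (\<lambda>l. \<rho> v_y l 0)"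
        "(\<Sum>l<n. \<rho> v_y l 0) \<le> (\<Sum>l<n. \<tau> v_y l 0) + int n"
        "(\<Sum>l<n. \<tau> v_y l 0) + 1 \<le> (\<Sum>l<n. \<rho> v_y l 0) \<and>
           \<not> stable n (\<tau> v_proj) (\<lambda>l. \<tau> v_scale l 0) (\<lambda>l. \<tau> v_y l 0) \<or>
         stable n (\<tau> v_proj) (\<lambda>l. \<tau> v_scale l 0) (\<lambda>l. \<rho> v_y l 0)"
      then show "J (Suc t) \<rho>" using Jt unfolding eqs J_def by (auto simp: algebra_simps)
    qed (use nc B in auto)
  next
    fix \<tau> assume "J T \<tau>" "\<And>z. z \<notin> insert v_j (mods (For v_i (Var v_nc) Relax)) \<Longrightarrow> \<tau> z = \<sigma> z"
    then show "Q \<tau>" unfolding J_def N_def s_def[abs_def] by (intro post) auto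
  qed (use T in auto)
qed

lemma wp_Halve_loop:
  assumes nc: "\<sigma> v_nc 0 0 = int n" "n \<le> R" and T: "\<sigma> v_sweeps 0 0 = T"
    and s: "\<And>l. l < n \<Longrightarrow> \<bar>\<sigma> v_scale l 0\<bar> \<le> B"
    and B: "int n \<le> B" "1 \<le> B"
    and post: "\<And>\<tau>. (\<And>l. l < n \<Longrightarrow> \<tau> v_scale l 0 =
        (if T \<le> \<sigma> v_y l 0 * int n then \<sigma> v_scale l 0 div 2 else \<sigma> v_scale l 0)) \<Longrightarrow>
      \<tau> v_changed 0 0 = (if \<exists>l<n. T \<le> \<sigma> v_y l 0 * int n then 1 else \<sigma> v_changed 0 0) \<Longrightarrow>
      (\<And>z. z \<notin> {v_l, v_scale, v_changed} \<Longrightarrow> \<tau> z = \<sigma> z) \<Longrightarrow> Q \<tau>"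
  shows "wp w R B (For v_l (Var v_nc) Halve) Q \<sigma>"
proof -
  define J where "J i \<tau> \<longleftrightarrow> (\<forall>l. \<tau> v_scale l 0 =
      (if l < i \<and> T \<le> \<sigma> v_y l 0 * int n then \<sigma> v_scale l 0 div 2 else \<sigma> v_scale l 0)) \<and>
    \<tau> v_changed 0 0 = (if \<exists>l<i. T \<le> \<sigma> v_y l 0 * int n then 1 else \<sigma> v_changed 0 0)" for i and \<tau> :: store
  have Jupd: "J i (upd \<tau> v_l 0 0 u) \<longleftrightarrow> J i \<tau>" for i \<tau> u by (simp add: J_def)
  show ?thesis
  proof (rule wp_For[where n = n and I = J])
    show "J 0 (upd \<sigma> v_l 0 0 0)" unfolding Jupd by (simp add: J_def)
    fix i \<tau> assume i: "i < n" and Ji: "J i \<tau>" and iv: "\<tau> v_l 0 0 = int i"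
      and fr1: "\<And>z. z \<notin> insert v_l (mods Halve) \<Longrightarrow> \<tau> z = \<sigma> z"
    have fr: "\<tau> z = \<sigma> z" if "z \<notin> {v_l, v_scale, v_changed}" for z using fr1[of z] that by auto
    have old: "J (Suc i) \<tau>" if "\<not> T \<le> \<sigma> v_y i 0 * int n"
      using Ji that by (auto simp: J_def less_Suc_eq)
    have new: "J (Suc i) (upd (upd \<tau> v_scale i 0 (\<sigma> v_scale i 0 div 2)) v_changed 0 0 1)"
      if "T \<le> \<sigma> v_y i 0 * int n"
      using Ji that by (auto simp: J_def less_Suc_eq)
    have si: "\<tau> v_scale i 0 = \<sigma> v_scale i 0" using Ji by (simp add: J_def)
    have "\<bar>\<sigma> v_scale i 0 div 2\<bar> \<le> B" using abs_div_le[of "\<sigma> v_scale i 0" 2] s[OF i] by linarith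
    then show "wp w R B Halve (\<lambda>\<tau>'. J (Suc i) (upd \<tau>' v_l 0 0 (int (Suc i)))) \<tau>"
      unfolding Jupd Halve_def using old new si iv fr nc T B by (auto simp: not_le)
  next
    fix \<tau> assume "J n \<tau>" "\<And>z. z \<notin> insert v_l (mods Halve) \<Longrightarrow> \<tau> z = \<sigma> z"
    then show "Q \<tau>" unfolding J_def by (intro post) auto
  qed (use nc B in auto)
qed

text \<open>The total bit length of the scales. Every halving of a positive scale lowers it, which
  limits the number of rescaling rounds.\<close>

definition potential :: "nat \<Rightarrow> (nat \<Rightarrow> int) \<Rightarrow> nat" where
  "potential n s = (\<Sum>l<n. floorlog 2 (nat (s l)))"

text \<open>This includes \<open>z = 1\<close>, whose bit length drops from \<open>1\<close> to
  \<open>0\<close>, so removing a coordinate counts as progress too.\<close>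

lemma floorlog_halve:
  assumes "0 < z"
  shows "Suc (floorlog 2 (nat (z div 2))) = floorlog 2 (nat z)"
proof -
  have "nat (z div 2) = nat z div 2" using assms by (simp add: nat_div_distrib)
  then show ?thesis using assms compute_floorlog[of 2 "nat z"] by simp
qed

lemma potential_decreases:
  assumes s': "\<And>l. l < n \<Longrightarrow> s' l = (if C l then s l div 2 else s l)"
    and pos: "\<And>l. l < n \<Longrightarrow> C l \<Longrightarrow> 0 < s l" and ex: "l0 < n" "C l0"
  shows "potential n s' < potential n s"
  unfolding potential_def
proof (rule sum_strict_mono_ex1)
  show "\<forall>l\<in>{..<n}. floorlog 2 (nat (s' l)) \<le> floorlog 2 (nat (s l))"
  proof
    fix l assume "l \<in> {..<n}"
    then show "floorlog 2 (nat (s' l)) \<le> floorlog 2 (nat (s l))"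
      using s'[of l] floorlog_halve[OF pos, of l] by (cases "C l") auto
  qed
  show "\<exists>l\<in>{..<n}. floorlog 2 (nat (s' l)) < floorlog 2 (nat (s l))"
    using ex s'[OF ex(1)] floorlog_halve[OF pos[OF ex]] by (intro bexI[of _ l0]) auto
qed simp

lemma potential_le:
  assumes "valid_scaling r n M S b s"
  shows "potential n s \<le> n * (b + 1)"
proof -
  have "floorlog 2 (nat (s l)) \<le> b + 1" if "l < n" for l
  proof -
    have "s l \<le> 2 ^ b" using assms that unfolding valid_scaling_def
      by (metis one_le_numeral power_increasing zero_le_numeral zero_le_power)
    moreover have "(2::int) ^ (b + 1) = 2 * 2 ^ b" "(0::int) < 2 ^ b" by simp_all
    ultimately have "s l < 2 ^ (b + 1)" by linarith
    then have "nat (s l) < 2 ^ (b + 1)" by (simp only: nat_less_numeral_power_cancel_iff)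
    then show ?thesis by (intro floorlog_leI) auto
  qed
  then show ?thesis
    using sum_bounded_above[of "{..<n}" "\<lambda>l. floorlog 2 (nat (s l))" "b + 1"] by (simp add: potential_def)
qed

lemma valid_scaling_cong:
  "valid_scaling r n M S b s \<Longrightarrow> (\<And>l. l < n \<Longrightarrow> s' l = s l) \<Longrightarrow> valid_scaling r n M S b s'"
  unfolding valid_scaling_def by (metis (no_types, lifting))

lemma valid_scaling_bound:
  assumes "valid_scaling r n M S b s" "l < n"
  shows "0 \<le> s l" "s l \<le> 2 ^ b"
  using assms unfolding valid_scaling_def
  by (metis order_refl zero_le_numeral zero_le_power)
     (metis assms one_le_numeral power_increasing valid_scaling_def zero_le_numeral zero_le_power)

text \<open>Halving reaches only coordinates with \<open>y l > 0\<close>, which are live, so every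
  change lowers the potential. If nothing is halved, the sum of \<open>y\<close> is too small for
  the sweeps to have ended otherwise than with a stable \<open>y\<close>, that is, with a solution.
  Since scales never exceed \<open>2 ^ b\<close>, scaled entries stay below
  \<open>A2 * 2 ^ b\<close>, or equal to it.\<close>

lemma wp_Iterate:
  assumes nc: "\<sigma> v_nc 0 0 = int n" "n \<le> R" and nr: "\<sigma> v_nr 0 0 = int r" "r \<le> R"
    and T: "\<sigma> v_sweeps 0 0 = 4 * int n ^ 4" "4 * n ^ 4 \<le> R" "1 \<le> R"
    and V: "valid_scaling r n (\<sigma> v_mat) S b (\<lambda>l. \<sigma> v_scale l 0)" and b: "minor_bound r n (\<sigma> v_mat) \<le> 2 ^ b"
    and A: "\<And>i l. i < r \<Longrightarrow> l < n \<Longrightarrow> \<bar>\<sigma> v_mat i l\<bar> \<le> A2" "1 \<le> A2" "A = A2 * 2 ^ b"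
    and D: "D = (int n * A\<^sup>2 + 1) ^ r"
    and B: "int n \<le> B" "int r \<le> B" "D \<le> B" "int n * (A * (int n * (D * A))) \<le> B" "2 ^ b \<le> B"
      "4 * int n ^ 4 \<le> B" "int n * (D * (int n * (4 * int n ^ 4))) \<le> B"
    and post: "\<And>\<tau>. valid_scaling r n (\<sigma> v_mat) S b (\<lambda>l. \<tau> v_scale l 0) \<Longrightarrow>
      \<tau> v_changed 0 0 = 1 \<and> potential n (\<lambda>l. \<tau> v_scale l 0) < potential n (\<lambda>l. \<sigma> v_scale l 0) \<or>
      \<tau> v_changed 0 0 = 0 \<and> (\<exists>x\<in>cone r n (\<sigma> v_mat) S. \<forall>l<n. 0 < \<tau> v_scale l 0 \<longrightarrow> 0 < x l) \<Longrightarrow>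
      (\<And>z. z \<notin> mods Iterate \<Longrightarrow> \<tau> z = \<sigma> z) \<Longrightarrow> Q \<tau>"
  shows "wp w R B Iterate Q \<sigma>"
proof -
  define M where "M = \<sigma> v_mat"
  define s where "s l = \<sigma> v_scale l 0" for l
  note V' = V[folded M_def, folded s_def]
  let ?T = "4 * n ^ 4"
  have s_bound: "0 \<le> s l" "s l \<le> 2 ^ b" if "l < n" for l using valid_scaling_bound[OF V' that] .
  have A1: "1 \<le> A" unfolding A(3) using A(2) mult_mono[of 1 A2 1 "2 ^ b"] by simp
  have MA: "\<bar>M i l * s l\<bar> \<le> A" if "i < r" "l < n" for i l
    unfolding A(3) abs_mult using A(1)[OF that] A(2) s_bound[OF that(2)]
    by (intro mult_mono) (auto simp: M_def)
  have D1: "1 \<le> D" unfolding D by (intro one_le_power) simp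
  have B1: "1 \<le> B" using D1 B(3) by simp
  have nT: "int n * int ?T \<le> B"
  proof (cases "n = 0")
    case False
    then have "1 * (1 * (int n * (4 * int n ^ 4))) \<le> int n * (D * (int n * (4 * int n ^ 4)))"
      using D1 by (intro mult_mono) auto
    then have "1 * (1 * (int n * (4 * int n ^ 4))) \<le> B" using B(7) by (rule order.trans)
    then show ?thesis by (simp only: mult_1) simp
  qed (use B1 in simp)
  show ?thesis
    unfolding Iterate_def
  proof (rule wp_Seq, rule wp_Set_Var)
    show "wp w R B (Proj ;; Fill v_y v_l v_p (Var v_nc) (Num 1) (Num 0) (Num 0) (Num 0) ;;
       For v_j (Var v_sweeps) (For v_i (Var v_nc) Relax) ;; For v_l (Var v_nc) Halve) Q
       (upd \<sigma> v_changed 0 0 (aval w (Num 0) \<sigma>))"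
    proof (rule wp_Seq, rule wp_Proj[where n = n and r = r and A = A and D = D])
      fix \<tau> assume O: "ortho_proj r n (\<lambda>i l. upd \<sigma> v_changed 0 0 (aval w (Num 0) \<sigma>) v_mat i l *
            upd \<sigma> v_changed 0 0 (aval w (Num 0) \<sigma>) v_scale l 0) (\<tau> v_det 0 0) (\<tau> v_proj)"
        and dD: "\<tau> v_det 0 0 \<le> D"
        and fr1: "\<And>z. z \<notin> {v_proj, v_l, v_p, v_det, v_i, v_image, v_acc, v_alpha} \<Longrightarrow>
           \<tau> z = upd \<sigma> v_changed 0 0 (aval w (Num 0) \<sigma>) z"
      define d N where "d = \<tau> v_det 0 0" and "N = \<tau> v_proj"
      have O': "ortho_proj r n (\<lambda>i l. M i l * s l) d N" using O by (simp add: M_def s_def d_def N_def)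
      have d1: "1 \<le> d" using O' by (simp add: ortho_proj_def)
      have dT: "int n * (d * (int n * int ?T)) \<le> B"
      proof -
        have "int n * (d * (int n * (4 * int n ^ 4))) \<le> int n * (D * (int n * (4 * int n ^ 4)))"
          using dD by (intro mult_left_mono mult_right_mono) (auto simp: d_def)
        also have "\<dots> \<le> B" by (rule B(7))
        finally show ?thesis by simp
      qed
      have fr: "\<tau> z = \<sigma> z" if "z \<notin> mods Iterate" for z using fr1[of z] that by auto
      have ch: "\<tau> v_changed 0 0 = 0" using fr1[of v_changed] by simp
      have sc: "\<tau> v_scale = \<sigma> v_scale" using fr1[of v_scale] by simp
      show "wp w R B (Fill v_y v_l v_p (Var v_nc) (Num 1) (Num 0) (Num 0) (Num 0) ;;
       For v_j (Var v_sweeps) (For v_i (Var v_nc) Relax) ;; For v_l (Var v_nc) Halve) Q \<tau>"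
      proof (rule wp_Seq, rule wp_Fill[where a = n and b = 1 and rb = 0 and cb = 0 and F = "\<lambda>i j. 0"])
        fix \<rho> assume y0: "\<And>i j. i < n \<Longrightarrow> j < 1 \<Longrightarrow> \<rho> v_y (0 + i) (0 + j) = 0"
          and fr2: "\<And>z. z \<notin> {v_y, v_l, v_p} \<Longrightarrow> \<rho> z = \<tau> z"
        have eqs: "\<rho> v_proj = N" "(\<lambda>l. \<rho> v_scale l 0) = s" using fr2 sc by (simp_all add: N_def s_def[abs_def])
        show "wp w R B (For v_j (Var v_sweeps) (For v_i (Var v_nc) Relax) ;; For v_l (Var v_nc) Halve) Q \<rho>"
        proof (rule wp_Seq, rule wp_Sweeps[where n = n and d = d and r = r and T = ?T and a = "\<lambda>i l. M i l * s l"])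
          show "ortho_proj r n (\<lambda>i l. M i l * s l) d (\<rho> v_proj)" unfolding eqs by (rule O')
          show "\<rho> v_y l 0 = 0" if "l < n" for l using y0[OF that, of 0] by simp
          fix \<tau>' assume adm: "admissible n (\<rho> v_proj) d (\<lambda>l. \<rho> v_scale l 0) (\<lambda>l. \<tau>' v_y l 0)"
            and sumT: "(\<Sum>l<n. \<tau>' v_y l 0) \<le> int n * int ?T"
            and progress: "int ?T \<le> (\<Sum>l<n. \<tau>' v_y l 0) \<or> stable n (\<rho> v_proj) (\<lambda>l. \<rho> v_scale l 0) (\<lambda>l. \<tau>' v_y l 0)"
            and fr3: "\<And>z. z \<notin> {v_acc, v_p, v_y, v_i, v_j} \<Longrightarrow> \<tau>' z = \<rho> z"
          define y where "y l = \<tau>' v_y l 0" for l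
          note adm = adm[unfolded eqs, folded y_def]
          have y: "0 \<le> y l" "0 < y l \<Longrightarrow> 0 < s l" if "l < n" for l
            using adm that by (auto simp: admissible_def)
          have sc': "\<tau>' v_scale l 0 = s l" for l using fr3 fr2 sc by (simp add: s_def)
          show "wp w R B (For v_l (Var v_nc) Halve) Q \<tau>'"
          proof (rule wp_Halve_loop[where n = n and T = "4 * int n ^ 4"])
            show "\<bar>\<tau>' v_scale l 0\<bar> \<le> B" if "l < n" for l
              using s_bound[OF that] B(5) by (simp add: sc')
            show "\<tau>' v_nc 0 0 = int n" "\<tau>' v_sweeps 0 0 = 4 * int n ^ 4"
              using fr3 fr2 fr nc T by simp_all
            fix \<rho>' assume halved: "\<And>l. l < n \<Longrightarrow> \<rho>' v_scale l 0 =
                (if 4 * int n ^ 4 \<le> \<tau>' v_y l 0 * int n then \<tau>' v_scale l 0 div 2 else \<tau>' v_scale l 0)"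
              and ch': "\<rho>' v_changed 0 0 = (if \<exists>l<n. 4 * int n ^ 4 \<le> \<tau>' v_y l 0 * int n then 1 else \<tau>' v_changed 0 0)"
              and fr4: "\<And>z. z \<notin> {v_l, v_scale, v_changed} \<Longrightarrow> \<rho>' z = \<tau>' z"
            have halved: "\<rho>' v_scale l 0 = (if 4 * int n ^ 4 \<le> y l * int n then s l div 2 else s l)" if "l < n" for l
              using halved[OF that] by (simp add: y_def sc')
            have ch': "\<rho>' v_changed 0 0 = (if \<exists>l<n. 4 * int n ^ 4 \<le> y l * int n then 1 else 0)"
              using ch' fr3 fr2 ch by (simp add: y_def)
            have V2: "valid_scaling r n M S b (\<lambda>l. \<rho>' v_scale l 0)"
              using adm sumT halved
              by (intro valid_scaling_halve[OF V' b[folded M_def] O']) (auto simp: admissible_def y_def)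
            have "\<rho>' v_changed 0 0 = 1 \<and> potential n (\<lambda>l. \<rho>' v_scale l 0) < potential n s \<or>
              \<rho>' v_changed 0 0 = 0 \<and> (\<exists>x\<in>cone r n M S. \<forall>l<n. 0 < \<rho>' v_scale l 0 \<longrightarrow> 0 < x l)"
            proof (cases "\<exists>l<n. 4 * int n ^ 4 \<le> y l * int n")
              case True
              then obtain l0 where l0: "l0 < n" "4 * int n ^ 4 \<le> y l0 * int n" by blast
              have "potential n (\<lambda>l. \<rho>' v_scale l 0) < potential n s"
              proof (rule potential_decreases[where C = "\<lambda>l. 4 * int n ^ 4 \<le> y l * int n" and s' = "\<lambda>l. \<rho>' v_scale l 0" and s = s, OF _ _ l0])
                fix l assume l: "l < n" "4 * int n ^ 4 \<le> y l * int n"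
                then have "0 < y l * int n" by (simp add: less_le_trans[of 0 "4 * int n ^ 4"])
                then show "0 < s l" using y(2)[OF l(1)] by (simp add: zero_less_mult_iff)
              qed (use halved in simp)
              then show ?thesis using ch' True by simp
            next
              case False
              \<comment> \<open>Pigeonhole: if every \<open>y l * n\<close> is below
                \<open>4 n^4\<close>, so is the sum of \<open>y\<close>.\<close>
              have "\<not> int ?T \<le> (\<Sum>l<n. y l)" if "n \<noteq> 0"
              proof -
                have "(\<Sum>l<n. y l) * int n = (\<Sum>l<n. y l * int n)" by (simp add: sum_distrib_right)
                also have "\<dots> < (\<Sum>l<n. 4 * int n ^ 4)"
                  using False that by (intro sum_strict_mono) auto
                finally have "(\<Sum>l<n. y l) * int n < int ?T * int n" by (simp add: mult.commute)
                then show ?thesis by (simp add: mult_less_cancel_right)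
              qed
              then have "stable n N s y"
                using progress unfolding eqs y_def[abs_def] by (cases "n = 0") (auto simp: stable_def)
              then have "\<exists>x\<in>cone r n M S. \<forall>l<n. 0 < s l \<longrightarrow> 0 < x l"
                by (intro stable_solution[OF V' O']) (auto simp: stable_def)
              then show ?thesis using ch' False halved by auto
            qed
            then show "Q \<rho>'"
              using V2 fr4 fr3 fr2 fr unfolding M_def s_def[abs_def] by (intro post) auto
          qed (use nc B B1 in auto)
        qed (use fr fr2 nc T B nT dT in auto)
      qed (use fr nc T(3) B B1 in auto)
    qed (use nc nr A1 MA D B in \<open>auto simp: M_def s_def\<close>)
  qed (use B1 in auto)
qed

text \<open>The last iteration provides a solution that is positive at all coordinates of positive
  scale, and no solution is positive anywhere else. So the positive scales mark the largest support,
  and one solution answers the question for every set \<open>J\<close>.\<close>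

lemma wp_Solve:
  assumes nc: "\<sigma> v_nc 0 0 = int n" "n \<le> R" and nr: "\<sigma> v_nr 0 0 = int r" "r \<le> R"
    and T: "\<sigma> v_sweeps 0 0 = 4 * int n ^ 4" "4 * n ^ 4 \<le> R" "n * (b + 1) < R"
    and V: "valid_scaling r n (\<sigma> v_mat) S b (\<lambda>l. \<sigma> v_scale l 0)" and b: "minor_bound r n (\<sigma> v_mat) \<le> 2 ^ b"
    and A: "\<And>i l. i < r \<Longrightarrow> l < n \<Longrightarrow> \<bar>\<sigma> v_mat i l\<bar> \<le> A2" "1 \<le> A2" "A = A2 * 2 ^ b"
    and D: "D = (int n * A\<^sup>2 + 1) ^ r"
    and B: "int n \<le> B" "int r \<le> B" "D \<le> B" "int n * (A * (int n * (D * A))) \<le> B" "2 ^ b \<le> B"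
      "4 * int n ^ 4 \<le> B" "int n * (D * (int n * (4 * int n ^ 4))) \<le> B"
    and post: "\<And>\<tau>. (\<And>J. J \<subseteq> {..<n} \<Longrightarrow> (\<exists>x\<in>cone r n (\<sigma> v_mat) S. \<forall>l\<in>J. 0 < x l) \<longleftrightarrow> (\<forall>l\<in>J. 0 < \<tau> v_scale l 0)) \<Longrightarrow>
      (\<And>l. l < n \<Longrightarrow> 0 \<le> \<tau> v_scale l 0) \<Longrightarrow>
      (\<And>z. z \<notin> mods Solve \<Longrightarrow> \<tau> z = \<sigma> z) \<Longrightarrow> Q \<tau>"
  shows "wp w R B Solve Q \<sigma>"
proof -
  have D1: "1 \<le> D" unfolding D by (intro one_le_power) simp
  \<comment> \<open>While the flag is set, the number of iterations made plus the potential never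
    exceeds \<open>n * (b + 1)\<close>, which bounds the loop count.\<close>
  define Inv where "Inv j \<tau> \<longleftrightarrow> (\<forall>z. z \<notin> mods Solve \<longrightarrow> \<tau> z = \<sigma> z) \<and>
    valid_scaling r n (\<sigma> v_mat) S b (\<lambda>l. \<tau> v_scale l 0) \<and>
    (\<tau> v_changed 0 0 = 1 \<and> j + potential n (\<lambda>l. \<tau> v_scale l 0) \<le> n * (b + 1) \<or>
     \<tau> v_changed 0 0 = 0 \<and> (\<exists>x\<in>cone r n (\<sigma> v_mat) S. \<forall>l<n. 0 < \<tau> v_scale l 0 \<longrightarrow> 0 < x l))" for j and \<tau> :: store
  have "Inv 0 (upd \<sigma> v_changed 0 0 1)"
    using V potential_le[OF V] by (simp add: Inv_def)
  moreover have "ok w (Var v_changed) \<tau> \<and> (if 0 < aval w (Var v_changed) \<tau> then j < R \<and>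
      wp w R B Iterate (Inv (Suc j)) \<tau> else Q \<tau>)" if I: "Inv j \<tau>" for j \<tau>
  proof -
    have fr: "\<tau> z = \<sigma> z" if "z \<notin> mods Solve" for z using I that by (simp add: Inv_def)
    have V\<tau>: "valid_scaling r n (\<sigma> v_mat) S b (\<lambda>l. \<tau> v_scale l 0)" using I by (simp add: Inv_def)
    have mat: "\<tau> v_mat = \<sigma> v_mat" using fr by simp
    show ?thesis
    proof (cases "0 < \<tau> v_changed 0 0")
      case True
      then have j: "j + potential n (\<lambda>l. \<tau> v_scale l 0) \<le> n * (b + 1)" using I by (auto simp: Inv_def)
      have "wp w R B Iterate (Inv (Suc j)) \<tau>"
      proof (rule wp_Iterate[where n = n and r = r and b = b and S = S and A = A and ?A2.0 = A2 and D = D])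
        fix \<rho> assume "valid_scaling r n (\<tau> v_mat) S b (\<lambda>l. \<rho> v_scale l 0)"
          "\<rho> v_changed 0 0 = 1 \<and> potential n (\<lambda>l. \<rho> v_scale l 0) < potential n (\<lambda>l. \<tau> v_scale l 0) \<or>
           \<rho> v_changed 0 0 = 0 \<and> (\<exists>x\<in>cone r n (\<tau> v_mat) S. \<forall>l<n. 0 < \<rho> v_scale l 0 \<longrightarrow> 0 < x l)"
          "\<And>z. z \<notin> mods Iterate \<Longrightarrow> \<rho> z = \<tau> z"
        then show "Inv (Suc j) \<rho>" using fr j unfolding mat Inv_def by auto
      qed (use fr nc nr T A D B b V\<tau> in \<open>auto simp: mat\<close>)
      then show ?thesis using True j T(3) by simp
    next
      case False
      then obtain x where x: "x \<in> cone r n (\<sigma> v_mat) S" "\<And>l. l < n \<Longrightarrow> 0 < \<tau> v_scale l 0 \<Longrightarrow> 0 < x l"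
        using I by (auto simp: Inv_def)
      have "Q \<tau>"
      proof (rule post)
        fix J assume J: "J \<subseteq> {..<n}"
        show "(\<exists>x\<in>cone r n (\<sigma> v_mat) S. \<forall>l\<in>J. 0 < x l) \<longleftrightarrow> (\<forall>l\<in>J. 0 < \<tau> v_scale l 0)"
          using valid_scaling_positive[OF V\<tau>] x J by blast
      qed (use fr valid_scaling_bound(1)[OF V\<tau>] in auto)
      then show ?thesis using False by simp
    qed
  qed
  ultimately have "wp w R B (CWhile (Var v_changed) Iterate) Q (upd \<sigma> v_changed 0 0 1)"
    by (subst wp.simps(5)) blast
  then show ?thesis
    unfolding Solve_def using D1 B(3) by (intro wp_Seq wp_Set_Var) auto
qed

section \<open>Encoded instances\<close>

definition mat_list :: "'a mat \<Rightarrow> 'a list" where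
  "mat_list M = concat (map list_of_vec (rows M))"

lemma concat_map_concat: "concat (map (\<lambda>xs. concat (map f xs)) xss) = concat (map f (concat xss))"
  by (induction xss) auto

lemma encode_mat_eq: "encode_mat M = concat (map encode_rat (mat_list M))"
  using concat_map_concat[of encode_rat "map list_of_vec (rows M)"]
  by (simp add: encode_mat_def encode_vec_def[abs_def] mat_list_def comp_def)

lemma concat_uniform:
  assumes "\<And>xs. xs \<in> set xss \<Longrightarrow> length xs = c"
  shows "length (concat xss) = length xss * c"
    and "i < length xss \<Longrightarrow> j < c \<Longrightarrow> concat xss ! (i * c + j) = xss ! i ! j"
proof -
  show "length (concat xss) = length xss * c"
    using assms by (induction xss) auto
  show "i < length xss \<Longrightarrow> j < c \<Longrightarrow> concat xss ! (i * c + j) = xss ! i ! j"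
    using assms
  proof (induction xss arbitrary: i)
    case (Cons xs xss)
    then show ?case
      by (cases i) (auto simp: nth_append)
  qed simp
qed

lemma mat_list_index:
  assumes "M \<in> carrier_mat r c"
  shows "length (mat_list M) = r * c"
    and "i < r \<Longrightarrow> j < c \<Longrightarrow> mat_list M ! (i * c + j) = M $$ (i, j)"
proof -
  have u: "length xs = c" if "xs \<in> set (map list_of_vec (rows M))" for xs
    using that assms by (auto simp: rows_def)
  show "length (mat_list M) = r * c"
    unfolding mat_list_def using concat_uniform(1)[of "map list_of_vec (rows M)" c, OF u] assms by simp
  show "mat_list M ! (i * c + j) = M $$ (i, j)" if "i < r" "j < c"
    unfolding mat_list_def using concat_uniform(2)[of "map list_of_vec (rows M)" c i j, OF u] that assms
    by (simp add: list_of_vec_index)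
qed

lemma length_encode_rat: "xs \<in> set (map encode_rat rs) \<Longrightarrow> length xs = 2"
  by (auto simp: encode_rat_def)

lemma encode_rats_index:
  assumes "q < length rs"
  shows "concat (map encode_rat rs) ! (2 * q) = fst (quotient_of (rs ! q))"
    "concat (map encode_rat rs) ! (2 * q + 1) = snd (quotient_of (rs ! q))"
  using concat_uniform(2)[of "map encode_rat rs" 2 q 0, OF length_encode_rat]
    concat_uniform(2)[of "map encode_rat rs" 2 q 1, OF length_encode_rat] assms
  by (auto simp: encode_rat_def mult.commute)

lemma length_encode_rats: "length (concat (map encode_rat rs)) = 2 * length rs"
  using concat_uniform(1)[of "map encode_rat rs" 2, OF length_encode_rat] by simp

lemma encoding_length_append: "encoding_length (xs @ ys) = encoding_length xs + encoding_length ys"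
  by (simp add: encoding_length_def)

lemma length_le_encoding_length: "length xs \<le> encoding_length xs"
  by (induction xs) (auto simp: encoding_length_def bit_length_def)

lemma entry_le_encoding_length:
  assumes "z \<in> set xs" shows "\<bar>z\<bar> \<le> 2 ^ encoding_length xs"
proof -
  have "bit_length z \<le> encoding_length xs"
    unfolding encoding_length_def using assms by (intro member_le_sum_list) auto
  then have "(2::int) ^ bit_length z \<le> 2 ^ encoding_length xs" by (intro power_increasing) auto
  then show ?thesis using abs_le_bit_length[of z] by linarith
qed

lemma input_memory_bound: "\<bar>input_memory xs a\<bar> \<le> 2 ^ encoding_length xs"
proof -
  have "int (length xs) \<le> 2 ^ encoding_length xs"
  proof -
    have "length xs < 2 ^ encoding_length xs"
      using length_le_encoding_length[of xs] less_exp[of "encoding_length xs"] by linarith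
    then have "int (length xs) < int (2 ^ encoding_length xs)" by linarith
    then show ?thesis by simp
  qed
  moreover have "xs ! nat (a - 1) \<in> set xs" if "1 \<le> a" "a \<le> int (length xs)"
    using that by (intro nth_mem) linarith
  ultimately show ?thesis
    using entry_le_encoding_length[of _ xs] by (auto simp: input_memory_def)
qed

text \<open>All rational data form one list \<open>rats\<close> in the order of the encoding, with
  block offsets \<open>oB\<close> to \<open>od\<close> and length \<open>nq\<close>, so that a
  single array of integers serves for all matrices and vectors. The common denominator is the
  product of all denominators: it takes no gcd computation and is still at most
  \<open>2 ^ enc_len\<close>.\<close>

locale bilfp_instance =
  fixes I :: bilfp
  assumes inst: "I \<in> bilfp_instances"
begin

definition "m = nrows I"
definition "n = nvars I"
definition "k = nparams I"
definition "g = nineqs I"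
definition "rats = mat_list (matA I) @ mat_list (matB I) @ list_of_vec (vecb I) @ mat_list (matC I)
  @ list_of_vec (vecc I) @ mat_list (matD I) @ list_of_vec (vecd I)"
definition "oB = m * n"
definition "ob = oB + m * k"
definition "oC = ob + m"
definition "oc = oC + n * k"
definition "oD = oc + n"
definition "od = oD + g * k"
definition "nq = od + g"
definition "num q = fst (quotient_of (rats ! q))"
definition "den q = snd (quotient_of (rats ! q))"
definition "denom = (\<Prod>q<nq. den q)"
definition "val q = num q * (denom div den q)"
definition "inp = input_memory (encode_bilfp I)"
definition "enc_len = encoding_length (encode_bilfp I)"

lemma carriers:
  "matA I \<in> carrier_mat m n" "matB I \<in> carrier_mat m k" "vecb I \<in> carrier_vec m"
  "matC I \<in> carrier_mat n k" "vecc I \<in> carrier_vec n" "matD I \<in> carrier_mat g k"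
  "vecd I \<in> carrier_vec g" "is_basis (real_mat (matA I)) (basis I)"
  using inst by (auto simp: bilfp_instances_def m_def n_def k_def g_def)

lemma lengths:
  "length (mat_list (matA I)) = m * n" "length (mat_list (matB I)) = m * k"
  "length (list_of_vec (vecb I)) = m" "length (mat_list (matC I)) = n * k"
  "length (list_of_vec (vecc I)) = n" "length (mat_list (matD I)) = g * k"
  "length (list_of_vec (vecd I)) = g"
  by (simp_all add: mat_list_index(1)[OF carriers(1)] mat_list_index(1)[OF carriers(2)]
      mat_list_index(1)[OF carriers(4)] mat_list_index(1)[OF carriers(6)]
      carrier_vecD[OF carriers(3)] carrier_vecD[OF carriers(5)] carrier_vecD[OF carriers(7)])

lemma length_rats: "length rats = nq"
  unfolding rats_def nq_def od_def oD_def oc_def oC_def ob_def oB_def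
  by (simp add: lengths del: length_list_of_vec)

lemma index_less: "i < a \<Longrightarrow> j < b \<Longrightarrow> i * b + j < a * (b :: nat)"
proof -
  assume "i < a" "j < b"
  then have "i * b + j < Suc i * b" by simp
  also have "\<dots> \<le> a * b" using \<open>i < a\<close> by (intro mult_right_mono) auto
  finally show ?thesis .
qed

lemma rats_index:
  "i < m \<Longrightarrow> l < n \<Longrightarrow> rats ! (i * n + l) = matA I $$ (i, l)"
  "i < m \<Longrightarrow> p < k \<Longrightarrow> rats ! (oB + (i * k + p)) = matB I $$ (i, p)"
  "i < m \<Longrightarrow> rats ! (ob + i) = vecb I $ i"
  "l < n \<Longrightarrow> p < k \<Longrightarrow> rats ! (oC + (l * k + p)) = matC I $$ (l, p)"
  "l < n \<Longrightarrow> rats ! (oc + l) = vecc I $ l"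
  "i < g \<Longrightarrow> p < k \<Longrightarrow> rats ! (oD + (i * k + p)) = matD I $$ (i, p)"
  "i < g \<Longrightarrow> rats ! (od + i) = vecd I $ i"
  using index_less[of i m l n] index_less[of i m p k] index_less[of l n p k] index_less[of i g p k] carriers
  by (auto simp: rats_def od_def oD_def oc_def oC_def ob_def oB_def nth_append lengths
      mat_list_index(2)[OF carriers(1)] mat_list_index(2)[OF carriers(2)]
      mat_list_index(2)[OF carriers(4)] mat_list_index(2)[OF carriers(6)] list_of_vec_index simp del: length_list_of_vec)

lemma offsets_less:
  "i < m \<Longrightarrow> l < n \<Longrightarrow> i * n + l < nq"
  "i < m \<Longrightarrow> p < k \<Longrightarrow> oB + (i * k + p) < nq"
  "i < m \<Longrightarrow> ob + i < nq"
  "l < n \<Longrightarrow> p < k \<Longrightarrow> oC + (l * k + p) < nq"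
  "l < n \<Longrightarrow> oc + l < nq"
  "i < g \<Longrightarrow> p < k \<Longrightarrow> oD + (i * k + p) < nq"
  "i < g \<Longrightarrow> od + i < nq"
  using index_less[of i m l n] index_less[of i m p k] index_less[of l n p k] index_less[of i g p k]
  by (auto simp: nq_def od_def oD_def oc_def oC_def ob_def oB_def)

lemma den_pos: "0 < den q"
  unfolding den_def by (rule quotient_of_denom_pos')

lemma denom_pos: "0 < denom"
  unfolding denom_def using den_pos by (intro prod_pos) auto

lemma val_eq:
  assumes "q < nq"
  shows "real_of_int (val q) = denom * real_of_rat (rats ! q)"
proof -
  have "den q dvd denom" unfolding denom_def using assms by (intro dvd_prodI) auto
  then have "denom = den q * (denom div den q)" by simp
  then have "real_of_int denom = den q * real_of_int (denom div den q)" by (metis of_int_mult)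
  moreover have "rats ! q = of_int (num q) / of_int (den q)"
    unfolding num_def den_def by (rule quotient_of_div) simp
  then have "real_of_rat (rats ! q) = num q / den q" by (simp add: of_rat_divide)
  ultimately show ?thesis using den_pos[of q] by (simp add: val_def)
qed

definition "bas i = sorted_list_of_set (basis I) ! i"

lemma finite_basis: "finite (basis I)" and card_basis: "card (basis I) = m"
  and basis_less: "l \<in> basis I \<Longrightarrow> l < n"
proof -
  have "real_mat (matA I) \<in> carrier_mat m n" using carriers by simp
  from is_basis_card[OF this carriers(8)]
  show "finite (basis I)" "card (basis I) = m" "l \<in> basis I \<Longrightarrow> l < n"
    using finite_subset by auto
qed

lemma basis_eq: "basis I = bas ` {..<m}"
proof -
  have "set (sorted_list_of_set (basis I)) = basis I" "length (sorted_list_of_set (basis I)) = m"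
    using finite_basis card_basis by auto
  moreover have "set xs = (!) xs ` {..<length xs}" for xs :: "nat list"
    by (auto simp: set_conv_nth)
  ultimately show ?thesis unfolding bas_def by metis
qed

lemma encode_eq: "encode_bilfp I = [int m, int n, int k, int g] @ concat (map encode_rat rats)
    @ map int (sorted_list_of_set (basis I))"
  by (simp add: encode_bilfp_def encode_mat_eq encode_vec_def rats_def m_def n_def k_def g_def)

lemma length_encode: "length (encode_bilfp I) = 4 + 2 * nq + m"
  using card_basis by (simp add: encode_eq length_encode_rats length_rats)

lemma inp_dims: "inp 1 = int m" "inp 2 = int n" "inp 3 = int k" "inp 4 = int g"
  unfolding inp_def input_memory_def by (simp_all add: length_encode) (simp_all add: encode_eq)

lemma inp_nth: "i < length (encode_bilfp I) \<Longrightarrow> inp (int i + 1) = encode_bilfp I ! i"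
  by (simp add: inp_def input_memory_def)

text \<open>Cell \<open>0\<close> holds the length of the word and cells \<open>1\<close> to
  \<open>4\<close> the dimensions, so the fractions start in cell \<open>5\<close> and take two
  cells each.\<close>

lemma inp_rats:
  assumes "q < nq"
  shows "inp (5 + 2 * int q) = num q" "inp (6 + 2 * int q) = den q"
proof -
  have "inp (int (4 + 2 * q) + 1) = encode_bilfp I ! (4 + 2 * q)"
    using assms by (intro inp_nth) (simp add: length_encode)
  also have "\<dots> = num q"
    using encode_rats_index(1)[of q rats] assms
    by (simp add: encode_eq nth_append length_encode_rats length_rats num_def)
  finally show "inp (5 + 2 * int q) = num q" by (simp add: algebra_simps)
  have "inp (int (4 + (2 * q + 1)) + 1) = encode_bilfp I ! (4 + (2 * q + 1))"
    using assms by (intro inp_nth) (simp add: length_encode)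
  also have "\<dots> = den q"
    using encode_rats_index(2)[of q rats] assms
    by (simp add: encode_eq nth_append length_encode_rats length_rats den_def del: add_2_eq_Suc')
  finally show "inp (6 + 2 * int q) = den q" by (simp add: algebra_simps)
qed

lemma inp_basis:
  assumes "i < m"
  shows "inp (5 + 2 * int nq + int i) = int (bas i)"
proof -
  have "inp (int (4 + (2 * nq + i)) + 1) = encode_bilfp I ! (4 + (2 * nq + i))"
    using assms by (intro inp_nth) (simp add: length_encode)
  also have "\<dots> = int (bas i)"
    using assms card_basis by (simp add: encode_eq nth_append length_encode_rats length_rats bas_def)
  finally show ?thesis by (simp add: algebra_simps)
qed

lemma size_bounds: "2 * nq + m + 4 \<le> enc_len"
  using length_le_encoding_length[of "encode_bilfp I"] by (simp add: length_encode enc_len_def)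

lemma num_bound: "q < nq \<Longrightarrow> \<bar>num q\<bar> \<le> 2 ^ enc_len"
  using input_memory_bound[of "encode_bilfp I" "5 + 2 * int q"] inp_rats(1)[of q]
  by (simp add: inp_def enc_len_def)

text \<open>A product has at most as many bits as its factors together, and the denominators are
  separate entries of the encoding.\<close>

lemma denom_bound: "denom \<le> 2 ^ enc_len"
proof -
  have "denom \<le> (\<Prod>q<nq. 2 ^ bit_length (den q))"
  proof -
    have "0 \<le> den q \<and> den q \<le> 2 ^ bit_length (den q)" for q
      using den_pos[of q] abs_le_bit_length[of "den q"] by linarith
    then show ?thesis unfolding denom_def by (intro prod_mono) auto
  qed
  also have "\<dots> = 2 ^ (\<Sum>q<nq. bit_length (den q))" by (simp add: power_sum)
  also have "\<dots> \<le> 2 ^ enc_len"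
  proof (intro power_increasing)
    have le: "(\<Sum>r\<leftarrow>rs. bit_length (snd (quotient_of r))) \<le> encoding_length (concat (map encode_rat rs))" for rs
      by (induction rs) (auto simp: encoding_length_def encode_rat_def)
    have "(\<Sum>q<nq. bit_length (den q)) = (\<Sum>r\<leftarrow>rats. bit_length (snd (quotient_of r)))"
      by (simp add: sum_list_sum_nth length_rats den_def atLeast0LessThan)
    also have "\<dots> \<le> encoding_length (concat (map encode_rat rats))" by (rule le)
    also have "\<dots> \<le> enc_len" by (simp only: enc_len_def encode_eq encoding_length_append)
    finally show "(\<Sum>q<nq. bit_length (den q)) \<le> enc_len" .
  qed auto
  finally show ?thesis .
qed

text \<open>The program stores every partial product; as all factors are at least \<open>1\<close>,
  none exceeds the full product.\<close>

lemma partial_denom_bound: "j \<le> nq \<Longrightarrow> 1 \<le> (\<Prod>q<j. den q) \<and> (\<Prod>q<j. den q) \<le> 2 ^ enc_len"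
proof -
  assume j: "j \<le> nq"
  have one: "1 \<le> den q" for q using den_pos[of q] by simp
  have "(\<Prod>q<j. 1) \<le> (\<Prod>q<j. den q)" using one by (intro prod_mono) auto
  moreover have "(\<Prod>q<j. den q) \<le> denom"
  proof -
    have "denom = (\<Prod>q<j. den q) * (\<Prod>q\<in>{j..<nq}. den q)"
      unfolding denom_def using j by (subst prod.union_disjoint[symmetric]) (auto intro!: prod.cong)
    moreover have "(\<Prod>q\<in>{j..<nq}. 1) \<le> (\<Prod>q\<in>{j..<nq}. den q)" using one by (intro prod_mono) auto
    moreover have "0 \<le> (\<Prod>q<j. den q)" using den_pos by (intro prod_nonneg) (auto simp: less_imp_le)
    ultimately show ?thesis using mult_left_mono[of 1 "\<Prod>q\<in>{j..<nq}. den q" "\<Prod>q<j. den q"] by simp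
  qed
  ultimately show ?thesis using denom_bound by simp
qed

lemma val_bound: 
  assumes "q < nq" shows "\<bar>val q\<bar> \<le> 2 ^ (2 * enc_len)"
proof -
  have "\<bar>denom div den q\<bar> \<le> 2 ^ enc_len"
    using abs_div_le[of denom "den q"] denom_bound denom_pos by linarith
  then have "\<bar>val q\<bar> \<le> 2 ^ enc_len * 2 ^ enc_len"
    unfolding val_def abs_mult using num_bound[OF assms] by (intro mult_mono) auto
  then show ?thesis by (simp add: power_add[symmetric] mult_2)
qed

definition "VA i l = val (i * n + l)"

text \<open>The projected unit vector \<open>N e\<^sub>j\<close> spans the kernel of the columns in \<open>basis I\<close> and \<open>j\<close>.\<close>

lemma direction_properties:
  assumes j: "j < n" and nc: "n \<le> nc" and r: "m \<le> r"
    and O: "ortho_proj r nc (\<lambda>i l. M i l * s l) d N"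
    and M: "\<And>i l. M i l = (if i < m \<and> l < n then VA i l else 0)"
    and s: "\<And>l. l < nc \<Longrightarrow> s l = (if l \<in> basis I \<or> l = j then 1 else 0)"
  shows "i < m \<Longrightarrow> (\<Sum>l<n. VA i l * N l j) = 0"
    and "l < n \<Longrightarrow> l \<notin> basis I \<Longrightarrow> l \<noteq> j \<Longrightarrow> N l j = 0"
    and "j \<notin> basis I \<Longrightarrow> 0 < N j j"
    and "j \<in> basis I \<Longrightarrow> l < n \<Longrightarrow> N l j = 0"
proof -
  have jc: "j < nc" using j nc by simp
  have A: "real_mat (matA I) \<in> carrier_mat m n" using carriers by simp
  have VA: "real_of_int (VA i l) = denom * real_mat (matA I) $$ (i, l)" if "i < m" "l < n" for i l
    using that carriers offsets_less(1) by (simp add: VA_def val_eq rats_index)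
  have trunc: "(\<Sum>p<nc. f p) = (\<Sum>p<n. f p)" if "\<And>p. p < nc \<Longrightarrow> n \<le> p \<Longrightarrow> f p = 0" for f :: "nat \<Rightarrow> 'a::comm_monoid_add"
    using nc that by (intro sum.mono_neutral_right) auto
  have row0: "(\<Sum>p<nc. (M i p * s p) * x p) = (if i < m then \<Sum>p<n. VA i p * s p * x p else 0)" for x :: "nat \<Rightarrow> real" and i
    by (subst trunc) (auto simp: M)
  have dead: "N l j = 0" if "l < nc" "l \<notin> basis I" "l \<noteq> j" for l
  proof -
    \<comment> \<open>For a column of scale \<open>0\<close> the unit vector lies in the kernel, so
      \<open>N\<close> maps it to \<open>d\<close> times itself, and its image has entry zero at
      \<open>j\<close>.\<close>
    define x :: "nat \<Rightarrow> real" where "x p = (if p = l then 1 else 0)" for p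
    have "(\<Sum>p<nc. (M i p * s p) * x p) = 0" for i
      using that s by (intro sum.neutral) (auto simp: x_def)
    then have "(\<Sum>p<nc. N j p * x p) = d * x j" using ortho_proj_kernel[OF O _ jc, of x] by simp
    moreover have "(\<Sum>p<nc. N j p * x p) = N j l"
      using that by (simp add: x_def if_distrib[of "(*) _"] cong: if_cong)
    ultimately show ?thesis using that ortho_proj_sym[OF O that(1) jc] by (simp add: x_def)
  qed
  then show "N l j = 0" if "l < n" "l \<notin> basis I" "l \<noteq> j" for l using that nc by simp
  have ker: "(\<Sum>l<n. VA i l * N l j) = 0" if i: "i < m" for i
  proof -
    have "(\<Sum>p<nc. N j p * (M i p * s p)) = 0" using ortho_proj_row[OF O _ jc] i r by simp
    moreover have "(\<Sum>p<nc. N j p * (M i p * s p)) = (\<Sum>p<n. N j p * (M i p * s p))"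
      by (rule trunc) (simp add: M)
    moreover have "(\<Sum>p<n. N j p * (M i p * s p)) = (\<Sum>l<n. VA i l * N l j)"
    proof (intro sum.cong refl)
      fix l assume "l \<in> {..<n}"
      then show "N j l * (M i l * s l) = VA i l * N l j"
        using dead[of l] ortho_proj_sym[OF O jc, of l] s[of l] nc i by (auto simp: M)
    qed
    ultimately show ?thesis by simp
  qed
  then show "(\<Sum>l<n. VA i l * N l j) = 0" if "i < m" for i using that by blast
  show "0 < N j j" if jB: "j \<notin> basis I"
  proof -
    obtain v where v: "\<And>l. l \<notin> basis I \<Longrightarrow> v l = 0"
      "\<And>i. i < m \<Longrightarrow> (\<Sum>l<n. real_mat (matA I) $$ (i, l) * v l) = real_mat (matA I) $$ (i, j)"
      using basic_solution_sat[OF A carriers(8), of "vec m (\<lambda>i. real_mat (matA I) $$ (i, j))"] by auto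
    \<comment> \<open>The unit vector of \<open>j\<close> minus the coordinates of column
      \<open>j\<close> in the basis: a kernel vector with entry \<open>1\<close> at
      \<open>j\<close>. Row \<open>j\<close> of \<open>N\<close> maps it to \<open>d\<close>, so
      this row is not zero.\<close>
    define x where "x l = (if l = j then 1 else 0) - v l" for l
    have xj: "x j = 1" using v(1)[OF jB] by (simp add: x_def)
    have "(\<Sum>p<nc. (M i p * s p) * x p) = 0" if "i < r" for i
    proof (cases "i < m")
      case True
      have "(\<Sum>p<n. VA i p * s p * x p) = denom * (\<Sum>p<n. (if p = j then real_mat (matA I) $$ (i, p) else 0)
          - real_mat (matA I) $$ (i, p) * v p)"
        unfolding sum_distrib_left
      proof (intro sum.cong refl)
        fix p assume "p \<in> {..<n}"
        then show "VA i p * s p * x p = denom * ((if p = j then real_mat (matA I) $$ (i, p) else 0)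
          - real_mat (matA I) $$ (i, p) * v p)"
          using VA[OF True, of p] s[of p] nc v(1)[of p] by (auto simp: x_def algebra_simps)
      qed
      also have "\<dots> = 0" using v(2)[OF True] j by (simp add: sum_subtractf)
      finally show ?thesis using True row0 by simp
    qed (simp add: M)
    then have Nx: "(\<Sum>p<nc. N j p * x p) = d * x j" by (intro ortho_proj_kernel[OF O _ jc])
    have d: "1 \<le> d" using O by (simp add: ortho_proj_def)
    have "N j j \<noteq> 0"
    proof
      assume "N j j = 0"
      then have "N j p = 0" if "p < nc" for p
        using ortho_proj_entry_bound(3)[OF O that jc] ortho_proj_sym[OF O jc that] by simp
      then show False using Nx xj d by simp
    qed
    then show ?thesis using ortho_proj_entry_bound(1)[OF O jc jc] by simp
  qed
  show "N l j = 0" if jB: "j \<in> basis I" and l: "l < n" for l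
  proof -
    \<comment> \<open>For basic \<open>j\<close> the column is a kernel vector supported on the
      basis, hence zero.\<close>
    define u where "u l = (if l < n then real_of_int (N l j) else 0)" for l
    have Au: "(\<Sum>l<n. real_mat (matA I) $$ (i, l) * u l) = 0" if "i < m" for i
    proof -
      have "denom * (\<Sum>l<n. real_mat (matA I) $$ (i, l) * u l) = real_of_int (\<Sum>l<n. VA i l * N l j)"
        using VA[OF that] by (simp add: u_def sum_distrib_left mult.assoc)
      then show ?thesis using ker[OF that] denom_pos by simp
    qed
    have u0: "u l = 0" if "l \<notin> basis I" for l
    proof (cases "l < n")
      case True
      then show ?thesis using dead[of l] that jB nc by (auto simp: u_def)
    qed (simp add: u_def)
    have "u l = 0" by (rule is_basis_kernel[OF A carriers(8), of u, OF u0 Au])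
    then show ?thesis using l by (simp add: u_def)
  qed
qed

end

section \<open>The complete decision program\<close>

abbreviation (input) "v_res \<equiv> 0 :: nat"
abbreviation (input) "v_den \<equiv> 2 :: nat"
abbreviation (input) "v_val \<equiv> 3 :: nat"
abbreviation (input) "v_q \<equiv> 18 :: nat"
abbreviation (input) "v_coeff \<equiv> 23 :: nat"
abbreviation (input) "v_dir \<equiv> 24 :: nat"

definition "e_m = Inp (Num 1)"
definition "e_n = Inp (Num 2)"
definition "e_k = Inp (Num 3)"
definition "e_g = Inp (Num 4)"
definition "e_oB = Times e_m e_n"
definition "e_ob = Plus e_oB (Times e_m e_k)"
definition "e_oC = Plus e_ob e_m"
definition "e_oc = Plus e_oC (Times e_n e_k)"
definition "e_oD = Plus e_oc e_n"
definition "e_od = Plus e_oD (Times e_g e_k)"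
definition "e_nq = Plus e_od e_g"

definition "e_num x = Inp (Plus (Num 5) (Times (Num 2) (Var x)))"
definition "e_den x = Inp (Plus (Num 6) (Times (Num 2) (Var x)))"
definition "e_bas x = Inp (Plus (Plus (Num 5) (Times (Num 2) e_nq)) (Var x))"
definition "e_val e = Arr v_val e (Num 0)"
definition "e_index x e y = Plus (Times (Var x) e) (Var y)"

definition Read_Data :: com where
  "Read_Data = Set_Var v_den (Num 1) ;;
     For v_i e_nq (Set_Var v_den (Times (Var v_den) (e_den v_i))) ;;
     Fill v_val v_l v_p e_nq (Num 1) (Num 0) (Num 0) (Times (e_num v_l) (Quot (Var v_den) (e_den v_l)))"

definition Fill_Blocks :: com where
  "Fill_Blocks =
     Fill v_mat v_l v_p e_m e_n (Num 0) (Num 0) (e_val (e_index v_l e_n v_p)) ;;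
     Fill v_coeff v_l v_p e_m e_k (Num 0) (Num 0) (Minus (Num 0) (e_val (Plus e_oB (e_index v_l e_k v_p)))) ;;
     Fill v_coeff v_l v_p e_m (Num 1) (Num 0) e_k (Minus (Num 0) (e_val (Plus e_ob (Var v_l)))) ;;
     Fill v_coeff v_l v_p e_g e_k e_m (Num 0) (e_val (Plus e_oD (e_index v_l e_k v_p))) ;;
     Fill v_coeff v_l v_p e_g (Num 1) e_m e_k (Minus (Num 0) (e_val (Plus e_od (Var v_l))))"

definition Mark :: "aexp \<Rightarrow> com" where
  "Mark h = For v_i e_m (Asg v_scale (e_bas v_i) (Num 0) h)"

text \<open>Scales \<open>0\<close> and \<open>1\<close> remove all columns except those of the
  basis and \<open>j\<close>. At this stage \<open>v_mat\<close> holds \<open>A\<close> surrounded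
  by zeros, so the remaining kernel below index \<open>n\<close> is a line for nonbasic
  \<open>j\<close> and trivial for basic \<open>j\<close>; column \<open>j\<close> of the projection
  spans it.\<close>

definition Direction :: com where
  "Direction =
     Fill v_scale v_l v_p (Var v_nc) (Num 1) (Num 0) (Num 0) (Num 0) ;; Mark (Num 1) ;;
     Asg v_scale (Var v_j) (Num 0) (Num 1) ;; Proj ;;
     Fill v_dir v_l v_p (Num 1) e_n (Var v_j) (Num 0) (Arr v_proj (Var v_p) (Var v_j))"

definition Cost_Rows :: com where
  "Cost_Rows =
     Fill_With (Sum v_acc v_q e_n (Times (Arr v_dir (Var v_l) (Var v_q)) (e_val (Plus e_oC (e_index v_q e_k v_p)))))
       v_coeff v_l v_p e_n e_k (Plus e_m e_g) (Num 0) (Minus (Num 0) (Var v_acc)) ;;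
     Fill_With (Sum v_acc v_q e_n (Times (Arr v_dir (Var v_l) (Var v_q)) (e_val (Plus e_oc (Var v_q)))))
       v_coeff v_l v_p e_n (Num 1) (Plus e_m e_g) e_k (Minus (Num 0) (Var v_acc))"

text \<open>The columns of \<open>u\<close> are in place already, since \<open>v_mat\<close> still
  holds \<open>A\<close> with zeros around it.\<close>

definition Assemble :: com where
  "Assemble =
     Fill v_mat v_l v_p (Var v_nr) (Plus e_k (Num 1)) (Num 0) e_n (Arr v_coeff (Var v_l) (Var v_p)) ;;
     Fill v_mat v_l v_p (Var v_nr) e_k (Num 0) (Plus (Plus e_n e_k) (Num 1))
       (Minus (Num 0) (Arr v_coeff (Var v_l) (Var v_p))) ;;
     Fill v_mat v_l v_p (Plus e_g e_n) (Plus e_g e_n) e_m (Plus (Plus e_n (Times (Num 2) e_k)) (Num 1)) (delta v_l v_p)"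

text \<open>Three passes put \<open>v_s0\<close> on the live columns and \<open>0\<close> on the
  nonbasic columns of \<open>u\<close>.\<close>

definition Scale :: com where
  "Scale =
     Set_Var v_sweeps (Times (Num 4) (Times (Times (Var v_nc) (Var v_nc)) (Times (Var v_nc) (Var v_nc)))) ;;
     Fill v_scale v_l v_p (Var v_nc) (Num 1) (Num 0) (Num 0) (Var v_s0) ;;
     Fill v_scale v_l v_p e_n (Num 1) (Num 0) (Num 0) (Num 0) ;; Mark (Var v_s0)"

text \<open>Each check clears the result if a coordinate that has to be positive has scale
  \<open>0\<close>. A product of two squares is positive iff both factors are nonzero, which
  combines two inequations into one guard; the \<open>1\<close> by \<open>1\<close> check is a
  single test of the variable \<open>t\<close>.\<close>

definition Answer :: com where
  "Answer = Set_Var v_res (Num 1) ;;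
     Check v_res v_l v_p e_m e_n
       (Times (Times (Arr v_dir (Var v_p) (e_bas v_l)) (Arr v_dir (Var v_p) (e_bas v_l)))
         (Times (Minus (e_bas v_l) (Var v_p)) (Minus (e_bas v_l) (Var v_p))))
       (Minus (Num 1) (Arr v_scale (e_bas v_l) (Num 0))) ;;
     Check v_res v_l v_p (Num 1) (Num 1) (Num 1) (Minus (Num 1) (Arr v_scale (Plus e_n e_k) (Num 0))) ;;
     Check v_res v_l v_p e_n e_n (Minus (Num 0) (Arr v_dir (Var v_l) (Var v_p)))
       (Minus (Num 1) (Arr v_scale (Plus (Plus (Plus (Plus e_n (Times (Num 2) e_k)) (Num 1)) e_g) (Var v_l)) (Num 0)))"

definition Main :: com where
  "Main =
     Set_Var v_nc (Plus (Plus (Plus (Plus e_n (Times (Num 2) e_k)) (Num 1)) e_g) e_n) ;;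
     Set_Var v_nr (Plus (Plus e_m e_g) e_n) ;;
     Read_Data ;; Fill_Blocks ;; For v_j e_n Direction ;; Cost_Rows ;; Assemble ;; Bound ;; Scale ;; Solve ;; Answer"

text \<open>If \<open>n = g = 0\<close>, then also \<open>m = 0\<close> and no matrix entry is encoded, so \<open>k\<close> may be exponential in
  the encoding length and must not bound a loop.\<close>

definition Decide :: com where
  "Decide = CIf (Plus e_n e_g) Main (Set_Var v_res (Num 1))"

lemma vars_offsets [simp]:
  "vars e_m = {}" "vars e_n = {}" "vars e_k = {}" "vars e_g = {}" "vars e_oB = {}" "vars e_ob = {}"
  "vars e_oC = {}" "vars e_oc = {}" "vars e_oD = {}" "vars e_od = {}" "vars e_nq = {}"
  by (simp_all add: e_m_def e_n_def e_k_def e_g_def e_oB_def e_ob_def e_oC_def e_oc_def e_oD_def e_od_def e_nq_def)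

lemma mods_Main_parts [simp]:
  "mods Read_Data = {v_den, v_i, v_val, v_l, v_p}" "mods Fill_Blocks = {v_mat, v_coeff, v_l, v_p}"
  "mods (Mark h) = {v_scale, v_i}"
  "mods Direction = {v_scale, v_l, v_p, v_i, v_proj, v_det, v_image, v_acc, v_alpha, v_dir}"
  by (auto simp: Read_Data_def Fill_Blocks_def Mark_def Direction_def)

lemma nat_index [simp]:
  "nat (int a + int b * int c) = a + b * c"
  "nat (int b * int c + int d) = b * c + d"
  "nat (int a + (int b * int c + int d)) = a + (b * c + d)"
  by (simp_all add: nat_add_distrib nat_mult_distrib)

section \<open>Correctness of the stages of the decision program\<close>

context bilfp_instance
begin

lemma aval_offsets [simp]:
  "aval inp e_m \<sigma> = int m" "aval inp e_n \<sigma> = int n" "aval inp e_k \<sigma> = int k" "aval inp e_g \<sigma> = int g"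
  "aval inp e_oB \<sigma> = int oB" "aval inp e_ob \<sigma> = int ob" "aval inp e_oC \<sigma> = int oC" "aval inp e_oc \<sigma> = int oc"
  "aval inp e_oD \<sigma> = int oD" "aval inp e_od \<sigma> = int od" "aval inp e_nq \<sigma> = int nq"
  using inp_dims
  by (simp_all add: e_m_def e_n_def e_k_def e_g_def e_oB_def e_ob_def e_oC_def e_oc_def e_oD_def e_od_def e_nq_def
      oB_def ob_def oC_def oc_def oD_def od_def nq_def)

lemma ok_offsets [simp]:
  "ok inp e_m \<sigma>" "ok inp e_n \<sigma>" "ok inp e_k \<sigma>" "ok inp e_g \<sigma>" "ok inp e_oB \<sigma>" "ok inp e_ob \<sigma>"
  "ok inp e_oC \<sigma>" "ok inp e_oc \<sigma>" "ok inp e_oD \<sigma>" "ok inp e_od \<sigma>" "ok inp e_nq \<sigma>"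
  by (simp_all add: e_m_def e_n_def e_k_def e_g_def e_oB_def e_ob_def e_oC_def e_oc_def e_oD_def e_od_def e_nq_def)

lemma e_num_den:
  assumes "\<sigma> x 0 0 = int q" "x < 32" "q < nq"
  shows "ok inp (e_num x) \<sigma>" "aval inp (e_num x) \<sigma> = num q"
    "ok inp (e_den x) \<sigma>" "aval inp (e_den x) \<sigma> = den q"
  using assms inp_rats by (simp_all add: e_num_def e_den_def)

lemma e_bas:
  assumes "\<sigma> x 0 0 = int i" "x < 32" "i < m"
  shows "ok inp (e_bas x) \<sigma>" "aval inp (e_bas x) \<sigma> = int (bas i)"
  using assms inp_basis by (simp_all add: e_bas_def)

definition "ncols = n + 2 * k + 1 + g + n"
definition "nrows' = m + g + n"
definition "lp_coeff X = sys_coeff m n k g (\<lambda>i p. val (oB + (i * k + p))) (\<lambda>i. val (ob + i))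
  (\<lambda>l p. val (oC + (l * k + p))) (\<lambda>l. val (oc + l)) (\<lambda>i p. val (oD + (i * k + p))) (\<lambda>i. val (od + i)) X"

definition "is_direction j f \<longleftrightarrow> (\<forall>i<m. (\<Sum>l<n. VA i l * f l) = 0) \<and>
  (\<forall>l<n. l \<notin> basis I \<longrightarrow> l \<noteq> j \<longrightarrow> f l = 0) \<and> (j \<notin> basis I \<longrightarrow> 0 < f j) \<and>
  (j \<in> basis I \<longrightarrow> (\<forall>l<n. f l = 0))" for f :: "nat \<Rightarrow> int"

lemma bilfp_system:
  assumes "\<And>j. j < n \<Longrightarrow> is_direction j (X j)"
  shows "bilfp_system I m n k g denom VA (\<lambda>i p. val (oB + (i * k + p))) (\<lambda>l p. val (oC + (l * k + p)))
    (\<lambda>i p. val (oD + (i * k + p))) X (\<lambda>i. val (ob + i)) (\<lambda>l. val (oc + l)) (\<lambda>i. val (od + i))"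
proof
  show "I \<in> bilfp_instances" by (rule inst)
  show "m = nrows I" "n = nvars I" "k = nparams I" "g = nineqs I"
    by (simp_all add: m_def n_def k_def g_def)
  show "0 < denom" by (rule denom_pos)
qed (use assms in \<open>auto simp: VA_def val_eq offsets_less rats_index is_direction_def\<close>)

end

text \<open>Keeps correctness apart from size estimates: \<open>R\<close> and \<open>B\<close> bound
  loop counts and stored values, \<open>V1\<close> the integral data, and \<open>A2\<close> the
  entries of the assembled matrix. The \<open>phase1\<close> conditions are those of
  \<open>wp_Proj\<close> for scales \<open>0\<close> and \<open>1\<close>, as used for the
  directions.\<close>

locale bilfp_run = bilfp_instance +
  fixes R :: nat and B V1 A2 :: int
  assumes R: "nq \<le> R" "ncols \<le> R" "nrows' \<le> R" "1 \<le> R"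
    and B: "int nq \<le> B" "int ncols \<le> B" "int nrows' \<le> B" "1 \<le> B"
    and denom_B: "\<And>j. j \<le> nq \<Longrightarrow> \<bar>\<Prod>q<j. den q\<bar> \<le> B"
    and V1: "\<And>q. q < nq \<Longrightarrow> \<bar>val q\<bar> \<le> V1" "1 \<le> V1" "V1 \<le> B"
    and phase1: "(int ncols * V1\<^sup>2 + 1) ^ nrows' \<le> B"
      "int ncols * (V1 * (int ncols * ((int ncols * V1\<^sup>2 + 1) ^ nrows' * V1))) \<le> B"
    and A2: "int n * ((int ncols * V1\<^sup>2 + 1) ^ nrows' * V1) \<le> A2" "V1 \<le> A2" "A2 \<le> B"
begin

definition "D1 = (int ncols * V1\<^sup>2 + 1) ^ nrows'"

lemma small: "m \<le> R" "n \<le> R" "k \<le> R" "g \<le> R" "int m \<le> B" "int n \<le> B" "int k \<le> B" "int g \<le> B"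
  "n \<le> ncols" "m \<le> nrows'"
  using R B by (simp_all add: ncols_def nrows'_def)

lemma wp_Read_Data:
  assumes post: "\<And>\<tau>. (\<And>q. q < nq \<Longrightarrow> \<tau> v_val q 0 = val q) \<Longrightarrow>
      (\<And>z. z \<notin> mods Read_Data \<Longrightarrow> \<tau> z = \<sigma> z) \<Longrightarrow> Q \<tau>"
  shows "wp inp R B Read_Data Q \<sigma>"
  unfolding Read_Data_def
proof (rule wp_Seq, rule wp_Set_Var)
  show "wp inp R B (For v_i e_nq (Set_Var v_den (Times (Var v_den) (e_den v_i))) ;;
     Fill v_val v_l v_p e_nq (Num 1) (Num 0) (Num 0) (Times (e_num v_l) (Quot (Var v_den) (e_den v_l)))) Q
     (upd \<sigma> v_den 0 0 (aval inp (Num 1) \<sigma>))"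
  proof (rule wp_Seq, rule wp_For[where n = nq and I = "\<lambda>j \<tau>. \<tau> v_den 0 0 = (\<Prod>q<j. den q)"])
    fix j and \<tau> :: store assume j: "j < nq" and I: "\<tau> v_den 0 0 = (\<Prod>q<j. den q)" and i: "\<tau> v_i 0 0 = int j"
    show "wp inp R B (Set_Var v_den (Times (Var v_den) (e_den v_i)))
      (\<lambda>\<tau>'. upd \<tau>' v_i 0 0 (int (Suc j)) v_den 0 0 = (\<Prod>q<Suc j. den q)) \<tau>"
      using e_num_den(3,4)[of \<tau> v_i j] i j I denom_B[of "Suc j"] by simp
  next
    fix \<tau> :: store assume gcd: "\<tau> v_den 0 0 = (\<Prod>q<nq. den q)"
      and fr: "\<And>y. y \<notin> insert v_i (mods (Set_Var v_den (Times (Var v_den) (e_den v_i)))) \<Longrightarrow>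
        \<tau> y = upd \<sigma> v_den 0 0 (aval inp (Num 1) \<sigma>) y"
    show "wp inp R B (Fill v_val v_l v_p e_nq (Num 1) (Num 0) (Num 0) (Times (e_num v_l) (Quot (Var v_den) (e_den v_l)))) Q \<tau>"
    proof (rule wp_Fill[where a = nq and b = 1 and rb = 0 and cb = 0 and F = "\<lambda>i j. val i"])
      fix i j and \<rho> :: store assume i: "i < nq" and l: "\<rho> v_l 0 0 = int i" and fr2: "\<And>z. z \<notin> {v_val, v_l, v_p} \<Longrightarrow> \<rho> z = \<tau> z"
      show "ok inp (Times (e_num v_l) (Quot (Var v_den) (e_den v_l))) \<rho> \<and>
        aval inp (Times (e_num v_l) (Quot (Var v_den) (e_den v_l))) \<rho> = val i"
        using e_num_den[of \<rho> v_l i] l i gcd fr2 by (simp add: val_def denom_def)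
    next
      fix \<rho> :: store assume "\<And>i j. i < nq \<Longrightarrow> j < 1 \<Longrightarrow> \<rho> v_val (0 + i) (0 + j) = val i"
        "\<And>z. z \<notin> {v_val, v_l, v_p} \<Longrightarrow> \<rho> z = \<tau> z"
      then show "Q \<rho>" using fr by (intro post) auto
    next
      fix i j assume "i < nq"
      then show "\<bar>val i\<bar> \<le> B" using V1(1)[of i] V1(3) by linarith
    qed (use R B in auto)
  qed (use R B in \<open>auto simp: e_den_def\<close>)
qed (use B in auto)

lemma val_B: "q < nq \<Longrightarrow> \<bar>val q\<bar> \<le> B" "q < nq \<Longrightarrow> \<bar>- val q\<bar> \<le> B"
  using V1(1)[of q] V1(3) by linarith+

lemma wp_Fill_Blocks:
  assumes v: "\<And>q. q < nq \<Longrightarrow> \<sigma> v_val q 0 = val q" and zero: "\<And>i l. \<sigma> v_mat i l = 0"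
    and post: "\<And>\<tau>. (\<And>i l. \<tau> v_mat i l = (if i < m \<and> l < n then VA i l else 0)) \<Longrightarrow>
      (\<And>i p X. i < m + g \<Longrightarrow> p \<le> k \<Longrightarrow> \<tau> v_coeff i p = lp_coeff X i p) \<Longrightarrow>
      (\<And>z. z \<notin> mods Fill_Blocks \<Longrightarrow> \<tau> z = \<sigma> z) \<Longrightarrow> Q \<tau>"
  shows "wp inp R B Fill_Blocks Q \<sigma>"
  unfolding Fill_Blocks_def
proof (rule wp_Seq, rule wp_Fill[where a = m and b = n and rb = 0 and cb = 0 and F = VA])
  fix \<tau>1 :: store assume m1: "\<And>i j. i < m \<Longrightarrow> j < n \<Longrightarrow> \<tau>1 v_mat (0 + i) (0 + j) = VA i j"
    "\<And>i j. \<not> (0 \<le> i \<and> i < 0 + m \<and> 0 \<le> j \<and> j < 0 + n) \<Longrightarrow> \<tau>1 v_mat i j = \<sigma> v_mat i j"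
    and f1: "\<And>z. z \<notin> {v_mat, v_l, v_p} \<Longrightarrow> \<tau>1 z = \<sigma> z"
  show "wp inp R B (Fill v_coeff v_l v_p e_m e_k (Num 0) (Num 0) (Minus (Num 0) (e_val (Plus e_oB (e_index v_l e_k v_p)))) ;;
     Fill v_coeff v_l v_p e_m (Num 1) (Num 0) e_k (Minus (Num 0) (e_val (Plus e_ob (Var v_l)))) ;;
     Fill v_coeff v_l v_p e_g e_k e_m (Num 0) (e_val (Plus e_oD (e_index v_l e_k v_p))) ;;
     Fill v_coeff v_l v_p e_g (Num 1) e_m e_k (Minus (Num 0) (e_val (Plus e_od (Var v_l))))) Q \<tau>1"
  proof (rule wp_Seq, rule wp_Fill[where a = m and b = k and rb = 0 and cb = 0 and F = "\<lambda>i p. - val (oB + (i * k + p))"])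
    fix \<tau>2 :: store assume m2: "\<And>i j. i < m \<Longrightarrow> j < k \<Longrightarrow> \<tau>2 v_coeff (0 + i) (0 + j) = - val (oB + (i * k + j))"
      and f2: "\<And>z. z \<notin> {v_coeff, v_l, v_p} \<Longrightarrow> \<tau>2 z = \<tau>1 z"
    show "wp inp R B (Fill v_coeff v_l v_p e_m (Num 1) (Num 0) e_k (Minus (Num 0) (e_val (Plus e_ob (Var v_l)))) ;;
     Fill v_coeff v_l v_p e_g e_k e_m (Num 0) (e_val (Plus e_oD (e_index v_l e_k v_p))) ;;
     Fill v_coeff v_l v_p e_g (Num 1) e_m e_k (Minus (Num 0) (e_val (Plus e_od (Var v_l))))) Q \<tau>2"
    proof (rule wp_Seq, rule wp_Fill[where a = m and b = 1 and rb = 0 and cb = k and F = "\<lambda>i p. - val (ob + i)"])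
      fix \<tau>3 :: store assume m3: "\<And>i j. i < m \<Longrightarrow> j < 1 \<Longrightarrow> \<tau>3 v_coeff (0 + i) (k + j) = - val (ob + i)"
        "\<And>i j. \<not> (0 \<le> i \<and> i < 0 + m \<and> k \<le> j \<and> j < k + 1) \<Longrightarrow> \<tau>3 v_coeff i j = \<tau>2 v_coeff i j"
        and f3: "\<And>z. z \<notin> {v_coeff, v_l, v_p} \<Longrightarrow> \<tau>3 z = \<tau>2 z"
      show "wp inp R B (Fill v_coeff v_l v_p e_g e_k e_m (Num 0) (e_val (Plus e_oD (e_index v_l e_k v_p))) ;;
         Fill v_coeff v_l v_p e_g (Num 1) e_m e_k (Minus (Num 0) (e_val (Plus e_od (Var v_l))))) Q \<tau>3"
      proof (rule wp_Seq, rule wp_Fill[where a = g and b = k and rb = m and cb = 0 and F = "\<lambda>i p. val (oD + (i * k + p))"])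
        fix \<tau>4 :: store assume m4: "\<And>i j. i < g \<Longrightarrow> j < k \<Longrightarrow> \<tau>4 v_coeff (m + i) (0 + j) = val (oD + (i * k + j))"
          "\<And>i j. \<not> (m \<le> i \<and> i < m + g \<and> 0 \<le> j \<and> j < 0 + k) \<Longrightarrow> \<tau>4 v_coeff i j = \<tau>3 v_coeff i j"
          and f4: "\<And>z. z \<notin> {v_coeff, v_l, v_p} \<Longrightarrow> \<tau>4 z = \<tau>3 z"
        show "wp inp R B (Fill v_coeff v_l v_p e_g (Num 1) e_m e_k (Minus (Num 0) (e_val (Plus e_od (Var v_l))))) Q \<tau>4"
        proof (rule wp_Fill[where a = g and b = 1 and rb = m and cb = k and F = "\<lambda>i p. - val (od + i)"])
          fix \<tau>5 :: store assume m5: "\<And>i j. i < g \<Longrightarrow> j < 1 \<Longrightarrow> \<tau>5 v_coeff (m + i) (k + j) = - val (od + i)"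
            "\<And>i j. \<not> (m \<le> i \<and> i < m + g \<and> k \<le> j \<and> j < k + 1) \<Longrightarrow> \<tau>5 v_coeff i j = \<tau>4 v_coeff i j"
            and f5: "\<And>z. z \<notin> {v_coeff, v_l, v_p} \<Longrightarrow> \<tau>5 z = \<tau>4 z"
          show "Q \<tau>5"
          proof (rule post)
            show "\<tau>5 v_mat i l = (if i < m \<and> l < n then VA i l else 0)" for i l
              using m1(1)[of i l] m1(2)[of i l] zero f5[of v_mat] f4[of v_mat] f3[of v_mat] f2[of v_mat] by auto
            show "\<tau>5 v_coeff i p = lp_coeff X i p" if i: "i < m + g" and p: "p \<le> k" for i p X
            proof (cases "i < m")
              case True
              have "\<tau>5 v_coeff i p = \<tau>3 v_coeff i p" using m5(2)[of i p] m4(2)[of i p] True by simp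
              then show ?thesis
                using True p m3(1)[of i 0] m3(2)[of i p] m2[of i p]
                by (cases "p = k") (auto simp: lp_coeff_def sys_coeff_def)
            next
              case False
              then obtain i' where i': "i = m + i'" "i' < g" using i by (metis add_less_cancel_left le_Suc_ex not_less)
              then show ?thesis
                using p m5(1)[of i' 0] m5(2)[of i p] m4(1)[of i' p]
                by (cases "p = k") (auto simp: lp_coeff_def sys_coeff_def)
            qed
            show "\<tau>5 z = \<sigma> z" if "z \<notin> mods Fill_Blocks" for z
              using that f1 f2 f3 f4 f5 by simp
          qed
        qed (use small R B f1 f2 f3 f4 v val_B offsets_less in \<open>auto simp: e_val_def e_index_def nat_int_add\<close>)
      qed (use small R B f1 f2 f3 v val_B offsets_less in \<open>auto simp: e_val_def e_index_def nat_int_add\<close>)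
    qed (use small R B f1 f2 v val_B offsets_less in \<open>auto simp: e_val_def e_index_def nat_int_add\<close>)
  qed (use small R B f1 v val_B offsets_less in \<open>auto simp: e_val_def e_index_def nat_int_add\<close>)
qed (use small R B v val_B offsets_less in \<open>auto simp: e_val_def e_index_def nat_int_add VA_def\<close>)

end

lemma cone_cong:
  assumes "\<And>i l. i < r \<Longrightarrow> l < n \<Longrightarrow> M i l = M' i l"
  shows "cone r n M S = cone r n M' S"
proof -
  have "(\<Sum>l<n. M i l * x l) = (\<Sum>l<n. M' i l * x l)" if "i < r" for i and x :: "nat \<Rightarrow> real"
    using assms[OF that] by (intro sum.cong) auto
  then show ?thesis unfolding cone_def by auto
qed

lemma mods_more_parts [simp]:
  "mods Cost_Rows = {v_coeff, v_l, v_p, v_acc, v_q}" "mods Assemble = {v_mat, v_l, v_p}"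
  "mods Scale = {v_sweeps, v_scale, v_l, v_p, v_i}" "mods Answer = {v_res, v_l, v_p}"
  by (auto simp: Cost_Rows_def Assemble_def Scale_def Answer_def)

context bilfp_run
begin

lemma wp_Mark:
  assumes h: "\<And>\<tau>. (\<And>z. z \<notin> {v_scale, v_i} \<Longrightarrow> \<tau> z = \<sigma> z) \<Longrightarrow> ok inp h \<tau> \<and> aval inp h \<tau> = c"
    and c: "\<bar>c\<bar> \<le> B"
    and post: "\<And>\<tau>. (\<And>l. \<tau> v_scale l 0 = (if l \<in> basis I then c else \<sigma> v_scale l 0)) \<Longrightarrow>
      (\<And>z. z \<notin> {v_scale, v_i} \<Longrightarrow> \<tau> z = \<sigma> z) \<Longrightarrow> Q \<tau>"
  shows "wp inp R B (Mark h) Q \<sigma>"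
  unfolding Mark_def
proof (rule wp_For[where n = m and I = "\<lambda>i \<tau>. \<forall>l. \<tau> v_scale l 0 = (if l \<in> bas ` {..<i} then c else \<sigma> v_scale l 0)"])
  fix i and \<tau> :: store assume i: "i < m" and I: "\<forall>l. \<tau> v_scale l 0 = (if l \<in> bas ` {..<i} then c else \<sigma> v_scale l 0)"
    and iv: "\<tau> v_i 0 0 = int i"
    and fr: "\<And>y. y \<notin> insert v_i (mods (Asg v_scale (e_bas v_i) (Num 0) h)) \<Longrightarrow> \<tau> y = \<sigma> y"
  have "ok inp h \<tau> \<and> aval inp h \<tau> = c" by (rule h) (use fr in auto)
  then show "wp inp R B (Asg v_scale (e_bas v_i) (Num 0) h)
    (\<lambda>\<tau>'. \<forall>l. upd \<tau>' v_i 0 0 (int (Suc i)) v_scale l 0 = (if l \<in> bas ` {..<Suc i} then c else \<sigma> v_scale l 0)) \<tau>"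
    using e_bas[of \<tau> v_i i] iv i I c by (auto simp: lessThan_Suc)
next
  fix \<tau> :: store assume "\<forall>l. \<tau> v_scale l 0 = (if l \<in> bas ` {..<m} then c else \<sigma> v_scale l 0)"
    and "\<And>y. y \<notin> insert v_i (mods (Asg v_scale (e_bas v_i) (Num 0) h)) \<Longrightarrow> \<tau> y = \<sigma> y"
  then show "Q \<tau>" unfolding basis_eq[symmetric] by (intro post) auto
qed (use small in auto)

lemma is_direction_cong: "is_direction j f \<Longrightarrow> j < n \<Longrightarrow> (\<And>l. l < n \<Longrightarrow> f' l = f l) \<Longrightarrow> is_direction j f'"
  unfolding is_direction_def by auto

lemma VA_V1: "i < m \<Longrightarrow> l < n \<Longrightarrow> \<bar>VA i l\<bar> \<le> V1"
  using V1(1) offsets_less(1) by (simp add: VA_def)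

lemma wp_Direction:
  assumes nc: "\<sigma> v_nc 0 0 = int ncols" and nr: "\<sigma> v_nr 0 0 = int nrows'"
    and mat: "\<And>i l. \<sigma> v_mat i l = (if i < m \<and> l < n then VA i l else 0)"
    and j: "\<sigma> v_j 0 0 = int j" "j < n"
    and post: "\<And>\<tau>. is_direction j (\<tau> v_dir j) \<Longrightarrow> (\<And>l. l < n \<Longrightarrow> \<bar>\<tau> v_dir j l\<bar> \<le> D1) \<Longrightarrow>
      (\<And>j'. j' \<noteq> j \<Longrightarrow> \<tau> v_dir j' = \<sigma> v_dir j') \<Longrightarrow>
      (\<And>z. z \<notin> mods Direction \<Longrightarrow> \<tau> z = \<sigma> z) \<Longrightarrow> Q \<tau>"
  shows "wp inp R B Direction Q \<sigma>"
  unfolding Direction_def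
proof (rule wp_Seq, rule wp_Fill[where a = ncols and b = 1 and rb = 0 and cb = 0 and F = "\<lambda>i j. 0"])
  fix \<tau>1 :: store assume s1: "\<And>i j. i < ncols \<Longrightarrow> j < 1 \<Longrightarrow> \<tau>1 v_scale (0 + i) (0 + j) = 0"
    and f1: "\<And>z. z \<notin> {v_scale, v_l, v_p} \<Longrightarrow> \<tau>1 z = \<sigma> z"
  show "wp inp R B (Mark (Num 1) ;; Asg v_scale (Var v_j) (Num 0) (Num 1) ;; Proj ;;
     Fill v_dir v_l v_p (Num 1) e_n (Var v_j) (Num 0) (Arr v_proj (Var v_p) (Var v_j))) Q \<tau>1"
  proof (rule wp_Seq, rule wp_Mark[where c = 1])
    fix \<tau>2 :: store assume s2: "\<And>l. \<tau>2 v_scale l 0 = (if l \<in> basis I then 1 else \<tau>1 v_scale l 0)"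
      and f2: "\<And>z. z \<notin> {v_scale, v_i} \<Longrightarrow> \<tau>2 z = \<tau>1 z"
    define \<tau>3 where "\<tau>3 = upd \<tau>2 v_scale j 0 1"
    have f3: "\<tau>3 z = \<sigma> z" if "z \<notin> {v_scale, v_l, v_p, v_i}" for z
      using that f1[of z] f2[of z] by (auto simp: \<tau>3_def)
    have s3: "\<tau>3 v_scale l 0 = (if l \<in> basis I \<or> l = j then 1 else 0)" if "l < ncols" for l
      using s1[OF that, of 0] s2[of l] by (auto simp: \<tau>3_def)
    have "wp inp R B (Proj ;; Fill v_dir v_l v_p (Num 1) e_n (Var v_j) (Num 0) (Arr v_proj (Var v_p) (Var v_j))) Q \<tau>3"
    proof (rule wp_Seq, rule wp_Proj[where n = ncols and r = nrows' and A = V1 and D = D1])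
      show "\<bar>\<tau>3 v_mat i l * \<tau>3 v_scale l 0\<bar> \<le> V1" if "i < nrows'" "l < ncols" for i l
        using s3[OF that(2)] VA_V1[of i l] V1(2) f3[of v_mat] mat by (auto simp: abs_mult)
      fix \<tau>4 :: store assume O: "ortho_proj nrows' ncols (\<lambda>i l. \<tau>3 v_mat i l * \<tau>3 v_scale l 0) (\<tau>4 v_det 0 0) (\<tau>4 v_proj)"
        and d: "\<tau>4 v_det 0 0 \<le> D1"
        and f4: "\<And>z. z \<notin> {v_proj, v_l, v_p, v_det, v_i, v_image, v_acc, v_alpha} \<Longrightarrow> \<tau>4 z = \<tau>3 z"
      have M: "\<tau>3 v_mat i l = (if i < m \<and> l < n then VA i l else 0)" for i l using f3[of v_mat] mat by simp
      have dir: "is_direction j (\<lambda>l. \<tau>4 v_proj l j)"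
        unfolding is_direction_def
        using direction_properties[OF j(2) small(9,10) O M s3] by blast
      have bnd: "\<bar>\<tau>4 v_proj l j\<bar> \<le> D1" if "l < n" for l
        using ortho_proj_entry_bound(2)[OF O, of l j] that j(2) small(9) d by auto
      have jv: "\<tau>4 v_j 0 0 = int j" using f4[of v_j] f3[of v_j] j by simp
      show "wp inp R B (Fill v_dir v_l v_p (Num 1) e_n (Var v_j) (Num 0) (Arr v_proj (Var v_p) (Var v_j))) Q \<tau>4"
      proof (rule wp_Fill[where a = 1 and b = n and rb = j and cb = 0 and F = "\<lambda>i l. \<tau>4 v_proj l j"])
        fix \<tau>5 :: store assume x5: "\<And>i l. i < 1 \<Longrightarrow> l < n \<Longrightarrow> \<tau>5 v_dir (j + i) (0 + l) = \<tau>4 v_proj l j"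
          "\<And>i l. \<not> (j \<le> i \<and> i < j + 1 \<and> 0 \<le> l \<and> l < 0 + n) \<Longrightarrow> \<tau>5 v_dir i l = \<tau>4 v_dir i l"
          and f5: "\<And>z. z \<notin> {v_dir, v_l, v_p} \<Longrightarrow> \<tau>5 z = \<tau>4 z"
        have x: "\<tau>5 v_dir j l = \<tau>4 v_proj l j" if "l < n" for l using x5(1)[of 0 l] that by simp
        show "Q \<tau>5"
        proof (rule post)
          show "is_direction j (\<tau>5 v_dir j)" by (rule is_direction_cong[OF dir j(2) x])
          show "\<bar>\<tau>5 v_dir j l\<bar> \<le> D1" if "l < n" for l using x[OF that] bnd[OF that] by simp
          show "\<tau>5 v_dir j' = \<sigma> v_dir j'" if "j' \<noteq> j" for j'
          proof
            fix l
            have "\<tau>5 v_dir j' l = \<tau>4 v_dir j' l" using that by (intro x5(2)) auto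
            then show "\<tau>5 v_dir j' l = \<sigma> v_dir j' l" using f4[of v_dir] f3[of v_dir] by simp
          qed
          show "\<tau>5 z = \<sigma> z" if "z \<notin> mods Direction" for z
            using that f3[of z] f4[of z] f5[of z] by simp
        qed
      next
        fix i l assume "l < n"
        then show "\<bar>\<tau>4 v_proj l j\<bar> \<le> B" using bnd[of l] phase1(1) by (simp add: D1_def)
      qed (use small R B jv in auto)
    qed (use f3 nc nr R B V1 phase1 in \<open>auto simp: D1_def\<close>)
    then show "wp inp R B (Asg v_scale (Var v_j) (Num 0) (Num 1) ;; Proj ;;
     Fill v_dir v_l v_p (Num 1) e_n (Var v_j) (Num 0) (Arr v_proj (Var v_p) (Var v_j))) Q \<tau>2"
      using f1[of v_j] f2[of v_j] j B by (simp add: \<tau>3_def)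
  qed (use B in auto)
qed (use nc R B in auto)

lemma wp_Directions:
  assumes nc: "\<sigma> v_nc 0 0 = int ncols" and nr: "\<sigma> v_nr 0 0 = int nrows'"
    and mat: "\<And>i l. \<sigma> v_mat i l = (if i < m \<and> l < n then VA i l else 0)"
    and post: "\<And>\<tau>. (\<And>j. j < n \<Longrightarrow> is_direction j (\<tau> v_dir j)) \<Longrightarrow> (\<And>j l. j < n \<Longrightarrow> l < n \<Longrightarrow> \<bar>\<tau> v_dir j l\<bar> \<le> D1) \<Longrightarrow>
      (\<And>z. z \<notin> insert v_j (mods Direction) \<Longrightarrow> \<tau> z = \<sigma> z) \<Longrightarrow> Q \<tau>"
  shows "wp inp R B (For v_j e_n Direction) Q \<sigma>"
proof (rule wp_For[where n = n and I = "\<lambda>j \<tau>. \<forall>j'<j. is_direction j' (\<tau> v_dir j') \<and> (\<forall>l<n. \<bar>\<tau> v_dir j' l\<bar> \<le> D1)"])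
  fix j and \<tau> :: store assume j: "j < n" and I: "\<forall>j'<j. is_direction j' (\<tau> v_dir j') \<and> (\<forall>l<n. \<bar>\<tau> v_dir j' l\<bar> \<le> D1)"
    and jv: "\<tau> v_j 0 0 = int j" and fr: "\<And>y. y \<notin> insert v_j (mods Direction) \<Longrightarrow> \<tau> y = \<sigma> y"
  show "wp inp R B Direction (\<lambda>\<tau>'. \<forall>j'<Suc j. is_direction j' (upd \<tau>' v_j 0 0 (int (Suc j)) v_dir j') \<and>
      (\<forall>l<n. \<bar>upd \<tau>' v_j 0 0 (int (Suc j)) v_dir j' l\<bar> \<le> D1)) \<tau>"
  proof (rule wp_Direction[where j = j])
    fix \<rho> :: store assume "is_direction j (\<rho> v_dir j)" "\<And>l. l < n \<Longrightarrow> \<bar>\<rho> v_dir j l\<bar> \<le> D1"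
      "\<And>j'. j' \<noteq> j \<Longrightarrow> \<rho> v_dir j' = \<tau> v_dir j'"
    then show "\<forall>j'<Suc j. is_direction j' (upd \<rho> v_j 0 0 (int (Suc j)) v_dir j') \<and>
      (\<forall>l<n. \<bar>upd \<rho> v_j 0 0 (int (Suc j)) v_dir j' l\<bar> \<le> D1)"
      using I by (auto simp: less_Suc_eq)
  qed (use fr nc nr mat j jv in auto)
qed (use small post in auto)

lemma wp_Cost_Rows:
  assumes v: "\<And>q. q < nq \<Longrightarrow> \<sigma> v_val q 0 = val q"
    and X: "\<And>j l. j < n \<Longrightarrow> l < n \<Longrightarrow> \<bar>\<sigma> v_dir j l\<bar> \<le> D1"
    and old: "\<And>i p. i < m + g \<Longrightarrow> p \<le> k \<Longrightarrow> \<sigma> v_coeff i p = lp_coeff (\<sigma> v_dir) i p"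
    and post: "\<And>\<tau>. (\<And>i p. i < nrows' \<Longrightarrow> p \<le> k \<Longrightarrow> \<tau> v_coeff i p = lp_coeff (\<sigma> v_dir) i p) \<Longrightarrow>
      (\<And>z. z \<notin> mods Cost_Rows \<Longrightarrow> \<tau> z = \<sigma> z) \<Longrightarrow> Q \<tau>"
  shows "wp inp R B Cost_Rows Q \<sigma>"
proof -
  have D1: "0 \<le> D1" unfolding D1_def by simp
  have sumB: "(\<Sum>l<n. \<bar>\<sigma> v_dir j l * val (f l)\<bar>) \<le> B" if "j < n" "\<And>l. l < n \<Longrightarrow> f l < nq" for j f
  proof -
    have "\<bar>\<sigma> v_dir j l * val (f l)\<bar> \<le> D1 * V1" if "l < n" for l
      unfolding abs_mult using X[OF \<open>j < n\<close> that] V1(1)[OF \<open>\<And>l. l < n \<Longrightarrow> f l < nq\<close>[OF that]] D1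
      by (intro mult_mono) auto
    then have "(\<Sum>l<n. \<bar>\<sigma> v_dir j l * val (f l)\<bar>) \<le> int n * (D1 * V1)"
      using sum_bounded_above[of "{..<n}" "\<lambda>l. \<bar>\<sigma> v_dir j l * val (f l)\<bar>" "D1 * V1"] by simp
    then show ?thesis using A2 by (simp add: D1_def)
  qed
  have negB: "\<bar>- (\<Sum>l<n. \<sigma> v_dir j l * val (f l))\<bar> \<le> B" if "j < n" "\<And>l. l < n \<Longrightarrow> f l < nq" for j f
    unfolding abs_minus_cancel by (rule order.trans[OF sum_abs sumB[OF that]])
  show ?thesis
    unfolding Cost_Rows_def
  proof (rule wp_Seq, rule wp_Fill_With[where a = n and b = k and rb = "m + g" and cb = 0
      and F = "\<lambda>j p. - (\<Sum>l<n. \<sigma> v_dir j l * val (oC + (l * k + p)))"])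
    fix i j and \<tau> :: store and Q'
    assume i: "i < n" and j: "j < k" and l: "\<tau> v_l 0 0 = int i" and p: "\<tau> v_p 0 0 = int j"
      and fr: "\<And>z. z \<notin> {v_coeff, v_l, v_p} \<union> mods (Sum v_acc v_q e_n (Times (Arr v_dir (Var v_l) (Var v_q)) (e_val (Plus e_oC (e_index v_q e_k v_p))))) \<Longrightarrow> \<tau> z = \<sigma> z"
      and Q': "\<And>\<tau>'. ok inp (Minus (Num 0) (Var v_acc)) \<tau>' \<Longrightarrow>
        aval inp (Minus (Num 0) (Var v_acc)) \<tau>' = - (\<Sum>l<n. \<sigma> v_dir i l * val (oC + (l * k + j))) \<Longrightarrow>
        (\<And>z. z \<notin> mods (Sum v_acc v_q e_n (Times (Arr v_dir (Var v_l) (Var v_q)) (e_val (Plus e_oC (e_index v_q e_k v_p))))) \<Longrightarrow> \<tau>' z = \<tau> z) \<Longrightarrow> Q' \<tau>'"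
    show "wp inp R B (Sum v_acc v_q e_n (Times (Arr v_dir (Var v_l) (Var v_q)) (e_val (Plus e_oC (e_index v_q e_k v_p))))) Q' \<tau>"
    proof (rule wp_Sum[where n = n and F = "\<lambda>l. \<sigma> v_dir i l * val (oC + (l * k + j))"])
      fix q and \<rho> :: store assume q: "q < n" "\<rho> v_q 0 0 = int q" and fr2: "\<And>z. z \<notin> {v_q, v_acc} \<Longrightarrow> \<rho> z = \<tau> z"
      have "\<rho> v_dir = \<sigma> v_dir" "\<rho> v_val = \<sigma> v_val" "\<rho> v_l 0 0 = int i" "\<rho> v_p 0 0 = int j"
        using fr2 fr l p by simp_all
      then show "ok inp (Times (Arr v_dir (Var v_l) (Var v_q)) (e_val (Plus e_oC (e_index v_q e_k v_p)))) \<rho> \<and>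
        aval inp (Times (Arr v_dir (Var v_l) (Var v_q)) (e_val (Plus e_oC (e_index v_q e_k v_p)))) \<rho> =
        \<sigma> v_dir i q * val (oC + (q * k + j))"
        using q j v offsets_less(4)[of q j] by (simp add: e_val_def e_index_def)
    next
      show "(\<Sum>l<n. \<bar>\<sigma> v_dir i l * val (oC + (l * k + j))\<bar>) \<le> B"
        using sumB[OF i] offsets_less(4) j by simp
    qed (use small in \<open>auto intro!: Q'\<close>)
  next
    fix \<tau>1 :: store assume c1: "\<And>i j. i < n \<Longrightarrow> j < k \<Longrightarrow> \<tau>1 v_coeff (m + g + i) (0 + j) = - (\<Sum>l<n. \<sigma> v_dir i l * val (oC + (l * k + j)))"
      "\<And>i j. \<not> (m + g \<le> i \<and> i < m + g + n \<and> 0 \<le> j \<and> j < 0 + k) \<Longrightarrow> \<tau>1 v_coeff i j = \<sigma> v_coeff i j"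
      and f1: "\<And>z. z \<notin> {v_coeff, v_l, v_p} \<union> mods (Sum v_acc v_q e_n (Times (Arr v_dir (Var v_l) (Var v_q)) (e_val (Plus e_oC (e_index v_q e_k v_p))))) \<Longrightarrow> \<tau>1 z = \<sigma> z"
    let ?c = "Sum v_acc v_q e_n (Times (Arr v_dir (Var v_l) (Var v_q)) (e_val (Plus e_oc (Var v_q))))"
    show "wp inp R B (Fill_With ?c v_coeff v_l v_p e_n (Num 1) (Plus e_m e_g) e_k (Minus (Num 0) (Var v_acc))) Q \<tau>1"
    proof (rule wp_Fill_With[where a = n and b = 1 and rb = "m + g" and cb = k
      and F = "\<lambda>j p. - (\<Sum>l<n. \<sigma> v_dir j l * val (oc + l))"])
      fix i j and \<tau> :: store and Q'
      assume i: "i < n" and l: "\<tau> v_l 0 0 = int i" and fr: "\<And>z. z \<notin> {v_coeff, v_l, v_p} \<union> mods ?c \<Longrightarrow> \<tau> z = \<tau>1 z"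
        and Q': "\<And>\<tau>'. ok inp (Minus (Num 0) (Var v_acc)) \<tau>' \<Longrightarrow>
          aval inp (Minus (Num 0) (Var v_acc)) \<tau>' = - (\<Sum>l<n. \<sigma> v_dir i l * val (oc + l)) \<Longrightarrow>
          (\<And>z. z \<notin> mods ?c \<Longrightarrow> \<tau>' z = \<tau> z) \<Longrightarrow> Q' \<tau>'"
      show "wp inp R B ?c Q' \<tau>"
      proof (rule wp_Sum[where n = n and F = "\<lambda>l. \<sigma> v_dir i l * val (oc + l)"])
        fix q and \<rho> :: store assume q: "q < n" "\<rho> v_q 0 0 = int q" and fr2: "\<And>z. z \<notin> {v_q, v_acc} \<Longrightarrow> \<rho> z = \<tau> z"
        have "\<rho> v_dir = \<sigma> v_dir" "\<rho> v_val = \<sigma> v_val" "\<rho> v_l 0 0 = int i"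
          using fr2 fr f1 l by simp_all
        then show "ok inp (Times (Arr v_dir (Var v_l) (Var v_q)) (e_val (Plus e_oc (Var v_q)))) \<rho> \<and>
          aval inp (Times (Arr v_dir (Var v_l) (Var v_q)) (e_val (Plus e_oc (Var v_q)))) \<rho> = \<sigma> v_dir i q * val (oc + q)"
          using q v offsets_less(5)[of q] by (simp add: e_val_def nat_int_add)
      next
        show "(\<Sum>l<n. \<bar>\<sigma> v_dir i l * val (oc + l)\<bar>) \<le> B" using sumB[OF i] offsets_less(5) by simp
      qed (use small in \<open>auto intro!: Q'\<close>)
    next
      fix \<tau>2 :: store assume c2: "\<And>i j. i < n \<Longrightarrow> j < 1 \<Longrightarrow> \<tau>2 v_coeff (m + g + i) (k + j) = - (\<Sum>l<n. \<sigma> v_dir i l * val (oc + l))"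
        "\<And>i j. \<not> (m + g \<le> i \<and> i < m + g + n \<and> k \<le> j \<and> j < k + 1) \<Longrightarrow> \<tau>2 v_coeff i j = \<tau>1 v_coeff i j"
        and f2: "\<And>z. z \<notin> {v_coeff, v_l, v_p} \<union> mods ?c \<Longrightarrow> \<tau>2 z = \<tau>1 z"
      show "Q \<tau>2"
      proof (rule post)
        fix i p assume i: "i < nrows'" and p: "p \<le> k"
        show "\<tau>2 v_coeff i p = lp_coeff (\<sigma> v_dir) i p"
        proof (cases "i < m + g")
          case True
          then show ?thesis using c2(2)[of i p] c1(2)[of i p] old[OF True p] by simp
        next
          case False
          then obtain j where j: "i = m + g + j" "j < n"
            using i unfolding nrows'_def by (metis add_less_cancel_left le_Suc_ex not_less)
          then show ?thesis
            using p c2(1)[of j 0] c2(2)[of i p] c1(1)[of j p]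
            by (cases "p = k") (auto simp: lp_coeff_def sys_coeff_def)
        qed
      next
        show "\<tau>2 z = \<sigma> z" if "z \<notin> mods Cost_Rows" for z using that f1 f2 by simp
      qed
    qed (use small R B negB offsets_less(5) in auto)
  qed (use small R B negB offsets_less(4) in auto)
qed

text \<open>The size of \<open>A2\<close> is dictated by the reduced cost rows: sums of
  \<open>n\<close> products of a direction entry, at most \<open>D1\<close>, and a datum, at most
  \<open>V1\<close>.\<close>

lemma lp_coeff_bound:
  assumes X: "\<And>j l. j < n \<Longrightarrow> l < n \<Longrightarrow> \<bar>X j l\<bar> \<le> D1" and i: "i < nrows'" and p: "p \<le> k"
  shows "\<bar>lp_coeff X i p\<bar> \<le> A2"
proof -
  have D1: "0 \<le> D1" unfolding D1_def by simp
  have V: "\<bar>val q\<bar> \<le> A2" if "q < nq" for q using V1(1)[OF that] A2(2) by simp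
  consider "i < m" | i' where "i = m + i'" "i' < g" | j where "i = m + g + j" "j < n"
  proof -
    have "i < m \<or> i - m < g \<and> i = m + (i - m) \<or> i - (m + g) < n \<and> i = m + g + (i - (m + g))"
      using i unfolding nrows'_def by linarith
    then show ?thesis using that by blast
  qed
  then show ?thesis
  proof cases
    case 1
    then show ?thesis using V offsets_less p by (auto simp: lp_coeff_def sys_coeff_def)
  next
    case 2
    then show ?thesis using V offsets_less p by (auto simp: lp_coeff_def sys_coeff_def)
  next
    case 3
    define q where "q l = (if p < k then oC + (l * k + p) else oc + l)" for l
    have q: "q l < nq" if "l < n" for l using that offsets_less(4,5) p by (auto simp: q_def)
    have "\<bar>X j l * val (q l)\<bar> \<le> D1 * V1" if "l < n" for l
      unfolding abs_mult using X[OF 3(2) that] V1(1)[OF q[OF that]] D1 by (intro mult_mono) auto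
    then have "(\<Sum>l<n. \<bar>X j l * val (q l)\<bar>) \<le> int n * (D1 * V1)"
      using sum_bounded_above[of "{..<n}" "\<lambda>l. \<bar>X j l * val (q l)\<bar>" "D1 * V1"] by simp
    then have "\<bar>\<Sum>l<n. X j l * val (q l)\<bar> \<le> A2"
      using sum_abs[of "\<lambda>l. X j l * val (q l)" "{..<n}"] A2(1) unfolding D1_def by linarith
    moreover have "lp_coeff X i p = - (\<Sum>l<n. X j l * val (q l))"
      using 3 by (cases "p < k") (simp_all add: lp_coeff_def sys_coeff_def q_def)
    ultimately show ?thesis by simp
  qed
qed

lemma wp_Assemble:
  assumes nr: "\<sigma> v_nr 0 0 = int nrows'"
    and mat: "\<And>i l. \<sigma> v_mat i l = (if i < m \<and> l < n then VA i l else 0)"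
    and E: "\<And>i p. i < nrows' \<Longrightarrow> p \<le> k \<Longrightarrow> \<sigma> v_coeff i p = E i p \<and> \<bar>E i p\<bar> \<le> A2"
    and post: "\<And>\<tau>. (\<And>i c. i < nrows' \<Longrightarrow> c < ncols \<Longrightarrow> \<tau> v_mat i c = sys_mat m n k VA E i c) \<Longrightarrow>
      (\<And>z. z \<notin> mods Assemble \<Longrightarrow> \<tau> z = \<sigma> z) \<Longrightarrow> Q \<tau>"
  shows "wp inp R B Assemble Q \<sigma>"
proof -
  have EB: "\<bar>E i p\<bar> \<le> B" "\<bar>- E i p\<bar> \<le> B" if "i < nrows'" "p \<le> k" for i p using E[OF that] A2(3) by auto
  have k1: "k + 1 \<le> R" "int (k + 1) \<le> B" "g + n \<le> R" "int (g + n) \<le> B"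
    using R B by (simp_all add: ncols_def)
  show ?thesis
    unfolding Assemble_def
  proof (rule wp_Seq, rule wp_Fill[where a = nrows' and b = "k + 1" and rb = 0 and cb = n and F = E])
    fix \<tau>1 :: store assume m1: "\<And>i j. i < nrows' \<Longrightarrow> j < k + 1 \<Longrightarrow> \<tau>1 v_mat (0 + i) (n + j) = E i j"
      "\<And>i j. \<not> (0 \<le> i \<and> i < 0 + nrows' \<and> n \<le> j \<and> j < n + (k + 1)) \<Longrightarrow> \<tau>1 v_mat i j = \<sigma> v_mat i j"
      and f1: "\<And>z. z \<notin> {v_mat, v_l, v_p} \<Longrightarrow> \<tau>1 z = \<sigma> z"
    show "wp inp R B (Fill v_mat v_l v_p (Var v_nr) e_k (Num 0) (Plus (Plus e_n e_k) (Num 1))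
       (Minus (Num 0) (Arr v_coeff (Var v_l) (Var v_p))) ;;
     Fill v_mat v_l v_p (Plus e_g e_n) (Plus e_g e_n) e_m (Plus (Plus e_n (Times (Num 2) e_k)) (Num 1)) (delta v_l v_p)) Q \<tau>1"
    proof (rule wp_Seq, rule wp_Fill[where a = nrows' and b = k and rb = 0 and cb = "n + k + 1" and F = "\<lambda>i p. - E i p"])
      fix \<tau>2 :: store assume m2: "\<And>i j. i < nrows' \<Longrightarrow> j < k \<Longrightarrow> \<tau>2 v_mat (0 + i) (n + k + 1 + j) = - E i j"
        "\<And>i j. \<not> (0 \<le> i \<and> i < 0 + nrows' \<and> n + k + 1 \<le> j \<and> j < n + k + 1 + k) \<Longrightarrow> \<tau>2 v_mat i j = \<tau>1 v_mat i j"
        and f2: "\<And>z. z \<notin> {v_mat, v_l, v_p} \<Longrightarrow> \<tau>2 z = \<tau>1 z"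
      show "wp inp R B (Fill v_mat v_l v_p (Plus e_g e_n) (Plus e_g e_n) e_m (Plus (Plus e_n (Times (Num 2) e_k)) (Num 1)) (delta v_l v_p)) Q \<tau>2"
      proof (rule wp_Fill[where a = "g + n" and b = "g + n" and rb = m and cb = "n + 2 * k + 1" and F = "\<lambda>i j. if i = j then 1 else 0"])
        fix i j and \<tau> :: store assume "\<tau> v_l 0 0 = int i" "\<tau> v_p 0 0 = int j"
        then show "ok inp (delta v_l v_p) \<tau> \<and> aval inp (delta v_l v_p) \<tau> = (if i = j then 1 else 0)"
          using aval_delta[of \<tau> v_l i v_p j inp] by (simp add: ok_delta)
      next
        fix \<tau>3 :: store assume m3: "\<And>i j. i < g + n \<Longrightarrow> j < g + n \<Longrightarrow> \<tau>3 v_mat (m + i) (n + 2 * k + 1 + j) = (if i = j then 1 else 0)"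
          "\<And>i j. \<not> (m \<le> i \<and> i < m + (g + n) \<and> n + 2 * k + 1 \<le> j \<and> j < n + 2 * k + 1 + (g + n)) \<Longrightarrow> \<tau>3 v_mat i j = \<tau>2 v_mat i j"
          and f3: "\<And>z. z \<notin> {v_mat, v_l, v_p} \<Longrightarrow> \<tau>3 z = \<tau>2 z"
        show "Q \<tau>3"
        proof (rule post)
          fix i c assume i: "i < nrows'" and c: "c < ncols"
          consider "c < n" | p where "p < k + 1" "c = n + p" | p where "p < k" "c = n + k + 1 + p"
            | p where "p < g + n" "c = n + 2 * k + 1 + p"
          proof -
            have "c < n \<or> c - n < k + 1 \<and> c = n + (c - n) \<or> c - (n + k + 1) < k \<and> c = n + k + 1 + (c - (n + k + 1))
              \<or> c - (n + 2 * k + 1) < g + n \<and> c = n + 2 * k + 1 + (c - (n + 2 * k + 1))"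
              using c unfolding ncols_def by linarith
            then show ?thesis using that by blast
          qed
          then show "\<tau>3 v_mat i c = sys_mat m n k VA E i c"
          proof cases
            case 1
            then have "\<tau>3 v_mat i c = \<sigma> v_mat i c" using m3(2)[of i c] m2(2)[of i c] m1(2)[of i c] by simp
            then show ?thesis using 1 mat by (simp add: sys_mat_def)
          next
            case 2
            then have "\<tau>3 v_mat i c = E i p" using m3(2)[of i c] m2(2)[of i c] m1(1)[OF i, of p] by simp
            then show ?thesis using 2 by (simp add: sys_mat_def)
          next
            case 3
            then have "\<tau>3 v_mat i c = - E i p" using m3(2)[of i c] m2(1)[OF i, of p] by simp
            then show ?thesis using 3 by (simp add: sys_mat_def)
          next
            case 4
            show ?thesis
            proof (cases "m \<le> i")
              case True
              then obtain i' where i': "i = m + i'" using le_Suc_ex by blast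
              then have "\<tau>3 v_mat i c = (if i' = p then 1 else 0)"
                using m3(1)[of i' p] 4 i by (simp add: nrows'_def)
              then show ?thesis using 4 i' by (auto simp: sys_mat_def)
            next
              case False
              then have "\<tau>3 v_mat i c = \<sigma> v_mat i c"
                using m3(2)[of i c] m2(2)[of i c] m1(2)[of i c] 4 by simp
              then show ?thesis using 4 mat False by (simp add: sys_mat_def)
            qed
          qed
        next
          show "\<tau>3 z = \<sigma> z" if "z \<notin> mods Assemble" for z using that f1 f2 f3 by simp
        qed
      qed (use small R B k1 in auto)
    qed (use nr E EB small R B f1 in auto)
  qed (use nr E EB small R B k1 in auto)
qed

lemma wp_Scale:
  assumes nc: "\<sigma> v_nc 0 0 = int ncols" and s0: "\<bar>\<sigma> v_s0 0 0\<bar> \<le> B" and T: "4 * int ncols ^ 4 \<le> B"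
    and post: "\<And>\<tau>. \<tau> v_sweeps 0 0 = 4 * int ncols ^ 4 \<Longrightarrow>
      (\<And>l. l < ncols \<Longrightarrow> \<tau> v_scale l 0 = (if l \<in> basis I \<union> {n..<ncols} then \<sigma> v_s0 0 0 else 0)) \<Longrightarrow>
      (\<And>z. z \<notin> mods Scale \<Longrightarrow> \<tau> z = \<sigma> z) \<Longrightarrow> Q \<tau>"
  shows "wp inp R B Scale Q \<sigma>"
proof -
  let ?T = "Times (Num 4) (Times (Times (Var v_nc) (Var v_nc)) (Times (Var v_nc) (Var v_nc)))"
  have sweeps: "aval inp ?T \<sigma> = 4 * int ncols ^ 4" using nc by (simp add: eval_nat_numeral)
  define \<tau>0 where "\<tau>0 = upd \<sigma> v_sweeps 0 0 (4 * int ncols ^ 4)"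
  have "wp inp R B (Fill v_scale v_l v_p (Var v_nc) (Num 1) (Num 0) (Num 0) (Var v_s0) ;;
     Fill v_scale v_l v_p e_n (Num 1) (Num 0) (Num 0) (Num 0) ;; Mark (Var v_s0)) Q \<tau>0"
  proof (rule wp_Seq, rule wp_Fill[where a = ncols and b = 1 and rb = 0 and cb = 0 and F = "\<lambda>i j. \<sigma> v_s0 0 0"])
    fix \<tau>1 :: store assume s1: "\<And>i j. i < ncols \<Longrightarrow> j < 1 \<Longrightarrow> \<tau>1 v_scale (0 + i) (0 + j) = \<sigma> v_s0 0 0"
      and f1: "\<And>z. z \<notin> {v_scale, v_l, v_p} \<Longrightarrow> \<tau>1 z = \<tau>0 z"
    show "wp inp R B (Fill v_scale v_l v_p e_n (Num 1) (Num 0) (Num 0) (Num 0) ;; Mark (Var v_s0)) Q \<tau>1"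
    proof (rule wp_Seq, rule wp_Fill[where a = n and b = 1 and rb = 0 and cb = 0 and F = "\<lambda>i j. 0"])
      fix \<tau>2 :: store assume s2: "\<And>i j. i < n \<Longrightarrow> j < 1 \<Longrightarrow> \<tau>2 v_scale (0 + i) (0 + j) = 0"
        "\<And>i j. \<not> (0 \<le> i \<and> i < 0 + n \<and> 0 \<le> j \<and> j < 0 + 1) \<Longrightarrow> \<tau>2 v_scale i j = \<tau>1 v_scale i j"
        and f2: "\<And>z. z \<notin> {v_scale, v_l, v_p} \<Longrightarrow> \<tau>2 z = \<tau>1 z"
      show "wp inp R B (Mark (Var v_s0)) Q \<tau>2"
      proof (rule wp_Mark[where c = "\<sigma> v_s0 0 0"])
        fix \<tau>3 :: store assume s3: "\<And>l. \<tau>3 v_scale l 0 = (if l \<in> basis I then \<sigma> v_s0 0 0 else \<tau>2 v_scale l 0)"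
          and f3: "\<And>z. z \<notin> {v_scale, v_i} \<Longrightarrow> \<tau>3 z = \<tau>2 z"
        show "Q \<tau>3"
        proof (rule post)
          show "\<tau>3 v_scale l 0 = (if l \<in> basis I \<union> {n..<ncols} then \<sigma> v_s0 0 0 else 0)" if "l < ncols" for l
            using s1[OF that, of 0] s2(1)[of l 0] s2(2)[of l 0] s3[of l] that by (cases "l < n") auto
          show "\<tau>3 v_sweeps 0 0 = 4 * int ncols ^ 4" using f1 f2 f3 by (simp add: \<tau>0_def)
          show "\<tau>3 z = \<sigma> z" if "z \<notin> mods Scale" for z using that f1 f2 f3 by (simp add: \<tau>0_def)
        qed
      qed (use f1 f2 s0 in \<open>auto simp: \<tau>0_def\<close>)
    qed (use small R B in auto)
  qed (use nc s0 R B in \<open>auto simp: \<tau>0_def\<close>)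
  then show ?thesis
    unfolding Scale_def using sweeps T nc
    by (intro wp_Seq wp_Set_Var) (auto simp del: aval.simps(4) simp: \<tau>0_def)
qed

definition "strict_set X = {i \<in> basis I. \<exists>j<n. i \<noteq> j \<and> X j i \<noteq> 0} \<union> {n + k} \<union>
  {n + 2 * k + 1 + g + j |j. j < n \<and> (\<exists>l<n. X j l < 0)}" for X :: "nat \<Rightarrow> nat \<Rightarrow> int"

lemma wp_Answer:
  assumes s: "\<And>l. l < ncols \<Longrightarrow> 0 \<le> \<sigma> v_scale l 0"
    and post: "\<And>\<tau>. \<tau> v_res 0 0 = (if \<forall>l\<in>strict_set (\<sigma> v_dir). 0 < \<sigma> v_scale l 0 then 1 else 0) \<Longrightarrow> Q \<tau>"
  shows "wp inp R B Answer Q \<sigma>"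
proof -
  let ?X = "\<sigma> v_dir"
  let ?e1 = "Times (Times (Arr v_dir (Var v_p) (e_bas v_l)) (Arr v_dir (Var v_p) (e_bas v_l)))
         (Times (Minus (e_bas v_l) (Var v_p)) (Minus (e_bas v_l) (Var v_p)))"
  let ?e2 = "Minus (Num 1) (Arr v_scale (e_bas v_l) (Num 0))"
  let ?e3 = "Minus (Num 1) (Arr v_scale (Plus (Plus (Plus (Plus e_n (Times (Num 2) e_k)) (Num 1)) e_g) (Var v_l)) (Num 0))"
  define C1 where "C1 i j \<longleftrightarrow> bas i \<noteq> j \<and> ?X j (bas i) \<noteq> 0 \<and> \<not> 0 < \<sigma> v_scale (bas i) 0" for i j
  define C2 where "C2 (i :: nat) (j :: nat) \<longleftrightarrow> \<not> 0 < \<sigma> v_scale (n + k) 0" for i j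
  define C3 where "C3 j l \<longleftrightarrow> ?X j l < 0 \<and> \<not> 0 < \<sigma> v_scale (n + 2 * k + 1 + g + j) 0" for j l
  have sq: "0 < x * x * (y * y) \<longleftrightarrow> x \<noteq> 0 \<and> y \<noteq> 0" for x y :: int
    by (auto simp: zero_less_mult_iff)
  have bas: "bas i < n" if "i < m" for i using basis_less[of "bas i"] basis_eq that by auto
  have strict: "(\<forall>l\<in>strict_set ?X. 0 < \<sigma> v_scale l 0) \<longleftrightarrow>
    \<not> (\<exists>i<m. \<exists>j<n. C1 i j) \<and> \<not> (\<exists>i<1. \<exists>j<1. C2 i j) \<and> \<not> (\<exists>i<n. \<exists>j<n. C3 i j)"
    unfolding strict_set_def C1_def C2_def C3_def basis_eq by (auto; blast)
  have nk: "n + k < ncols" by (simp add: ncols_def)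
  show ?thesis
    unfolding Answer_def
  proof (rule wp_Seq, rule wp_Set_Var)
    show "wp inp R B (Check v_res v_l v_p e_m e_n ?e1 ?e2 ;;
      Check v_res v_l v_p (Num 1) (Num 1) (Num 1) (Minus (Num 1) (Arr v_scale (Plus e_n e_k) (Num 0))) ;;
      Check v_res v_l v_p e_n e_n (Minus (Num 0) (Arr v_dir (Var v_l) (Var v_p))) ?e3) Q
      (upd \<sigma> v_res 0 0 (aval inp (Num 1) \<sigma>))"
    proof (rule wp_Seq, rule wp_Check[where a = m and b = n and C = C1])
      fix i j and \<tau> :: store assume i: "i < m" "j < n" "\<tau> v_l 0 0 = int i" "\<tau> v_p 0 0 = int j"
        and fr: "\<And>z. z \<notin> {v_res, v_l, v_p} \<Longrightarrow> \<tau> z = upd \<sigma> v_res 0 0 (aval inp (Num 1) \<sigma>) z"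
      show "ok inp ?e1 \<tau> \<and> ok inp ?e2 \<tau> \<and> (0 < aval inp ?e1 \<tau> \<and> 0 < aval inp ?e2 \<tau> \<longleftrightarrow> C1 i j)"
        using e_bas[of \<tau> v_l i] i fr s[of "bas i"] bas[of i] small(9) by (simp add: sq C1_def) auto
    next
      fix \<tau>1 :: store assume r1: "\<tau>1 v_res 0 0 = (if \<exists>i<m. \<exists>j<n. C1 i j then 0 else upd \<sigma> v_res 0 0 (aval inp (Num 1) \<sigma>) v_res 0 0)"
        and f1: "\<And>z. z \<notin> {v_res, v_l, v_p} \<Longrightarrow> \<tau>1 z = upd \<sigma> v_res 0 0 (aval inp (Num 1) \<sigma>) z"
      show "wp inp R B (Check v_res v_l v_p (Num 1) (Num 1) (Num 1) (Minus (Num 1) (Arr v_scale (Plus e_n e_k) (Num 0))) ;;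
        Check v_res v_l v_p e_n e_n (Minus (Num 0) (Arr v_dir (Var v_l) (Var v_p))) ?e3) Q \<tau>1"
      proof (rule wp_Seq, rule wp_Check[where a = 1 and b = 1 and C = C2])
        fix i j and \<tau> :: store assume fr: "\<And>z. z \<notin> {v_res, v_l, v_p} \<Longrightarrow> \<tau> z = \<tau>1 z"
        show "ok inp (Num 1) \<tau> \<and> ok inp (Minus (Num 1) (Arr v_scale (Plus e_n e_k) (Num 0))) \<tau> \<and>
          (0 < aval inp (Num 1) \<tau> \<and> 0 < aval inp (Minus (Num 1) (Arr v_scale (Plus e_n e_k) (Num 0))) \<tau> \<longleftrightarrow> C2 i j)"
          using fr f1 s[OF nk] by (simp add: C2_def nat_int_add) auto
      next
        fix \<tau>2 :: store assume r2: "\<tau>2 v_res 0 0 = (if \<exists>i<1. \<exists>j<1. C2 i j then 0 else \<tau>1 v_res 0 0)"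
          and f2: "\<And>z. z \<notin> {v_res, v_l, v_p} \<Longrightarrow> \<tau>2 z = \<tau>1 z"
        show "wp inp R B (Check v_res v_l v_p e_n e_n (Minus (Num 0) (Arr v_dir (Var v_l) (Var v_p))) ?e3) Q \<tau>2"
        proof (rule wp_Check[where a = n and b = n and C = C3])
          fix i j and \<tau> :: store assume i: "i < n" "j < n" "\<tau> v_l 0 0 = int i" "\<tau> v_p 0 0 = int j"
            and fr: "\<And>z. z \<notin> {v_res, v_l, v_p} \<Longrightarrow> \<tau> z = \<tau>2 z"
          have nat: "nat (int n + 2 * int k + 1 + int g + int i) = n + 2 * k + 1 + g + i"
            by linarith
          show "ok inp (Minus (Num 0) (Arr v_dir (Var v_l) (Var v_p))) \<tau> \<and> ok inp ?e3 \<tau> \<and>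
            (0 < aval inp (Minus (Num 0) (Arr v_dir (Var v_l) (Var v_p))) \<tau> \<and> 0 < aval inp ?e3 \<tau> \<longleftrightarrow> C3 i j)"
            using i fr f1 f2 s[of "n + 2 * k + 1 + g + i"]
            by (simp add: C3_def nat ncols_def del: nat_int_add) auto
        next
          fix \<tau>3 :: store assume "\<tau>3 v_res 0 0 = (if \<exists>i<n. \<exists>j<n. C3 i j then 0 else \<tau>2 v_res 0 0)"
          then show "Q \<tau>3" using r1 r2 strict by (intro post) auto
        qed (use small in auto)
      qed (use R B in auto)
    qed (use small in auto)
  qed (use B in auto)
qed

end

section \<open>Correctness of the whole run\<close>

context bilfp_run
begin

lemma sys_mat_bound:
  assumes "\<And>i p. i < nrows' \<Longrightarrow> p \<le> k \<Longrightarrow> \<bar>E i p\<bar> \<le> A2" "i < nrows'" "c < ncols"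
  shows "\<bar>sys_mat m n k VA E i c\<bar> \<le> A2"
proof -
  have "1 \<le> A2" using A2(2) V1(2) by simp
  then show ?thesis
    using assms(1)[OF assms(2), of "c - n"] assms(1)[OF assms(2), of "c - n - k - 1"]
      VA_V1[of i c] A2(2) by (auto simp: sys_mat_def)
qed

lemma strict_set_subset: "strict_set X \<subseteq> {..<ncols}"
  using basis_less by (fastforce simp: strict_set_def ncols_def)

text \<open>The directions are values found at run time, so the system is interpreted for whatever
  array they form; the matrix has to agree with it only within its dimensions.\<close>

lemma pessimistic_iff:
  assumes X: "\<And>j. j < n \<Longrightarrow> is_direction j (X j)"
    and M: "\<And>i c. i < nrows' \<Longrightarrow> c < ncols \<Longrightarrow> M i c = sys_mat m n k VA (lp_coeff X) i c"
  shows "pessimistic_bilfp I \<longleftrightarrow>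
    (\<exists>x\<in>cone nrows' ncols M (basis I \<union> {n..<ncols}). \<forall>l\<in>strict_set X. 0 < x l)"
proof -
  interpret Sys: bilfp_system I m n k g denom VA "\<lambda>i p. val (oB + (i * k + p))" "\<lambda>l p. val (oC + (l * k + p))"
    "\<lambda>i p. val (oD + (i * k + p))" X "\<lambda>i. val (ob + i)" "\<lambda>l. val (oc + l)" "\<lambda>i. val (od + i)"
    by (rule bilfp_system[OF X])
  have eqs: "Sys.ncols = ncols" "Sys.E = lp_coeff X" "Sys.strict = strict_set X" "Sys.live = basis I \<union> {n..<ncols}"
    by (simp_all add: Sys.ncols_def ncols_def Sys.E_def lp_coeff_def Sys.strict_def strict_set_def Sys.live_def)
  have "cone nrows' ncols M S = cone nrows' ncols (sys_mat m n k VA (lp_coeff X)) S" for S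
    by (rule cone_cong[OF M])
  then show ?thesis
    using Sys.pessimistic_iff_cone unfolding eqs nrows'_def by simp
qed

text \<open>The exponent \<open>b\<close> of the initial scale is found only at run time, so the
  size conditions are required for all \<open>b \<le> b1\<close>. The arrays are zero at the start,
  which provides the zero blocks of the matrix.\<close>

lemma wp_Main:
  assumes K: "K = (int ncols * A2\<^sup>2 + 1) ^ nrows'" "K < 2 ^ b1" "b1 \<le> R" "2 * K \<le> B" "int ncols * A2\<^sup>2 \<le> B"
    and T: "4 * ncols ^ 4 \<le> R" "ncols * (b1 + 1) < R" "4 * int ncols ^ 4 \<le> B"
    and D: "\<And>b A D. b \<le> b1 \<Longrightarrow> A = A2 * 2 ^ b \<Longrightarrow> D = (int ncols * A\<^sup>2 + 1) ^ nrows' \<Longrightarrow>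
      D \<le> B \<and> int ncols * (A * (int ncols * (D * A))) \<le> B \<and> int ncols * (D * (int ncols * (4 * int ncols ^ 4))) \<le> B"
  shows "wp inp R B Main (\<lambda>\<tau>. \<tau> v_res 0 0 = (if pessimistic_bilfp I then 1 else 0)) (\<lambda>_ _ _. 0)"
proof -
  let ?Q = "\<lambda>\<tau>. \<tau> v_res 0 0 = (if pessimistic_bilfp I then 1 else 0)"
  let ?S = "basis I \<union> {n..<ncols}"
  define \<tau>0 :: store where "\<tau>0 = upd (upd (\<lambda>_ _ _. 0) v_nc 0 0 (int ncols)) v_nr 0 0 (int nrows')"
  have nc0: "\<tau>0 v_nc 0 0 = int ncols" "\<tau>0 v_nr 0 0 = int nrows'" by (simp_all add: \<tau>0_def)
  have A21: "1 \<le> A2" using A2(2) V1(2) by simp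
  have "wp inp R B (Read_Data ;; Fill_Blocks ;; For v_j e_n Direction ;; Cost_Rows ;; Assemble ;; Bound ;; Scale ;; Solve ;; Answer) ?Q \<tau>0"
  proof (rule wp_Seq, rule wp_Read_Data)
    fix \<tau>1 :: store assume v1: "\<And>q. q < nq \<Longrightarrow> \<tau>1 v_val q 0 = val q"
      and f1: "\<And>z. z \<notin> mods Read_Data \<Longrightarrow> \<tau>1 z = \<tau>0 z"
    show "wp inp R B (Fill_Blocks ;; For v_j e_n Direction ;; Cost_Rows ;; Assemble ;; Bound ;; Scale ;; Solve ;; Answer) ?Q \<tau>1"
    proof (rule wp_Seq, rule wp_Fill_Blocks)
      show "\<tau>1 v_val q 0 = val q" if "q < nq" for q by (rule v1[OF that])
      show "\<tau>1 v_mat i l = 0" for i l using f1[of v_mat] by (simp add: \<tau>0_def)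
      fix \<tau>2 :: store assume m2: "\<And>i l. \<tau>2 v_mat i l = (if i < m \<and> l < n then VA i l else 0)"
        and c2: "\<And>i p X. i < m + g \<Longrightarrow> p \<le> k \<Longrightarrow> \<tau>2 v_coeff i p = lp_coeff X i p"
        and f2: "\<And>z. z \<notin> mods Fill_Blocks \<Longrightarrow> \<tau>2 z = \<tau>1 z"
      have nc2: "\<tau>2 v_nc 0 0 = int ncols" "\<tau>2 v_nr 0 0 = int nrows'" using f2 f1 nc0 by simp_all
      show "wp inp R B (For v_j e_n Direction ;; Cost_Rows ;; Assemble ;; Bound ;; Scale ;; Solve ;; Answer) ?Q \<tau>2"
      proof (rule wp_Seq, rule wp_Directions)
        show "\<tau>2 v_nc 0 0 = int ncols" "\<tau>2 v_nr 0 0 = int nrows'" by (rule nc2)+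
        show "\<tau>2 v_mat i l = (if i < m \<and> l < n then VA i l else 0)" for i l by (rule m2)
        fix \<tau>3 :: store assume dir: "\<And>j. j < n \<Longrightarrow> is_direction j (\<tau>3 v_dir j)"
          and X3: "\<And>j l. j < n \<Longrightarrow> l < n \<Longrightarrow> \<bar>\<tau>3 v_dir j l\<bar> \<le> D1"
          and f3: "\<And>z. z \<notin> insert v_j (mods Direction) \<Longrightarrow> \<tau>3 z = \<tau>2 z"
        define X where "X = \<tau>3 v_dir"
        show "wp inp R B (Cost_Rows ;; Assemble ;; Bound ;; Scale ;; Solve ;; Answer) ?Q \<tau>3"
        proof (rule wp_Seq, rule wp_Cost_Rows)
          show "\<tau>3 v_val q 0 = val q" if "q < nq" for q using v1[OF that] f2 f3 by simp
          show "\<tau>3 v_coeff i p = lp_coeff (\<tau>3 v_dir) i p" if "i < m + g" "p \<le> k" for i p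
            using c2[OF that] f3 by simp
          fix \<tau>4 :: store assume c4: "\<And>i p. i < nrows' \<Longrightarrow> p \<le> k \<Longrightarrow> \<tau>4 v_coeff i p = lp_coeff (\<tau>3 v_dir) i p"
            and f4: "\<And>z. z \<notin> mods Cost_Rows \<Longrightarrow> \<tau>4 z = \<tau>3 z"
          have EB: "\<bar>lp_coeff X i p\<bar> \<le> A2" if "i < nrows'" "p \<le> k" for i p
            using lp_coeff_bound[OF X3 that] by (simp add: X_def)
          have nc4: "\<tau>4 v_nc 0 0 = int ncols" "\<tau>4 v_nr 0 0 = int nrows'" using f4 f3 nc2 by simp_all
          show "wp inp R B (Assemble ;; Bound ;; Scale ;; Solve ;; Answer) ?Q \<tau>4"
          proof (rule wp_Seq, rule wp_Assemble[where E = "lp_coeff X"])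
            show "\<tau>4 v_mat i l = (if i < m \<and> l < n then VA i l else 0)" for i l using m2 f3 f4 by simp
            show "\<tau>4 v_coeff i p = lp_coeff X i p \<and> \<bar>lp_coeff X i p\<bar> \<le> A2" if "i < nrows'" "p \<le> k" for i p
              using c4[OF that] EB[OF that] by (simp add: X_def)
            fix \<tau>5 :: store assume m5: "\<And>i c. i < nrows' \<Longrightarrow> c < ncols \<Longrightarrow> \<tau>5 v_mat i c = sys_mat m n k VA (lp_coeff X) i c"
              and f5: "\<And>z. z \<notin> mods Assemble \<Longrightarrow> \<tau>5 z = \<tau>4 z"
            have nc5: "\<tau>5 v_nc 0 0 = int ncols" "\<tau>5 v_nr 0 0 = int nrows'" using f5 nc4 by simp_all
            have MA: "\<bar>\<tau>5 v_mat i c\<bar> \<le> A2" if "i < nrows'" "c < ncols" for i c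
              unfolding m5[OF that] by (rule sys_mat_bound[OF EB that])
            show "wp inp R B (Bound ;; Scale ;; Solve ;; Answer) ?Q \<tau>5"
            proof (rule wp_Seq, rule wp_Bound[where n = ncols and r = nrows' and A = A2 and K = K and ?b1.0 = b1])
              show "\<bar>\<tau>5 v_mat i c\<bar> \<le> A2" if "i < nrows'" "c < ncols" for i c by (rule MA[OF that])
              fix \<tau>6 :: store and b assume s6: "\<tau>6 v_s0 0 0 = 2 ^ b" and mb: "minor_bound nrows' ncols (\<tau>5 v_mat) \<le> 2 ^ b"
                and b: "b \<le> b1" "2 ^ b \<le> 2 * K"
                and f6: "\<And>z. z \<notin> {v_prod, v_i, v_acc, v_l, v_s0} \<Longrightarrow> \<tau>6 z = \<tau>5 z"
              have bB: "2 ^ b \<le> B" using b(2) K(4) by simp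
              define A where "A = A2 * 2 ^ b"
              define D' where "D' = (int ncols * A\<^sup>2 + 1) ^ nrows'"
              note DB = D[OF b(1) A_def D'_def]
              have bR: "ncols * (b + 1) < R"
                using T(2) b(1) mult_le_mono2[of "b + 1" "b1 + 1" ncols] by linarith
              show "wp inp R B (Scale ;; Solve ;; Answer) ?Q \<tau>6"
              proof (rule wp_Seq, rule wp_Scale)
                show "\<tau>6 v_nc 0 0 = int ncols" using f6 nc5 by simp
                show "\<bar>\<tau>6 v_s0 0 0\<bar> \<le> B" using s6 bB by simp
                show "4 * int ncols ^ 4 \<le> B" by (rule T(3))
                fix \<tau>7 :: store assume t7: "\<tau>7 v_sweeps 0 0 = 4 * int ncols ^ 4"
                  and s7: "\<And>l. l < ncols \<Longrightarrow> \<tau>7 v_scale l 0 = (if l \<in> ?S then \<tau>6 v_s0 0 0 else 0)"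
                  and f7: "\<And>z. z \<notin> mods Scale \<Longrightarrow> \<tau>7 z = \<tau>6 z"
                have m7: "\<tau>7 v_mat = \<tau>5 v_mat" using f7 f6 by simp
                show "wp inp R B (Solve ;; Answer) ?Q \<tau>7"
                proof (rule wp_Seq, rule wp_Solve[where n = ncols and r = nrows' and b = b and S = ?S and A = A
                    and ?A2.0 = A2 and D = D'])
                  show "valid_scaling nrows' ncols (\<tau>7 v_mat) ?S b (\<lambda>l. \<tau>7 v_scale l 0)"
                    by (rule valid_scaling_init) (use s7 s6 in simp)
                  show "minor_bound nrows' ncols (\<tau>7 v_mat) \<le> 2 ^ b" using mb m7 by simp
                  show "\<bar>\<tau>7 v_mat i c\<bar> \<le> A2" if "i < nrows'" "c < ncols" for i c using MA[OF that] m7 by simp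
                  show "\<tau>7 v_nc 0 0 = int ncols" "\<tau>7 v_nr 0 0 = int nrows'" using f7 f6 nc5 by simp_all
                  fix \<tau>8 :: store assume s8: "\<And>J. J \<subseteq> {..<ncols} \<Longrightarrow>
                      (\<exists>x\<in>cone nrows' ncols (\<tau>7 v_mat) ?S. \<forall>l\<in>J. 0 < x l) \<longleftrightarrow> (\<forall>l\<in>J. 0 < \<tau>8 v_scale l 0)"
                    and p8: "\<And>l. l < ncols \<Longrightarrow> 0 \<le> \<tau>8 v_scale l 0"
                    and f8: "\<And>z. z \<notin> mods Solve \<Longrightarrow> \<tau>8 z = \<tau>7 z"
                  have X8: "\<tau>8 v_dir = X" using f8 f7 f6 f5 f4 by (simp add: X_def)
                  have "pessimistic_bilfp I \<longleftrightarrow> (\<exists>x\<in>cone nrows' ncols (\<tau>7 v_mat) ?S. \<forall>l\<in>strict_set X. 0 < x l)"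
                    by (rule pessimistic_iff) (use dir m5 m7 in \<open>auto simp: X_def\<close>)
                  also have "\<dots> \<longleftrightarrow> (\<forall>l\<in>strict_set X. 0 < \<tau>8 v_scale l 0)"
                    by (rule s8[OF strict_set_subset])
                  finally show "wp inp R B Answer ?Q \<tau>8"
                    using X8 p8 by (intro wp_Answer) auto
                qed (use R B T t7 bR A21 DB bB A_def D'_def in auto)
              qed
            qed (use R B K nc5 in auto)
          qed (use nc4 in auto)
        qed (use X3 in auto)
      qed
    qed
  qed
  then show ?thesis
    unfolding Main_def using B
    by (intro wp_Seq wp_Set_Var) (auto simp: \<tau>0_def ncols_def nrows'_def add_ac)
qed

end

section \<open>Bit lengths\<close>

lemma square_bound:
  assumes "int c < 2 ^ h"
  shows "int c * (2 ^ a)\<^sup>2 + 1 \<le> 2 ^ (h + 2 * a)"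
proof -
  have "int c * (2 ^ a)\<^sup>2 + 1 \<le> (int c + 1) * (2 ^ a)\<^sup>2" by (simp add: distrib_right)
  also have "\<dots> \<le> 2 ^ h * (2 ^ a)\<^sup>2"
  proof (intro mult_right_mono)
    show "int c + 1 \<le> 2 ^ h" using assms by linarith
  qed simp
  also have "\<dots> = 2 ^ (h + 2 * a)" by (simp add: power_add power_mult[symmetric] mult.commute)
  finally show ?thesis .
qed

lemma det_bound:
  assumes "int c < 2 ^ h" "r \<le> h"
  shows "(int c * (2 ^ a)\<^sup>2 + 1) ^ r \<le> 2 ^ ((h + 2 * a) * h)"
proof -
  have "(int c * (2 ^ a)\<^sup>2 + 1) ^ r \<le> (2 ^ (h + 2 * a)) ^ r"
    by (intro power_mono square_bound assms) auto
  also have "\<dots> = 2 ^ ((h + 2 * a) * r)" by (simp add: power_mult)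
  also have "\<dots> \<le> 2 ^ ((h + 2 * a) * h)" using assms(2) by (intro power_increasing) auto
  finally show ?thesis .
qed

lemma product_bound:
  assumes "int c < 2 ^ h" "0 \<le> D" "D \<le> 2 ^ e"
  shows "int c * (2 ^ a * (int c * (D * 2 ^ a))) \<le> 2 ^ (2 * h + 2 * a + e)"
proof -
  have "int c * (2 ^ a * (int c * (D * 2 ^ a))) \<le> 2 ^ h * (2 ^ a * (2 ^ h * (2 ^ e * 2 ^ a)))"
    using assms by (intro mult_mono order_refl) auto
  also have "\<dots> = 2 ^ (h + (a + (h + (e + a))))" by (simp only: power_add)
  also have "h + (a + (h + (e + a))) = 2 * h + 2 * a + e" by simp
  finally show ?thesis .
qed

context bilfp_instance
begin

text \<open>Origin of the exponents: data are at most \<open>2 ^ (2 * h)\<close>, a numerator times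
  a quotient of the common denominator. The determinants of the directions are then at most
  \<open>2 ^ (5 * h^2)\<close>, the assembled entries \<open>2 ^ (8 * h^2)\<close>, and the minor
  bound \<open>2 ^ (17 * h^3)\<close>. Hence scaled entries are at most
  \<open>2 ^ (26 * h^3)\<close> and the determinants of the solver \<open>2 ^ (53 * h^4)\<close>;
  the number \<open>200\<close> leaves room for products of these. The loop bound covers
  \<open>4 * ncols ^ 4\<close> sweeps and about \<open>17 * h^4\<close> rescaling rounds.\<close>

lemma wp_Main_bounded:
  assumes h: "ncols \<le> h" "nrows' \<le> h" "nq \<le> h" "enc_len \<le> h" "1 \<le> h"
  shows "wp inp (40 * h ^ 4) (2 ^ (200 * h ^ 4)) Main
    (\<lambda>\<tau>. \<tau> v_res 0 0 = (if pessimistic_bilfp I then 1 else 0)) (\<lambda>_ _ _. 0)"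
proof -
  let ?B = "2 ^ (200 * h ^ 4) :: int"
  have p12: "h \<le> h ^ 2" and p23: "h ^ 2 \<le> h ^ 3" and p34: "h ^ 3 \<le> h ^ 4"
    using h(5) self_le_power[of h 2] by (auto intro: power_increasing)
  have m2: "h * h = h ^ 2" and m3: "h ^ 2 * h = h ^ 3" and m4: "h ^ 3 * h = h ^ 4"
    by (simp_all add: eval_nat_numeral)
  have ch: "int ncols < 2 ^ h" "int nrows' < 2 ^ h" "int nq < 2 ^ h"
  proof -
    have "h < 2 ^ h" by (rule less_exp)
    then have "ncols < 2 ^ h" "nrows' < 2 ^ h" "nq < 2 ^ h" using h by linarith+
    then show "int ncols < 2 ^ h" "int nrows' < 2 ^ h" "int nq < 2 ^ h"
      by (metis of_nat_less_iff of_nat_numeral of_nat_power)+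
  qed
  have pw: "2 ^ e \<le> ?B" if "e \<le> 200 * h ^ 4" for e
    using that by (intro power_increasing) auto
  have hB: "2 ^ h \<le> ?B" using p12 p23 p34 by (intro pw) linarith
  let ?D1 = "(int ncols * (2 ^ (2 * h))\<^sup>2 + 1) ^ nrows'"
  have e1: "(h + 2 * (2 * h)) * h = 5 * h ^ 2" by (simp add: m2[symmetric])
  have D1: "?D1 \<le> 2 ^ (5 * h ^ 2)" using det_bound[OF ch(1) h(2), of "2 * h"] unfolding e1 .
  have D1_0: "0 \<le> ?D1" by simp
  have run: "bilfp_run I (40 * h ^ 4) ?B (2 ^ (2 * h)) (2 ^ (8 * h ^ 2))"
  proof unfold_locales
    show "nq \<le> 40 * h ^ 4" "ncols \<le> 40 * h ^ 4" "nrows' \<le> 40 * h ^ 4" "1 \<le> 40 * h ^ 4"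
      using h p12 p23 p34 by linarith+
    show "int nq \<le> ?B" "int ncols \<le> ?B" "int nrows' \<le> ?B" "1 \<le> ?B" using ch hB by linarith+
    show "\<bar>\<Prod>q<j. den q\<bar> \<le> ?B" if "j \<le> nq" for j
    proof -
      have "(2::int) ^ enc_len \<le> ?B" using h(4) p12 p23 p34 by (intro pw) linarith
      then show ?thesis using partial_denom_bound[OF that] by linarith
    qed
    show "\<bar>val q\<bar> \<le> 2 ^ (2 * h)" if "q < nq" for q
    proof -
      have "(2::int) ^ (2 * enc_len) \<le> 2 ^ (2 * h)" using h(4) by (intro power_increasing) auto
      then show ?thesis using val_bound[OF that] by linarith
    qed
    show "(1::int) \<le> 2 ^ (2 * h)" by simp
    show "(2::int) ^ (2 * h) \<le> ?B" using p12 p23 p34 by (intro pw) linarith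
    have "(2::int) ^ (5 * h ^ 2) \<le> ?B" using p12 p23 p34 by (intro pw) linarith
    then show "?D1 \<le> ?B" using D1 by linarith
    have "(2::int) ^ (2 * h + 2 * (2 * h) + 5 * h ^ 2) \<le> ?B" using p12 p23 p34 by (intro pw) linarith
    then show "int ncols * (2 ^ (2 * h) * (int ncols * (?D1 * 2 ^ (2 * h)))) \<le> ?B"
      using product_bound[OF ch(1) D1_0 D1, of "2 * h"] by linarith
    have "int n * (?D1 * 2 ^ (2 * h)) \<le> 2 ^ h * (2 ^ (5 * h ^ 2) * 2 ^ (2 * h))"
    proof (intro mult_mono order_refl D1)
      have "int n \<le> int ncols" by (simp add: ncols_def)
      then show "int n \<le> 2 ^ h" using ch(1) by linarith
    qed auto
    also have "\<dots> = 2 ^ (h + (5 * h ^ 2 + 2 * h))" by (simp only: power_add)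
    also have "\<dots> \<le> 2 ^ (8 * h ^ 2)" using p12 by (intro power_increasing) auto
    finally show "int n * (?D1 * 2 ^ (2 * h)) \<le> 2 ^ (8 * h ^ 2)" .
    show "(2::int) ^ (2 * h) \<le> 2 ^ (8 * h ^ 2)" using p12 by (intro power_increasing) auto
    show "(2::int) ^ (8 * h ^ 2) \<le> ?B" using p12 p23 p34 by (intro pw) linarith
  qed
  interpret run: bilfp_run I "40 * h ^ 4" ?B "2 ^ (2 * h)" "2 ^ (8 * h ^ 2)" by (rule run)
  let ?K = "(int ncols * (2 ^ (8 * h ^ 2))\<^sup>2 + 1) ^ nrows'"
  have e2: "(h + 2 * (8 * h ^ 2)) * h = h ^ 2 + 16 * h ^ 3"
    by (simp add: distrib_right m2 m3 mult.assoc)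
  have "?K \<le> 2 ^ (h ^ 2 + 16 * h ^ 3)" using det_bound[OF ch(1) h(2), of "8 * h ^ 2"] unfolding e2 .
  also have "\<dots> \<le> 2 ^ (17 * h ^ 3)" using p23 by (intro power_increasing) auto
  finally have K: "?K \<le> 2 ^ (17 * h ^ 3)" .
  show ?thesis
  proof (rule run.wp_Main[where K = ?K and ?b1.0 = "17 * h ^ 3 + 1"])
    have two: "(2::int) * 2 ^ (17 * h ^ 3) = 2 ^ (17 * h ^ 3 + 1)" by simp
    have "(0::int) < 2 ^ (17 * h ^ 3)" by simp
    then show "?K < 2 ^ (17 * h ^ 3 + 1)" using K two by linarith
    show "17 * h ^ 3 + 1 \<le> 40 * h ^ 4" using h(5) p12 p23 p34 by linarith
    have "(2::int) ^ (17 * h ^ 3 + 1) \<le> ?B" using h(5) p12 p23 p34 by (intro pw) linarith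
    then show "2 * ?K \<le> ?B" using K two by linarith
    have "(2::int) ^ (h + 2 * (8 * h ^ 2)) \<le> ?B" using p12 p23 p34 by (intro pw) linarith
    then show "int ncols * (2 ^ (8 * h ^ 2))\<^sup>2 \<le> ?B" using square_bound[OF ch(1), of "8 * h ^ 2"] by linarith
    have c4: "ncols ^ 4 \<le> h ^ 4" using h(1) by (intro power_mono) auto
    then show "4 * ncols ^ 4 \<le> 40 * h ^ 4" by linarith
    have "ncols * (17 * h ^ 3 + 1 + 1) \<le> h * (17 * h ^ 3 + 1 + 1)" using h(1) by (intro mult_right_mono) auto
    also have "\<dots> = 17 * h ^ 4 + 2 * h" by (simp add: distrib_left m4[symmetric] mult_ac)
    also have "\<dots> < 40 * h ^ 4" using h(5) p12 p23 p34 by linarith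
    finally show "ncols * (17 * h ^ 3 + 1 + 1) < 40 * h ^ 4" .
    have c4': "4 * int ncols ^ 4 \<le> 2 ^ (2 + 4 * h)"
    proof -
      have "int ncols ^ 4 \<le> (2 ^ h) ^ 4" using ch(1) by (intro power_mono) auto
      then show ?thesis by (simp add: power_add power_mult[symmetric] mult.commute)
    qed
    have "(2::int) ^ (2 + 4 * h) \<le> ?B" using h(5) p12 p23 p34 by (intro pw) linarith
    then show "4 * int ncols ^ 4 \<le> ?B" using c4' by linarith
    fix b and A D :: int assume b: "b \<le> 17 * h ^ 3 + 1" and A: "A = 2 ^ (8 * h ^ 2) * 2 ^ b"
      and D: "D = (int ncols * A\<^sup>2 + 1) ^ nrows'"
    have A': "A = 2 ^ (8 * h ^ 2 + b)" unfolding A by (simp add: power_add)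
    have a26: "8 * h ^ 2 + b \<le> 26 * h ^ 3" using b h(5) p12 p23 by linarith
    have D0: "0 \<le> D" unfolding D by simp
    have "D \<le> 2 ^ ((h + 2 * (8 * h ^ 2 + b)) * h)"
      unfolding D A' by (rule det_bound[OF ch(1) h(2)])
    also have "\<dots> \<le> 2 ^ (53 * h ^ 4)"
    proof (intro power_increasing)
      have "e \<le> 26 * q \<Longrightarrow> h \<le> r \<Longrightarrow> r \<le> q \<Longrightarrow> h + 2 * e \<le> 53 * q" for e q r :: nat
        by linarith
      from this[OF a26 p12 p23] have "h + 2 * (8 * h ^ 2 + b) \<le> 53 * h ^ 3" .
      then have "(h + 2 * (8 * h ^ 2 + b)) * h \<le> (53 * h ^ 3) * h"
        by (rule mult_right_mono) simp
      then show "(h + 2 * (8 * h ^ 2 + b)) * h \<le> 53 * h ^ 4" by (simp only: mult.assoc m4)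
    qed auto
    finally have DD: "D \<le> 2 ^ (53 * h ^ 4)" .
    have "(2::int) ^ (53 * h ^ 4) \<le> ?B" by (intro pw) simp
    then have 1: "D \<le> ?B" using DD by linarith
    have "(2::int) ^ (2 * h + 2 * (8 * h ^ 2 + b) + 53 * h ^ 4) \<le> ?B"
    proof (rule pw)
      have "e \<le> 26 * q \<Longrightarrow> h \<le> r \<Longrightarrow> r \<le> q \<Longrightarrow> q \<le> v \<Longrightarrow> 2 * h + 2 * e + 53 * v \<le> 200 * v" for e q r v :: nat
        by linarith
      from this[OF a26 p12 p23 p34] show "2 * h + 2 * (8 * h ^ 2 + b) + 53 * h ^ 4 \<le> 200 * h ^ 4" .
    qed
    then have 2: "int ncols * (A * (int ncols * (D * A))) \<le> ?B"
      using product_bound[OF ch(1) D0 DD, of "8 * h ^ 2 + b"] unfolding A' by linarith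
    have "int ncols * (D * (int ncols * (4 * int ncols ^ 4))) \<le> 2 ^ h * (2 ^ (53 * h ^ 4) * (2 ^ h * 2 ^ (2 + 4 * h)))"
      using ch(1) D0 DD c4' by (intro mult_mono) auto
    also have "\<dots> = 2 ^ (h + (53 * h ^ 4 + (h + (2 + 4 * h))))" by (simp only: power_add)
    also have "\<dots> \<le> ?B" using h(5) p12 p23 p34 by (intro pw) linarith
    finally have 3: "int ncols * (D * (int ncols * (4 * int ncols ^ 4))) \<le> ?B" .
    show "D \<le> ?B \<and> int ncols * (A * (int ncols * (D * A))) \<le> ?B \<and>
      int ncols * (D * (int ncols * (4 * int ncols ^ 4))) \<le> ?B" using 1 2 3 by blast
  qed simp
qed

text \<open>The basis is empty, so \<open>m = 0\<close> as well and the homogeneous system has no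
  rows; the indicator function of the live columns solves it.\<close>

lemma trivial_instance:
  assumes "n = 0" "g = 0"
  shows "pessimistic_bilfp I"
proof -
  have m: "m = 0" using card_basis basis_less assms by (metis all_not_in_conv card.empty less_nat_zero_code)
  define X :: "nat \<Rightarrow> nat \<Rightarrow> int" where "X = (\<lambda>_ _. 0)"
  interpret Sys: bilfp_system I m n k g denom VA "\<lambda>i p. val (oB + (i * k + p))" "\<lambda>l p. val (oC + (l * k + p))"
    "\<lambda>i p. val (oD + (i * k + p))" X "\<lambda>i. val (ob + i)" "\<lambda>l. val (oc + l)" "\<lambda>i. val (od + i)"
    by (rule bilfp_system) (use assms in simp)
  have "(\<lambda>c. if c \<in> Sys.live then 1 else 0) \<in> cone (m + g + n) Sys.ncols (sys_mat m n k VA Sys.E) Sys.live"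
    using m assms by (simp add: cone_def)
  then show ?thesis unfolding Sys.pessimistic_iff_cone
  proof (rule bexI[rotated])
    show "\<forall>l\<in>Sys.strict. 0 < (if l \<in> Sys.live then 1 else 0 :: real)"
    unfolding Sys.strict_def Sys.live_def Sys.ncols_def using assms basis_less by auto
  qed
qed

text \<open>The factor \<open>5\<close>: when \<open>n + g > 0\<close>, some row of \<open>C\<close>
  or \<open>D\<close> with \<open>k\<close> entries is encoded, so both \<open>k\<close> and
  \<open>m + n + g\<close> are at most \<open>nq\<close>, and the number of columns is at most
  \<open>4 * nq + 1\<close>.\<close>

lemma wp_Decide:
  "wp inp (40 * (5 * enc_len) ^ 4) (2 ^ (200 * (5 * enc_len) ^ 4)) Decide
    (\<lambda>\<tau>. \<tau> v_res 0 0 = (if pessimistic_bilfp I then 1 else 0)) (\<lambda>_ _ _. 0)"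
proof (cases "0 < n + g")
  case True
  have "k \<le> n * k + g * k"
  proof (cases "0 < n")
    case True
    then show ?thesis by (cases n) auto
  next
    case False
    then show ?thesis using \<open>0 < n + g\<close> by (cases g) auto
  qed
  then have sizes: "k \<le> nq" "m + n + g \<le> nq"
    unfolding nq_def od_def oD_def oc_def oC_def ob_def oB_def by linarith+
  have "ncols \<le> 5 * enc_len" "nrows' \<le> 5 * enc_len" "nq \<le> 5 * enc_len" "1 \<le> 5 * enc_len"
    using sizes size_bounds unfolding ncols_def nrows'_def by linarith+
  moreover have "0 < int n + int g" using True by linarith
  ultimately show ?thesis
    unfolding Decide_def using wp_Main_bounded[of "5 * enc_len"] by simp
next
  case False
  then show ?thesis
    unfolding Decide_def using trivial_instance by simp
qed

end

theorem theorem7: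
  shows "decidable_in_polynomial_time encode_bilfp bilfp_instances pessimistic_bilfp"
proof -
  \<comment> \<open>\<open>Decide\<close> leaves its answer in entry \<open>(0, 0)\<close> of array
    \<open>0\<close>, which is cell \<open>- 1\<close>.\<close>
  define p where "p = Seq (comp Decide) (Store (Const 0) (Load (Const (- 1))))"
  \<comment> \<open>The polynomial whose value at \<open>enc_len\<close> is
    \<open>(5 * enc_len) ^ 4\<close>, the quantity that governs both bounds of
    \<open>wp_Decide\<close>.\<close>
  define h :: "nat poly" where "h = monom 5 1 ^ 4"
  define c where "c = cost_const (Const 0) + cost_const (Load (Const (- 1)))"
  \<comment> \<open>\<open>time_bound\<close> evaluated at polynomials is a polynomial; the other
    summands pay for the final copy and the sequencing.\<close>
  define T :: "nat poly" where "T = time_bound Decide (smult 40 h) (smult 200 h) + smult (200 * c) h + [:2:]"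
  have "\<exists>t s. exec p (input_memory (encode_bilfp I)) t s \<and> t \<le> poly T (encoding_length (encode_bilfp I)) \<and>
      s 0 = (if pessimistic_bilfp I then 1 else 0)" if "I \<in> bilfp_instances" for I
  proof -
    interpret bilfp_instance I by standard (rule that)
    define R W where "R = 40 * (5 * enc_len) ^ 4" and "W = 200 * (5 * enc_len) ^ 4"
    define s0 where "s0 = input_memory (encode_bilfp I)"
    have wp: "wp inp R (2 ^ W) Decide (\<lambda>\<tau>. \<tau> v_res 0 0 = (if pessimistic_bilfp I then 1 else 0)) (\<lambda>_ _ _. 0)"
      unfolding R_def W_def by (rule wp_Decide)
    have len: "1 \<le> enc_len" using size_bounds by linarith
    then have "enc_len \<le> (5 * enc_len) ^ 4" using self_le_power[of "5 * enc_len" 4] by linarith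
    then have W: "enc_len \<le> W" "1 \<le> W" using len unfolding W_def by linarith+
    have rep: "represents inp s0 (\<lambda>_ _ _. 0)"
      unfolding represents_def
    proof (intro conjI allI impI)
      show "s0 a = inp a" for a by (simp add: s0_def inp_def)
      show "s0 (cell x i j) = 0" for x i j
        using cell_neg[of x i j] by (simp add: s0_def input_memory_def)
    qed
    have bnd: "\<bar>s0 a\<bar> \<le> 2 ^ W" for a
    proof -
      have "(2::int) ^ enc_len \<le> 2 ^ W" using W by (intro power_increasing) auto
      then show ?thesis using input_memory_bound[of "encode_bilfp I" a] unfolding s0_def enc_len_def by linarith
    qed
    obtain t s' \<sigma>' where ex: "exec (comp Decide) s0 t s'" "t \<le> time_bound Decide R W"
      "represents inp s' \<sigma>'" "\<forall>a. \<bar>s' a\<bar> \<le> 2 ^ W" "\<sigma>' v_res 0 0 = (if pessimistic_bilfp I then 1 else 0)"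
      using wp_sound[OF wp rep bnd W(2)] by blast
    have res: "s' (- 1) = (if pessimistic_bilfp I then 1 else 0)"
    proof -
      have "s' (cell 0 0 0) = \<sigma>' 0 0 0" using ex(3) by (simp add: represents_def)
      then show ?thesis using ex(5) by (simp add: cell_def)
    qed
    define u where "u = 1 + eval_cost (Const 0) s' + eval_cost (Load (Const (- 1))) s'"
    have "exec (Store (Const 0) (Load (Const (- 1)))) s' u (s'(0 := s' (- 1)))"
      using exec_Store[of "Const 0" "Load (Const (- 1))" s'] by (simp add: u_def)
    then have "exec p s0 (1 + t + u) (s'(0 := s' (- 1)))"
      unfolding p_def by (rule exec_Seq[OF ex(1)])
    moreover have "1 + t + u \<le> poly T enc_len"
    proof -
      have b: "\<bar>s' a\<bar> \<le> 2 ^ W" for a using ex(4) by blast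
      have "u \<le> 1 + c * W"
        using cost_const_bound[where s = s' and W = W and e = "Const 0", OF b W(2)]
          cost_const_bound[where s = s' and W = W and e = "Load (Const (- 1))", OF b W(2)]
        unfolding u_def c_def distrib_right by linarith
      moreover have "poly T enc_len = time_bound Decide R W + c * W + 2"
        by (simp add: T_def poly_time_bound h_def poly_monom R_def W_def)
      ultimately show ?thesis using ex(2) by linarith
    qed
    ultimately show ?thesis
      using res unfolding s0_def enc_len_def by (intro exI[of _ "1 + t + u"] exI[of _ "s'(0 := s' (- 1))"]) simp
  qed
  then show ?thesis unfolding decidable_in_polynomial_time_def by blast
qed

end
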